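(* Let $\Omega$ be a domain in $\mathbf{R}^n$. Let $p\in(n,\infty)$, $\alpha=(p-n)/(p-1)$, and let $\eta\ge41$. A function $f:(\partial\Omega)_\alpha\to\mathbf{R}$ is the trace to $(\partial\Omega)_\alpha$ of a continuous function $F\in L^1_p(\Omega)$ if and only if $f$ is continuous with respect to $d_{\alpha,\overline\Omega}$ and there exists a constant $\lambda>0$ such that for every finite family $\{Q_i:i=1,\dots,m\}$ of pairwise disjoint cubes in $\Omega$ and every choice of $(\alpha,Q_i)$-visible elements $\omega_i^{(1)},\omega_i^{(2)}\in(\partial\Omega)_\alpha$ such that $$\ell(\omega_i^{(1)}),\ \ell(\omega_i^{(2)})\in(\eta Q_i)\cap\partial\Omega,$$ the inequality $$\sum_{i=1}^m\frac{|f(\omega_i^{(1)})-f(\omega_i^{(2)})|^p}{(\operatorname{diam}Q_i)^{p-n}}\le\lambda$$ holds. Moreover, $\|f\|_{\operatorname{tr}(L^1_p(\Omega))}\sim\inf\lambda^{1/p}$ (infimum over all such $\lambda$), with constants of equivalence depending only on $n$, $p$ and $\eta$.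
   Context: Conventions. $\mathbf{R}^n$ carries the uniform norm $\|x\|=\max_i|x_i|$; distances, diameters and arc length are taken with respect to it. A cube is a closed cube $Q=Q(x_Q,r_Q)=\{y:\|y-x_Q\|\le r_Q\}$, $r_Q>0$, and $\lambda Q(x,r)=Q(x,\lambda r)$. $\Omega\subset\mathbf{R}^n$ is a domain (nonempty open connected set) with $\Omega\ne\mathbf{R}^n$. $X\sim Y$ means $X/C\le Y\le CX$ for a constant $C\ge1$. Metrics. For $\alpha\in(0,1]$ and $x,y\in\Omega$, $d_{\alpha,\Omega}(x,y)=\inf_\gamma\int_\gamma\operatorname{dist}(z,\partial\Omega)^{\alpha-1}ds(z)$, the infimum being over rectifiable curves $\gamma\subset\Omega$ joining $x$ to $y$; $\rho_{\alpha,\Omega}(x,y)=d_{\alpha,\Omega}(x,y)+\|x-y\|^\alpha$. Completion. $\Omega^{*,\alpha}$ is the Cauchy completion of $(\Omega,\rho_{\alpha,\Omega})$, i.e. the set of equivalence classes $\omega=[(x_i)]_\alpha$ of $\rho_{\alpha,\Omega}$-Cauchy sequences in $\Omega$, where $(x_i)\stackrel{\alpha}{\sim}(y_i)$ iff $\rho_{\alpha,\Omega}(x_i,y_i)\to0$; $\Omega$ is viewed as a subset via constant sequences. For $\omega\in\Omega^{*,\alpha}$, all sequences in $\omega$ converge in $\|\cdot\|$ to a common point $\ell(\omega)\in\overline{\Omega}$. $\rho_{\alpha,\overline\Omega}$ is the completion metric, and $d_{\alpha,\overline\Omega}(\omega_1,\omega_2)=\lim_i d_{\alpha,\Omega}(x_i,y_i)$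 for $(x_i)\in\omega_1$, $(y_i)\in\omega_2$. The $\alpha$-boundary is $(\partial\Omega)_\alpha=\Omega^{*,\alpha}\setminus\Omega$; one has $\ell(\omega)\in\partial\Omega$ for $\omega\in(\partial\Omega)_\alpha$. Visibility. For a cube $Q\subset\Omega$, a point $x\in\overline\Omega$ is $Q$-visible in $\Omega$ if for each $y\in Q$ the semi-open segment $(x,y]$ lies in $\Omega$. An element $\omega\in(\partial\Omega)_\alpha$ is $(\alpha,Q)$-visible in $\Omega$ if (i) the point $\ell(\omega)\in\partial\Omega$ is $Q$-visible in $\Omega$, and (ii) there is a sequence of points $y_i\in(\ell(\omega),x_Q]$ such that $[(y_i)]_\alpha=\omega$. Sobolev spaces and traces. $L^1_p(\Omega)$ is the homogeneous Sobolev space with seminorm $\|F\|_{L^1_p(\Omega)}=\|\nabla F\|_{L_p(\Omega)}$. For $p>n$ each element is identified with its continuous representative; with $\alpha=(p-n)/(p-1)$ this representative is uniformly continuous with respect to $\rho_{\alpha,\Omega}$, so it extends uniquely to a continuous function on $\Omega^{*,\alpha}$, and its trace $\operatorname{tr}_{(\partial\Omega)_\alpha}F$ is the restriction of this extension to $(\partial\Omega)_\alpha$; i.e. $\operatorname{tr}_{(\partial\Omega)_\alpha}F(\omega)=\lim_iF(y_i)$ for any $(y_i)\in\omega$. $\|f\|_{\operatorname{tr}(L^1_p(\Omega))}=\inf\{\|F\|_{L^1_p(\Omega)}:F\in L^1_p(\Omega)\text{ continuous},\ \operatorname{tr}_{(\partial\Omega)_\alpha}F=f\}$. *)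

theory Defs
  imports "HOL-Analysis.Analysis"
begin

text \<open>
  Vectors in \<open>\<real>\<^sup>n\<close> are elements of \<open>real ^ 'n\<close> with \<open>n = CARD('n)\<close>. All metric quantities use
  the uniform norm \<^const>\<open>infnorm\<close>; topological notions (\<^const>\<open>open\<close>, \<^const>\<open>frontier\<close>,
  convergence, continuity) are the library's, as the uniform and Euclidean norms induce the
  same topology.
\<close>

definition is_domain :: "(real ^ 'n) set \<Rightarrow> bool" where
  "is_domain \<Omega> \<longleftrightarrow> \<Omega> \<noteq> {} \<and> open \<Omega> \<and> connected \<Omega> \<and> \<Omega> \<noteq> UNIV"

definition cube :: "real ^ 'n \<Rightarrow> real \<Rightarrow> (real ^ 'n) set" where
  "cube x r = {y. infnorm (y - x) \<le> r}"

definition udiam :: "(real ^ 'n) set \<Rightarrow> real" where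
  "udiam S = (SUP (x, y) \<in> S \<times> S. infnorm (x - y))"

definition uinfdist :: "real ^ 'n \<Rightarrow> (real ^ 'n) set \<Rightarrow> real" where
  "uinfdist z S = (INF w\<in>S. infnorm (z - w))"


section \<open>Rectifiable curves and integration with respect to arc length\<close>

definition polygonal_sums :: "(real \<Rightarrow> real ^ 'n) \<Rightarrow> real \<Rightarrow> real \<Rightarrow> real set" where
  "polygonal_sums \<gamma> a b =
     {\<Sum>i<m. infnorm (\<gamma> (t (Suc i)) - \<gamma> (t i)) | m (t :: nat \<Rightarrow> real).
        mono_on {..m} t \<and> t ` {..m} \<subseteq> {a..b}}"

definition rectifiable :: "(real \<Rightarrow> real ^ 'n) \<Rightarrow> bool" where
  "rectifiable \<gamma> \<longleftrightarrow> path \<gamma> \<and> bdd_above (polygonal_sums \<gamma> 0 1)"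

text \<open>
  The length of \<open>\<gamma>\<close> restricted to \<open>[0, t]\<close>, extended to all real \<open>t\<close> by constants
  outside \<open>[0, 1]\<close>.
\<close>

definition arc_length_fun :: "(real \<Rightarrow> real ^ 'n) \<Rightarrow> real \<Rightarrow> real" where
  "arc_length_fun \<gamma> t = Sup (polygonal_sums \<gamma> 0 (max 0 (min 1 t)))"

text \<open>
  The arc length function of a rectifiable curve is continuous and nondecreasing, and \<open>ds\<close> is
  integration against its Lebesgue-Stieltjes measure.
\<close>

definition arc_integral :: "(real \<Rightarrow> real ^ 'n) \<Rightarrow> (real ^ 'n \<Rightarrow> real) \<Rightarrow> real" where
  "arc_integral \<gamma> w = (LINT t:{0..1}|interval_measure (arc_length_fun \<gamma>). w (\<gamma> t))"


section \<open>The metrics and the completion\<close>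

definition d_alpha :: "real \<Rightarrow> (real ^ 'n) set \<Rightarrow> real ^ 'n \<Rightarrow> real ^ 'n \<Rightarrow> real" where
  "d_alpha \<alpha> \<Omega> x y =
     (INF \<gamma> \<in> {\<gamma>. rectifiable \<gamma> \<and> path_image \<gamma> \<subseteq> \<Omega> \<and> pathstart \<gamma> = x \<and> pathfinish \<gamma> = y}.
        arc_integral \<gamma> (\<lambda>z. uinfdist z (frontier \<Omega>) powr (\<alpha> - 1)))"

definition rho_alpha :: "real \<Rightarrow> (real ^ 'n) set \<Rightarrow> real ^ 'n \<Rightarrow> real ^ 'n \<Rightarrow> real" where
  "rho_alpha \<alpha> \<Omega> x y = d_alpha \<alpha> \<Omega> x y + infnorm (x - y) powr \<alpha>"

definition alpha_Cauchy :: "real \<Rightarrow> (real ^ 'n) set \<Rightarrow> (nat \<Rightarrow> real ^ 'n) \<Rightarrow> bool" where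
  "alpha_Cauchy \<alpha> \<Omega> xs \<longleftrightarrow> range xs \<subseteq> \<Omega> \<and>
     (\<forall>\<epsilon>>0. \<exists>N. \<forall>i\<ge>N. \<forall>j\<ge>N. rho_alpha \<alpha> \<Omega> (xs i) (xs j) < \<epsilon>)"

definition alpha_rel ::
    "real \<Rightarrow> (real ^ 'n) set \<Rightarrow> ((nat \<Rightarrow> real ^ 'n) \<times> (nat \<Rightarrow> real ^ 'n)) set" where
  "alpha_rel \<alpha> \<Omega> =
     {(xs, ys). alpha_Cauchy \<alpha> \<Omega> xs \<and> alpha_Cauchy \<alpha> \<Omega> ys \<and>
                (\<lambda>i. rho_alpha \<alpha> \<Omega> (xs i) (ys i)) \<longlonglongrightarrow> 0}"

definition alpha_class ::
    "real \<Rightarrow> (real ^ 'n) set \<Rightarrow> (nat \<Rightarrow> real ^ 'n) \<Rightarrow> (nat \<Rightarrow> real ^ 'n) set" where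
  "alpha_class \<alpha> \<Omega> xs = alpha_rel \<alpha> \<Omega> `` {xs}"

definition alpha_completion :: "real \<Rightarrow> (real ^ 'n) set \<Rightarrow> (nat \<Rightarrow> real ^ 'n) set set" where
  "alpha_completion \<alpha> \<Omega> = {xs. alpha_Cauchy \<alpha> \<Omega> xs} // alpha_rel \<alpha> \<Omega>"

definition alpha_boundary :: "real \<Rightarrow> (real ^ 'n) set \<Rightarrow> (nat \<Rightarrow> real ^ 'n) set set" where
  "alpha_boundary \<alpha> \<Omega> = alpha_completion \<alpha> \<Omega> - (\<lambda>x. alpha_class \<alpha> \<Omega> (\<lambda>_. x)) ` \<Omega>"

definition ell :: "(nat \<Rightarrow> real ^ 'n) set \<Rightarrow> real ^ 'n" where
  "ell \<omega> = (THE z. \<forall>xs\<in>\<omega>. xs \<longlonglongrightarrow> z)"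

definition d_alpha_closure ::
    "real \<Rightarrow> (real ^ 'n) set \<Rightarrow> (nat \<Rightarrow> real ^ 'n) set \<Rightarrow> (nat \<Rightarrow> real ^ 'n) set \<Rightarrow> real" where
  "d_alpha_closure \<alpha> \<Omega> \<omega>1 \<omega>2 =
     (THE L. \<forall>xs\<in>\<omega>1. \<forall>ys\<in>\<omega>2. (\<lambda>i. d_alpha \<alpha> \<Omega> (xs i) (ys i)) \<longlonglongrightarrow> L)"

definition alpha_continuous ::
    "real \<Rightarrow> (real ^ 'n) set \<Rightarrow> ((nat \<Rightarrow> real ^ 'n) set \<Rightarrow> real) \<Rightarrow> bool" where
  "alpha_continuous \<alpha> \<Omega> f \<longleftrightarrow>
     (\<forall>\<omega> \<in> alpha_boundary \<alpha> \<Omega>. \<forall>\<epsilon>>0. \<exists>\<delta>>0. \<forall>\<omega>' \<in> alpha_boundary \<alpha> \<Omega>.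
        d_alpha_closure \<alpha> \<Omega> \<omega> \<omega>' < \<delta> \<longrightarrow> \<bar>f \<omega>' - f \<omega>\<bar> < \<epsilon>)"


section \<open>Visibility\<close>

text \<open>The semi-open segment \<open>(x, y]\<close>.\<close>

definition semi_segment :: "real ^ 'n \<Rightarrow> real ^ 'n \<Rightarrow> (real ^ 'n) set" where
  "semi_segment x y = {(1 - t) *\<^sub>R x + t *\<^sub>R y | t. 0 < t \<and> t \<le> 1}"

definition visible :: "(real ^ 'n) set \<Rightarrow> (real ^ 'n) set \<Rightarrow> real ^ 'n \<Rightarrow> bool" where
  "visible \<Omega> Q x \<longleftrightarrow> x \<in> closure \<Omega> \<and> (\<forall>y\<in>Q. semi_segment x y \<subseteq> \<Omega>)"

text \<open>
  The cube enters through its center \<open>c\<close> and radius \<open>r\<close>. The class of a sequence that is not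
  Cauchy is empty, hence never equal to an element of the boundary.
\<close>

definition alpha_visible ::
    "real \<Rightarrow> (real ^ 'n) set \<Rightarrow> real ^ 'n \<Rightarrow> real \<Rightarrow> (nat \<Rightarrow> real ^ 'n) set \<Rightarrow> bool" where
  "alpha_visible \<alpha> \<Omega> c r \<omega> \<longleftrightarrow> \<omega> \<in> alpha_boundary \<alpha> \<Omega> \<and>
     visible \<Omega> (cube c r) (ell \<omega>) \<and>
     (\<exists>ys. (\<forall>i. ys i \<in> semi_segment (ell \<omega>) c) \<and> alpha_class \<alpha> \<Omega> ys = \<omega>)"


section \<open>Homogeneous Sobolev spaces and traces\<close>

definition partial :: "'n \<Rightarrow> (real ^ 'n \<Rightarrow> real) \<Rightarrow> real ^ 'n \<Rightarrow> real" where
  "partial i \<phi> x = frechet_derivative \<phi> (at x) (axis i 1)"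

primrec C_k :: "nat \<Rightarrow> (real ^ 'n \<Rightarrow> real) \<Rightarrow> bool" where
  "C_k 0 \<phi> \<longleftrightarrow> continuous_on UNIV \<phi>"
| "C_k (Suc k) \<phi> \<longleftrightarrow> (\<forall>x. \<phi> differentiable (at x)) \<and> (\<forall>i. C_k k (partial i \<phi>))"

definition test_function :: "(real ^ 'n) set \<Rightarrow> (real ^ 'n \<Rightarrow> real) \<Rightarrow> bool" where
  "test_function \<Omega> \<phi> \<longleftrightarrow>
     (\<forall>k. C_k k \<phi>) \<and> compact (closure {x. \<phi> x \<noteq> 0}) \<and> closure {x. \<phi> x \<noteq> 0} \<subseteq> \<Omega>"

definition locally_integrable :: "(real ^ 'n) set \<Rightarrow> (real ^ 'n \<Rightarrow> real) \<Rightarrow> bool" where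
  "locally_integrable \<Omega> F \<longleftrightarrow> (\<forall>K. compact K \<and> K \<subseteq> \<Omega> \<longrightarrow> set_integrable lebesgue K F)"

definition weak_gradient ::
    "(real ^ 'n) set \<Rightarrow> (real ^ 'n \<Rightarrow> real) \<Rightarrow> (real ^ 'n \<Rightarrow> real ^ 'n) \<Rightarrow> bool" where
  "weak_gradient \<Omega> F G \<longleftrightarrow>
     locally_integrable \<Omega> F \<and> (\<forall>i. locally_integrable \<Omega> (\<lambda>x. G x $ i)) \<and>
     (\<forall>\<phi> i. test_function \<Omega> \<phi> \<longrightarrow>
        (LINT x:\<Omega>|lebesgue. F x * partial i \<phi> x) = - (LINT x:\<Omega>|lebesgue. G x $ i * \<phi> x))"

definition L1p :: "real \<Rightarrow> (real ^ 'n) set \<Rightarrow> (real ^ 'n \<Rightarrow> real) set" where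
  "L1p p \<Omega> = {F. \<exists>G. weak_gradient \<Omega> F G \<and> set_integrable lebesgue \<Omega> (\<lambda>x. infnorm (G x) powr p)}"

text \<open>Weak gradients are unique up to null sets, so the choice of \<open>G\<close> is immaterial.\<close>

definition L1p_norm :: "real \<Rightarrow> (real ^ 'n) set \<Rightarrow> (real ^ 'n \<Rightarrow> real) \<Rightarrow> real" where
  "L1p_norm p \<Omega> F =
     (let G = (SOME G. weak_gradient \<Omega> F G)
      in (LINT x:\<Omega>|lebesgue. infnorm (G x) powr p) powr (1 / p))"

definition has_trace ::
    "real \<Rightarrow> (real ^ 'n) set \<Rightarrow> (real ^ 'n \<Rightarrow> real) \<Rightarrow> ((nat \<Rightarrow> real ^ 'n) set \<Rightarrow> real) \<Rightarrow> bool" where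
  "has_trace \<alpha> \<Omega> F f \<longleftrightarrow>
     (\<forall>\<omega> \<in> alpha_boundary \<alpha> \<Omega>. \<forall>ys\<in>\<omega>. (\<lambda>i. F (ys i)) \<longlonglongrightarrow> f \<omega>)"

definition trace_extensions ::
    "real \<Rightarrow> real \<Rightarrow> (real ^ 'n) set \<Rightarrow> ((nat \<Rightarrow> real ^ 'n) set \<Rightarrow> real) \<Rightarrow> (real ^ 'n \<Rightarrow> real) set" where
  "trace_extensions p \<alpha> \<Omega> f = {F \<in> L1p p \<Omega>. continuous_on \<Omega> F \<and> has_trace \<alpha> \<Omega> F f}"

definition trace_norm ::
    "real \<Rightarrow> real \<Rightarrow> (real ^ 'n) set \<Rightarrow> ((nat \<Rightarrow> real ^ 'n) set \<Rightarrow> real) \<Rightarrow> real" where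
  "trace_norm p \<alpha> \<Omega> f = (INF F \<in> trace_extensions p \<alpha> \<Omega> f. L1p_norm p \<Omega> F)"


section \<open>The variational condition\<close>

text \<open>The cubes are \<open>Q\<^sub>i = cube (c i) (r i)\<close> for \<open>i = 1, \<dots>, m\<close>.\<close>

definition variational_bound ::
    "real \<Rightarrow> real \<Rightarrow> real \<Rightarrow> (real ^ 'n) set \<Rightarrow> ((nat \<Rightarrow> real ^ 'n) set \<Rightarrow> real) \<Rightarrow> real \<Rightarrow> bool" where
  "variational_bound p \<alpha> \<eta> \<Omega> f B \<longleftrightarrow>
     (\<forall>(m::nat) (c :: nat \<Rightarrow> real ^ 'n) (r :: nat \<Rightarrow> real) \<omega>1 \<omega>2.
        (\<forall>i\<in>{1..m}. 0 < r i \<and> cube (c i) (r i) \<subseteq> \<Omega>) \<longrightarrow>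
        disjoint_family_on (\<lambda>i. cube (c i) (r i)) {1..m} \<longrightarrow>
        (\<forall>i\<in>{1..m}.
           alpha_visible \<alpha> \<Omega> (c i) (r i) (\<omega>1 i) \<and> alpha_visible \<alpha> \<Omega> (c i) (r i) (\<omega>2 i) \<and>
           ell (\<omega>1 i) \<in> cube (c i) (\<eta> * r i) \<inter> frontier \<Omega> \<and>
           ell (\<omega>2 i) \<in> cube (c i) (\<eta> * r i) \<inter> frontier \<Omega>) \<longrightarrow>
        (\<Sum>i=1..m. \<bar>f (\<omega>1 i) - f (\<omega>2 i)\<bar> powr p
                     / udiam (cube (c i) (r i)) powr (p - real CARD('n))) \<le> B)"

end

theory Submission
  imports Defs "HOL-Computational_Algebra.Polynomial"
begin

text \<open>
  Let \<open>\<omega>\<close> be visible from the cube \<open>Q\<close> with centre \<open>c\<close> and radius \<open>r\<close>, and let \<open>l = ell \<omega>\<close>.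
  For \<open>0 < s \<le> 1\<close> the homothetic copy \<open>l + s (Q/2 - l)\<close> of the half cube lies in \<open>\<Omega>\<close>, at
  distance at least \<open>s r / 2\<close> from the boundary, and for a suitable sequence of parameters
  tending to 0 any choice of points in the copies represents \<open>\<omega>\<close>
  (\<open>alpha_visible_sequences\<close>). So the averages of a continuous extension \<open>F\<close> over these
  copies tend to \<open>f \<omega>\<close>, while at \<open>s = 1\<close> they give the average of \<open>F\<close> over \<open>Q/2\<close>, whatever
  \<open>\<omega>\<close> is.

  \<^bold>\<open>A trace satisfies the variational bound.\<close> Averaging against a smooth bump, the
  derivative of the average with respect to \<open>s\<close> is, after integration by parts, an average
  of the weak gradient multiplied by a length of order \<open>r\<close>. Hence \<open>f \<omega>\<close> differs from the
  average over \<open>Q/2\<close> by at most a constant times \<open>r\<close> times the integral over \<open>s\<close> of the mean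
  of the gradient on the copies (\<open>trace_average_estimate\<close>). Jensen's inequality with a power
  of \<open>s\<close> as weight (\<open>nn_integral_Jensen\<close>, \<open>trace_average_bound\<close>) turns this into a bound of
  the summand of \<open>Q\<close> in the variational sum by the integral of \<open>|\<nabla>F|\<^sup>p\<close> against a multiple
  of the weight \<open>(dist(z, \<partial>\<Omega>) / r)\<^sup>\<epsilon>\<close>, because \<open>z\<close> belongs to the copy with parameter \<open>s\<close>
  only if \<open>s \<le> 2 dist(z, \<partial>\<Omega>) / r\<close>. An exponent \<open>\<epsilon> > 0\<close> is possible precisely since \<open>p > n\<close>.
  The cubes that give weight to \<open>z\<close> are disjoint, within a bounded multiple of their size
  from \<open>z\<close>, and not much smaller than \<open>dist(z, \<partial>\<Omega>)\<close>; at each dyadic scale there are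
  boundedly many of them, so their weights are dominated by a geometric series
  (\<open>sum_disjoint_cubes_scale\<close>). The result is \<open>variational_bound_of_trace\<close>.

  \<^bold>\<open>A function with the variational bound extends.\<close> Cover \<open>\<Omega>\<close> by lattice cells of side
  comparable to the distance to the boundary (\<open>cells_cover\<close>). To each cell belongs the
  boundary element reached on the segment from its node to a nearest boundary point. The
  extension averages the values of \<open>f\<close> at these elements with a smooth partition of unity
  (\<open>ext\<close>). Its gradient at a point is controlled by the differences of \<open>f\<close> between elements
  of overlapping cells, divided by the side (\<open>dext_bound\<close>). Both elements are visible from a
  cube around one of the nodes, the patch, and their points on \<open>\<partial>\<Omega>\<close> lie in its dilation by
  41 (\<open>nbr_visible\<close>).
  The cells can be coloured with \<open>2 \<cdot> 5\<^sup>n\<close> colours such that patches of equal colour are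
  disjoint (\<open>colour_separates\<close>), so the energy is bounded by a constant times \<open>2 \<cdot> 5\<^sup>n\<close>
  admissible variational sums (\<open>ext_energy\<close>). The boundary values are right because the
  elements belonging to the cells around \<open>y\<^sub>i\<close> converge to \<open>\<omega>\<close> when the sequence \<open>y\<^sub>i\<close>
  represents \<open>\<omega>\<close>, and \<open>f\<close> is continuous (\<open>has_trace_ext\<close>).

  \<^bold>\<open>A trace is continuous.\<close> A discontinuity of \<open>f\<close> at \<open>\<omega>\<close> yields by a diagonal choice a
  sequence in \<open>\<Omega>\<close> that represents \<open>\<omega>\<close> but along which \<open>F\<close> stays away from \<open>f \<omega>\<close>
  (\<open>alpha_continuous_of_has_trace\<close>).

  Two foundations are needed. For \<open>d_alpha\<close> to be a pseudometric, integrals along curves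
  must behave under reversal and concatenation; this follows from additivity and continuity
  of arc length (\<open>arc_integral_transfer\<close>). For the seminorm to be the expected integral,
  weak gradients must be unique up to null sets (\<open>weak_gradient_unique\<close>), and classical
  gradients must be weak gradients (\<open>weak_gradient_of_C1\<close>).
\<close>

section \<open>Cubes and the uniform norm\<close>

lemma infnorm_le_iff: "infnorm (x :: real ^ 'n) \<le> r \<longleftrightarrow> (\<forall>i. \<bar>x $ i\<bar> \<le> r)"
proof
  assume "infnorm x \<le> r"
  then show "\<forall>i. \<bar>x $ i\<bar> \<le> r"
    using component_le_infnorm_cart[of x] order_trans by blast
next
  assume r: "\<forall>i. \<bar>x $ i\<bar> \<le> r"
  show "infnorm x \<le> r"
    unfolding infnorm_cart by (rule cSup_least) (use r in auto)
qed

lemma infnorm_triangle3: "infnorm (x - z) \<le> infnorm (x - y) + infnorm (y - z)"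
  using infnorm_triangle[of "x - y" "y - z"] by simp

lemma tendsto_infnorm_iff:
  fixes z :: "real ^ 'n"
  shows "(f \<longlongrightarrow> z) F \<longleftrightarrow> ((\<lambda>i. infnorm (f i - z)) \<longlongrightarrow> 0) F"
proof
  assume "(f \<longlongrightarrow> z) F"
  then have "((\<lambda>i. f i - z) \<longlongrightarrow> 0) F" by (simp add: LIM_zero)
  then show "((\<lambda>i. infnorm (f i - z)) \<longlongrightarrow> 0) F"
    using tendsto_infnorm[of "\<lambda>i. f i - z" 0 F] by (simp add: infnorm_0)
next
  assume a: "((\<lambda>i. infnorm (f i - z)) \<longlongrightarrow> 0) F"
  have b: "((\<lambda>i. sqrt DIM(real^'n) * infnorm (f i - z)) \<longlongrightarrow> 0) F"
    using tendsto_mult_right_zero[OF a] by simp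
  have "((\<lambda>i. f i - z) \<longlongrightarrow> 0) F"
    by (rule Lim_null_comparison[OF _ b]) (use norm_le_infnorm[where 'a = "real^'n"] in simp)
  then show "(f \<longlongrightarrow> z) F" by (simp add: LIM_zero_iff)
qed

lemma continuous_on_infnorm [continuous_intros]:
  "continuous_on S f \<Longrightarrow> continuous_on S (\<lambda>x. infnorm (f x :: real ^ 'n))"
  unfolding continuous_on_def by (blast intro: tendsto_infnorm)

lemma mem_cube: "y \<in> cube c r \<longleftrightarrow> infnorm (y - c) \<le> r"
  by (simp add: cube_def)

lemma mem_cube_iff: "y \<in> cube c r \<longleftrightarrow> (\<forall>i. \<bar>y $ i - c $ i\<bar> \<le> r)"
  by (simp add: mem_cube infnorm_le_iff)

lemma cube_eq_cbox: "cube (c :: real ^ 'n) r = cbox (c - (\<chi> i. r)) (c + (\<chi> i. r))"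
  by (auto simp: mem_cube_iff mem_box_cart abs_le_iff algebra_simps)

lemma compact_cube [simp]: "compact (cube c r)"
  and closed_cube [simp]: "closed (cube c r)"
  and convex_cube [simp]: "convex (cube c r)"
  and borel_cube [measurable, simp]: "cube c r \<in> sets borel"
  and bounded_cube [simp]: "bounded (cube c r)"
  by (simp_all add: cube_eq_cbox compact_cbox closed_cbox)

lemma center_in_cube: "0 \<le> r \<Longrightarrow> c \<in> cube c r"
  by (simp add: mem_cube infnorm_0)

lemma cube_mono: "r \<le> s \<Longrightarrow> cube c r \<subseteq> cube c s"
  by (auto simp: mem_cube)

lemma emeasure_cube:
  assumes "0 \<le> r"
  shows "emeasure lborel (cube (c :: real ^ 'n) r) = ennreal ((2 * r) ^ CARD('n))"
proof -
  have "(\<Prod>b\<in>Basis. ((c + (\<chi> i. r)) - (c - (\<chi> i. r))) \<bullet> b) = (\<Prod>b\<in>(Basis :: (real^'n) set). 2 * r)"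
  proof (rule prod.cong)
    fix b :: "real ^ 'n" assume "b \<in> Basis"
    then obtain i where "b = axis i 1" by (auto simp: Basis_vec_def)
    then show "((c + (\<chi> i. r)) - (c - (\<chi> i. r))) \<bullet> b = 2 * r"
      by (simp add: inner_axis)
  qed simp
  moreover have "\<And>b. b \<in> Basis \<Longrightarrow> (c - (\<chi> i. r)) \<bullet> b \<le> (c + (\<chi> i. r)) \<bullet> b"
    using assms by (auto simp: Basis_vec_def inner_axis)
  ultimately show ?thesis
    by (simp add: cube_eq_cbox emeasure_lborel_cbox_eq)
qed

lemma measure_cube:
  assumes "0 \<le> r"
  shows "measure lborel (cube (c :: real ^ 'n) r) = (2 * r) ^ CARD('n)"
  using emeasure_cube[OF assms, of c] assms unfolding measure_def by simp

lemma udiam_cube: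
  assumes "0 < r"
  shows "udiam (cube (c :: real ^ 'n) r) = 2 * r"
proof -
  let ?e = "\<chi> i. r :: real ^ 'n"
  have e: "infnorm ?e = r" "infnorm (2 *\<^sub>R ?e) = 2 * r"
  proof -
    have "infnorm ?e \<le> r" using assms by (simp add: infnorm_le_iff)
    moreover have "r \<le> infnorm ?e"
      using component_le_infnorm_cart[of ?e] assms by simp
    ultimately show "infnorm ?e = r" by simp
    then show "infnorm (2 *\<^sub>R ?e) = 2 * r" by (simp add: infnorm_mul)
  qed
  have le: "infnorm (x - y) \<le> 2 * r" if "x \<in> cube c r" "y \<in> cube c r" for x y
    using infnorm_triangle3[of x y c] that infnorm_sub[of c y] by (simp add: mem_cube)
  have mem: "c + ?e \<in> cube c r" "c - ?e \<in> cube c r"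
    using e by (simp_all add: mem_cube infnorm_neg)
  have diff: "(c + ?e) - (c - ?e) = 2 *\<^sub>R ?e" by (simp add: scaleR_2)
  show ?thesis unfolding udiam_def
  proof (rule antisym)
    show "(SUP (x, y)\<in>cube c r \<times> cube c r. infnorm (x - y)) \<le> 2 * r"
      by (rule cSUP_least) (use le mem in auto)
    have bdd: "bdd_above ((\<lambda>(x, y). infnorm (x - y)) ` (cube c r \<times> cube c r))"
      using le by (auto intro!: bdd_aboveI[of _ "2 * r"])
    have "infnorm ((c + ?e) - (c - ?e)) \<le> (SUP (x, y)\<in>cube c r \<times> cube c r. infnorm (x - y))"
      using cSUP_upper[OF _ bdd, of "(c + ?e, c - ?e)"] mem by (simp del: diff_add_eq)
    then show "2 * r \<le> (SUP (x, y)\<in>cube c r \<times> cube c r. infnorm (x - y))"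
      unfolding diff e .
  qed
qed

text \<open>
  Each cube occupies volume at least \<open>(2 \<rho>)\<^sup>n\<close> of the \<open>(2 R)\<^sup>n\<close> available.
\<close>

lemma card_disjoint_cubes:
  fixes c :: "'i \<Rightarrow> real ^ 'n"
  assumes fin: "finite I" and dj: "disjoint_family_on (\<lambda>i. cube (c i) (r i)) I"
    and sub: "\<And>i. i \<in> I \<Longrightarrow> cube (c i) (r i) \<subseteq> cube z R"
    and r: "\<And>i. i \<in> I \<Longrightarrow> \<rho> \<le> r i" and \<rho>: "0 < \<rho>" and R: "0 \<le> R"
  shows "real (card I) \<le> (R / \<rho>) ^ CARD('n)"
proof -
  have "real (card I) * (2 * \<rho>) ^ CARD('n) = (\<Sum>i\<in>I. (2 * \<rho>) ^ CARD('n))" by simp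
  also have "\<dots> \<le> (\<Sum>i\<in>I. measure lborel (cube (c i) (r i)))"
  proof (rule sum_mono)
    fix i assume "i \<in> I"
    then have "\<rho> \<le> r i" by (rule r)
    then show "(2 * \<rho>) ^ CARD('n) \<le> measure lborel (cube (c i) (r i))"
      using \<rho> by (simp add: measure_cube power_mono)
  qed
  also have "\<dots> = measure lborel (\<Union>i\<in>I. cube (c i) (r i))"
  proof (rule measure_finite_Union[symmetric, OF fin _ dj])
    fix i assume "i \<in> I"
    then have "0 \<le> r i" using r \<rho> by force
    then show "emeasure lborel (cube (c i) (r i)) \<noteq> \<infinity>" by (simp add: emeasure_cube)
  qed auto
  also have "\<dots> \<le> measure lborel (cube z R)"
    by (rule measure_mono_fmeasurable)
      (use sub fin R in \<open>auto simp: fmeasurable_def emeasure_cube\<close>)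
  also have "\<dots> = (2 * R) ^ CARD('n)" using R by (rule measure_cube)
  finally show ?thesis using \<rho> by (simp add: power_mult_distrib power_divide field_simps)
qed

section \<open>Distance to the boundary\<close>

lemma uinfdist_nonneg: "S \<noteq> {} \<Longrightarrow> 0 \<le> uinfdist z S"
  unfolding uinfdist_def by (rule cINF_greatest) (auto simp: infnorm_pos_le)

lemma uinfdist_le: "w \<in> S \<Longrightarrow> uinfdist z S \<le> infnorm (z - w)"
  unfolding uinfdist_def
  by (rule cINF_lower) (auto intro!: bdd_belowI[of _ 0] simp: infnorm_pos_le)

lemma uinfdist_lipschitz:
  assumes "S \<noteq> {}"
  shows "uinfdist z S \<le> uinfdist w S + infnorm (z - w)"
proof -
  have "uinfdist z S - infnorm (z - w) \<le> uinfdist w S"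
    unfolding uinfdist_def[of w]
  proof (rule cINF_greatest[OF assms])
    fix x assume "x \<in> S"
    then show "uinfdist z S - infnorm (z - w) \<le> infnorm (w - x)"
      using uinfdist_le[of x S z] infnorm_triangle3[of z x w] by simp
  qed
  then show ?thesis by simp
qed

lemma uinfdist_lipschitz_abs:
  assumes "S \<noteq> {}"
  shows "\<bar>uinfdist z S - uinfdist w S\<bar> \<le> infnorm (z - w)"
  using uinfdist_lipschitz[OF assms, of z w] uinfdist_lipschitz[OF assms, of w z] infnorm_sub[of z w]
  by simp

lemma continuous_on_uinfdist:
  fixes S :: "(real ^ 'n) set"
  assumes "S \<noteq> {}"
  shows "continuous_on T (\<lambda>z. uinfdist z S)"
  unfolding continuous_on_def
proof
  fix x assume "x \<in> T"
  have "((\<lambda>y. infnorm (y - x)) \<longlongrightarrow> 0) (at x within T)"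
    by (rule tendsto_infnorm_iff[THEN iffD1]) (rule tendsto_ident_at)
  then have "((\<lambda>y. uinfdist y S - uinfdist x S) \<longlongrightarrow> 0) (at x within T)"
    by (rule Lim_null_comparison[rotated])
      (use uinfdist_lipschitz_abs[OF assms] in auto)
  then show "((\<lambda>z. uinfdist z S) \<longlongrightarrow> uinfdist x S) (at x within T)"
    by (simp add: LIM_zero_iff)
qed

lemma uinfdist_attained:
  fixes S :: "(real ^ 'n) set"
  assumes "closed S" "S \<noteq> {}"
  obtains a where "a \<in> S" "uinfdist z S = infnorm (z - a)"
proof -
  obtain b where b: "b \<in> S" using assms by auto
  let ?K = "S \<inter> cube z (infnorm (z - b))"
  have "compact ?K" using assms by (simp add: closed_Int_compact)
  moreover have "b \<in> ?K" using b by (simp add: mem_cube infnorm_sub)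
  moreover have "continuous_on ?K (\<lambda>w. infnorm (z - w))"
    by (intro continuous_intros)
  ultimately obtain a where a: "a \<in> ?K" "\<And>w. w \<in> ?K \<Longrightarrow> infnorm (z - a) \<le> infnorm (z - w)"
    using continuous_attains_inf[of ?K "\<lambda>w. infnorm (z - w)"] by blast
  have "infnorm (z - a) \<le> infnorm (z - w)" if "w \<in> S" for w
  proof (cases "w \<in> ?K")
    case False
    then have "infnorm (z - b) \<le> infnorm (z - w)"
      using that by (simp add: mem_cube infnorm_sub)
    then show ?thesis using a(2)[OF \<open>b \<in> ?K\<close>] by simp
  qed (use a in auto)
  then have "infnorm (z - a) \<le> uinfdist z S"
    unfolding uinfdist_def using assms by (intro cINF_greatest) auto
  moreover have "uinfdist z S \<le> infnorm (z - a)" using a by (intro uinfdist_le) auto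
  ultimately show ?thesis using a that by auto
qed

locale proper_domain =
  fixes \<Omega> :: "(real ^ 'n) set"
  assumes dom: "is_domain \<Omega>"
begin

definition bdist :: "real ^ 'n \<Rightarrow> real" where
  "bdist z = uinfdist z (frontier \<Omega>)"

lemma open_dom: "open \<Omega>" and connected_dom: "connected \<Omega>" and dom_nonempty: "\<Omega> \<noteq> {}"
  using dom by (auto simp: is_domain_def)

lemma frontier_dom_nonempty: "frontier \<Omega> \<noteq> {}"
  using dom frontier_eq_empty[of \<Omega>] by (auto simp: is_domain_def)

lemma frontier_disjoint: "frontier \<Omega> \<inter> \<Omega> = {}"
  using open_dom by (simp add: frontier_disjoint_eq)

lemma bdist_nonneg: "0 \<le> bdist z"
  unfolding bdist_def by (rule uinfdist_nonneg[OF frontier_dom_nonempty])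

lemma bdist_le: "w \<in> frontier \<Omega> \<Longrightarrow> bdist z \<le> infnorm (z - w)"
  unfolding bdist_def by (rule uinfdist_le)

lemma bdist_lipschitz: "bdist z \<le> bdist w + infnorm (z - w)"
  unfolding bdist_def by (rule uinfdist_lipschitz[OF frontier_dom_nonempty])

lemma continuous_on_bdist: "continuous_on T bdist"
  unfolding bdist_def by (rule continuous_on_uinfdist[OF frontier_dom_nonempty])

lemma bdist_attained:
  obtains a where "a \<in> frontier \<Omega>" "bdist z = infnorm (z - a)"
  using uinfdist_attained[of "frontier \<Omega>" z] frontier_dom_nonempty
  unfolding bdist_def by auto

lemma bdist_pos: "z \<in> \<Omega> \<Longrightarrow> 0 < bdist z"
proof -
  assume z: "z \<in> \<Omega>"
  obtain a where a: "a \<in> frontier \<Omega>" "bdist z = infnorm (z - a)" by (rule bdist_attained)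
  then have "z - a \<noteq> 0" using z frontier_disjoint by auto
  then show ?thesis using a by (simp add: infnorm_pos_lt)
qed

text \<open>
  A segment leaving \<open>\<Omega>\<close> must cross the frontier.
\<close>

lemma near_point_in_dom:
  assumes x: "x \<in> \<Omega>" and y: "infnorm (y - x) < bdist x"
  shows "y \<in> \<Omega>"
proof (rule ccontr)
  assume "y \<notin> \<Omega>"
  then have "closed_segment x y \<inter> frontier \<Omega> \<noteq> {}"
    using x by (intro connected_Int_frontier) auto
  then obtain w where w: "w \<in> closed_segment x y" "w \<in> frontier \<Omega>" by auto
  then obtain u where u: "0 \<le> u" "u \<le> 1" "w = (1 - u) *\<^sub>R x + u *\<^sub>R y"
    by (auto simp: in_segment)
  have "x - w = u *\<^sub>R (x - y)" using u by (simp add: algebra_simps)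
  then have "infnorm (x - w) = u * infnorm (y - x)"
    using u by (simp add: infnorm_mul infnorm_sub)
  also have "\<dots> \<le> infnorm (y - x)" using u infnorm_pos_le[of "y - x"] by (simp add: mult_left_le_one_le)
  finally show False using bdist_le[OF w(2), of x] y by simp
qed

lemma cube_subset_dom: "x \<in> \<Omega> \<Longrightarrow> r < bdist x \<Longrightarrow> cube x r \<subseteq> \<Omega>"
  using near_point_in_dom by (force simp: mem_cube)

lemma bdist_cube_subset:
  assumes "cube c r \<subseteq> \<Omega>"
  shows "r - infnorm (z - c) \<le> bdist z"
proof -
  obtain a where a: "a \<in> frontier \<Omega>" "bdist z = infnorm (z - a)" by (rule bdist_attained)
  have "a \<notin> cube c r" using a assms frontier_disjoint by auto
  then have "r < infnorm (a - c)" by (simp add: mem_cube)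
  also have "\<dots> \<le> infnorm (z - a) + infnorm (z - c)"
    using infnorm_triangle3[of a c z] infnorm_sub[of a z] by simp
  finally show ?thesis using a by simp
qed

end

section \<open>Arc length\<close>

declare infnorm_0 [simp] infnorm_pos_le [simp]

abbreviation polylen :: "(real \<Rightarrow> real ^ 'n) \<Rightarrow> real \<Rightarrow> real \<Rightarrow> real" where
  "polylen \<gamma> a b \<equiv> Sup (polygonal_sums \<gamma> a b)"

lemma polygonal_sumsI:
  "mono_on {..m} t \<Longrightarrow> t ` {..m} \<subseteq> {a..b} \<Longrightarrow>
    x = (\<Sum>i<m. infnorm (\<gamma> (t (Suc i)) - \<gamma> (t i))) \<Longrightarrow> x \<in> polygonal_sums \<gamma> a b"
  unfolding polygonal_sums_def by blast

lemma polygonal_sumsE: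
  assumes "x \<in> polygonal_sums \<gamma> a b"
  obtains m t where "mono_on {..m} t" "t ` {..m} \<subseteq> {a..b}"
    "x = (\<Sum>i<m. infnorm (\<gamma> (t (Suc i)) - \<gamma> (t i)))"
  using assms unfolding polygonal_sums_def by blast

lemma polygonal_sums_zero: "a \<le> b \<Longrightarrow> 0 \<in> polygonal_sums \<gamma> a b"
  by (rule polygonal_sumsI[where m = 0 and t = "\<lambda>_. a"]) (auto simp: mono_on_def)

lemma polygonal_sums_chord: "a \<le> b \<Longrightarrow> infnorm (\<gamma> b - \<gamma> a) \<in> polygonal_sums \<gamma> a b"
  by (rule polygonal_sumsI[where m = 1 and t = "\<lambda>i. if i = 0 then a else b"])
    (auto simp: mono_on_def)

lemma polygonal_sums_subset: "a' \<le> a \<Longrightarrow> b \<le> b' \<Longrightarrow> polygonal_sums \<gamma> a b \<subseteq> polygonal_sums \<gamma> a' b'"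
  unfolding polygonal_sums_def by fastforce

lemma polygonal_sums_append:
  assumes "x \<in> polygonal_sums \<gamma> a b" "y \<in> polygonal_sums \<gamma> b c"
  shows "\<exists>z\<in>polygonal_sums \<gamma> a c. x + y \<le> z"
proof -
  obtain m t where t: "mono_on {..m} t" "t ` {..m} \<subseteq> {a..b}"
    "x = (\<Sum>i<m. infnorm (\<gamma> (t (Suc i)) - \<gamma> (t i)))"
    using assms(1) by (rule polygonal_sumsE)
  obtain l u where u: "mono_on {..l} u" "u ` {..l} \<subseteq> {b..c}"
    "y = (\<Sum>i<l. infnorm (\<gamma> (u (Suc i)) - \<gamma> (u i)))"
    using assms(2) by (rule polygonal_sumsE)
  define v where "v i = (if i \<le> m then t i else u (i - Suc m))" for i
  let ?s = "\<lambda>i. infnorm (\<gamma> (v (Suc i)) - \<gamma> (v i))"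
  have tb: "a \<le> t i \<and> t i \<le> b" if "i \<le> m" for i using t(2) that by auto
  have ub: "b \<le> u i \<and> u i \<le> c" if "i \<le> l" for i using u(2) that by auto
  have "mono_on {..Suc m + l} v"
  proof (rule mono_onI)
    fix i j :: nat assume ij: "i \<in> {..Suc m + l}" "j \<in> {..Suc m + l}" "i \<le> j"
    show "v i \<le> v j"
    proof (cases "i \<le> m \<and> \<not> j \<le> m")
      case True
      moreover have "j - Suc m \<le> l" using ij by auto
      ultimately show ?thesis using tb[of i] ub[of "j - Suc m"] ij by (simp add: v_def)
    next
      case False
      then show ?thesis
        using ij t(1) u(1) by (auto simp: v_def intro!: mono_onD[OF t(1)] mono_onD[OF u(1)])
    qed
  qed
  moreover have "v ` {..Suc m + l} \<subseteq> {a..c}"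
  proof (rule image_subsetI)
    fix i assume "i \<in> {..Suc m + l}"
    then have "i - Suc m \<le> l" "i \<le> Suc m + l" by auto
    then show "v i \<in> {a..c}"
      using tb[of i] ub[of "i - Suc m"] tb[of 0] ub[of 0] by (cases "i \<le> m") (auto simp: v_def)
  qed
  ultimately have "(\<Sum>i<Suc m + l. ?s i) \<in> polygonal_sums \<gamma> a c"
    by (rule polygonal_sumsI) simp
  moreover have "x + y \<le> (\<Sum>i<Suc m + l. ?s i)"
  proof -
    have "(\<Sum>i<Suc m + l. ?s i) = (\<Sum>i<Suc m. ?s i) + (\<Sum>i<l. ?s (Suc m + i))"
      by (induction l) auto
    also have "(\<Sum>i<l. ?s (Suc m + i)) = y"
      unfolding u(3) by (rule sum.cong) (auto simp: v_def)
    also have "(\<Sum>i<Suc m. ?s i) = (\<Sum>i<m. ?s i) + ?s m" by simp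
    also have "(\<Sum>i<m. ?s i) = x"
      unfolding t(3) by (rule sum.cong) (auto simp: v_def)
    finally show ?thesis using infnorm_pos_le[of "\<gamma> (v (Suc m)) - \<gamma> (v m)"] by simp
  qed
  ultimately show ?thesis by blast
qed

text \<open>
  Truncating the partition points at \<open>b\<close> from above and from below adds \<open>b\<close> as a vertex:
  only the chord that jumps over \<open>b\<close> is affected, and the triangle inequality makes it
  longer.
\<close>

lemma polygonal_sums_split:
  assumes "mono_on {..m} t" "t ` {..m} \<subseteq> {a..c}" "a \<le> b" "b \<le> c"
    and x: "x = (\<Sum>i<m. infnorm (\<gamma> (t (Suc i)) - \<gamma> (t i)))"
    and y: "y = (\<Sum>i<m. infnorm (\<gamma> (min (t (Suc i)) b) - \<gamma> (min (t i) b)))"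
    and z: "z = (\<Sum>i<m. infnorm (\<gamma> (max (t (Suc i)) b) - \<gamma> (max (t i) b)))"
  shows "y \<in> polygonal_sums \<gamma> a b" "z \<in> polygonal_sums \<gamma> b c" "x \<le> y + z"
proof -
  have tm: "t i \<le> t j" if "i \<le> j" "j \<le> m" for i j
    using mono_onD[OF assms(1)] that by auto
  show "y \<in> polygonal_sums \<gamma> a b"
    by (rule polygonal_sumsI[where m = m and t = "\<lambda>i. min (t i) b"])
      (use assms(2,3) tm y in \<open>fastforce simp: mono_on_def\<close>)+
  show "z \<in> polygonal_sums \<gamma> b c"
    by (rule polygonal_sumsI[where m = m and t = "\<lambda>i. max (t i) b"])
      (use assms(2,4) tm z in \<open>fastforce simp: mono_on_def\<close>)+
  show "x \<le> y + z" unfolding x y z sum.distrib[symmetric]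
  proof (rule sum_mono)
    fix i assume "i \<in> {..<m}"
    then have le: "t i \<le> t (Suc i)" using tm by auto
    consider "t (Suc i) \<le> b" | "b \<le> t i" | "t i \<le> b" "b \<le> t (Suc i)" by linarith
    then show "infnorm (\<gamma> (t (Suc i)) - \<gamma> (t i))
        \<le> infnorm (\<gamma> (min (t (Suc i)) b) - \<gamma> (min (t i) b))
         + infnorm (\<gamma> (max (t (Suc i)) b) - \<gamma> (max (t i) b))"
    proof cases
      case 3
      then show ?thesis
        using infnorm_triangle3[of "\<gamma> (t (Suc i))" "\<gamma> (t i)" "\<gamma> b"] by (simp add: min_def max_def)
    qed (use le in \<open>auto simp: min_def max_def infnorm_0\<close>)
  qed
qed

lemma polygonal_sums_affine:
  assumes k: "0 < k" and g: "\<And>t. a \<le> t \<Longrightarrow> t \<le> b \<Longrightarrow> g t = \<gamma> (k * t + d)"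
  shows "polygonal_sums g a b = polygonal_sums \<gamma> (k * a + d) (k * b + d)"
proof (intro set_eqI iffI)
  fix x assume "x \<in> polygonal_sums g a b"
  then obtain m t where t: "mono_on {..m} t" "t ` {..m} \<subseteq> {a..b}"
    "x = (\<Sum>i<m. infnorm (g (t (Suc i)) - g (t i)))" by (rule polygonal_sumsE)
  have tb: "a \<le> t i \<and> t i \<le> b" if "i \<le> m" for i using t(2) that by auto
  show "x \<in> polygonal_sums \<gamma> (k * a + d) (k * b + d)"
  proof (rule polygonal_sumsI)
    show "mono_on {..m} (\<lambda>i. k * t i + d)" using t(1) k by (auto simp: mono_on_def)
    show "(\<lambda>i. k * t i + d) ` {..m} \<subseteq> {k * a + d..k * b + d}" using tb k by auto
    show "x = (\<Sum>i<m. infnorm (\<gamma> (k * t (Suc i) + d) - \<gamma> (k * t i + d)))"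
      unfolding t(3) by (rule sum.cong) (use g tb in auto)
  qed
next
  fix x assume "x \<in> polygonal_sums \<gamma> (k * a + d) (k * b + d)"
  then obtain m t where t: "mono_on {..m} t" "t ` {..m} \<subseteq> {k * a + d..k * b + d}"
    "x = (\<Sum>i<m. infnorm (\<gamma> (t (Suc i)) - \<gamma> (t i)))" by (rule polygonal_sumsE)
  have tb: "k * a + d \<le> t i \<and> t i \<le> k * b + d" if "i \<le> m" for i using t(2) that by auto
  have tb': "a \<le> (t i - d) / k \<and> (t i - d) / k \<le> b" if "i \<le> m" for i
    using tb[OF that] k by (auto simp: field_simps)
  show "x \<in> polygonal_sums g a b"
  proof (rule polygonal_sumsI)
    show "mono_on {..m} (\<lambda>i. (t i - d) / k)" using t(1) k by (auto simp: mono_on_def divide_right_mono)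
    show "(\<lambda>i. (t i - d) / k) ` {..m} \<subseteq> {a..b}" using tb' by auto
    show "x = (\<Sum>i<m. infnorm (g ((t (Suc i) - d) / k) - g ((t i - d) / k)))"
      unfolding t(3) by (rule sum.cong) (use g tb' k in auto)
  qed
qed

lemma polygonal_sums_reflect_subset:
  assumes g: "\<And>t. a \<le> t \<Longrightarrow> t \<le> b \<Longrightarrow> g t = \<gamma> (d - t)"
  shows "polygonal_sums g a b \<subseteq> polygonal_sums \<gamma> (d - b) (d - a)"
proof
  fix x assume "x \<in> polygonal_sums g a b"
  then obtain m t where t: "mono_on {..m} t" "t ` {..m} \<subseteq> {a..b}"
    "x = (\<Sum>i<m. infnorm (g (t (Suc i)) - g (t i)))" by (rule polygonal_sumsE)
  have tb: "a \<le> t i \<and> t i \<le> b" if "i \<le> m" for i using t(2) that by auto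
  show "x \<in> polygonal_sums \<gamma> (d - b) (d - a)"
  proof (rule polygonal_sumsI)
    show "mono_on {..m} (\<lambda>i. d - t (m - i))" using t(1) by (auto simp: mono_on_def)
    show "(\<lambda>i. d - t (m - i)) ` {..m} \<subseteq> {d - b..d - a}" using tb by auto
    have "x = (\<Sum>i<m. infnorm (g (t (Suc (m - Suc i))) - g (t (m - Suc i))))"
      unfolding t(3) by (rule sum.nat_diff_reindex[symmetric])
    also have "\<dots> = (\<Sum>i<m. infnorm (\<gamma> (d - t (m - Suc i)) - \<gamma> (d - t (m - i))))"
    proof (rule sum.cong)
      fix i assume "i \<in> {..<m}"
      then have i: "Suc (m - Suc i) = m - i" by auto
      show "infnorm (g (t (Suc (m - Suc i))) - g (t (m - Suc i)))
          = infnorm (\<gamma> (d - t (m - Suc i)) - \<gamma> (d - t (m - i)))"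
        unfolding i using g tb infnorm_sub by (metis diff_le_self)
    qed simp
    finally show "x = (\<Sum>i<m. infnorm (\<gamma> (d - t (m - Suc i)) - \<gamma> (d - t (m - i))))" .
  qed
qed

lemma polygonal_sums_reflect:
  assumes "\<And>t. a \<le> t \<Longrightarrow> t \<le> b \<Longrightarrow> g t = \<gamma> (d - t)"
  shows "polygonal_sums g a b = polygonal_sums \<gamma> (d - b) (d - a)"
proof
  show "polygonal_sums g a b \<subseteq> polygonal_sums \<gamma> (d - b) (d - a)"
    by (rule polygonal_sums_reflect_subset) (rule assms)
  have "polygonal_sums \<gamma> (d - b) (d - a) \<subseteq> polygonal_sums g (d - (d - a)) (d - (d - b))"
    by (rule polygonal_sums_reflect_subset) (use assms in auto)
  then show "polygonal_sums \<gamma> (d - b) (d - a) \<subseteq> polygonal_sums g a b" by simp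
qed

context
  fixes \<gamma> :: "real \<Rightarrow> real ^ 'n"
  assumes rect: "rectifiable \<gamma>"
begin

lemma bdd_polygonal_sums: "0 \<le> a \<Longrightarrow> b \<le> 1 \<Longrightarrow> bdd_above (polygonal_sums \<gamma> a b)"
  using rect polygonal_sums_subset[of 0 a b 1 \<gamma>] unfolding rectifiable_def
  by (meson bdd_above_mono)

lemma polylen_upper: "0 \<le> a \<Longrightarrow> b \<le> 1 \<Longrightarrow> x \<in> polygonal_sums \<gamma> a b \<Longrightarrow> x \<le> polylen \<gamma> a b"
  using bdd_polygonal_sums by (intro cSup_upper)

lemma polylen_nonneg: "0 \<le> a \<Longrightarrow> a \<le> b \<Longrightarrow> b \<le> 1 \<Longrightarrow> 0 \<le> polylen \<gamma> a b"
  by (rule polylen_upper) (auto intro: polygonal_sums_zero)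

lemma polylen_additive:
  assumes "0 \<le> a" "a \<le> b" "b \<le> c" "c \<le> 1"
  shows "polylen \<gamma> a c = polylen \<gamma> a b + polylen \<gamma> b c"
proof (rule antisym)
  show "polylen \<gamma> a c \<le> polylen \<gamma> a b + polylen \<gamma> b c"
  proof (rule cSup_least)
    show "polygonal_sums \<gamma> a c \<noteq> {}" using polygonal_sums_zero[of a c \<gamma>] assms by auto
    fix x assume "x \<in> polygonal_sums \<gamma> a c"
    then obtain m t where t: "mono_on {..m} t" "t ` {..m} \<subseteq> {a..c}"
      "x = (\<Sum>i<m. infnorm (\<gamma> (t (Suc i)) - \<gamma> (t i)))" by (rule polygonal_sumsE)
    note s = polygonal_sums_split[OF t(1,2) assms(2,3) t(3) refl refl]
    show "x \<le> polylen \<gamma> a b + polylen \<gamma> b c"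
      using s(3) polylen_upper[OF _ _ s(1)] polylen_upper[OF _ _ s(2)] assms by simp
  qed
  have "polylen \<gamma> a b \<le> polylen \<gamma> a c - polylen \<gamma> b c"
  proof (rule cSup_least)
    show "polygonal_sums \<gamma> a b \<noteq> {}" using polygonal_sums_zero[of a b \<gamma>] assms by auto
    fix x assume x: "x \<in> polygonal_sums \<gamma> a b"
    have "polylen \<gamma> b c \<le> polylen \<gamma> a c - x"
    proof (rule cSup_least)
      show "polygonal_sums \<gamma> b c \<noteq> {}" using polygonal_sums_zero[of b c \<gamma>] assms by auto
      fix y assume y: "y \<in> polygonal_sums \<gamma> b c"
      obtain z where "z \<in> polygonal_sums \<gamma> a c" "x + y \<le> z"
        using polygonal_sums_append[OF x y] by auto
      then show "y \<le> polylen \<gamma> a c - x" using polylen_upper[of a c z] assms by simp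
    qed
    then show "x \<le> polylen \<gamma> a c - polylen \<gamma> b c" by simp
  qed
  then show "polylen \<gamma> a b + polylen \<gamma> b c \<le> polylen \<gamma> a c" by simp
qed

text \<open>
  Arc length has no jump to the right of \<open>t\<close>. Take a polygon on \<open>[t, 1]\<close> whose length is
  almost that of the curve and choose \<open>u\<close> before its next vertex after \<open>t\<close>. On \<open>[t, u]\<close> the
  polygon has at most one chord, which is short by continuity of the curve; so the curve on
  \<open>[u, 1]\<close> already has almost the full length, and additivity leaves little for \<open>[t, u]\<close>.
\<close>

lemma polylen_right_small:
  assumes t: "0 \<le> t" "t < 1" and \<epsilon>: "0 < \<epsilon>"
  shows "\<exists>u>t. u \<le> 1 \<and> polylen \<gamma> t u < \<epsilon>"
proof -
  have "polylen \<gamma> t 1 - \<epsilon> / 2 < polylen \<gamma> t 1" using \<epsilon> by simp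
  then obtain x where x: "x \<in> polygonal_sums \<gamma> t 1" "polylen \<gamma> t 1 - \<epsilon> / 2 < x"
    using less_cSupD[of "polygonal_sums \<gamma> t 1"] polygonal_sums_zero[of t 1 \<gamma>] t by fastforce
  then obtain m \<tau> where \<tau>: "mono_on {..m} \<tau>" "\<tau> ` {..m} \<subseteq> {t..1}"
    "x = (\<Sum>i<m. infnorm (\<gamma> (\<tau> (Suc i)) - \<gamma> (\<tau> i)))" by (auto elim: polygonal_sumsE)
  have "path \<gamma>" using rect by (simp add: rectifiable_def)
  then have "(\<gamma> \<longlongrightarrow> \<gamma> t) (at t within {0..1})"
    using t by (auto simp: path_def continuous_on_def)
  then have "((\<lambda>v. infnorm (\<gamma> v - \<gamma> t)) \<longlongrightarrow> 0) (at t within {0..1})"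
    using tendsto_infnorm_iff by blast
  then have "\<forall>\<^sub>F v in at t within {0..1}. infnorm (\<gamma> v - \<gamma> t) < \<epsilon> / 2"
    using \<epsilon> by (intro order_tendstoD) auto
  then obtain \<delta> where \<delta>: "0 < \<delta>" "\<And>v. v \<in> {0..1} \<Longrightarrow> v \<noteq> t \<Longrightarrow> dist v t < \<delta> \<Longrightarrow> infnorm (\<gamma> v - \<gamma> t) < \<epsilon> / 2"
    unfolding eventually_at by auto
  \<comment> \<open>\<open>u\<close> lies to the left of the next vertex and is so close to \<open>t\<close> that its chord is short.\<close>
  let ?S = "insert 1 {v \<in> \<tau> ` {..m}. t < v}"
  define u where "u = min (Min ?S) (t + \<delta> / 2)"
  have "t < Min ?S" using t by (subst Min_gr_iff) auto
  then have u1: "t < u" using \<delta> by (simp add: u_def)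
  have "Min ?S \<le> 1" by (rule Min_le) auto
  then have u2: "u \<le> 1" unfolding u_def by linarith
  have \<tau>u: "min (\<tau> i) u = t \<or> min (\<tau> i) u = u" if "i \<le> m" for i
  proof (cases "\<tau> i = t")
    case False
    then have "\<tau> i \<in> ?S" using \<tau>(2) that by force
    then have "Min ?S \<le> \<tau> i" by (intro Min_le) auto
    then show ?thesis by (simp add: u_def)
  qed (use u1 in auto)
  note s = polygonal_sums_split[OF \<tau>(1,2) _ u2 \<tau>(3) refl refl]
  let ?v = "\<lambda>i. min (\<tau> i) u"
  have sum: "(\<Sum>i<j. infnorm (\<gamma> (?v (Suc i)) - \<gamma> (?v i))) = infnorm (\<gamma> (?v j) - \<gamma> (?v 0))" if "j \<le> m" for j
    using that
  proof (induction j)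
    case (Suc j)
    show ?case
    proof (cases "?v (Suc j) = ?v j")
      case True
      then show ?thesis using Suc by (simp add: infnorm_0)
    next
      case False
      have "?v j \<le> ?v (Suc j)" using mono_onD[OF \<tau>(1), of j "Suc j"] Suc.prems by auto
      then have vj: "?v j = t" using \<tau>u[of j] \<tau>u[of "Suc j"] False u1 Suc.prems by auto
      have "?v 0 \<le> ?v j" using mono_onD[OF \<tau>(1), of 0 j] Suc.prems by auto
      then have "?v 0 = t" using \<tau>u[of 0] u1 vj Suc.prems by auto
      then show ?thesis using Suc vj by (simp add: infnorm_0)
    qed
  qed (simp add: infnorm_0)
  have "u \<le> t + \<delta> / 2" by (simp add: u_def)
  then have "infnorm (\<gamma> u - \<gamma> t) < \<epsilon> / 2" using \<delta>(1) u1 u2 t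
    by (intro \<delta>(2)) (auto simp: dist_real_def)
  then have "infnorm (\<gamma> (?v m) - \<gamma> (?v 0)) < \<epsilon> / 2"
    using \<tau>u[of m] \<tau>u[of 0] \<epsilon> by (auto simp: infnorm_0 infnorm_sub)
  moreover have "(\<Sum>i<m. infnorm (\<gamma> (max (\<tau> (Suc i)) u) - \<gamma> (max (\<tau> i) u))) \<le> polylen \<gamma> u 1"
    by (rule polylen_upper) (use s(2) u1 t in auto)
  ultimately have "x < \<epsilon> / 2 + polylen \<gamma> u 1"
    using s(3) u1 sum[of m] by simp
  moreover have "polylen \<gamma> t 1 = polylen \<gamma> t u + polylen \<gamma> u 1"
    by (rule polylen_additive) (use t u1 u2 in auto)
  ultimately have "polylen \<gamma> t u < \<epsilon>" using x(2) by simp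
  then show ?thesis using u1 u2 by blast
qed

lemma rectifiable_reversepath: "rectifiable (reversepath \<gamma>)"
proof -
  have "polygonal_sums (reversepath \<gamma>) 0 1 = polygonal_sums \<gamma> (1 - 1) (1 - 0)"
    by (rule polygonal_sums_reflect) (simp add: reversepath_def)
  then show ?thesis using rect by (simp add: rectifiable_def)
qed

lemma arc_length_eq: "0 \<le> t \<Longrightarrow> t \<le> 1 \<Longrightarrow> arc_length_fun \<gamma> t = polylen \<gamma> 0 t"
  by (simp add: arc_length_fun_def)

lemma arc_length_clip: "arc_length_fun \<gamma> t = arc_length_fun \<gamma> (max 0 (min 1 t))"
  by (simp add: arc_length_fun_def)

lemma arc_length_diff: "0 \<le> a \<Longrightarrow> a \<le> b \<Longrightarrow> b \<le> 1 \<Longrightarrow> arc_length_fun \<gamma> b - arc_length_fun \<gamma> a = polylen \<gamma> a b"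
  using polylen_additive[of 0 a b] by (simp add: arc_length_eq)

lemma arc_length_mono: 
  assumes "a \<le> b" 
  shows "arc_length_fun \<gamma> a \<le> arc_length_fun \<gamma> b"
proof -
  define a' b' where "a' = max 0 (min 1 a)" and "b' = max 0 (min 1 b)"
  have ab: "0 \<le> a'" "a' \<le> b'" "b' \<le> 1" using assms by (auto simp: a'_def b'_def)
  have "arc_length_fun \<gamma> a = arc_length_fun \<gamma> a'" "arc_length_fun \<gamma> b = arc_length_fun \<gamma> b'"
    unfolding a'_def b'_def by (rule arc_length_clip)+
  then show ?thesis using arc_length_diff[OF ab] polylen_nonneg[OF ab] by linarith
qed

end

lemma polylen_left_small:
  assumes rect: "rectifiable \<gamma>" and t: "0 < t" "t \<le> 1" and \<epsilon>: "0 < \<epsilon>"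
  shows "\<exists>u<t. 0 \<le> u \<and> polylen \<gamma> u t < \<epsilon>"
proof -
  obtain u where u: "1 - t < u" "u \<le> 1" "polylen (reversepath \<gamma>) (1 - t) u < \<epsilon>"
    using polylen_right_small[OF rectifiable_reversepath[OF rect], of "1 - t" \<epsilon>] t \<epsilon> by auto
  have "polygonal_sums (reversepath \<gamma>) (1 - t) u = polygonal_sums \<gamma> (1 - u) (1 - (1 - t))"
    by (rule polygonal_sums_reflect) (simp add: reversepath_def)
  then show ?thesis using u by (intro exI[of _ "1 - u"]) auto
qed

text \<open>
  Continuity makes points null for the Stieltjes measure of arc length, so that half-open
  and closed parameter intervals have the same measure.
\<close>

lemma arc_length_isCont:
  assumes rect: "rectifiable \<gamma>"
  shows "isCont (arc_length_fun \<gamma>) t"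
proof -
  let ?s = "arc_length_fun \<gamma>"
  note mono = arc_length_mono[OF rect]
  have right: "\<exists>\<delta>>0. ?s (t + \<delta>) < ?s t + \<epsilon>" if \<epsilon>: "0 < \<epsilon>" for \<epsilon>
  proof (cases "0 \<le> t \<and> t < 1")
    case True
    then obtain u where u: "t < u" "u \<le> 1" "polylen \<gamma> t u < \<epsilon>"
      using polylen_right_small[OF rect _ _ \<epsilon>, of t] by auto
    then show ?thesis using arc_length_diff[OF rect, of t u] True by (intro exI[of _ "u - t"]) auto
  next
    case False
    show ?thesis
    proof (cases "1 \<le> t")
      case True
      then show ?thesis using arc_length_clip[OF rect, of t] arc_length_clip[OF rect, of "t + 1"] \<epsilon>
        by (intro exI[of _ 1]) auto
    next
      case False
      then have "t < 0" using \<open>\<not> (0 \<le> t \<and> t < 1)\<close> by auto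
      then show ?thesis using arc_length_clip[OF rect, of t] \<epsilon>
        by (intro exI[of _ "- t"]) auto
    qed
  qed
  have left: "\<exists>\<delta>>0. ?s t - \<epsilon> < ?s (t - \<delta>)" if \<epsilon>: "0 < \<epsilon>" for \<epsilon>
  proof (cases "0 < t \<and> t \<le> 1")
    case True
    then obtain u where u: "u < t" "0 \<le> u" "polylen \<gamma> u t < \<epsilon>"
      using polylen_left_small[OF rect _ _ \<epsilon>, of t] by auto
    then show ?thesis using arc_length_diff[OF rect, of u t] True by (intro exI[of _ "t - u"]) auto
  next
    case False
    show ?thesis
    proof (cases "t \<le> 0")
      case True
      then show ?thesis using arc_length_clip[OF rect, of t] arc_length_clip[OF rect, of "t - 1"] \<epsilon>
        by (intro exI[of _ 1]) auto
    next
      case False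
      then have "1 < t" using \<open>\<not> (0 < t \<and> t \<le> 1)\<close> by auto
      then show ?thesis using arc_length_clip[OF rect, of t] \<epsilon>
        by (intro exI[of _ "t - 1"]) auto
    qed
  qed
  show ?thesis
    unfolding continuous_at_eps_delta
  proof (intro allI impI)
    fix \<epsilon> :: real assume \<epsilon>: "0 < \<epsilon>"
    obtain \<delta>1 where 1: "\<delta>1 > 0" "?s (t + \<delta>1) < ?s t + \<epsilon>" using right[OF \<epsilon>] by auto
    obtain \<delta>2 where 2: "\<delta>2 > 0" "?s t - \<epsilon> < ?s (t - \<delta>2)" using left[OF \<epsilon>] by auto
    have "dist (?s x) (?s t) < \<epsilon>" if "dist x t < min \<delta>1 \<delta>2" for x
      using that 1 2 mono[of x "t + \<delta>1"] mono[of "t - \<delta>2" x]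
      by (auto simp: dist_real_def abs_less_iff)
    then show "\<exists>d>0. \<forall>x. dist x t < d \<longrightarrow> dist (?s x) (?s t) < \<epsilon>"
      using 1 2 by (intro exI[of _ "min \<delta>1 \<delta>2"]) auto
  qed
qed

section \<open>Integration along curves\<close>

abbreviation arc_measure :: "(real \<Rightarrow> real ^ 'n) \<Rightarrow> real measure" where
  "arc_measure \<gamma> \<equiv> interval_measure (arc_length_fun \<gamma>)"

context
  fixes \<gamma> :: "real \<Rightarrow> real ^ 'n"
  assumes rect: "rectifiable \<gamma>"
begin

lemma emeasure_arc_Icc:
  assumes "0 \<le> a" "a \<le> b" "b \<le> 1"
  shows "emeasure (arc_measure \<gamma>) {a..b} = ennreal (polylen \<gamma> a b)"
  unfolding arc_length_diff[OF rect assms, symmetric]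
  by (rule emeasure_interval_measure_Icc[OF assms(2)])
    (use arc_length_mono[OF rect] arc_length_isCont[OF rect]
      in \<open>auto intro: continuous_at_imp_continuous_on\<close>)

lemma emeasure_arc_singleton:
  assumes "0 \<le> a" "a \<le> 1"
  shows "emeasure (arc_measure \<gamma>) {a} = 0"
  using emeasure_arc_Icc[of a a] polylen_additive[OF rect, of a a a] assms by simp

lemma integrable_arc:
  fixes w :: "real ^ 'n \<Rightarrow> real"
  assumes ab: "0 \<le> a" "a \<le> b" "b \<le> 1" and w: "continuous_on (path_image \<gamma>) w"
  shows "set_integrable (arc_measure \<gamma>) {a..b} (\<lambda>t. w (\<gamma> t))"
proof -
  have "continuous_on {0..1} \<gamma>" using rect by (simp add: rectifiable_def path_def)
  then have c: "continuous_on {0..1} (\<lambda>t. w (\<gamma> t))"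
    by (rule continuous_on_compose2[OF w]) (auto simp: path_image_def)
  then have c': "continuous_on {a..b} (\<lambda>t. w (\<gamma> t))"
    by (rule continuous_on_subset) (use ab in auto)
  then have "bounded ((\<lambda>t. w (\<gamma> t)) ` {a..b})"
    by (intro compact_imp_bounded compact_continuous_image) auto
  then obtain B where "\<forall>x\<in>(\<lambda>t. w (\<gamma> t)) ` {a..b}. norm x \<le> B"
    unfolding bounded_iff by blast
  then have B: "\<And>t. t \<in> {a..b} \<Longrightarrow> norm (w (\<gamma> t)) \<le> B" by blast
  show ?thesis
    unfolding set_integrable_def
  proof (rule Bochner_Integration.integrable_bound)
    show "integrable (arc_measure \<gamma>) (\<lambda>t. indicator {a..b} t *\<^sub>R B)"
      using emeasure_arc_Icc[OF ab] by (intro integrable_real_indicator integrable_scaleR_left) auto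
    have "(\<lambda>t. indicator {a..b} t *\<^sub>R w (\<gamma> t)) \<in> borel_measurable borel"
      by (rule borel_measurable_continuous_on_indicator) (use c' in auto)
    then show "(\<lambda>t. indicator {a..b} t *\<^sub>R w (\<gamma> t)) \<in> borel_measurable (arc_measure \<gamma>)"
      by (simp cong: measurable_cong_sets)
    show "AE t in arc_measure \<gamma>. norm (indicator {a..b} t *\<^sub>R w (\<gamma> t)) \<le> norm (indicator {a..b} t *\<^sub>R B)"
      using B by (intro AE_I2) (force simp: indicator_def)
  qed
qed

lemma arc_integral_split:
  assumes ab: "0 \<le> a" "a \<le> 1" and w: "continuous_on (path_image \<gamma>) w"
  shows "arc_integral \<gamma> w = (LINT t:{0..a}|arc_measure \<gamma>. w (\<gamma> t)) + (LINT t:{a..1}|arc_measure \<gamma>. w (\<gamma> t))"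
proof -
  have i: "set_integrable (arc_measure \<gamma>) {0..a} (\<lambda>t. w (\<gamma> t))"
     "set_integrable (arc_measure \<gamma>) {a..1} (\<lambda>t. w (\<gamma> t))"
    using ab w by (auto intro!: integrable_arc)
  have "arc_integral \<gamma> w = (LINT t:{0..a} \<union> {a..1}|arc_measure \<gamma>. w (\<gamma> t))"
    using ab by (simp add: arc_integral_def ivl_disj_un_two_touch)
  also have "\<dots> = (LINT t:{0..a}|arc_measure \<gamma>. w (\<gamma> t)) + (LINT t:{a..1}|arc_measure \<gamma>. w (\<gamma> t))"
  proof (rule set_integral_Un_AE[OF _ _ _ i])
    have "AE x in arc_measure \<gamma>. x \<noteq> a"
      using emeasure_arc_singleton[OF ab] by (intro AE_I[where N = "{a}"]) auto
    then show "AE x in arc_measure \<gamma>. \<not> (x \<in> {0..a} \<and> x \<in> {a..1})" by eventually_elim auto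
  qed auto
  finally show ?thesis .
qed

lemma arc_integral_upper:
  assumes w: "continuous_on (path_image \<gamma>) w" and B: "\<And>z. z \<in> path_image \<gamma> \<Longrightarrow> w z \<le> B"
  shows "arc_integral \<gamma> w \<le> B * polylen \<gamma> 0 1"
proof -
  have fin: "set_integrable (arc_measure \<gamma>) {0..1} (\<lambda>t. B)"
    unfolding set_integrable_def
    using emeasure_arc_Icc[of 0 1] by (intro integrable_real_indicator integrable_scaleR_left) auto
  have "arc_integral \<gamma> w \<le> (LINT t:{0..1}|arc_measure \<gamma>. B)"
    unfolding arc_integral_def
    by (rule set_integral_mono[OF integrable_arc[OF _ _ _ w] fin]) (use B in \<open>auto simp: path_image_def\<close>)
  also have "\<dots> = B * measure (arc_measure \<gamma>) {0..1}"
    by (simp add: set_lebesgue_integral_def)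
  also have "measure (arc_measure \<gamma>) {0..1} = polylen \<gamma> 0 1"
    using emeasure_arc_Icc[of 0 1] polylen_nonneg[OF rect, of 0 1] by (simp add: measure_def)
  finally show ?thesis .
qed

lemma arc_integral_lower:
  assumes w: "continuous_on (path_image \<gamma>) w" and w0: "\<And>z. z \<in> path_image \<gamma> \<Longrightarrow> 0 \<le> w z"
    and b: "0 \<le> b" "b \<le> 1" and B: "\<And>t. t \<in> {0..b} \<Longrightarrow> B \<le> w (\<gamma> t)"
  shows "B * polylen \<gamma> 0 b \<le> arc_integral \<gamma> w"
proof -
  have fin: "set_integrable (arc_measure \<gamma>) {0..b} (\<lambda>t. B)"
    unfolding set_integrable_def
    using emeasure_arc_Icc[of 0 b] b by (intro integrable_real_indicator integrable_scaleR_left) auto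
  have "B * polylen \<gamma> 0 b = B * measure (arc_measure \<gamma>) {0..b}"
    using emeasure_arc_Icc[of 0 b] polylen_nonneg[OF rect, of 0 b] b by (simp add: measure_def)
  also have "\<dots> = (LINT t:{0..b}|arc_measure \<gamma>. B)"
    by (simp add: set_lebesgue_integral_def)
  also have "\<dots> \<le> (LINT t:{0..b}|arc_measure \<gamma>. w (\<gamma> t))"
    by (rule set_integral_mono[OF fin integrable_arc[OF _ _ _ w]]) (use B b in auto)
  also have "\<dots> \<le> arc_integral \<gamma> w"
  proof -
    have "0 \<le> (LINT t:{b..1}|arc_measure \<gamma>. w (\<gamma> t))"
      unfolding set_lebesgue_integral_def
      using w0 b by (intro integral_nonneg_AE AE_I2) (auto simp: indicator_def path_image_def)
    then show ?thesis using arc_integral_split[OF b w] by simp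
  qed
  finally show ?thesis .
qed

lemma arc_integral_nonneg:
  assumes w0: "\<And>z. z \<in> path_image \<gamma> \<Longrightarrow> 0 \<le> w z"
  shows "0 \<le> arc_integral \<gamma> w"
  unfolding arc_integral_def set_lebesgue_integral_def
  using w0 by (intro integral_nonneg_AE AE_I2) (auto simp: indicator_def path_image_def)

end

text \<open>
  A change of variables for \<open>ds\<close>. Both sides integrate \<open>w \<circ> g\<close> over \<open>[a, b]\<close>, on the left
  against the arc length measure of \<open>g\<close>, on the right against the image under \<open>\<theta>\<close> of that of
  \<open>\<gamma>\<close>. The hypothesis \<open>len\<close> says that these measures agree on intervals, hence they are
  equal. It is applied with affine \<open>\<theta>\<close>, to reversed and to joined paths.
\<close>

lemma arc_integral_transfer:
  fixes \<gamma> g :: "real \<Rightarrow> real ^ 'n" and w :: "real ^ 'n \<Rightarrow> real"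
  assumes \<gamma>: "rectifiable \<gamma>" and g: "rectifiable g" and ab: "0 \<le> a" "a \<le> b" "b \<le> 1"
    and \<theta>: "\<theta> \<in> borel_measurable borel" and S: "S \<in> sets borel"
    and \<theta>S: "\<And>v. v \<in> S \<longleftrightarrow> \<theta> v \<in> {a..b}"
    and g\<theta>: "\<And>v. v \<in> S \<Longrightarrow> g (\<theta> v) = \<gamma> v"
    and len: "\<And>u v. a \<le> u \<Longrightarrow> u \<le> v \<Longrightarrow> v \<le> b \<Longrightarrow>
      emeasure (arc_measure \<gamma>) (\<theta> -` {u..v}) = ennreal (polylen g u v)"
    and w: "continuous_on (path_image g) w"
  shows "(LINT t:{a..b}|arc_measure g. w (g t)) = (LINT t:S|arc_measure \<gamma>. w (\<gamma> t))"
proof -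
  let ?N1 = "density (arc_measure g) (indicator {a..b})"
  let ?N2 = "distr (density (arc_measure \<gamma>) (indicator S)) borel \<theta>"
  have [measurable]: "\<theta> \<in> borel_measurable borel" "S \<in> sets borel" by fact+
  have null1: "emeasure (arc_measure g) {u} = 0" and null2: "emeasure (arc_measure \<gamma>) (\<theta> -` {u}) = 0"
    if "a \<le> u" "u \<le> b" for u
    using emeasure_arc_singleton[OF g, of u] len[of u u] polylen_additive[OF g, of u u u] that ab by auto
  have e1: "emeasure ?N1 {x<..} = emeasure (arc_measure g) ({x<..} \<inter> {a..b})" for x
    by (subst emeasure_density) (auto simp: indicator_inter_arith[symmetric] Int_commute)
  have e2: "emeasure ?N2 {x<..} = emeasure (arc_measure \<gamma>) (\<theta> -` ({x<..} \<inter> {a..b}))" for x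
  proof -
    have "emeasure ?N2 {x<..} = emeasure (density (arc_measure \<gamma>) (indicator S)) (\<theta> -` {x<..})"
      by (subst emeasure_distr) (auto simp: measurable_cong_sets[OF sets_density refl] cong: measurable_cong_sets)
    also have "\<dots> = emeasure (arc_measure \<gamma>) (S \<inter> \<theta> -` {x<..})"
      using measurable_sets[OF \<theta>, of "{x<..}"]
      by (subst emeasure_density) (auto simp: indicator_inter_arith[symmetric])
    also have "S \<inter> \<theta> -` {x<..} = \<theta> -` ({x<..} \<inter> {a..b})" by (auto simp: \<theta>S)
    finally show ?thesis .
  qed
  have eq: "emeasure (arc_measure g) ({x<..} \<inter> {a..b}) = emeasure (arc_measure \<gamma>) (\<theta> -` ({x<..} \<inter> {a..b})) \<and>
      emeasure (arc_measure g) ({x<..} \<inter> {a..b}) < \<infinity>" for x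
  proof -
    have lt: "\<theta> -` A \<in> sets borel" if "A \<in> sets borel" for A
      using measurable_sets[OF \<theta> that] by simp
    consider "x < a" | "a \<le> x" "x \<le> b" | "b < x" by linarith
    then show ?thesis
    proof cases
      case 1
      then have "{x<..} \<inter> {a..b} = {a..b}" by auto
      then show ?thesis using len[of a b] emeasure_arc_Icc[OF g ab] ab by simp
    next
      case 2
      have s: "{x..b} = {x} \<union> ({x<..} \<inter> {a..b})" using 2 by auto
      have "emeasure (arc_measure g) {x..b} = emeasure (arc_measure g) ({x<..} \<inter> {a..b})"
        unfolding s Un_commute[of "{x}"] 
        by (rule emeasure_Un_null_set) (use null1 2 in \<open>auto simp: null_sets_def\<close>)
      moreover have "emeasure (arc_measure \<gamma>) (\<theta> -` {x..b}) = emeasure (arc_measure \<gamma>) (\<theta> -` ({x<..} \<inter> {a..b}))"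
        unfolding s vimage_Un Un_commute[of "\<theta> -` {x}"] 
        by (rule emeasure_Un_null_set) (use null2 2 lt in \<open>auto simp: null_sets_def\<close>)
      moreover have "emeasure (arc_measure g) {x..b} = emeasure (arc_measure \<gamma>) (\<theta> -` {x..b})"
        using len[of x b] emeasure_arc_Icc[OF g, of x b] 2 ab by simp
      moreover have "emeasure (arc_measure g) {x..b} < \<infinity>"
        using emeasure_arc_Icc[OF g, of x b] 2 ab by simp
      ultimately show ?thesis by simp
    next
      case 3
      then have "{x<..} \<inter> {a..b} = {}" by auto
      then show ?thesis by simp
    qed
  qed
  have N: "?N1 = ?N2"
  proof (rule measure_eqI_lessThan)
    show "emeasure ?N1 {x<..} < \<infinity>" for x using eq[of x] unfolding e1 by blast
    show "emeasure ?N1 {x<..} = emeasure ?N2 {x<..}" for x using eq[of x] unfolding e1 e2 by blast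
  qed simp_all
  let ?h = "\<lambda>t. indicator {a..b} t *\<^sub>R w (g t)"
  have "continuous_on {a..b} g" 
    using g ab by (auto simp: rectifiable_def path_def intro: continuous_on_subset)
  then have "continuous_on {a..b} (\<lambda>t. w (g t))"
    using ab by (intro continuous_on_compose2[OF w]) (auto simp: path_image_def)
  then have h [measurable]: "?h \<in> borel_measurable borel"
    by (rule borel_measurable_continuous_on_indicator[rotated]) auto
  have "(LINT t:{a..b}|arc_measure g. w (g t)) = integral\<^sup>L ?N1 ?h"
  proof -
    have hg: "?h \<in> borel_measurable (arc_measure g)" using h by (simp cong: measurable_cong_sets)
    have "integral\<^sup>L ?N1 ?h = (\<integral>t. indicator {a..b} t *\<^sub>R ?h t \<partial>arc_measure g)"
      using integral_density[of ?h "arc_measure g" "indicator {a..b}"] hg by (simp add: ennreal_indicator)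
    also have "\<dots> = integral\<^sup>L (arc_measure g) ?h"
      by (rule Bochner_Integration.integral_cong) (auto simp: indicator_def)
    finally show ?thesis by (simp add: set_lebesgue_integral_def)
  qed
  also have "\<dots> = integral\<^sup>L ?N2 ?h" unfolding N ..
  also have "\<dots> = (\<integral>t. ?h (\<theta> t) \<partial>density (arc_measure \<gamma>) (indicator S))"
  proof -
    have "\<theta> \<in> measurable (density (arc_measure \<gamma>) (indicator S)) borel"
      using \<theta> by (simp cong: measurable_cong_sets)
    then show ?thesis
      using integral_distr[of \<theta> "density (arc_measure \<gamma>) (indicator S)" borel ?h] h by simp
  qed
  also have "\<dots> = (\<integral>t. indicator S t *\<^sub>R ?h (\<theta> t) \<partial>arc_measure \<gamma>)"
  proof -
    have "(\<lambda>t. ?h (\<theta> t)) \<in> borel_measurable borel" by measurable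
    then have "(\<lambda>t. ?h (\<theta> t)) \<in> borel_measurable (arc_measure \<gamma>)" by (simp cong: measurable_cong_sets)
    then show ?thesis
      using integral_density[of "\<lambda>t. ?h (\<theta> t)" "arc_measure \<gamma>" "indicator S"] 
      by (simp add: ennreal_indicator)
  qed
  also have "\<dots> = (LINT t:S|arc_measure \<gamma>. w (\<gamma> t))"
    unfolding set_lebesgue_integral_def
    by (rule Bochner_Integration.integral_cong) (use \<theta>S g\<theta> in \<open>auto simp: indicator_def\<close>)
  finally show ?thesis .
qed

lemma arc_integral_reversepath:
  assumes \<gamma>: "rectifiable \<gamma>" and w: "continuous_on (path_image \<gamma>) w"
  shows "arc_integral (reversepath \<gamma>) w = arc_integral \<gamma> w"
  unfolding arc_integral_def
proof (rule arc_integral_transfer[OF \<gamma> rectifiable_reversepath[OF \<gamma>], where \<theta> = "\<lambda>v. 1 - v"])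
  fix u v :: real assume uv: "0 \<le> u" "u \<le> v" "v \<le> 1"
  have "(\<lambda>v. 1 - v) -` {u..v} = {1 - v..1 - u}" by auto
  moreover have "polygonal_sums (reversepath \<gamma>) u v = polygonal_sums \<gamma> (1 - v) (1 - u)"
    by (rule polygonal_sums_reflect) (simp add: reversepath_def)
  ultimately show "emeasure (arc_measure \<gamma>) ((\<lambda>v. 1 - v) -` {u..v}) = ennreal (polylen (reversepath \<gamma>) u v)"
    using emeasure_arc_Icc[OF \<gamma>, of "1 - v" "1 - u"] uv by simp
next
  show "reversepath \<gamma> (1 - v) = \<gamma> v" for v by (simp add: reversepath_def)
qed (use w in \<open>auto simp: path_image_reversepath\<close>)

context
  fixes g1 g2 :: "real \<Rightarrow> real ^ 'n"
  assumes g1: "rectifiable g1" and g2: "rectifiable g2" and join: "pathfinish g1 = pathstart g2"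
begin

lemma polygonal_sums_join1:
  "0 \<le> a \<Longrightarrow> b \<le> 1 / 2 \<Longrightarrow> polygonal_sums (g1 +++ g2) a b = polygonal_sums g1 (2 * a) (2 * b)"
  using polygonal_sums_affine[of 2 a b "g1 +++ g2" g1 0] by (simp add: joinpaths_def)

lemma polygonal_sums_join2:
  assumes "1 / 2 \<le> a"
  shows "polygonal_sums (g1 +++ g2) a b = polygonal_sums g2 (2 * a - 1) (2 * b - 1)"
proof -
  have "(g1 +++ g2) t = g2 (2 * t + -1)" if "1 / 2 \<le> t" for t
  proof (cases "t = 1 / 2")
    case True
    show ?thesis using join unfolding True by (simp add: joinpaths_def pathfinish_def pathstart_def)
  qed (use that in \<open>simp add: joinpaths_def\<close>)
  then show ?thesis using polygonal_sums_affine[of 2 a b "g1 +++ g2" g2 "-1"] assms by simp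
qed

lemma rectifiable_joinpaths: "rectifiable (g1 +++ g2)"
  unfolding rectifiable_def
proof
  show "path (g1 +++ g2)" using g1 g2 join by (simp add: rectifiable_def)
  show "bdd_above (polygonal_sums (g1 +++ g2) 0 1)"
  proof (rule bdd_aboveI)
    fix x assume "x \<in> polygonal_sums (g1 +++ g2) 0 1"
    then obtain m t where t: "mono_on {..m} t" "t ` {..m} \<subseteq> {0..1}"
      "x = (\<Sum>i<m. infnorm ((g1 +++ g2) (t (Suc i)) - (g1 +++ g2) (t i)))" by (rule polygonal_sumsE)
    have h: "0 \<le> (1/2 :: real)" "1/2 \<le> (1 :: real)" by auto
    note s = polygonal_sums_split[OF t(1,2) h t(3) refl refl]
    show "x \<le> polylen g1 0 1 + polylen g2 0 1"
      using s polylen_upper[OF g1, of 0 1] polylen_upper[OF g2, of 0 1]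
        polygonal_sums_join1[of 0 "1/2"] polygonal_sums_join2[of "1/2" 1] by force
  qed
qed

lemma arc_integral_joinpaths:
  assumes w1: "continuous_on (path_image g1 \<union> path_image g2) w"
  shows "arc_integral (g1 +++ g2) w = arc_integral g1 w + arc_integral g2 w"
proof -
  let ?g = "g1 +++ g2"
  have w: "continuous_on (path_image ?g) w"
    using w1 join by (simp add: path_image_join)
  have "(LINT t:{0..1/2}|arc_measure ?g. w (?g t)) = arc_integral g1 w"
    unfolding arc_integral_def
  proof (rule arc_integral_transfer[OF g1 rectifiable_joinpaths, where \<theta> = "\<lambda>v. v / 2"])
    fix u v :: real assume uv: "0 \<le> u" "u \<le> v" "v \<le> 1/2"
    have "(\<lambda>v. v / 2) -` {u..v} = {2 * u..2 * v}" by auto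
    then show "emeasure (arc_measure g1) ((\<lambda>v. v / 2) -` {u..v}) = ennreal (polylen ?g u v)"
      using emeasure_arc_Icc[OF g1, of "2 * u" "2 * v"] polygonal_sums_join1[of u v] uv by simp
  qed (use w in \<open>auto simp: joinpaths_def\<close>)
  moreover have "(LINT t:{1/2..1}|arc_measure ?g. w (?g t)) = arc_integral g2 w"
    unfolding arc_integral_def
  proof (rule arc_integral_transfer[OF g2 rectifiable_joinpaths, where \<theta> = "\<lambda>v. (v + 1) / 2"])
    fix u v :: real assume uv: "1/2 \<le> u" "u \<le> v" "v \<le> 1"
    have "(\<lambda>v. (v + 1) / 2) -` {u..v} = {2 * u - 1..2 * v - 1}" by auto
    then show "emeasure (arc_measure g2) ((\<lambda>v. (v + 1) / 2) -` {u..v}) = ennreal (polylen ?g u v)"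
      using emeasure_arc_Icc[OF g2, of "2 * u - 1" "2 * v - 1"] polygonal_sums_join2[of u v] uv by simp
  next
    fix v :: real assume "v \<in> {0..1}"
    then show "?g ((v + 1) / 2) = g2 v"
      using join by (cases "v = 0") (auto simp: joinpaths_def pathfinish_def pathstart_def add_divide_distrib)
  qed (use w in auto)
  ultimately show ?thesis using arc_integral_split[OF rectifiable_joinpaths _ _ w, of "1/2"] by simp
qed

end

text \<open>
  Along a segment the chord lengths telescope.
\<close>

lemma polygonal_sums_linepath:
  assumes "v \<in> polygonal_sums (linepath x y) 0 1"
  shows "v \<le> infnorm (x - y)"
proof -
  obtain m t where t: "mono_on {..m} t" "t ` {..m} \<subseteq> {0..1}"
      "v = (\<Sum>i<m. infnorm (linepath x y (t (Suc i)) - linepath x y (t i)))"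
    using assms by (rule polygonal_sumsE)
  have eq: "infnorm (linepath x y (t (Suc i)) - linepath x y (t i)) = (t (Suc i) - t i) * infnorm (x - y)"
    if "i < m" for i
  proof -
    have "linepath x y (t (Suc i)) - linepath x y (t i) = (t (Suc i) - t i) *\<^sub>R (y - x)"
      by (simp add: linepath_def algebra_simps)
    moreover have "t i \<le> t (Suc i)" using mono_onD[OF t(1), of i "Suc i"] that by auto
    ultimately show ?thesis by (simp add: infnorm_mul infnorm_sub)
  qed
  have "v = (\<Sum>i<m. (t (Suc i) - t i) * infnorm (x - y))"
    unfolding t(3) by (rule sum.cong) (use eq in auto)
  also have "\<dots> = (t m - t 0) * infnorm (x - y)"
    unfolding sum_distrib_right[symmetric] sum_lessThan_telescope ..
  also have "\<dots> \<le> 1 * infnorm (x - y)"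
  proof (rule mult_right_mono)
    have "t m \<in> {0..1}" "t 0 \<in> {0..1}" using t(2) by auto
    then show "t m - t 0 \<le> 1" by auto
  qed simp
  finally show ?thesis by simp
qed

lemma rectifiable_linepath: "rectifiable (linepath x y)"
  unfolding rectifiable_def using polygonal_sums_linepath by (auto intro!: bdd_aboveI)

lemma polylen_linepath: "polylen (linepath x y) 0 1 \<le> infnorm (x - y)"
  using polygonal_sums_linepath[of _ x y] polygonal_sums_zero[of 0 1 "linepath x y"]
  by (intro cSup_least) auto

section \<open>The metric \<open>d_alpha\<close>\<close>

locale alpha_domain = proper_domain \<Omega> for \<Omega> :: "(real ^ 'n) set" +
  fixes \<alpha> :: real
  assumes alpha_pos: "0 < \<alpha>" and alpha_le: "\<alpha> \<le> 1"
begin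

definition wt :: "real ^ 'n \<Rightarrow> real" where
  "wt z = bdist z powr (\<alpha> - 1)"

definition curves :: "real ^ 'n \<Rightarrow> real ^ 'n \<Rightarrow> (real \<Rightarrow> real ^ 'n) set" where
  "curves x y = {\<gamma>. rectifiable \<gamma> \<and> path_image \<gamma> \<subseteq> \<Omega> \<and> pathstart \<gamma> = x \<and> pathfinish \<gamma> = y}"

abbreviation dist\<^sub>\<alpha> :: "real ^ 'n \<Rightarrow> real ^ 'n \<Rightarrow> real" where
  "dist\<^sub>\<alpha> \<equiv> d_alpha \<alpha> \<Omega>"

lemma dist_alpha_eq: "dist\<^sub>\<alpha> x y = (INF \<gamma>\<in>curves x y. arc_integral \<gamma> wt)"
  by (simp add: d_alpha_def curves_def wt_def[abs_def] bdist_def)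

lemma wt_nonneg: "0 \<le> wt z"
  by (simp add: wt_def)

lemma continuous_on_wt: "T \<subseteq> \<Omega> \<Longrightarrow> continuous_on T wt"
  unfolding wt_def using bdist_pos
  by (intro continuous_on_powr continuous_on_bdist continuous_intros) force

lemma curve_integral_nonneg: "\<gamma> \<in> curves x y \<Longrightarrow> 0 \<le> arc_integral \<gamma> wt"
  by (rule arc_integral_nonneg) (auto simp: curves_def wt_nonneg)

lemma linepath_curve: "closed_segment x y \<subseteq> \<Omega> \<Longrightarrow> linepath x y \<in> curves x y"
  by (simp add: curves_def rectifiable_linepath)

lemma reverse_curve: "\<gamma> \<in> curves x y \<Longrightarrow> reversepath \<gamma> \<in> curves y x"
  by (auto simp: curves_def rectifiable_reversepath)

lemma join_curve: "g1 \<in> curves x y \<Longrightarrow> g2 \<in> curves y z \<Longrightarrow> g1 +++ g2 \<in> curves x z"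
  by (auto simp: curves_def rectifiable_joinpaths path_image_join)

text \<open>
  Being joined by a rectifiable curve is an equivalence relation with open classes, since
  small balls contain segments.
\<close>

lemma curves_nonempty:
  assumes "x \<in> \<Omega>" "y \<in> \<Omega>"
  shows "curves x y \<noteq> {}"
proof (rule connected_equivalence_relation[OF connected_dom assms])
  fix x y assume "curves x y \<noteq> {}" then show "curves y x \<noteq> {}" using reverse_curve by blast
next
  fix x y z assume "curves x y \<noteq> {}" "curves y z \<noteq> {}"
  then show "curves x z \<noteq> {}" using join_curve by blast
next
  fix a assume "a \<in> \<Omega>"
  then obtain e where e: "0 < e" "ball a e \<subseteq> \<Omega>" using open_dom openE by blast
  have "curves a x \<noteq> {}" if "x \<in> ball a e" for x
  proof -
    have "closed_segment a x \<subseteq> ball a e" using that e by (intro closed_segment_subset) auto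
    then show ?thesis using linepath_curve e by blast
  qed
  then show "\<exists>T. openin (top_of_set \<Omega>) T \<and> a \<in> T \<and> (\<forall>x\<in>T. curves a x \<noteq> {})"
    using e by (intro exI[of _ "ball a e"]) (auto simp: openin_open_eq open_dom)
qed

lemma dist_alpha_le: "\<gamma> \<in> curves x y \<Longrightarrow> dist\<^sub>\<alpha> x y \<le> arc_integral \<gamma> wt"
  unfolding dist_alpha_eq
  by (rule cINF_lower) (auto intro!: bdd_belowI[of _ 0] curve_integral_nonneg)

lemma dist_alpha_nonneg: "x \<in> \<Omega> \<Longrightarrow> y \<in> \<Omega> \<Longrightarrow> 0 \<le> dist\<^sub>\<alpha> x y"
  unfolding dist_alpha_eq using curve_integral_nonneg curves_nonempty
  by (intro cINF_greatest) auto

lemma dist_alpha_sym_le: 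
  assumes "x \<in> \<Omega>" "y \<in> \<Omega>" shows "dist\<^sub>\<alpha> x y \<le> dist\<^sub>\<alpha> y x"
  unfolding dist_alpha_eq[of y x]
proof (rule cINF_greatest[OF curves_nonempty[OF assms(2,1)]])
  fix \<gamma> assume g: "\<gamma> \<in> curves y x"
  have "dist\<^sub>\<alpha> x y \<le> arc_integral (reversepath \<gamma>) wt" by (rule dist_alpha_le[OF reverse_curve[OF g]])
  also have "\<dots> = arc_integral \<gamma> wt"
    using g by (intro arc_integral_reversepath continuous_on_wt) (auto simp: curves_def)
  finally show "dist\<^sub>\<alpha> x y \<le> arc_integral \<gamma> wt" .
qed

lemma dist_alpha_sym: "x \<in> \<Omega> \<Longrightarrow> y \<in> \<Omega> \<Longrightarrow> dist\<^sub>\<alpha> x y = dist\<^sub>\<alpha> y x"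
  using dist_alpha_sym_le by (simp add: antisym)

lemma dist_alpha_triangle:
  assumes "x \<in> \<Omega>" "y \<in> \<Omega>" "z \<in> \<Omega>"
  shows "dist\<^sub>\<alpha> x z \<le> dist\<^sub>\<alpha> x y + dist\<^sub>\<alpha> y z"
proof -
  have *: "dist\<^sub>\<alpha> x z \<le> arc_integral g1 wt + arc_integral g2 wt" 
    if g: "g1 \<in> curves x y" "g2 \<in> curves y z" for g1 g2
  proof -
    have "arc_integral (g1 +++ g2) wt = arc_integral g1 wt + arc_integral g2 wt"
      by (rule arc_integral_joinpaths)
        (use g in \<open>auto simp: curves_def intro!: continuous_on_wt\<close>)
    then show ?thesis using dist_alpha_le[OF join_curve[OF g]] by simp
  qed
  have "dist\<^sub>\<alpha> x z - dist\<^sub>\<alpha> y z \<le> dist\<^sub>\<alpha> x y"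
    unfolding dist_alpha_eq[of x y]
  proof (rule cINF_greatest[OF curves_nonempty[OF assms(1,2)]])
    fix g1 assume g1: "g1 \<in> curves x y"
    have "dist\<^sub>\<alpha> x z - arc_integral g1 wt \<le> dist\<^sub>\<alpha> y z"
      unfolding dist_alpha_eq[of y z]
    proof (rule cINF_greatest[OF curves_nonempty[OF assms(2,3)]])
      fix g2 assume "g2 \<in> curves y z"
      then show "dist\<^sub>\<alpha> x z - arc_integral g1 wt \<le> arc_integral g2 wt" using *[OF g1] by force
    qed
    then show "dist\<^sub>\<alpha> x z - dist\<^sub>\<alpha> y z \<le> arc_integral g1 wt" by simp
  qed
  then show ?thesis by simp
qed

text \<open>
  Since \<open>\<alpha> \<le> 1\<close>, the weight is at most \<open>\<delta> powr (\<alpha> - 1)\<close> where the distance to the boundary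
  is at least \<open>\<delta>\<close>.
\<close>

lemma dist_alpha_segment:
  assumes "\<And>z. z \<in> closed_segment x y \<Longrightarrow> z \<in> \<Omega> \<and> \<delta> \<le> bdist z" "0 < \<delta>"
  shows "dist\<^sub>\<alpha> x y \<le> \<delta> powr (\<alpha> - 1) * infnorm (x - y)"
proof -
  have s: "closed_segment x y \<subseteq> \<Omega>" using assms by auto
  have "dist\<^sub>\<alpha> x y \<le> arc_integral (linepath x y) wt" by (rule dist_alpha_le[OF linepath_curve[OF s]])
  also have "\<dots> \<le> \<delta> powr (\<alpha> - 1) * polylen (linepath x y) 0 1"
  proof (rule arc_integral_upper[OF rectifiable_linepath])
    show "continuous_on (path_image (linepath x y)) wt" using s by (intro continuous_on_wt) simp
    show "wt z \<le> \<delta> powr (\<alpha> - 1)" if "z \<in> path_image (linepath x y)" for z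
      unfolding wt_def using that assms alpha_le by (intro powr_mono2') auto
  qed
  also have "\<dots> \<le> \<delta> powr (\<alpha> - 1) * infnorm (x - y)"
    by (rule mult_left_mono[OF polylen_linepath]) simp
  finally show ?thesis .
qed

text \<open>
  Follow a curve from \<open>x\<close> until its distance from \<open>x\<close> first reaches the minimum in the
  statement. On this piece, which is at least that long, the distance to the boundary is at
  most \<open>bdist x + 1\<close>, so the weight is bounded below. In particular, smallness of \<open>d_alpha\<close>
  near \<open>x\<close> forces smallness of the distance.
\<close>

lemma dist_alpha_lower:
  assumes x: "x \<in> \<Omega>" and y: "y \<in> \<Omega>"
  shows "(bdist x + 1) powr (\<alpha> - 1) * min 1 (infnorm (x - y)) \<le> dist\<^sub>\<alpha> x y"
  unfolding dist_alpha_eq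
proof (rule cINF_greatest[OF curves_nonempty[OF x y]])
  fix \<gamma> assume g: "\<gamma> \<in> curves x y"
  define c where "c = min 1 (infnorm (x - y))"
  let ?f = "\<lambda>t. infnorm (\<gamma> t - x)"
  have rect: "rectifiable \<gamma>" and im: "path_image \<gamma> \<subseteq> \<Omega>" and ends: "\<gamma> 0 = x" "\<gamma> 1 = y"
    using g by (auto simp: curves_def pathstart_def pathfinish_def)
  have cf: "continuous_on {0..1} ?f"
    using rect by (intro continuous_intros) (auto simp: rectifiable_def path_def)
  let ?S = "{0..1} \<inter> ?f -` {c..}"
  have "closed ?S" by (intro continuous_closed_preimage cf) auto
  then have "compact ?S" by (simp add: compact_eq_bounded_closed bounded_Int)
  moreover have "1 \<in> ?S" using ends by (auto simp: c_def infnorm_sub)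
  ultimately obtain b where b: "b \<in> ?S" "\<And>t. t \<in> ?S \<Longrightarrow> b \<le> t"
    using compact_attains_inf[of ?S] by blast
  have le: "?f t \<le> c" if t: "t \<in> {0..b}" for t
  proof (rule ccontr)
    assume "\<not> ?f t \<le> c"
    then have "c < ?f t" by simp
    moreover have "continuous_on {0..t} ?f" using cf by (rule continuous_on_subset) (use t b in auto)
    moreover have "?f 0 \<le> c" using ends by (simp add: c_def)
    ultimately obtain u where u: "0 \<le> u" "u \<le> t" "?f u = c"
      using IVT'[of ?f 0 c t] t by auto
    then have "b \<le> u" using b t by auto
    then have "u = t" using u t by simp
    then show False using u \<open>c < ?f t\<close> by simp
  qed
  have "(bdist x + 1) powr (\<alpha> - 1) * c \<le> (bdist x + 1) powr (\<alpha> - 1) * polylen \<gamma> 0 b"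
  proof (rule mult_left_mono)
    have "?f b \<le> polylen \<gamma> 0 b"
      using polygonal_sums_chord[of 0 b \<gamma>] polylen_upper[OF rect, of 0 b] b ends by auto
    then show "c \<le> polylen \<gamma> 0 b" using b by auto
  qed simp
  also have "\<dots> \<le> arc_integral \<gamma> wt"
  proof (rule arc_integral_lower[OF rect])
    show "continuous_on (path_image \<gamma>) wt" by (rule continuous_on_wt[OF im])
    fix t assume t: "t \<in> {0..b}"
    then have "\<gamma> t \<in> \<Omega>" using im b by (auto simp: path_image_def)
    moreover have "bdist (\<gamma> t) \<le> bdist x + 1"
      using bdist_lipschitz[of "\<gamma> t" x] le[OF t] by (simp add: c_def)
    ultimately show "(bdist x + 1) powr (\<alpha> - 1) \<le> wt (\<gamma> t)"
      unfolding wt_def using bdist_pos alpha_le by (intro powr_mono2') auto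
  qed (use b wt_nonneg in auto)
  finally show "(bdist x + 1) powr (\<alpha> - 1) * min 1 (infnorm (x - y)) \<le> arc_integral \<gamma> wt"
    by (simp add: c_def)
qed

end

section \<open>The completion\<close>

context alpha_domain
begin

abbreviation rho :: "real ^ 'n \<Rightarrow> real ^ 'n \<Rightarrow> real" where
  "rho \<equiv> rho_alpha \<alpha> \<Omega>"

abbreviation Cauchy\<^sub>\<alpha> :: "(nat \<Rightarrow> real ^ 'n) \<Rightarrow> bool" where
  "Cauchy\<^sub>\<alpha> \<equiv> alpha_Cauchy \<alpha> \<Omega>"

lemma tendsto_powr_zero:
  fixes f :: "'b \<Rightarrow> real"
  assumes "(f \<longlongrightarrow> 0) F" "\<And>x. 0 \<le> f x" "0 < a"
  shows "((\<lambda>x. f x powr a) \<longlongrightarrow> 0) F"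
  by (rule tendsto_zero_powrI[OF assms(1) tendsto_const]) (use assms in auto)

lemma dist_alpha_self: "x \<in> \<Omega> \<Longrightarrow> dist\<^sub>\<alpha> x x = 0"
  using dist_alpha_segment[of x x "bdist x"] bdist_pos[of x] dist_alpha_nonneg[of x x] by simp

text \<open>
  The two terms of \<open>rho\<close> are nonnegative and \<open>t \<mapsto> t powr \<alpha>\<close> is a homeomorphism of the half
  line, so the condition on \<open>rho\<close> splits into one for \<open>d_alpha\<close> and one for the norm.
\<close>

lemma alpha_Cauchy_iff:
  "Cauchy\<^sub>\<alpha> xs \<longleftrightarrow> range xs \<subseteq> \<Omega> \<and>
    (\<forall>\<epsilon>>0. \<exists>N. \<forall>i\<ge>N. \<forall>j\<ge>N. dist\<^sub>\<alpha> (xs i) (xs j) < \<epsilon> \<and> infnorm (xs i - xs j) < \<epsilon>)"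
    (is "_ \<longleftrightarrow> _ \<and> ?R")
proof (cases "range xs \<subseteq> \<Omega>")
  case True
  then have mem: "xs i \<in> \<Omega>" for i by auto
  have "(\<forall>\<epsilon>>0. \<exists>N. \<forall>i\<ge>N. \<forall>j\<ge>N. rho (xs i) (xs j) < \<epsilon>) \<longleftrightarrow> ?R"
  proof (intro iffI allI impI)
    fix \<epsilon> :: real
    assume a: "\<forall>\<epsilon>>0. \<exists>N. \<forall>i\<ge>N. \<forall>j\<ge>N. rho (xs i) (xs j) < \<epsilon>" and \<epsilon>: "0 < \<epsilon>"
    have "0 < min \<epsilon> (\<epsilon> powr \<alpha>)" using \<epsilon> by simp
    then obtain N where N: "\<And>i j. i \<ge> N \<Longrightarrow> j \<ge> N \<Longrightarrow> rho (xs i) (xs j) < min \<epsilon> (\<epsilon> powr \<alpha>)"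
      using a by blast
    have "dist\<^sub>\<alpha> (xs i) (xs j) < \<epsilon> \<and> infnorm (xs i - xs j) < \<epsilon>" if ij: "i \<ge> N" "j \<ge> N" for i j
    proof
      have 1: "rho (xs i) (xs j) < \<epsilon>" "rho (xs i) (xs j) < \<epsilon> powr \<alpha>" using N[OF ij] by auto
      have "0 \<le> dist\<^sub>\<alpha> (xs i) (xs j)" "0 \<le> infnorm (xs i - xs j) powr \<alpha>"
        using mem by (auto intro: dist_alpha_nonneg)
      then show "dist\<^sub>\<alpha> (xs i) (xs j) < \<epsilon>" using 1 unfolding rho_alpha_def by linarith
      have "infnorm (xs i - xs j) powr \<alpha> < \<epsilon> powr \<alpha>"
        using 1 \<open>0 \<le> dist\<^sub>\<alpha> (xs i) (xs j)\<close> by (simp add: rho_alpha_def)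
      then show "infnorm (xs i - xs j) < \<epsilon>"
        using \<epsilon> alpha_pos powr_mono2[of \<alpha> \<epsilon> "infnorm (xs i - xs j)"] by force
    qed
    then show "\<exists>N. \<forall>i\<ge>N. \<forall>j\<ge>N. dist\<^sub>\<alpha> (xs i) (xs j) < \<epsilon> \<and> infnorm (xs i - xs j) < \<epsilon>" by blast
  next
    fix \<epsilon> :: real
    assume a: ?R and \<epsilon>: "0 < \<epsilon>"
    define \<delta> where "\<delta> = min (\<epsilon> / 2) ((\<epsilon> / 2) powr (1 / \<alpha>))"
    have "0 < \<delta>" using \<epsilon> by (simp add: \<delta>_def)
    then obtain N where N: "\<And>i j. i \<ge> N \<Longrightarrow> j \<ge> N \<Longrightarrow> dist\<^sub>\<alpha> (xs i) (xs j) < \<delta> \<and> infnorm (xs i - xs j) < \<delta>"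
      using a by blast
    have "rho (xs i) (xs j) < \<epsilon>" if ij: "i \<ge> N" "j \<ge> N" for i j
    proof -
      have "infnorm (xs i - xs j) powr \<alpha> \<le> ((\<epsilon> / 2) powr (1 / \<alpha>)) powr \<alpha>"
        using N[OF ij] alpha_pos by (intro powr_mono2) (auto simp: \<delta>_def)
      also have "\<dots> = \<epsilon> / 2" using \<epsilon> alpha_pos by (simp add: powr_powr)
      finally show ?thesis using N[OF ij] by (simp add: rho_alpha_def \<delta>_def)
    qed
    then show "\<exists>N. \<forall>i\<ge>N. \<forall>j\<ge>N. rho (xs i) (xs j) < \<epsilon>" by blast
  qed
  then show ?thesis using True by (simp add: alpha_Cauchy_def)
qed (simp add: alpha_Cauchy_def)

lemma alpha_Cauchy_mem: "Cauchy\<^sub>\<alpha> xs \<Longrightarrow> xs i \<in> \<Omega>"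
  by (auto simp: alpha_Cauchy_def)

lemma alpha_CauchyD:
  assumes "Cauchy\<^sub>\<alpha> xs" "0 < \<epsilon>"
  shows "\<exists>N. \<forall>i\<ge>N. \<forall>j\<ge>N. dist\<^sub>\<alpha> (xs i) (xs j) < \<epsilon> \<and> infnorm (xs i - xs j) < \<epsilon>"
  using assms unfolding alpha_Cauchy_iff by simp

lemma alpha_rel_iff:
  "(xs, ys) \<in> alpha_rel \<alpha> \<Omega> \<longleftrightarrow> Cauchy\<^sub>\<alpha> xs \<and> Cauchy\<^sub>\<alpha> ys \<and>
     (\<lambda>i. dist\<^sub>\<alpha> (xs i) (ys i)) \<longlonglongrightarrow> 0 \<and> (\<lambda>i. infnorm (xs i - ys i)) \<longlonglongrightarrow> 0"
proof (cases "Cauchy\<^sub>\<alpha> xs \<and> Cauchy\<^sub>\<alpha> ys")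
  case True
  then have mem: "xs i \<in> \<Omega>" "ys i \<in> \<Omega>" for i by (auto intro: alpha_Cauchy_mem)
  have d0: "0 \<le> dist\<^sub>\<alpha> (xs i) (ys i)" for i using mem by (intro dist_alpha_nonneg)
  have "(\<lambda>i. rho (xs i) (ys i)) \<longlonglongrightarrow> 0 \<longleftrightarrow>
     (\<lambda>i. dist\<^sub>\<alpha> (xs i) (ys i)) \<longlonglongrightarrow> 0 \<and> (\<lambda>i. infnorm (xs i - ys i)) \<longlonglongrightarrow> 0"
  proof
    assume r: "(\<lambda>i. rho (xs i) (ys i)) \<longlonglongrightarrow> 0"
    have "(\<lambda>i. dist\<^sub>\<alpha> (xs i) (ys i)) \<longlonglongrightarrow> 0"
      by (rule Lim_null_comparison[OF _ r]) (use d0 in \<open>simp add: rho_alpha_def\<close>)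
    moreover have "(\<lambda>i. infnorm (xs i - ys i) powr \<alpha>) \<longlonglongrightarrow> 0"
      by (rule Lim_null_comparison[OF _ r]) (use d0 in \<open>simp add: rho_alpha_def\<close>)
    then have "(\<lambda>i. (infnorm (xs i - ys i) powr \<alpha>) powr (1 / \<alpha>)) \<longlonglongrightarrow> 0"
      by (rule tendsto_powr_zero) (use alpha_pos in auto)
    then have "(\<lambda>i. infnorm (xs i - ys i)) \<longlonglongrightarrow> 0"
      using alpha_pos by (simp add: powr_powr)
    ultimately show "(\<lambda>i. dist\<^sub>\<alpha> (xs i) (ys i)) \<longlonglongrightarrow> 0 \<and> (\<lambda>i. infnorm (xs i - ys i)) \<longlonglongrightarrow> 0"
      by blast
  next
    assume r: "(\<lambda>i. dist\<^sub>\<alpha> (xs i) (ys i)) \<longlonglongrightarrow> 0 \<and> (\<lambda>i. infnorm (xs i - ys i)) \<longlonglongrightarrow> 0"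
    then have "(\<lambda>i. infnorm (xs i - ys i) powr \<alpha>) \<longlonglongrightarrow> 0"
      using alpha_pos by (intro tendsto_powr_zero) auto
    then show "(\<lambda>i. rho (xs i) (ys i)) \<longlonglongrightarrow> 0"
      unfolding rho_alpha_def using r tendsto_add[of _ 0 _ _ 0] by fastforce
  qed
  then show ?thesis using True by (simp add: alpha_rel_def)
qed (auto simp: alpha_rel_def)

lemma alpha_rel_refl: "Cauchy\<^sub>\<alpha> xs \<Longrightarrow> (xs, xs) \<in> alpha_rel \<alpha> \<Omega>"
  by (simp add: alpha_rel_iff dist_alpha_self alpha_Cauchy_mem)

lemma alpha_rel_sym: "(xs, ys) \<in> alpha_rel \<alpha> \<Omega> \<Longrightarrow> (ys, xs) \<in> alpha_rel \<alpha> \<Omega>"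
proof -
  assume r: "(xs, ys) \<in> alpha_rel \<alpha> \<Omega>"
  then have "dist\<^sub>\<alpha> (xs i) (ys i) = dist\<^sub>\<alpha> (ys i) (xs i)" for i
    by (intro dist_alpha_sym) (auto simp: alpha_rel_iff alpha_Cauchy_mem)
  then show ?thesis using r by (simp add: alpha_rel_iff infnorm_sub)
qed

lemma alpha_rel_trans:
  assumes r: "(xs, ys) \<in> alpha_rel \<alpha> \<Omega>" "(ys, zs) \<in> alpha_rel \<alpha> \<Omega>"
  shows "(xs, zs) \<in> alpha_rel \<alpha> \<Omega>"
proof -
  have mem: "xs i \<in> \<Omega>" "ys i \<in> \<Omega>" "zs i \<in> \<Omega>" for i
    using r by (auto simp: alpha_rel_iff alpha_Cauchy_mem)
  have "(\<lambda>i. dist\<^sub>\<alpha> (xs i) (ys i) + dist\<^sub>\<alpha> (ys i) (zs i)) \<longlonglongrightarrow> 0 + 0"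
    using r by (intro tendsto_add) (auto simp: alpha_rel_iff)
  then have 1: "(\<lambda>i. dist\<^sub>\<alpha> (xs i) (ys i) + dist\<^sub>\<alpha> (ys i) (zs i)) \<longlonglongrightarrow> 0" by simp
  have "(\<lambda>i. infnorm (xs i - ys i) + infnorm (ys i - zs i)) \<longlonglongrightarrow> 0 + 0"
    using r by (intro tendsto_add) (auto simp: alpha_rel_iff)
  then have 2: "(\<lambda>i. infnorm (xs i - ys i) + infnorm (ys i - zs i)) \<longlonglongrightarrow> 0" by simp
  have "(\<lambda>i. dist\<^sub>\<alpha> (xs i) (zs i)) \<longlonglongrightarrow> 0"
    by (rule Lim_null_comparison[OF _ 1])
      (use mem in \<open>auto intro!: always_eventually dist_alpha_triangle simp: dist_alpha_nonneg\<close>)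
  moreover have "(\<lambda>i. infnorm (xs i - zs i)) \<longlonglongrightarrow> 0"
    by (rule Lim_null_comparison[OF _ 2]) (auto intro!: always_eventually infnorm_triangle3)
  ultimately show ?thesis using r by (simp add: alpha_rel_iff)
qed

lemma equiv_alpha_rel: "equiv {xs. Cauchy\<^sub>\<alpha> xs} (alpha_rel \<alpha> \<Omega>)"
proof (rule equivI)
  show "alpha_rel \<alpha> \<Omega> \<subseteq> {xs. Cauchy\<^sub>\<alpha> xs} \<times> {xs. Cauchy\<^sub>\<alpha> xs}" by (auto simp: alpha_rel_iff)
  show "refl_on {xs. Cauchy\<^sub>\<alpha> xs} (alpha_rel \<alpha> \<Omega>)" by (auto simp: refl_on_def alpha_rel_refl)
  show "sym (alpha_rel \<alpha> \<Omega>)" by (rule symI) (rule alpha_rel_sym)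
  show "trans (alpha_rel \<alpha> \<Omega>)" by (rule transI) (rule alpha_rel_trans)
qed

text \<open>
  The Cauchy property is inherited by the triangle inequality. Later, sequences are
  recognised as representatives of a boundary element because they shadow a known one.
\<close>

lemma alpha_rel_shadow:
  assumes xs: "Cauchy\<^sub>\<alpha> xs" and ys: "range ys \<subseteq> \<Omega>"
    and d: "(\<lambda>i. dist\<^sub>\<alpha> (xs i) (ys i)) \<longlonglongrightarrow> 0" and n: "(\<lambda>i. infnorm (xs i - ys i)) \<longlonglongrightarrow> 0"
  shows "(xs, ys) \<in> alpha_rel \<alpha> \<Omega>"
proof -
  have mem: "xs i \<in> \<Omega>" "ys i \<in> \<Omega>" for i using ys alpha_Cauchy_mem[OF xs] by auto
  have "Cauchy\<^sub>\<alpha> ys" unfolding alpha_Cauchy_iff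
  proof (intro conjI allI impI ys)
    fix \<epsilon> :: real assume \<epsilon>: "0 < \<epsilon>"
    then have \<epsilon>3: "0 < \<epsilon> / 3" by simp
    obtain N where "\<forall>i\<ge>N. \<forall>j\<ge>N. dist\<^sub>\<alpha> (xs i) (xs j) < \<epsilon> / 3 \<and> infnorm (xs i - xs j) < \<epsilon> / 3"
      using alpha_CauchyD[OF xs \<epsilon>3] by blast
    then have N: "\<And>i j. i \<ge> N \<Longrightarrow> j \<ge> N \<Longrightarrow> dist\<^sub>\<alpha> (xs i) (xs j) < \<epsilon> / 3" "\<And>i j. i \<ge> N \<Longrightarrow> j \<ge> N \<Longrightarrow> infnorm (xs i - xs j) < \<epsilon> / 3" by auto
    have "\<forall>\<^sub>F i in sequentially. dist\<^sub>\<alpha> (xs i) (ys i) < \<epsilon> / 3 \<and> infnorm (xs i - ys i) < \<epsilon> / 3"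
      using order_tendstoD(2)[OF d \<epsilon>3] order_tendstoD(2)[OF n \<epsilon>3] by eventually_elim auto
    then obtain M where M: "\<And>i. i \<ge> M \<Longrightarrow> dist\<^sub>\<alpha> (xs i) (ys i) < \<epsilon> / 3 \<and> infnorm (xs i - ys i) < \<epsilon> / 3"
      unfolding eventually_sequentially by blast
    have "dist\<^sub>\<alpha> (ys i) (ys j) < \<epsilon> \<and> infnorm (ys i - ys j) < \<epsilon>" if ij: "i \<ge> max M N" "j \<ge> max M N" for i j
    proof
      have "dist\<^sub>\<alpha> (ys i) (ys j) \<le> dist\<^sub>\<alpha> (ys i) (xs i) + dist\<^sub>\<alpha> (xs i) (ys j)"
        "dist\<^sub>\<alpha> (xs i) (ys j) \<le> dist\<^sub>\<alpha> (xs i) (xs j) + dist\<^sub>\<alpha> (xs j) (ys j)"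
        "dist\<^sub>\<alpha> (ys i) (xs i) = dist\<^sub>\<alpha> (xs i) (ys i)"
        using mem by (auto intro: dist_alpha_triangle dist_alpha_sym)
      then show "dist\<^sub>\<alpha> (ys i) (ys j) < \<epsilon>"
        using M[of i] M[of j] N(1)[of i j] ij by simp
      show "infnorm (ys i - ys j) < \<epsilon>"
        using M[of i] M[of j] N(2)[of i j] ij infnorm_triangle3[of "ys i" "ys j" "xs i"]
          infnorm_triangle3[of "xs i" "ys j" "xs j"] infnorm_sub[of "xs i" "ys i"] by simp
    qed
    then show "\<exists>N. \<forall>i\<ge>N. \<forall>j\<ge>N. dist\<^sub>\<alpha> (ys i) (ys j) < \<epsilon> \<and> infnorm (ys i - ys j) < \<epsilon>" by blast
  qed
  then show ?thesis using assms by (simp add: alpha_rel_iff)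
qed

abbreviation completion :: "(nat \<Rightarrow> real ^ 'n) set set" where
  "completion \<equiv> alpha_completion \<alpha> \<Omega>"

abbreviation boundary :: "(nat \<Rightarrow> real ^ 'n) set set" where
  "boundary \<equiv> alpha_boundary \<alpha> \<Omega>"

lemma class_in_completion: "Cauchy\<^sub>\<alpha> xs \<Longrightarrow> alpha_class \<alpha> \<Omega> xs \<in> completion"
  unfolding alpha_completion_def alpha_class_def by (auto intro: quotientI)

lemma completion_nonempty: "\<omega> \<in> completion \<Longrightarrow> \<omega> \<noteq> {}"
  unfolding alpha_completion_def using equiv_alpha_rel in_quotient_imp_non_empty by blast

lemma completion_Cauchy: "\<omega> \<in> completion \<Longrightarrow> xs \<in> \<omega> \<Longrightarrow> Cauchy\<^sub>\<alpha> xs"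
  unfolding alpha_completion_def using equiv_alpha_rel in_quotient_imp_subset by blast

lemma completion_rel: "\<omega> \<in> completion \<Longrightarrow> xs \<in> \<omega> \<Longrightarrow> ys \<in> \<omega> \<longleftrightarrow> (xs, ys) \<in> alpha_rel \<alpha> \<Omega>"
  unfolding alpha_completion_def
proof
  assume q: "\<omega> \<in> {xs. Cauchy\<^sub>\<alpha> xs} // alpha_rel \<alpha> \<Omega>" "xs \<in> \<omega>" "ys \<in> \<omega>"
  then show "(xs, ys) \<in> alpha_rel \<alpha> \<Omega>" using in_quotient_imp_in_rel[OF equiv_alpha_rel q(1)] by simp
next
  assume "\<omega> \<in> {xs. Cauchy\<^sub>\<alpha> xs} // alpha_rel \<alpha> \<Omega>" "xs \<in> \<omega>" "(xs, ys) \<in> alpha_rel \<alpha> \<Omega>"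
  then show "ys \<in> \<omega>" by (rule in_quotient_imp_closed[OF equiv_alpha_rel])
qed

lemma mem_class: "Cauchy\<^sub>\<alpha> xs \<Longrightarrow> xs \<in> alpha_class \<alpha> \<Omega> xs"
  by (simp add: alpha_class_def alpha_rel_refl)

lemma class_eq: "(xs, ys) \<in> alpha_rel \<alpha> \<Omega> \<Longrightarrow> alpha_class \<alpha> \<Omega> xs = alpha_class \<alpha> \<Omega> ys"
  unfolding alpha_class_def by (rule equiv_class_eq[OF equiv_alpha_rel])

lemma completion_eq_class: "\<omega> \<in> completion \<Longrightarrow> xs \<in> \<omega> \<Longrightarrow> \<omega> = alpha_class \<alpha> \<Omega> xs"
  using completion_rel by (auto simp: alpha_class_def)

lemma boundary_completion: "\<omega> \<in> boundary \<Longrightarrow> \<omega> \<in> completion"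
  by (simp add: alpha_boundary_def)

lemma alpha_Cauchy_convergent:
  assumes "Cauchy\<^sub>\<alpha> xs"
  obtains z where "xs \<longlonglongrightarrow> z"
proof -
  have "Cauchy xs"
  proof (rule metric_CauchyI)
    fix e :: real assume e: "0 < e"
    define D where "D = sqrt DIM(real ^ 'n)"
    have D: "0 < D" by (simp add: D_def)
    have eD: "0 < e / D" using e D by simp
    obtain N where "\<forall>i\<ge>N. \<forall>j\<ge>N. dist\<^sub>\<alpha> (xs i) (xs j) < e / D \<and> infnorm (xs i - xs j) < e / D"
      using alpha_CauchyD[OF assms eD] by blast
    then have N: "\<And>i j. i \<ge> N \<Longrightarrow> j \<ge> N \<Longrightarrow> dist\<^sub>\<alpha> (xs i) (xs j) < e / D" "\<And>i j. i \<ge> N \<Longrightarrow> j \<ge> N \<Longrightarrow> infnorm (xs i - xs j) < e / D" by auto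
    have "dist (xs i) (xs j) < e" if "i \<ge> N" "j \<ge> N" for i j
    proof -
      have "norm (xs i - xs j) \<le> D * infnorm (xs i - xs j)"
        unfolding D_def by (rule norm_le_infnorm)
      also have "\<dots> < e" using N(2)[OF that] D by (simp add: field_simps)
      finally show ?thesis by (simp add: dist_norm)
    qed
    then show "\<exists>N. \<forall>i\<ge>N. \<forall>j\<ge>N. dist (xs i) (xs j) < e" by blast
  qed
  then show ?thesis using that Cauchy_convergent convergentD by blast
qed

lemma tendsto_ell:
  assumes \<omega>: "\<omega> \<in> completion" and ys: "ys \<in> \<omega>"
  shows "ys \<longlonglongrightarrow> ell \<omega>"
proof -
  obtain xs where xs: "xs \<in> \<omega>" using completion_nonempty[OF \<omega>] by auto
  obtain z where z: "xs \<longlonglongrightarrow> z" using alpha_Cauchy_convergent[OF completion_Cauchy[OF \<omega> xs]] by blast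
  have all: "\<forall>ys\<in>\<omega>. ys \<longlonglongrightarrow> z"
  proof
    fix ys assume "ys \<in> \<omega>"
    then have "(\<lambda>i. infnorm ((ys i - xs i) - 0)) \<longlonglongrightarrow> 0"
      using completion_rel[OF \<omega> xs] by (simp add: alpha_rel_iff infnorm_sub)
    then have "(\<lambda>i. ys i - xs i) \<longlonglongrightarrow> 0" using tendsto_infnorm_iff by blast
    then have "(\<lambda>i. (ys i - xs i) + xs i) \<longlonglongrightarrow> 0 + z" by (rule tendsto_add[OF _ z])
    then show "ys \<longlonglongrightarrow> z" by simp
  qed
  have "ell \<omega> = z" unfolding ell_def
    by (rule the_equality) (use all xs z LIMSEQ_unique in blast)+
  then show ?thesis using all ys by simp
qed

lemma ell_class: "Cauchy\<^sub>\<alpha> xs \<Longrightarrow> xs \<longlonglongrightarrow> z \<Longrightarrow> ell (alpha_class \<alpha> \<Omega> xs) = z"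
  using tendsto_ell[OF class_in_completion mem_class] LIMSEQ_unique by blast

lemma alpha_Cauchy_const: "x \<in> \<Omega> \<Longrightarrow> Cauchy\<^sub>\<alpha> (\<lambda>_. x)"
  unfolding alpha_Cauchy_iff by (auto simp: dist_alpha_self)

text \<open>
  If the limit were an inner point \<open>z\<close>, the segments from the sequence to \<open>z\<close> would
  eventually stay away from the boundary, and the sequence would be equivalent to the
  constant sequence \<open>z\<close>.
\<close>

lemma ell_boundary:
  assumes \<omega>: "\<omega> \<in> boundary"
  shows "ell \<omega> \<in> frontier \<Omega>"
proof -
  note \<omega>c = boundary_completion[OF \<omega>]
  obtain xs where xs: "xs \<in> \<omega>" using completion_nonempty[OF \<omega>c] by auto
  note c = completion_Cauchy[OF \<omega>c xs] and l = tendsto_ell[OF \<omega>c xs]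
  let ?z = "ell \<omega>"
  have "?z \<in> closure \<Omega>"
    using l alpha_Cauchy_mem[OF c] closure_sequential by blast
  moreover have "?z \<notin> \<Omega>"
  proof
    assume z: "?z \<in> \<Omega>"
    define \<delta> where "\<delta> = bdist ?z / 2"
    have \<delta>: "0 < \<delta>" using bdist_pos[OF z] by (simp add: \<delta>_def)
    have n: "(\<lambda>i. infnorm (xs i - ?z)) \<longlonglongrightarrow> 0" using l tendsto_infnorm_iff by blast
    then have ev: "\<forall>\<^sub>F i in sequentially. infnorm (xs i - ?z) < \<delta>" by (rule order_tendstoD) (rule \<delta>)
    have "\<forall>\<^sub>F i in sequentially. norm (dist\<^sub>\<alpha> (xs i) ?z) \<le> \<delta> powr (\<alpha> - 1) * infnorm (xs i - ?z)"
      using ev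
    proof eventually_elim
      case (elim i)
      have "w \<in> \<Omega> \<and> \<delta> \<le> bdist w" if "w \<in> closed_segment (xs i) ?z" for w
      proof -
        have "closed_segment (xs i) ?z \<subseteq> cube ?z \<delta>"
          using elim \<delta> by (intro closed_segment_subset) (auto simp: mem_cube)
        then have "infnorm (w - ?z) \<le> \<delta>" using that by (auto simp: mem_cube)
        then show ?thesis
          using near_point_in_dom[OF z, of w] bdist_lipschitz[of ?z w] \<delta>
          by (simp add: \<delta>_def infnorm_sub)
      qed
      then have "dist\<^sub>\<alpha> (xs i) ?z \<le> \<delta> powr (\<alpha> - 1) * infnorm (xs i - ?z)"
        using dist_alpha_segment[of "xs i" ?z \<delta>] \<delta> by blast
      then show ?case using dist_alpha_nonneg[OF alpha_Cauchy_mem[OF c] z, of i] by simp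
    qed
    moreover have "(\<lambda>i. \<delta> powr (\<alpha> - 1) * infnorm (xs i - ?z)) \<longlonglongrightarrow> 0"
      using tendsto_mult_right_zero[OF n] by simp
    ultimately have "(\<lambda>i. dist\<^sub>\<alpha> (xs i) ?z) \<longlonglongrightarrow> 0" by (rule Lim_null_comparison)
    moreover have "range (\<lambda>_::nat. ?z) \<subseteq> \<Omega>" using z by auto
    ultimately have "(xs, \<lambda>_. ?z) \<in> alpha_rel \<alpha> \<Omega>"
      using n by (intro alpha_rel_shadow[OF c])
    then have "\<omega> = alpha_class \<alpha> \<Omega> (\<lambda>_. ?z)"
      using completion_eq_class[OF \<omega>c xs] class_eq[of xs "\<lambda>_. ?z"] by simp
    then show False using \<omega> z by (simp add: alpha_boundary_def)
  qed
  ultimately show ?thesis using open_dom by (simp add: frontier_def interior_open)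
qed

lemma class_in_boundary:
  assumes xs: "Cauchy\<^sub>\<alpha> xs" "xs \<longlonglongrightarrow> a" and a: "a \<in> frontier \<Omega>"
  shows "alpha_class \<alpha> \<Omega> xs \<in> boundary"
proof -
  have "alpha_class \<alpha> \<Omega> xs \<noteq> alpha_class \<alpha> \<Omega> (\<lambda>_. x)" if x: "x \<in> \<Omega>" for x
  proof
    assume "alpha_class \<alpha> \<Omega> xs = alpha_class \<alpha> \<Omega> (\<lambda>_. x)"
    then have "a = x"
      using ell_class[OF xs] ell_class[OF alpha_Cauchy_const[OF x], of x] by simp
    then show False using a x frontier_disjoint by auto
  qed
  then show ?thesis using class_in_completion[OF xs(1)] by (auto simp: alpha_boundary_def)
qed

lemma dist_alpha_quadrilateral:
  assumes "x \<in> \<Omega>" "y \<in> \<Omega>" "x' \<in> \<Omega>" "y' \<in> \<Omega>"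
  shows "\<bar>dist\<^sub>\<alpha> x y - dist\<^sub>\<alpha> x' y'\<bar> \<le> dist\<^sub>\<alpha> x x' + dist\<^sub>\<alpha> y y'"
  using dist_alpha_triangle[of x x' y] dist_alpha_triangle[of x' y' y]
    dist_alpha_triangle[of x' x y'] dist_alpha_triangle[of x y y']
    dist_alpha_sym[of x x'] dist_alpha_sym[of y y'] assms by (simp add: abs_le_iff)

lemma tendsto_d_alpha_closure:
  assumes \<omega>: "\<omega>1 \<in> completion" "\<omega>2 \<in> completion" and xs: "xs \<in> \<omega>1" and ys: "ys \<in> \<omega>2"
  shows "(\<lambda>i. dist\<^sub>\<alpha> (xs i) (ys i)) \<longlonglongrightarrow> d_alpha_closure \<alpha> \<Omega> \<omega>1 \<omega>2"
proof -
  note c = completion_Cauchy[OF \<omega>(1) xs] completion_Cauchy[OF \<omega>(2) ys]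
  note mem = alpha_Cauchy_mem[OF c(1)] alpha_Cauchy_mem[OF c(2)]
  have "Cauchy (\<lambda>i. dist\<^sub>\<alpha> (xs i) (ys i))"
  proof (rule metric_CauchyI)
    fix e :: real assume "0 < e"
    then have e: "0 < e / 2" by simp
    obtain N where "\<forall>i\<ge>N. \<forall>j\<ge>N. dist\<^sub>\<alpha> (xs i) (xs j) < e / 2 \<and> infnorm (xs i - xs j) < e / 2"
      using alpha_CauchyD[OF c(1) e] by blast
    then have N: "\<And>i j. i \<ge> N \<Longrightarrow> j \<ge> N \<Longrightarrow> dist\<^sub>\<alpha> (xs i) (xs j) < e / 2" "\<And>i j. i \<ge> N \<Longrightarrow> j \<ge> N \<Longrightarrow> infnorm (xs i - xs j) < e / 2" by auto
    obtain M where "\<forall>i\<ge>M. \<forall>j\<ge>M. dist\<^sub>\<alpha> (ys i) (ys j) < e / 2 \<and> infnorm (ys i - ys j) < e / 2"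
      using alpha_CauchyD[OF c(2) e] by blast
    then have M: "\<And>i j. i \<ge> M \<Longrightarrow> j \<ge> M \<Longrightarrow> dist\<^sub>\<alpha> (ys i) (ys j) < e / 2" "\<And>i j. i \<ge> M \<Longrightarrow> j \<ge> M \<Longrightarrow> infnorm (ys i - ys j) < e / 2" by auto
    have "dist (dist\<^sub>\<alpha> (xs i) (ys i)) (dist\<^sub>\<alpha> (xs j) (ys j)) < e" if "i \<ge> max M N" "j \<ge> max M N" for i j
      using dist_alpha_quadrilateral[OF mem(1)[of i] mem(2)[of i] mem(1)[of j] mem(2)[of j]]
        N(1)[of i j] M(1)[of i j] that by (simp add: dist_real_def)
    then show "\<exists>N. \<forall>i\<ge>N. \<forall>j\<ge>N. dist (dist\<^sub>\<alpha> (xs i) (ys i)) (dist\<^sub>\<alpha> (xs j) (ys j)) < e" by blast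
  qed
  then obtain L where L: "(\<lambda>i. dist\<^sub>\<alpha> (xs i) (ys i)) \<longlonglongrightarrow> L"
    using Cauchy_convergent convergentD by blast
  have all: "\<forall>xs'\<in>\<omega>1. \<forall>ys'\<in>\<omega>2. (\<lambda>i. dist\<^sub>\<alpha> (xs' i) (ys' i)) \<longlonglongrightarrow> L"
  proof (intro ballI)
    fix xs' ys' assume xs': "xs' \<in> \<omega>1" and ys': "ys' \<in> \<omega>2"
    have r: "(xs', xs) \<in> alpha_rel \<alpha> \<Omega>" "(ys', ys) \<in> alpha_rel \<alpha> \<Omega>"
      using xs xs' ys ys' completion_rel \<omega> by blast+
    have "(\<lambda>i. dist\<^sub>\<alpha> (xs' i) (xs i) + dist\<^sub>\<alpha> (ys' i) (ys i)) \<longlonglongrightarrow> 0 + 0"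
      using r by (intro tendsto_add) (auto simp: alpha_rel_iff)
    then have s: "(\<lambda>i. dist\<^sub>\<alpha> (xs' i) (xs i) + dist\<^sub>\<alpha> (ys' i) (ys i)) \<longlonglongrightarrow> 0" by simp
    have mem': "xs' i \<in> \<Omega>" "ys' i \<in> \<Omega>" for i
      using r by (auto simp: alpha_rel_iff alpha_Cauchy_mem)
    have "(\<lambda>i. dist\<^sub>\<alpha> (xs' i) (ys' i) - dist\<^sub>\<alpha> (xs i) (ys i)) \<longlonglongrightarrow> 0"
      by (rule Lim_null_comparison[OF _ s])
        (use dist_alpha_quadrilateral mem mem' in \<open>auto intro!: always_eventually\<close>)
    from tendsto_add[OF this L] show "(\<lambda>i. dist\<^sub>\<alpha> (xs' i) (ys' i)) \<longlonglongrightarrow> L" by simp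
  qed
  have "d_alpha_closure \<alpha> \<Omega> \<omega>1 \<omega>2 = L" unfolding d_alpha_closure_def
    by (rule the_equality) (use all xs ys L LIMSEQ_unique in blast)+
  then show ?thesis using L by simp
qed

text \<open>
  A diagonal argument. If \<open>f\<close> jumps by \<open>\<epsilon>\<close> at elements \<open>\<omega>'\<close> arbitrarily close to \<open>\<omega>\<close>, pick
  for each \<open>k\<close> such an \<open>\<omega>'\<close> at distance less than \<open>1 / (k + 1)\<close>, and from a representative
  of it a point \<open>z k\<close> that is just as close to a late member of a representative of \<open>\<omega>\<close> and
  has \<open>F (z k)\<close> close to \<open>f \<omega>'\<close>. By \<open>dist_alpha_lower\<close> the points \<open>z k\<close> are also close in
  norm, so they represent \<open>\<omega>\<close>, although \<open>F (z k)\<close> does not tend to \<open>f \<omega>\<close>.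
\<close>

lemma alpha_continuous_of_has_trace:
  assumes tr: "has_trace \<alpha> \<Omega> F f"
  shows "alpha_continuous \<alpha> \<Omega> f"
  unfolding alpha_continuous_def
proof (intro ballI allI impI)
  fix \<omega> and \<epsilon> :: real
  assume \<omega>: "\<omega> \<in> boundary" and \<epsilon>: "0 < \<epsilon>"
  note \<omega>c = boundary_completion[OF \<omega>]
  obtain xs where xs: "xs \<in> \<omega>" using completion_nonempty[OF \<omega>c] by auto
  note xc = completion_Cauchy[OF \<omega>c xs]
  show "\<exists>\<delta>>0. \<forall>\<omega>'\<in>boundary. d_alpha_closure \<alpha> \<Omega> \<omega> \<omega>' < \<delta> \<longrightarrow> \<bar>f \<omega>' - f \<omega>\<bar> < \<epsilon>"
  proof (rule ccontr)
    assume neg: "\<not> ?thesis"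
    have "\<exists>z\<in>\<Omega>. \<exists>i\<ge>k. dist\<^sub>\<alpha> (xs i) z < 1 / Suc k \<and> \<epsilon> / 2 \<le> \<bar>F z - f \<omega>\<bar>" for k :: nat
    proof -
      have "0 < 1 / real (Suc k)" by simp
      then obtain \<omega>' where \<omega>': "\<omega>' \<in> boundary" "d_alpha_closure \<alpha> \<Omega> \<omega> \<omega>' < 1 / real (Suc k)"
          "\<not> \<bar>f \<omega>' - f \<omega>\<bar> < \<epsilon>" using neg by blast
      note \<omega>c' = boundary_completion[OF \<omega>'(1)]
      obtain zs where zs: "zs \<in> \<omega>'" using completion_nonempty[OF \<omega>c'] by auto
      have "\<forall>\<^sub>F i in sequentially. dist\<^sub>\<alpha> (xs i) (zs i) < 1 / real (Suc k)"
        using tendsto_d_alpha_closure[OF \<omega>c \<omega>c' xs zs] \<omega>'(2) by (rule order_tendstoD)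
      moreover have "(\<lambda>i. F (zs i)) \<longlonglongrightarrow> f \<omega>'" using tr \<omega>'(1) zs by (simp add: has_trace_def)
      then have "\<forall>\<^sub>F i in sequentially. dist (F (zs i)) (f \<omega>') < \<epsilon> / 2"
        using \<epsilon> by (intro tendstoD) auto
      moreover have "\<forall>\<^sub>F i in sequentially. k \<le> i" by (rule eventually_ge_at_top)
      ultimately have "\<forall>\<^sub>F i in sequentially. dist\<^sub>\<alpha> (xs i) (zs i) < 1 / real (Suc k)
          \<and> dist (F (zs i)) (f \<omega>') < \<epsilon> / 2 \<and> k \<le> i" by eventually_elim simp
      then obtain i where i: "dist\<^sub>\<alpha> (xs i) (zs i) < 1 / real (Suc k)" 
          "dist (F (zs i)) (f \<omega>') < \<epsilon> / 2" "k \<le> i"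
        using eventually_happens sequentially_bot by (metis (mono_tags, lifting))
      then have "\<epsilon> / 2 \<le> \<bar>F (zs i) - f \<omega>\<bar>" using \<omega>'(3) unfolding dist_real_def by linarith
      then show ?thesis using i alpha_Cauchy_mem[OF completion_Cauchy[OF \<omega>c' zs], of i] by blast
    qed
    then obtain z where "\<forall>k. z k \<in> \<Omega> \<and> (\<exists>i\<ge>k. dist\<^sub>\<alpha> (xs i) (z k) < 1 / Suc k \<and> \<epsilon> / 2 \<le> \<bar>F (z k) - f \<omega>\<bar>)"
      by metis
    then obtain i where z: "\<And>k. z k \<in> \<Omega>" and i: "\<And>k. k \<le> i k" 
      and d: "\<And>k. dist\<^sub>\<alpha> (xs (i k)) (z k) < 1 / Suc k" and F: "\<And>k. \<epsilon> / 2 \<le> \<bar>F (z k) - f \<omega>\<bar>"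
      by metis
    note mem = alpha_Cauchy_mem[OF xc]
    have filt: "filterlim i at_top sequentially"
      using i by (rule filterlim_at_top_mono[OF filterlim_ident always_eventually[OF allI]])
    \<comment> \<open>\<open>xs (i k)\<close> stays close to \<open>xs k\<close>\<close>
    have xi: "(\<lambda>k. dist\<^sub>\<alpha> (xs k) (xs (i k))) \<longlonglongrightarrow> 0" "(\<lambda>k. infnorm (xs k - xs (i k))) \<longlonglongrightarrow> 0"
    proof -
      have *: "\<exists>N. \<forall>k\<ge>N. dist\<^sub>\<alpha> (xs k) (xs (i k)) < e \<and> infnorm (xs k - xs (i k)) < e" if e: "0 < e" for e
      proof -
        obtain N where "\<forall>k\<ge>N. \<forall>j\<ge>N. dist\<^sub>\<alpha> (xs k) (xs j) < e \<and> infnorm (xs k - xs j) < e"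
          using alpha_CauchyD[OF xc e] by blast
        then show ?thesis using i order_trans by meson
      qed
      show "(\<lambda>k. dist\<^sub>\<alpha> (xs k) (xs (i k))) \<longlonglongrightarrow> 0"
        by (rule LIMSEQ_I) (use * mem in \<open>force simp: dist_alpha_nonneg\<close>)
      show "(\<lambda>k. infnorm (xs k - xs (i k))) \<longlonglongrightarrow> 0"
        by (rule LIMSEQ_I) (use * in force)
    qed
    have inv: "(\<lambda>k. 1 / real (Suc k)) \<longlonglongrightarrow> 0"
      using LIMSEQ_inverse_real_of_nat by (simp add: inverse_eq_divide)
    have dz: "(\<lambda>k. dist\<^sub>\<alpha> (xs (i k)) (z k)) \<longlonglongrightarrow> 0"
      by (rule Lim_null_comparison[OF _ inv])
        (use d z mem in \<open>auto intro!: always_eventually less_imp_le simp: dist_alpha_nonneg simp del: of_nat_Suc\<close>)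
    have bd: "(\<lambda>k. bdist (xs (i k))) \<longlonglongrightarrow> bdist (ell \<omega>)"
    proof -
      have "isCont bdist (ell \<omega>)"
        using continuous_on_bdist[of UNIV] by (simp add: continuous_on_eq_continuous_at)
      moreover have "(\<lambda>k. xs (i k)) \<longlonglongrightarrow> ell \<omega>"
        by (rule filterlim_compose[OF tendsto_ell[OF \<omega>c xs] filt])
      ultimately show ?thesis by (rule isCont_tendsto_compose)
    qed
    define c where "c = (bdist (ell \<omega>) + 1 + 1) powr (\<alpha> - 1)"
    have c: "0 < c" using bdist_nonneg[of "ell \<omega>"] by (simp add: c_def)
    have nz: "(\<lambda>k. infnorm (xs (i k) - z k)) \<longlonglongrightarrow> 0"
    proof -
      have ev: "\<forall>\<^sub>F k in sequentially. norm (min 1 (infnorm (xs (i k) - z k))) \<le> dist\<^sub>\<alpha> (xs (i k)) (z k) / c"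
        using order_tendstoD(2)[OF bd, of "bdist (ell \<omega>) + 1", OF less_add_one]
      proof eventually_elim
        case (elim k)
        have "c * min 1 (infnorm (xs (i k) - z k)) \<le> (bdist (xs (i k)) + 1) powr (\<alpha> - 1) * min 1 (infnorm (xs (i k) - z k))"
          unfolding c_def using elim alpha_le bdist_nonneg[of "xs (i k)"]
          by (intro mult_right_mono powr_mono2') auto
        also have "\<dots> \<le> dist\<^sub>\<alpha> (xs (i k)) (z k)" by (rule dist_alpha_lower[OF mem z])
        finally show ?case using c by (simp add: field_simps)
      qed
      have "(\<lambda>k. dist\<^sub>\<alpha> (xs (i k)) (z k) / c) \<longlonglongrightarrow> 0"
        using tendsto_divide[OF dz tendsto_const, of c] c by simp
      then have m: "(\<lambda>k. min 1 (infnorm (xs (i k) - z k))) \<longlonglongrightarrow> 0"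
        by (rule Lim_null_comparison[OF ev])
      then have "\<forall>\<^sub>F k in sequentially. min 1 (infnorm (xs (i k) - z k)) < 1"
        by (rule order_tendstoD) simp
      then have "\<forall>\<^sub>F k in sequentially. min 1 (infnorm (xs (i k) - z k)) = infnorm (xs (i k) - z k)"
        by eventually_elim auto
      then show ?thesis by (rule Lim_transform_eventually[OF m])
    qed
    have "(xs, z) \<in> alpha_rel \<alpha> \<Omega>"
    proof (rule alpha_rel_shadow[OF xc])
      show "range z \<subseteq> \<Omega>" using z by auto
      have s: "(\<lambda>k. dist\<^sub>\<alpha> (xs k) (xs (i k)) + dist\<^sub>\<alpha> (xs (i k)) (z k)) \<longlonglongrightarrow> 0"
        using tendsto_add[OF xi(1) dz] by simp
      show "(\<lambda>k. dist\<^sub>\<alpha> (xs k) (z k)) \<longlonglongrightarrow> 0"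
        by (rule Lim_null_comparison[OF _ s])
          (use z mem in \<open>auto intro!: always_eventually dist_alpha_triangle simp: dist_alpha_nonneg\<close>)
      have s: "(\<lambda>k. infnorm (xs k - xs (i k)) + infnorm (xs (i k) - z k)) \<longlonglongrightarrow> 0"
        using tendsto_add[OF xi(2) nz] by simp
      show "(\<lambda>k. infnorm (xs k - z k)) \<longlonglongrightarrow> 0"
        by (rule Lim_null_comparison[OF _ s]) (auto intro!: always_eventually infnorm_triangle3)
    qed
    then have "z \<in> \<omega>" using completion_rel[OF \<omega>c xs] by blast
    then have "(\<lambda>k. F (z k)) \<longlonglongrightarrow> f \<omega>" using tr \<omega> by (simp add: has_trace_def)
    then have "\<forall>\<^sub>F k in sequentially. dist (F (z k)) (f \<omega>) < \<epsilon> / 2"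
      using \<epsilon> by (intro tendstoD) auto
    then obtain k where "dist (F (z k)) (f \<omega>) < \<epsilon> / 2"
      using eventually_happens sequentially_bot by (metis (mono_tags, lifting))
    then show False using F[of k] by (simp add: dist_real_def)
  qed
qed

section \<open>Visible boundary elements\<close>

definition ray :: "real ^ 'n \<Rightarrow> real ^ 'n \<Rightarrow> nat \<Rightarrow> real ^ 'n" where
  "ray a z k = a + (1 / 2 ^ k) *\<^sub>R (z - a)"

lemma ray_0 [simp]: "ray a z 0 = z"
  by (simp add: ray_def)

lemma ray_tendsto: "ray a z \<longlonglongrightarrow> a"
proof -
  have "(\<lambda>k. (1 / 2 :: real) ^ k) \<longlonglongrightarrow> 0" by (rule LIMSEQ_power_zero) simp
  then have "(\<lambda>k. a + ((1 / 2) ^ k) *\<^sub>R (z - a)) \<longlonglongrightarrow> a + 0 *\<^sub>R (z - a)"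
    by (intro tendsto_intros) auto
  then show ?thesis by (simp add: ray_def[abs_def] power_one_over)
qed

text \<open>
  The homothety with centre \<open>a\<close> and ratio \<open>s\<close> maps the cube onto a cube of radius \<open>s r\<close>
  inside \<open>\<Omega>\<close>.
\<close>

lemma bdist_homothety:
  assumes vis: "\<And>y. y \<in> cube c r \<Longrightarrow> a + s *\<^sub>R (y - a) \<in> \<Omega>" and s: "0 < s"
  shows "s * (r - infnorm (y - c)) \<le> bdist (a + s *\<^sub>R (y - a))"
proof -
  have "cube (a + s *\<^sub>R (c - a)) (s * r) \<subseteq> \<Omega>"
  proof
    fix z assume z: "z \<in> cube (a + s *\<^sub>R (c - a)) (s * r)"
    define y where "y = a + (1 / s) *\<^sub>R (z - a)"
    have zy: "z = a + s *\<^sub>R (y - a)" using s by (simp add: y_def)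
    have "z - (a + s *\<^sub>R (c - a)) = s *\<^sub>R (y - c)" unfolding zy by (simp add: algebra_simps)
    then have "s * infnorm (y - c) \<le> s * r" using z s by (simp add: mem_cube infnorm_mul)
    then have "y \<in> cube c r" using s by (simp add: mem_cube)
    then show "z \<in> \<Omega>" unfolding zy by (rule vis)
  qed
  from bdist_cube_subset[OF this, of "a + s *\<^sub>R (y - a)"]
  have "s * r - infnorm (a + s *\<^sub>R (y - a) - (a + s *\<^sub>R (c - a))) \<le> bdist (a + s *\<^sub>R (y - a))" .
  moreover have "a + s *\<^sub>R (y - a) - (a + s *\<^sub>R (c - a)) = s *\<^sub>R (y - c)" by (simp add: algebra_simps)
  ultimately show ?thesis using s by (simp add: infnorm_mul right_diff_distrib)
qed

lemma segment_homothety: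
  assumes "w \<in> closed_segment (a + s *\<^sub>R (x - a)) (a + s *\<^sub>R (y - a))"
  obtains v where "v \<in> closed_segment x y" "w = a + s *\<^sub>R (v - a)"
proof -
  obtain u where u: "0 \<le> u" "u \<le> 1" "w = (1 - u) *\<^sub>R (a + s *\<^sub>R (x - a)) + u *\<^sub>R (a + s *\<^sub>R (y - a))"
    using assms by (auto simp: in_segment)
  have "w = a + s *\<^sub>R (((1 - u) *\<^sub>R x + u *\<^sub>R y) - a)" unfolding u(3) by (simp add: algebra_simps)
  then show ?thesis using u that by (auto simp: in_segment)
qed

text \<open>
  Two points of a visible cube, kept at distance \<open>\<rho>\<close> from its boundary, have images under
  the homothety whose distance shrinks with \<open>s\<close>: the segment between the images has length
  proportional to \<open>s\<close> and stays at distance at least \<open>s \<rho>\<close> from the boundary of \<open>\<Omega>\<close>, where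
  the weight is at most \<open>(s \<rho>) powr (\<alpha> - 1)\<close>.
\<close>

lemma dist_alpha_homothety:
  assumes vis: "\<And>y. y \<in> cube c r \<Longrightarrow> a + s *\<^sub>R (y - a) \<in> \<Omega>" and s: "0 < s" and \<rho>: "0 < \<rho>"
    and xy: "x \<in> cube c (r - \<rho>)" "y \<in> cube c (r - \<rho>)"
  shows "dist\<^sub>\<alpha> (a + s *\<^sub>R (x - a)) (a + s *\<^sub>R (y - a)) \<le> \<rho> powr (\<alpha> - 1) * infnorm (x - y) * s powr \<alpha>"
proof -
  have "dist\<^sub>\<alpha> (a + s *\<^sub>R (x - a)) (a + s *\<^sub>R (y - a))
      \<le> (s * \<rho>) powr (\<alpha> - 1) * infnorm ((a + s *\<^sub>R (x - a)) - (a + s *\<^sub>R (y - a)))"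
  proof (rule dist_alpha_segment)
    fix w assume "w \<in> closed_segment (a + s *\<^sub>R (x - a)) (a + s *\<^sub>R (y - a))"
    then obtain v where v: "v \<in> closed_segment x y" "w = a + s *\<^sub>R (v - a)" by (rule segment_homothety)
    have "closed_segment x y \<subseteq> cube c (r - \<rho>)" using xy by (intro closed_segment_subset) auto
    then have vc: "infnorm (v - c) \<le> r - \<rho>" using v by (auto simp: mem_cube)
    then have "w \<in> \<Omega>" unfolding v using \<rho> by (intro vis) (simp add: mem_cube)
    moreover have "s * \<rho> \<le> bdist w"
    proof -
      have "s * \<rho> \<le> s * (r - infnorm (v - c))" using vc s by (intro mult_left_mono) auto
      also have "s * (r - infnorm (v - c)) \<le> bdist w"
        unfolding v by (rule bdist_homothety[OF _ s]) (rule vis)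
      finally show ?thesis .
    qed
    ultimately show "w \<in> \<Omega> \<and> s * \<rho> \<le> bdist w" ..
  qed (use s \<rho> in simp)
  also have "(a + s *\<^sub>R (x - a)) - (a + s *\<^sub>R (y - a)) = s *\<^sub>R (x - y)" by (simp add: algebra_simps)
  also have "infnorm (s *\<^sub>R (x - y)) = s * infnorm (x - y)" using s by (simp add: infnorm_mul)
  also have "(s * \<rho>) powr (\<alpha> - 1) * (s * infnorm (x - y)) = \<rho> powr (\<alpha> - 1) * infnorm (x - y) * s powr \<alpha>"
    using s \<rho> powr_add[of s "\<alpha> - 1" 1] by (simp add: powr_mult)
  finally show ?thesis .
qed

text \<open>
  Halving the distance to the boundary multiplies the \<open>d_alpha\<close>-length of a ray segment by
  this factor.
\<close>

definition ratio :: real where "ratio = 2 powr (- \<alpha>)"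

lemma ratio: "0 < ratio" "ratio < 1"
  using alpha_pos by (auto simp: ratio_def powr_less_one)

context
  fixes a z :: "real ^ 'n"
  assumes z: "z \<in> \<Omega>" and a: "a \<in> frontier \<Omega>" and az: "bdist z = infnorm (z - a)"
begin

text \<open>
  The open cube around \<open>z\<close> that touches the boundary at \<open>a\<close> lies in \<open>\<Omega>\<close>, is convex and has
  \<open>a\<close> in its closure.
\<close>

lemma nearest_homothety:
  assumes s: "0 < s" "s \<le> 1" and y: "infnorm (y - z) < bdist z"
  shows "a + s *\<^sub>R (y - a) \<in> \<Omega>"
proof (rule near_point_in_dom[OF z])
  have "a + s *\<^sub>R (y - a) - z = s *\<^sub>R (y - z) + (1 - s) *\<^sub>R (a - z)" by (simp add: algebra_simps)
  then have "infnorm (a + s *\<^sub>R (y - a) - z) \<le> infnorm (s *\<^sub>R (y - z)) + infnorm ((1 - s) *\<^sub>R (a - z))"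
    by (simp add: infnorm_triangle)
  also have "\<dots> = s * infnorm (y - z) + (1 - s) * bdist z"
    using s az by (simp add: infnorm_mul infnorm_sub)
  also have "\<dots> < s * bdist z + (1 - s) * bdist z" using y s by simp
  also have "\<dots> = bdist z" by (simp add: algebra_simps)
  finally show "infnorm (a + s *\<^sub>R (y - a) - z) < bdist z" .
qed

lemma bdist_nearest_ray:
  assumes s: "0 < s" "s \<le> 1"
  shows "s * bdist z \<le> bdist (a + s *\<^sub>R (z - a))"
proof -
  have "a + s *\<^sub>R (z - a) - z = (1 - s) *\<^sub>R (a - z)" by (simp add: algebra_simps)
  then have "infnorm (z - (a + s *\<^sub>R (z - a))) = (1 - s) * bdist z"
    using s az by (metis (no_types, lifting) abs_of_nonneg diff_ge_0_iff_ge infnorm_mul infnorm_sub)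
  then show ?thesis using bdist_lipschitz[of z "a + s *\<^sub>R (z - a)"] by (simp add: algebra_simps)
qed

text \<open>
  The segment from \<open>ray a z k\<close> to the next point has length \<open>s * bdist z\<close> with
  \<open>s = 1 / 2 ^ Suc k\<close>, and on it the distance to the boundary is at least \<open>s * bdist z\<close>, as
  \<open>a\<close> is a nearest boundary point.
\<close>

lemma ray_step: "dist\<^sub>\<alpha> (ray a z k) (ray a z (Suc k)) \<le> bdist z powr \<alpha> * ratio ^ Suc k"
proof -
  define s :: real where "s = 1 / 2 ^ Suc k"
  have "1 \<le> (2 :: real) ^ k" by simp
  then have s: "0 < s" "2 * s \<le> 1" "s \<le> 1" by (auto simp: s_def field_simps simp del: one_le_power)
  have r: "ray a z k = a + (2 * s) *\<^sub>R (z - a)" "ray a z (Suc k) = a + s *\<^sub>R (z - a)"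
    by (simp_all add: ray_def s_def)
  have "dist\<^sub>\<alpha> (ray a z k) (ray a z (Suc k)) \<le> (s * bdist z) powr (\<alpha> - 1) * infnorm (ray a z k - ray a z (Suc k))"
  proof (rule dist_alpha_segment)
    fix w assume "w \<in> closed_segment (ray a z k) (ray a z (Suc k))"
    then obtain u where u: "0 \<le> u" "u \<le> 1" "w = (1 - u) *\<^sub>R (a + (2 * s) *\<^sub>R (z - a)) + u *\<^sub>R (a + s *\<^sub>R (z - a))"
      unfolding r by (auto simp: in_segment)
    define t where "t = (1 - u) * (2 * s) + u * s"
    have t': "t = 2 * s - u * s" by (simp add: t_def algebra_simps)
    have t: "s \<le> t" "t \<le> 1" using u s by (auto simp: t' mult_left_le_one_le)
       (smt (verit) mult_nonneg_nonneg s)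
    have "(1 - u) *\<^sub>R (a + p *\<^sub>R v) + u *\<^sub>R (a + q *\<^sub>R v) = a + ((1 - u) * p + u * q) *\<^sub>R v"
      for p q :: real and v by (simp add: algebra_simps)
    then have w: "w = a + t *\<^sub>R (z - a)" unfolding u(3) t_def .
    have "w \<in> \<Omega>" unfolding w using t s bdist_pos[OF z] by (intro nearest_homothety) auto
    moreover have "s * bdist z \<le> t * bdist z" using t bdist_nonneg by (intro mult_right_mono) auto
    ultimately show "w \<in> \<Omega> \<and> s * bdist z \<le> bdist w"
      using bdist_nearest_ray[of t] t s unfolding w by simp
  qed (use s bdist_pos[OF z] in simp)
  also have "infnorm (ray a z k - ray a z (Suc k)) = s * bdist z"
  proof -
    have "ray a z k - ray a z (Suc k) = s *\<^sub>R (z - a)"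
      unfolding r mult_2 scaleR_add_left add.assoc[symmetric] by (rule add_diff_cancel_left')
    then show ?thesis using s az by (simp add: infnorm_mul)
  qed
  also have "(s * bdist z) powr (\<alpha> - 1) * (s * bdist z) = (s * bdist z) powr \<alpha>"
    using powr_add[of "s * bdist z" "\<alpha> - 1" 1] s bdist_pos[OF z] by simp
  also have "\<dots> = bdist z powr \<alpha> * s powr \<alpha>" using s bdist_nonneg by (simp add: powr_mult)
  also have "s powr \<alpha> = ratio ^ Suc k"
  proof -
    have "s = 2 powr (- real (Suc k))" unfolding s_def powr_minus by (simp add: powr_realpow del: power_Suc of_nat_Suc) (simp add: field_simps)
    then show ?thesis by (simp add: ratio_def powr_powr powr_power mult.commute del: of_nat_Suc power_Suc)
  qed
  finally show ?thesis .
qed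

lemma ray_mem: "ray a z k \<in> \<Omega>"
  unfolding ray_def using bdist_pos[OF z] by (intro nearest_homothety) auto

text \<open>
  The sum of a geometric series of steps.
\<close>

lemma ray_dist_le: "dist\<^sub>\<alpha> (ray a z i) (ray a z (i + k)) \<le> bdist z powr \<alpha> * ratio ^ i / (1 - ratio)"
proof -
  have "dist\<^sub>\<alpha> (ray a z i) (ray a z (i + k)) \<le> bdist z powr \<alpha> * ratio ^ i * (1 - ratio ^ k) / (1 - ratio)"
  proof (induction k)
    case 0
    then show ?case by (simp add: dist_alpha_self ray_mem)
  next
    case (Suc k)
    let ?D = "bdist z powr \<alpha>"
    have D: "0 \<le> ?D" by simp
    have "dist\<^sub>\<alpha> (ray a z i) (ray a z (i + Suc k))
        \<le> dist\<^sub>\<alpha> (ray a z i) (ray a z (i + k)) + dist\<^sub>\<alpha> (ray a z (i + k)) (ray a z (Suc (i + k)))"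
      using ray_mem by (simp add: dist_alpha_triangle)
    also have "\<dots> \<le> ?D * ratio ^ i * (1 - ratio ^ k) / (1 - ratio) + ?D * ratio ^ Suc (i + k)"
      using Suc ray_step[of "i + k"] by (rule add_mono)
    also have "?D * ratio ^ Suc (i + k) \<le> ?D * ratio ^ (i + k)"
      using ratio D by (intro mult_left_mono power_decreasing) auto
    also have "?D * ratio ^ i * (1 - ratio ^ k) / (1 - ratio) + ?D * ratio ^ (i + k)
       = ?D * ratio ^ i * (1 - ratio ^ Suc k) / (1 - ratio)"
      using ratio by (simp add: field_simps power_add)
    finally show ?case by simp
  qed
  also have "\<dots> \<le> bdist z powr \<alpha> * ratio ^ i * 1 / (1 - ratio)"
    using ratio by (intro divide_right_mono mult_left_mono) auto
  finally show ?thesis by simp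
qed

lemma alpha_Cauchy_ray: "Cauchy\<^sub>\<alpha> (ray a z)"
  unfolding alpha_Cauchy_iff
proof (intro conjI allI impI)
  show "range (ray a z) \<subseteq> \<Omega>" using ray_mem by auto
  fix \<epsilon> :: real assume \<epsilon>: "0 < \<epsilon>"
  define B where "B = bdist z powr \<alpha> / (1 - ratio)"
  have "(\<lambda>k. B * ratio ^ k) \<longlonglongrightarrow> B * 0"
    using ratio by (intro tendsto_mult_left LIMSEQ_power_zero) auto
  then have "\<forall>\<^sub>F k in sequentially. B * ratio ^ k < \<epsilon>" using \<epsilon> by (intro order_tendstoD(2)) auto
  then obtain N where N: "\<And>k. N \<le> k \<Longrightarrow> B * ratio ^ k < \<epsilon>" unfolding eventually_sequentially by blast
  have 1: "dist\<^sub>\<alpha> (ray a z i) (ray a z j) < \<epsilon>" if "N \<le> i" "i \<le> j" for i j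
    using ray_dist_le[of i "j - i"] N[of i] that by (simp add: B_def)
  have "dist\<^sub>\<alpha> (ray a z i) (ray a z j) < \<epsilon>" if "N \<le> i" "N \<le> j" for i j
    using 1[of i j] 1[of j i] dist_alpha_sym[OF ray_mem ray_mem, of i j] that by (cases "i \<le> j") auto
  moreover obtain M where M: "\<And>i. M \<le> i \<Longrightarrow> infnorm (ray a z i - a) < \<epsilon> / 2"
  proof -
    have "(\<lambda>i. infnorm (ray a z i - a)) \<longlonglongrightarrow> 0" using ray_tendsto tendsto_infnorm_iff by blast
    then have "\<forall>\<^sub>F i in sequentially. infnorm (ray a z i - a) < \<epsilon> / 2" using \<epsilon> by (intro order_tendstoD(2)) auto
    then show ?thesis using that unfolding eventually_sequentially by blast
  qed
  have "infnorm (ray a z i - ray a z j) < \<epsilon>" if "M \<le> i" "M \<le> j" for i j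
    using M[OF that(1)] M[OF that(2)] infnorm_triangle3[of "ray a z i" "ray a z j" a]
      infnorm_sub[of "ray a z j" a] by simp
  ultimately show "\<exists>N. \<forall>i\<ge>N. \<forall>j\<ge>N. dist\<^sub>\<alpha> (ray a z i) (ray a z j) < \<epsilon> \<and> infnorm (ray a z i - ray a z j) < \<epsilon>"
    by (intro exI[of _ "max M N"]) auto
qed

lemma ray_class_boundary: "alpha_class \<alpha> \<Omega> (ray a z) \<in> boundary"
  by (rule class_in_boundary[OF alpha_Cauchy_ray ray_tendsto a])

lemma ell_ray_class: "ell (alpha_class \<alpha> \<Omega> (ray a z)) = a"
  by (rule ell_class[OF alpha_Cauchy_ray ray_tendsto])

text \<open>
  The hypothesis puts the cube inside the open cube around \<open>z\<close> that touches the boundary at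
  \<open>a\<close>, so \<open>a\<close> is visible. Visibility of the element asks for a representing sequence on the
  segment from \<open>a\<close> to the centre \<open>c\<close> of the given cube; the ray through \<open>c\<close> is one, because
  it shadows the ray through \<open>z\<close>.
\<close>

lemma alpha_visible_nearest:
  assumes r: "0 < r" "r + infnorm (c - z) < bdist z"
  shows "alpha_visible \<alpha> \<Omega> c r (alpha_class \<alpha> \<Omega> (ray a z))"
proof -
  have in\<Omega>: "a + s *\<^sub>R (y - a) \<in> \<Omega>" if "0 < s" "s \<le> 1" "y \<in> cube c r" for s y
    using that r infnorm_triangle3[of y z c] by (intro nearest_homothety) (auto simp: mem_cube)
  have vis: "visible \<Omega> (cube c r) a"
    unfolding visible_def
  proof (intro conjI ballI subsetI)
    show "a \<in> closure \<Omega>" using a by (simp add: frontier_def)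
    fix y w assume y: "y \<in> cube c r" and "w \<in> semi_segment a y"
    then obtain t where t: "0 < t" "t \<le> 1" "w = (1 - t) *\<^sub>R a + t *\<^sub>R y" by (auto simp: semi_segment_def)
    have "w = a + t *\<^sub>R (y - a)" unfolding t by (simp add: algebra_simps)
    then show "w \<in> \<Omega>" using in\<Omega> t y by simp
  qed
  define \<rho> where "\<rho> = bdist z - infnorm (c - z)"
  have \<rho>: "0 < \<rho>" using r by (simp add: \<rho>_def)
  have "(ray a z, ray a c) \<in> alpha_rel \<alpha> \<Omega>"
  proof (rule alpha_rel_shadow[OF alpha_Cauchy_ray])
    show rc: "range (ray a c) \<subseteq> \<Omega>"
      using in\<Omega>[of "1 / 2 ^ _" c] r by (auto simp: ray_def center_in_cube)
    define B where "B = (\<rho> / 2) powr (\<alpha> - 1) * infnorm (z - c)"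
    have le: "dist\<^sub>\<alpha> (ray a z k) (ray a c k) \<le> B * (1 / 2 ^ k) powr \<alpha>" for k
      unfolding ray_def B_def
    proof (rule dist_alpha_homothety[where c = z and r = "infnorm (c - z) + \<rho> / 2"])
      fix y assume "y \<in> cube z (infnorm (c - z) + \<rho> / 2)"
      then show "a + (1 / 2 ^ k) *\<^sub>R (y - a) \<in> \<Omega>"
        using \<rho> by (intro nearest_homothety) (auto simp: mem_cube \<rho>_def field_simps)
    qed (use \<rho> in \<open>auto simp: mem_cube\<close>)
    have p: "(\<lambda>k. 1 / 2 ^ k :: real) \<longlonglongrightarrow> 0"
      using LIMSEQ_power_zero[of "1/2 :: real"] by (simp add: power_one_over)
    then have "(\<lambda>k. (1 / 2 ^ k :: real) powr \<alpha>) \<longlonglongrightarrow> 0" by (rule tendsto_powr_zero) (use alpha_pos in auto)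
    from tendsto_mult_right_zero[OF this] have B: "(\<lambda>k. B * (1 / 2 ^ k) powr \<alpha>) \<longlonglongrightarrow> 0" .
    show "(\<lambda>k. dist\<^sub>\<alpha> (ray a z k) (ray a c k)) \<longlonglongrightarrow> 0"
      by (rule Lim_null_comparison[OF _ B])
        (use le rc ray_mem in \<open>auto intro!: always_eventually simp: dist_alpha_nonneg image_subset_iff\<close>)
    have eq: "infnorm (ray a z k - ray a c k) = 1 / 2 ^ k * infnorm (z - c)" for k
    proof -
      have "ray a z k - ray a c k = (1 / 2 ^ k) *\<^sub>R (z - c)" by (simp add: ray_def algebra_simps)
      then show ?thesis by (simp add: infnorm_mul)
    qed
    show "(\<lambda>k. infnorm (ray a z k - ray a c k)) \<longlonglongrightarrow> 0"
      unfolding eq using tendsto_mult_left_zero[OF p] .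
  qed
  then have "alpha_class \<alpha> \<Omega> (ray a c) = alpha_class \<alpha> \<Omega> (ray a z)" using class_eq by simp
  moreover have "ray a c k \<in> semi_segment a c" for k
    unfolding semi_segment_def ray_def by (intro CollectI exI[of _ "1 / 2 ^ k"]) (simp add: algebra_simps)
  ultimately show ?thesis
    using vis ray_class_boundary by (auto simp: alpha_visible_def ell_ray_class)
qed

text \<open>
  Go from \<open>ys k\<close> to \<open>ys i\<close>, from there on a segment to \<open>z\<close>, and from \<open>z\<close> along the ray; the
  last two parts cost multiples of \<open>bdist z powr \<alpha>\<close>.
\<close>

lemma d_alpha_closure_nearest:
  assumes \<omega>: "\<omega> \<in> boundary" and ys: "ys \<in> \<omega>" and near: "infnorm (z - ys i) \<le> bdist z / 2"
    and e: "\<And>k. i \<le> k \<Longrightarrow> dist\<^sub>\<alpha> (ys k) (ys i) \<le> e"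
  shows "d_alpha_closure \<alpha> \<Omega> \<omega> (alpha_class \<alpha> \<Omega> (ray a z)) \<le> e + (1 + 1 / (1 - ratio)) * bdist z powr \<alpha>"
proof (rule tendsto_upperbound)
  note \<omega>c = boundary_completion[OF \<omega>]
  show "(\<lambda>k. dist\<^sub>\<alpha> (ys k) (ray a z k)) \<longlonglongrightarrow> d_alpha_closure \<alpha> \<Omega> \<omega> (alpha_class \<alpha> \<Omega> (ray a z))"
    by (rule tendsto_d_alpha_closure[OF \<omega>c class_in_completion[OF alpha_Cauchy_ray] ys mem_class[OF alpha_Cauchy_ray]])
  note mem = alpha_Cauchy_mem[OF completion_Cauchy[OF \<omega>c ys]]
  have "dist\<^sub>\<alpha> (ys i) z \<le> (bdist z / 2) powr (\<alpha> - 1) * infnorm (ys i - z)"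
  proof (rule dist_alpha_segment)
    fix w assume w: "w \<in> closed_segment (ys i) z"
    have "closed_segment (ys i) z \<subseteq> cube z (bdist z / 2)"
      using near bdist_nonneg[of z] by (intro closed_segment_subset) (auto simp: mem_cube infnorm_sub)
    then have "infnorm (w - z) \<le> bdist z / 2" using w by (auto simp: mem_cube)
    then show "w \<in> \<Omega> \<and> bdist z / 2 \<le> bdist w"
      using near_point_in_dom[OF z, of w] bdist_lipschitz[of z w] bdist_pos[OF z]
      by (simp add: infnorm_sub)
  qed (use bdist_pos[OF z] in simp)
  also have "\<dots> \<le> (bdist z / 2) powr (\<alpha> - 1) * (bdist z / 2)"
    using near by (intro mult_left_mono) (auto simp: infnorm_sub)
  also have "\<dots> = (bdist z / 2) powr \<alpha>"
    using powr_add[of "bdist z / 2" "\<alpha> - 1" 1] bdist_pos[OF z] by simp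
  also have "\<dots> \<le> bdist z powr \<alpha>" using bdist_nonneg[of z] alpha_pos by (intro powr_mono2) auto
  finally have 1: "dist\<^sub>\<alpha> (ys i) z \<le> bdist z powr \<alpha>" .
  have "dist\<^sub>\<alpha> (ys k) (ray a z k) \<le> e + (1 + 1 / (1 - ratio)) * bdist z powr \<alpha>" if "i \<le> k" for k
    using dist_alpha_triangle[OF mem[of k] mem[of i] ray_mem[of k]]
      dist_alpha_triangle[OF mem[of i] z ray_mem[of k]] e[OF that] 1 ray_dist_le[of 0 k]
    by (simp add: algebra_simps)
  then show "\<forall>\<^sub>F k in sequentially. dist\<^sub>\<alpha> (ys k) (ray a z k) \<le> e + (1 + 1 / (1 - ratio)) * bdist z powr \<alpha>"
    unfolding eventually_sequentially by blast
qed simp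

end

text \<open>
  By definition \<open>\<omega>\<close> has a representing sequence on the segment from \<open>ell \<omega>\<close> to the centre,
  that is, one consisting of homothetic images of the centre with ratios \<open>t i\<close> tending to 0.
  Images under the same homotheties of other points of the half cube shadow it. The half
  cube leaves the margin \<open>r / 2\<close> that \<open>dist_alpha_homothety\<close> requires.
\<close>

lemma alpha_visible_sequences:
  assumes vis: "alpha_visible \<alpha> \<Omega> c r \<omega>" and r: "0 < r"
  shows "\<exists>t :: nat \<Rightarrow> real. (\<forall>i. 0 < t i \<and> t i \<le> 1) \<and> t \<longlonglongrightarrow> 0 \<and>
    (\<forall>w. (\<forall>i. w i \<in> cube c (r / 2)) \<longrightarrow> (\<lambda>i. ell \<omega> + t i *\<^sub>R (w i - ell \<omega>)) \<in> \<omega>) \<and>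
    (\<forall>s y. 0 < s \<longrightarrow> s \<le> 1 \<longrightarrow> y \<in> cube c r \<longrightarrow> ell \<omega> + s *\<^sub>R (y - ell \<omega>) \<in> \<Omega>)"
proof -
  let ?l = "ell \<omega>"
  have \<omega>: "\<omega> \<in> boundary" and v: "visible \<Omega> (cube c r) ?l" using vis by (auto simp: alpha_visible_def)
  obtain ys where ys: "\<And>i. ys i \<in> semi_segment ?l c" "alpha_class \<alpha> \<Omega> ys = \<omega>"
    using vis by (auto simp: alpha_visible_def)
  note \<omega>c = boundary_completion[OF \<omega>]
  have in\<Omega>: "?l + s *\<^sub>R (y - ?l) \<in> \<Omega>" if "0 < s" "s \<le> 1" "y \<in> cube c r" for s y
  proof -
    have "?l + s *\<^sub>R (y - ?l) \<in> semi_segment ?l y"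
      unfolding semi_segment_def using that by (intro CollectI exI[of _ s]) (simp add: algebra_simps)
    then show ?thesis using v that by (auto simp: visible_def)
  qed
  have "\<exists>t. 0 < t \<and> t \<le> 1 \<and> ys i = ?l + t *\<^sub>R (c - ?l)" for i
  proof -
    obtain t where "0 < t" "t \<le> 1" "ys i = (1 - t) *\<^sub>R ?l + t *\<^sub>R c"
      using ys(1)[of i] by (auto simp: semi_segment_def)
    then show ?thesis by (intro exI[of _ t]) (simp add: algebra_simps)
  qed
  then obtain t where t: "\<And>i. 0 < t i" "\<And>i. t i \<le> 1" "\<And>i. ys i = ?l + t i *\<^sub>R (c - ?l)" by metis
  have ysc: "Cauchy\<^sub>\<alpha> ys"
  proof (rule ccontr)
    assume "\<not> Cauchy\<^sub>\<alpha> ys"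
    then have "alpha_class \<alpha> \<Omega> ys = {}" by (auto simp: alpha_class_def alpha_rel_def)
    then show False using ys completion_nonempty[OF \<omega>c] by simp
  qed
  have ys\<omega>: "ys \<in> \<omega>" using mem_class[OF ysc] ys by simp
  have cne: "c - ?l \<noteq> 0"
    using in\<Omega>[of 1 c] ell_boundary[OF \<omega>] frontier_disjoint r by (auto simp: center_in_cube)
  have "(\<lambda>i. infnorm (ys i - ?l)) \<longlonglongrightarrow> 0" using tendsto_ell[OF \<omega>c ys\<omega>] tendsto_infnorm_iff by blast
  moreover have "infnorm (ys i - ?l) = t i * infnorm (c - ?l)" for i
    unfolding t(3) using t(1)[of i] by (simp add: infnorm_mul)
  ultimately have "(\<lambda>i. t i * infnorm (c - ?l) / infnorm (c - ?l)) \<longlonglongrightarrow> 0 / infnorm (c - ?l)"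
    using cne by (intro tendsto_divide) (auto simp: infnorm_eq_0)
  then have t0: "t \<longlonglongrightarrow> 0" using cne by (simp add: infnorm_eq_0)
  have "(\<lambda>i. ?l + t i *\<^sub>R (w i - ?l)) \<in> \<omega>" if w: "\<And>i. w i \<in> cube c (r / 2)" for w
  proof -
    have wm: "w i \<in> cube c r" for i using w[of i] r cube_mono[of "r / 2" r c] by auto
    have "(ys, \<lambda>i. ?l + t i *\<^sub>R (w i - ?l)) \<in> alpha_rel \<alpha> \<Omega>"
    proof (rule alpha_rel_shadow[OF ysc])
      show rg: "range (\<lambda>i. ?l + t i *\<^sub>R (w i - ?l)) \<subseteq> \<Omega>" using in\<Omega> t wm by auto
      have le: "dist\<^sub>\<alpha> (ys i) (?l + t i *\<^sub>R (w i - ?l)) \<le> (r / 2) powr (\<alpha> - 1) * (r / 2) * t i powr \<alpha>" for i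
      proof -
        have "dist\<^sub>\<alpha> (ys i) (?l + t i *\<^sub>R (w i - ?l)) \<le> (r / 2) powr (\<alpha> - 1) * infnorm (c - w i) * t i powr \<alpha>"
          unfolding t(3) 
          by (rule dist_alpha_homothety[of c r]) (use in\<Omega> t w[of i] r in \<open>auto simp: mem_cube\<close>)
        also have "\<dots> \<le> (r / 2) powr (\<alpha> - 1) * (r / 2) * t i powr \<alpha>"
          using w[of i] by (intro mult_right_mono mult_left_mono) (auto simp: mem_cube infnorm_sub)
        finally show ?thesis .
      qed
      have "(\<lambda>i. t i powr \<alpha>) \<longlonglongrightarrow> 0" by (rule tendsto_powr_zero[OF t0 less_imp_le[OF t(1)] alpha_pos])
      from tendsto_mult_right_zero[OF this]
      have B: "(\<lambda>i. (r / 2) powr (\<alpha> - 1) * (r / 2) * t i powr \<alpha>) \<longlonglongrightarrow> 0" .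
      show "(\<lambda>i. dist\<^sub>\<alpha> (ys i) (?l + t i *\<^sub>R (w i - ?l))) \<longlonglongrightarrow> 0"
      proof (rule Lim_null_comparison[OF always_eventually[OF allI] B])
        fix i
        have "0 \<le> dist\<^sub>\<alpha> (ys i) (?l + t i *\<^sub>R (w i - ?l))"
          using rg alpha_Cauchy_mem[OF ysc] by (intro dist_alpha_nonneg) auto
        then show "norm (dist\<^sub>\<alpha> (ys i) (?l + t i *\<^sub>R (w i - ?l))) \<le> (r / 2) powr (\<alpha> - 1) * (r / 2) * t i powr \<alpha>"
          using le[of i] by simp
      qed
      have eq: "infnorm (ys i - (?l + t i *\<^sub>R (w i - ?l))) \<le> t i * (r / 2)" for i
      proof -
        have "ys i - (?l + t i *\<^sub>R (w i - ?l)) = t i *\<^sub>R (c - w i)" unfolding t(3) by (simp add: algebra_simps)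
        then show ?thesis using t(1)[of i] w[of i] by (simp add: infnorm_mul mem_cube infnorm_sub)
      qed
      have B: "(\<lambda>i. t i * (r / 2)) \<longlonglongrightarrow> 0" using tendsto_mult_left_zero[OF t0] .
      show "(\<lambda>i. infnorm (ys i - (?l + t i *\<^sub>R (w i - ?l)))) \<longlonglongrightarrow> 0"
        by (rule Lim_null_comparison[OF always_eventually[OF allI] B]) (use eq in simp)
    qed
    then show ?thesis using completion_rel[OF \<omega>c ys\<omega>] by blast
  qed
  then show ?thesis using t(1,2) t0 in\<Omega> by blast
qed

end

section \<open>Smooth functions\<close>

lemma partial_eqI: "(\<phi> has_derivative D) (at x) \<Longrightarrow> partial i \<phi> x = D (axis i 1)"
  unfolding partial_def using frechet_derivative_at by metis

lemma C_k_Suc: "C_k (Suc k) \<phi> \<Longrightarrow> C_k k \<phi>"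
proof (induction k arbitrary: \<phi>)
  case 0
  then show ?case
    by (auto intro!: continuous_at_imp_continuous_on differentiable_imp_continuous_within)
next
  case (Suc k)
  have "\<phi> differentiable (at x)" for x using Suc.prems by simp
  moreover have "C_k k (partial i \<phi>)" for i using Suc.prems by (intro Suc.IH) simp
  ultimately show ?case by simp
qed

lemma C_k_const: "C_k k (\<lambda>_ :: real ^ 'n. c)"
proof (induction k arbitrary: c)
  case (Suc k)
  have "partial i (\<lambda>_::real^'n. c) = (\<lambda>_. 0)" for i :: 'n
    by (rule ext) (simp add: partial_eqI[OF has_derivative_const])
  then show ?case using Suc by simp
qed simp

lemma partial_add:
  assumes "\<And>x. \<phi> differentiable (at x)" "\<And>x. \<psi> differentiable (at x)"
  shows "partial i (\<lambda>x. \<phi> x + \<psi> x) = (\<lambda>x. partial i \<phi> x + partial i \<psi> x)"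
proof
  fix x
  have "((\<lambda>x. \<phi> x + \<psi> x) has_derivative (\<lambda>h. frechet_derivative \<phi> (at x) h + frechet_derivative \<psi> (at x) h)) (at x)"
    using assms by (intro has_derivative_add) (simp_all add: frechet_derivative_works[symmetric])
  from partial_eqI[OF this] show "partial i (\<lambda>x. \<phi> x + \<psi> x) x = partial i \<phi> x + partial i \<psi> x"
    by (simp add: partial_def)
qed

lemma partial_mult:
  assumes "\<And>x. \<phi> differentiable (at x)" "\<And>x. \<psi> differentiable (at x)"
  shows "partial i (\<lambda>x. \<phi> x * \<psi> x) = (\<lambda>x. \<phi> x * partial i \<psi> x + partial i \<phi> x * \<psi> x)"
proof
  fix x
  have "((\<lambda>x. \<phi> x * \<psi> x) has_derivative
      (\<lambda>h. \<phi> x * frechet_derivative \<psi> (at x) h + frechet_derivative \<phi> (at x) h * \<psi> x)) (at x)"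
    using assms by (intro has_derivative_mult) (simp_all add: frechet_derivative_works[symmetric])
  from partial_eqI[OF this] show "partial i (\<lambda>x. \<phi> x * \<psi> x) x = \<phi> x * partial i \<psi> x + partial i \<phi> x * \<psi> x"
    by (simp add: partial_def)
qed

lemma C_k_add: "C_k k \<phi> \<Longrightarrow> C_k k \<psi> \<Longrightarrow> C_k k (\<lambda>x. \<phi> x + \<psi> x)"
proof (induction k arbitrary: \<phi> \<psi>)
  case (Suc k)
  then show ?case by (simp add: partial_add)
qed (simp add: continuous_on_add)

lemma C_k_mult: "C_k k \<phi> \<Longrightarrow> C_k k \<psi> \<Longrightarrow> C_k k (\<lambda>x. \<phi> x * \<psi> x)"
proof (induction k arbitrary: \<phi> \<psi>)
  case (Suc k)
  have "C_k k (\<lambda>x. \<phi> x * partial i \<psi> x + partial i \<phi> x * \<psi> x)" for i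
    using Suc.prems C_k_Suc[OF Suc.prems(1)] C_k_Suc[OF Suc.prems(2)] by (intro C_k_add Suc.IH) auto
  then show ?case using Suc.prems by (simp add: partial_mult)
qed (simp add: continuous_on_mult)

lemma C_k_prod:
  assumes "finite S" "\<And>i. i \<in> S \<Longrightarrow> C_k k (\<phi> i)"
  shows "C_k k (\<lambda>x. \<Prod>i\<in>S. \<phi> i x)"
  using assms by (induction S) (auto simp: C_k_const intro: C_k_mult)

lemma has_derivative_component: "((\<lambda>x. x $ i) has_derivative (\<lambda>h. h $ i)) (at (x :: real ^ 'n))"
  by (rule bounded_linear_imp_has_derivative) (rule bounded_linear_vec_nth)

lemma C_k_component: "C_k k (\<lambda>x :: real ^ 'n. x $ i - c)"
proof (cases k)
  case 0
  then show ?thesis by (auto intro!: continuous_intros)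
next
  case (Suc m)
  have d: "((\<lambda>x. x $ i - c) has_derivative (\<lambda>h. h $ i)) (at x)" for x :: "real ^ 'n"
    using has_derivative_diff[OF has_derivative_component has_derivative_const] by simp
  then have "partial j (\<lambda>x :: real ^ 'n. x $ i - c) = (\<lambda>_. axis j 1 $ i)" for j
    by (intro ext partial_eqI)
  moreover have "(\<lambda>x. x $ i - c) differentiable (at x)" for x :: "real ^ 'n"
    using d by (rule differentiableI)
  ultimately show ?thesis using Suc by (simp add: C_k_const)
qed

text \<open>
  The functions \<open>P(1/t) exp (-1/t)\<close>, continued by 0, are closed under differentiation as \<open>P\<close>
  ranges over all polynomials; this gives smoothness by induction on the order.
\<close>

definition flat :: "real poly \<Rightarrow> real \<Rightarrow> real" where
  "flat P t = (if t \<le> 0 then 0 else poly P (inverse t) * exp (- inverse t))"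

lemma poly_times_exp_tendsto: "((\<lambda>x. poly P x * exp (- x)) \<longlongrightarrow> (0 :: real)) at_top"
proof -
  have "((\<lambda>x. \<Sum>i\<le>degree P. coeff P i * (x ^ i / exp x)) \<longlongrightarrow> (\<Sum>i\<le>degree P. coeff P i * 0)) at_top"
    by (intro tendsto_sum tendsto_mult tendsto_const tendsto_power_div_exp_0)
  moreover have "(\<Sum>i\<le>degree P. coeff P i * (x ^ i / exp x)) = poly P x * exp (- x)" for x :: real
    by (simp add: poly_altdef sum_distrib_right exp_minus divide_inverse mult.assoc)
  ultimately show ?thesis by simp
qed

lemma flat_tendsto_0: "(flat P \<longlongrightarrow> 0) (at_right 0)"
proof -
  have "((\<lambda>t. poly P (inverse t) * exp (- inverse t)) \<longlongrightarrow> 0) (at_right 0)"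
    by (rule filterlim_compose[OF poly_times_exp_tendsto filterlim_inverse_at_top_right])
  moreover have "\<forall>\<^sub>F t :: real in at_right 0. poly P (inverse t) * exp (- inverse t) = flat P t"
    unfolding eventually_at_right_field by (intro exI[of _ 1]) (auto simp: flat_def)
  ultimately show ?thesis by (rule Lim_transform_eventually)
qed

text \<open>
  At 0 the difference quotient is again a flat function, with \<open>P\<close> multiplied by the
  variable, and therefore tends to 0.
\<close>

lemma flat_has_derivative:
  "(flat P has_real_derivative flat ([:0, 0, 1:] * (P - pderiv P)) t) (at t)"
proof -
  let ?Q = "[:0, 0, 1:] * (P - pderiv P)"
  consider "t < 0" | "t = 0" | "0 < t" by linarith
  then show ?thesis
  proof cases
    case 1
    have "((\<lambda>_. 0) has_real_derivative 0) (at t)" by simp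
    then have "(flat P has_real_derivative 0) (at t)"
      by (rule has_field_derivative_transform_within_open[of _ _ _ "{..<0}"]) (use 1 in \<open>auto simp: flat_def\<close>)
    then show ?thesis using 1 by (simp add: flat_def)
  next
    case 3
    have "((\<lambda>t. poly P (inverse t) * exp (- inverse t)) has_real_derivative
        poly ?Q (inverse t) * exp (- inverse t)) (at t)"
      using 3 by (auto intro!: derivative_eq_intros poly_DERIV[THEN DERIV_chain2] simp: field_simps power2_eq_square)
    then have "(flat P has_real_derivative poly ?Q (inverse t) * exp (- inverse t)) (at t)"
      by (rule has_field_derivative_transform_within_open[of _ _ _ "{0<..}"]) (use 3 in \<open>auto simp: flat_def\<close>)
    then show ?thesis using 3 by (simp add: flat_def)
  next
    case 2
    have "((\<lambda>h. flat P h / h) \<longlongrightarrow> 0) (at_right 0)"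
    proof (rule Lim_transform_eventually[OF flat_tendsto_0[of "[:0, 1:] * P"]])
      show "\<forall>\<^sub>F h in at_right 0. flat ([:0, 1:] * P) h = flat P h / h"
        unfolding eventually_at_right_field
        by (intro exI[of _ 1]) (auto simp: flat_def field_simps)
    qed
    moreover have "((\<lambda>h. flat P h / h) \<longlongrightarrow> 0) (at_left 0)"
    proof (rule Lim_transform_eventually[OF tendsto_const])
      show "\<forall>\<^sub>F h in at_left 0. 0 = flat P h / h"
        unfolding eventually_at_left_field by (intro exI[of _ "-1"]) (auto simp: flat_def)
    qed
    ultimately have "((\<lambda>h. flat P h / h) \<longlongrightarrow> 0) (at 0)"
      by (simp add: filterlim_split_at)
    then show ?thesis using 2 by (simp add: has_field_derivative_iff flat_def)
  qed
qed

lemma C_k_flat: "C_k k (\<lambda>x :: real ^ 'n. flat P (s * (x $ i - c)))"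
proof (induction k arbitrary: P)
  case 0
  have "continuous_on UNIV (flat P)"
    using flat_has_derivative by (intro continuous_at_imp_continuous_on) (blast intro: DERIV_isCont)
  then show ?case by (auto intro!: continuous_on_compose2[of UNIV "flat P"] continuous_intros)
next
  case (Suc k)
  let ?Q = "[:0, 0, 1:] * (P - pderiv P)"
  have d: "((\<lambda>x. flat P (s * (x $ i - c))) has_derivative (\<lambda>h. flat ?Q (s * (x $ i - c)) * (s * h $ i))) (at x)"
    for x :: "real ^ 'n"
  proof -
    have "((\<lambda>x. s * (x $ i - c)) has_derivative (\<lambda>h. s * h $ i)) (at x)"
      using has_derivative_diff[OF has_derivative_component[of i x] has_derivative_const]
      by (intro has_derivative_mult_right) simp
    then show ?thesis
      using has_derivative_compose[of "\<lambda>x. s * (x $ i - c)" _ x UNIV "flat P"]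
        flat_has_derivative[of P "s * (x $ i - c)"] by (simp add: has_field_derivative_def)
  qed
  then have "partial j (\<lambda>x :: real ^ 'n. flat P (s * (x $ i - c))) =
      (\<lambda>x. flat ?Q (s * (x $ i - c)) * (s * axis j 1 $ i))" for j
    by (intro ext partial_eqI)
  moreover have "(\<lambda>x. flat P (s * (x $ i - c))) differentiable (at x)" for x :: "real ^ 'n"
    using d by (rule differentiableI)
  ultimately show ?case using C_k_mult[OF Suc C_k_const] by (simp del: mult_pCons_left)
qed

section \<open>Bump functions\<close>

definition step :: "real \<Rightarrow> real" where "step = flat [:1:]"

lemma step_pos_iff: "0 < step t \<longleftrightarrow> 0 < t" by (simp add: step_def flat_def)
lemma step_nonneg: "0 \<le> step t" by (simp add: step_def flat_def)
lemma step_le_1: "step t \<le> 1" by (simp add: step_def flat_def)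
lemma step_eq_0: "step t = 0 \<longleftrightarrow> t \<le> 0" by (simp add: step_def flat_def)

lemma step_mono: "s \<le> t \<Longrightarrow> step s \<le> step t"
  by (auto simp: step_def flat_def le_imp_inverse_le)

text \<open>
  As \<open>m\<close> grows, these functions increase to the indicator of the open box. The slope
  parameter \<open>m\<close> also makes the family closed under homotheties.
\<close>

definition box_bump :: "real \<Rightarrow> real ^ 'n \<Rightarrow> real ^ 'n \<Rightarrow> real ^ 'n \<Rightarrow> real" where
  "box_bump m a b x = (\<Prod>i\<in>UNIV. step (m * (x $ i - a $ i)) * step (- m * (x $ i - b $ i)))"

lemma C_k_box_bump: "C_k k (box_bump m a b)"
  unfolding box_bump_def[abs_def] step_def by (intro C_k_prod C_k_mult C_k_flat) simp

lemma box_bump_nonneg: "0 \<le> box_bump m a b x"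
  unfolding box_bump_def by (intro prod_nonneg) (simp add: step_nonneg)

lemma box_bump_le_1: "box_bump m a b x \<le> 1"
  unfolding box_bump_def
  by (intro prod_le_1) (auto intro!: mult_le_one simp: step_nonneg step_le_1)

lemma box_bump_eq_0:
  assumes "0 < m"
  shows "box_bump m a b x = 0 \<longleftrightarrow> x \<notin> box a b"
proof -
  have "step (m * (x $ i - a $ i)) * step (- m * (x $ i - b $ i)) = 0 \<longleftrightarrow> \<not> (a $ i < x $ i \<and> x $ i < b $ i)" for i
    using assms by (auto simp: step_eq_0 mult_le_0_iff zero_le_mult_iff)
  then show ?thesis by (simp add: box_bump_def mem_box_cart)
qed

lemma test_function_box_bump_mult:
  assumes m: "0 < m" and ab: "cbox a b \<subseteq> \<Omega>" and \<psi>: "\<And>k. C_k k \<psi>"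
  shows "test_function \<Omega> (\<lambda>x. \<psi> x * box_bump m a b x)"
proof -
  have "{x. \<psi> x * box_bump m a b x \<noteq> 0} \<subseteq> cbox a b"
    using box_bump_eq_0[OF m, of a b] box_subset_cbox by auto
  then have cl: "closure {x. \<psi> x * box_bump m a b x \<noteq> 0} \<subseteq> cbox a b"
    by (rule closure_minimal) (rule closed_cbox)
  then have "compact (closure {x. \<psi> x * box_bump m a b x \<noteq> 0})"
    using bounded_subset[OF bounded_cbox cl] by (simp add: compact_eq_bounded_closed)
  moreover have "C_k k (\<lambda>x. \<psi> x * box_bump m a b x)" for k
    by (rule C_k_mult[OF \<psi> C_k_box_bump])
  ultimately show ?thesis
    unfolding test_function_def using order_trans[OF cl ab] by blast
qed

lemma test_function_box_bump: "0 < m \<Longrightarrow> cbox a b \<subseteq> \<Omega> \<Longrightarrow> test_function \<Omega> (box_bump m a b)"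
  using test_function_box_bump_mult[of m a b \<Omega> "\<lambda>_. 1", OF _ _ C_k_const] by simp

lemma box_bump_tendsto:
  "(\<lambda>k. box_bump (real (Suc k)) a b x) \<longlonglongrightarrow> indicator (box a b) x"
proof (cases "x \<in> box a b")
  case True
  have "(\<lambda>k. step (real (Suc k) * t)) \<longlonglongrightarrow> 1" if t: "0 < t" for t
  proof -
    have "(\<lambda>k. inverse (real (Suc k)) * inverse t) \<longlonglongrightarrow> 0 * inverse t"
      by (intro tendsto_mult_right LIMSEQ_inverse_real_of_nat)
    then have "(\<lambda>k. exp (- (inverse (real (Suc k)) * inverse t))) \<longlonglongrightarrow> exp (- (0 * inverse t))"
      by (intro tendsto_exp tendsto_minus)
    moreover have "step (real (Suc k) * t) = exp (- (inverse (real (Suc k)) * inverse t))" for k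
      using t by (simp add: step_def flat_def mult_le_0_iff del: of_nat_Suc)
    ultimately show ?thesis by simp
  qed
  then have "(\<lambda>k. step (real (Suc k) * (x $ i - a $ i)) * step (real (Suc k) * (b $ i - x $ i))) \<longlonglongrightarrow> 1 * 1" for i
    using True by (intro tendsto_mult) (auto simp: mem_box_cart)
  moreover have "- real (Suc k) * (x $ i - b $ i) = real (Suc k) * (b $ i - x $ i)" for k i
    by (simp add: algebra_simps)
  ultimately have "(\<lambda>k. box_bump (real (Suc k)) a b x) \<longlonglongrightarrow> (\<Prod>i\<in>(UNIV :: 'a set). 1 * 1)"
    unfolding box_bump_def by (intro tendsto_prod) simp
  then show ?thesis using True by simp
next
  case False
  then have "box_bump (real (Suc k)) a b x = 0" for k using box_bump_eq_0 by (metis of_nat_0_less_iff zero_less_Suc)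
  then show ?thesis using False by simp
qed

section \<open>Uniqueness of weak gradients\<close>

lemma borel_measurable_test: "C_k 0 \<phi> \<Longrightarrow> \<phi> \<in> borel_measurable borel"
  by (simp add: borel_measurable_continuous_onI)

lemma locally_integrable_mult:
  assumes h: "locally_integrable \<Omega> h" and \<Omega>: "open \<Omega>" and \<phi>: "test_function \<Omega> \<phi>"
  shows "set_integrable lebesgue \<Omega> (\<lambda>x. h x * \<phi> x)"
proof -
  let ?K = "closure {x. \<phi> x \<noteq> 0}"
  have K: "compact ?K" "?K \<subseteq> \<Omega>" and c: "C_k 0 \<phi>" using \<phi> by (auto simp: test_function_def simp del: C_k.simps)
  have c': "continuous_on UNIV \<phi>" using c by simp
  have "bounded (\<phi> ` ?K)"
    using K c' by (intro compact_imp_bounded compact_continuous_image) (auto intro: continuous_on_subset)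
  then obtain B where "\<forall>x\<in>\<phi> ` ?K. norm x \<le> B" unfolding bounded_iff by blast
  then have B: "\<bar>\<phi> x\<bar> \<le> \<bar>B\<bar>" for x
    using closure_subset[of "{x. \<phi> x \<noteq> 0}"] by (cases "\<phi> x = 0") force+
  have hK: "integrable lebesgue (\<lambda>x. indicator ?K x *\<^sub>R h x)"
    using h K unfolding locally_integrable_def set_integrable_def by blast
  have \<phi>m: "\<phi> \<in> borel_measurable lebesgue"
    using borel_measurable_test[OF c] by (intro measurable_completion) simp
  have eq: "indicator \<Omega> x *\<^sub>R (h x * \<phi> x) = \<phi> x * (indicator ?K x *\<^sub>R h x)" for x
    using K closure_subset[of "{x. \<phi> x \<noteq> 0}"] by (auto simp: indicator_def)
  show ?thesis unfolding set_integrable_def eq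
  proof (rule Bochner_Integration.integrable_bound)
    show "integrable lebesgue (\<lambda>x. \<bar>B\<bar> * (indicator ?K x *\<^sub>R h x))" by (intro integrable_mult_right hK)
    show "(\<lambda>x. \<phi> x * (indicator ?K x *\<^sub>R h x)) \<in> borel_measurable lebesgue"
      using \<phi>m borel_measurable_integrable[OF hK] by (intro borel_measurable_times)
    show "AE x in lebesgue. norm (\<phi> x * (indicator ?K x *\<^sub>R h x)) \<le> norm (\<bar>B\<bar> * (indicator ?K x *\<^sub>R h x))"
      using B by (intro AE_I2) (auto simp: abs_mult intro!: mult_right_mono)
  qed
qed

text \<open>
  The measures with densities the positive and the negative part of \<open>g\<close> agree on open boxes,
  which generate the Borel sets, so they are equal; but they live on disjoint sets.
\<close>

lemma AE_zero_of_box_integrals: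
  fixes g :: "real ^ 'n \<Rightarrow> real"
  assumes g: "integrable lborel g"
    and box0: "\<And>a b. (\<integral>x. indicator (box a b) x * g x \<partial>lborel) = 0"
  shows "AE x in lborel. g x = 0"
proof -
  have [measurable]: "g \<in> borel_measurable borel" using borel_measurable_integrable[OF g] by simp
  define p where "p x = max 0 (g x)" for x
  define q where "q x = max 0 (- g x)" for x
  have [measurable]: "p \<in> borel_measurable borel" "q \<in> borel_measurable borel"
    unfolding p_def[abs_def] q_def[abs_def] by measurable
  have pq: "integrable lborel p" "integrable lborel q"
    unfolding p_def[abs_def] q_def[abs_def] using g by (auto intro!: integrable_max)
  let ?P = "density lborel (\<lambda>x. ennreal (p x))" and ?Q = "density lborel (\<lambda>x. ennreal (q x))"
  have ip: "integrable lborel (\<lambda>x. indicator A x * p x)" "integrable lborel (\<lambda>x. indicator A x * q x)"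
    if "A \<in> sets borel" for A
    using integrable_real_mult_indicator[of A lborel p] integrable_real_mult_indicator[of A lborel q] pq that
    by (simp_all add: mult.commute[of "indicator _ _"])
  have eP: "emeasure ?P A = ennreal (\<integral>x. indicator A x * p x \<partial>lborel)" if "A \<in> sets borel" for A
  proof -
    have "emeasure ?P A = (\<integral>\<^sup>+x. ennreal (indicator A x * p x) \<partial>lborel)"
      using that by (subst emeasure_density) (auto intro!: nn_integral_cong simp: indicator_def)
    also have "\<dots> = ennreal (\<integral>x. indicator A x * p x \<partial>lborel)"
      using ip[OF that] by (intro nn_integral_eq_integral) (auto simp: p_def)
    finally show ?thesis .
  qed
  have eQ: "emeasure ?Q A = ennreal (\<integral>x. indicator A x * q x \<partial>lborel)" if "A \<in> sets borel" for A
  proof -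
    have "emeasure ?Q A = (\<integral>\<^sup>+x. ennreal (indicator A x * q x) \<partial>lborel)"
      using that by (subst emeasure_density) (auto intro!: nn_integral_cong simp: indicator_def)
    also have "\<dots> = ennreal (\<integral>x. indicator A x * q x \<partial>lborel)"
      using ip[OF that] by (intro nn_integral_eq_integral) (auto simp: q_def)
    finally show ?thesis .
  qed
  let ?E = "range (\<lambda>(a, b). box a b :: (real ^ 'n) set)"
  have "?P = ?Q"
  proof (rule measure_eqI_generator_eq[where E = ?E and \<Omega> = UNIV and A = "\<lambda>n. box (\<chi> i. - real n) (\<chi> i. real n)"])
    show "Int_stable ?E"
      by (auto simp: Int_stable_def box_Int_box)
    show "?E \<subseteq> Pow UNIV" by simp
    show "sets ?P = sigma_sets UNIV ?E" "sets ?Q = sigma_sets UNIV ?E"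
      by (simp_all add: borel_eq_box)
    show "range (\<lambda>n. box (\<chi> i. - real n) (\<chi> i. real n)) \<subseteq> ?E" by auto
    show "(\<Union>n. box (\<chi> i. - real n) (\<chi> i. real n)) = (UNIV :: (real ^ 'n) set)"
    proof (intro set_eqI iffI UNIV_I)
      fix x :: "real ^ 'n"
      obtain n where n: "infnorm x < real n" using reals_Archimedean2 by blast
      have "- real n < x $ i \<and> x $ i < real n" for i
        using component_le_infnorm_cart[of x i] n by (auto simp: abs_le_iff)
      then show "x \<in> (\<Union>n. box (\<chi> i. - real n) (\<chi> i. real n))" by (auto simp: mem_box_cart)
    qed
    show "emeasure ?P (box (\<chi> i. - real n) (\<chi> i. real n)) \<noteq> \<infinity>" for n by (subst eP) auto
    fix X assume "X \<in> ?E"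
    then obtain a b where X: "X = box a b" by auto
    have "(\<integral>x. indicator X x * p x \<partial>lborel) - (\<integral>x. indicator X x * q x \<partial>lborel)
        = (\<integral>x. indicator X x * p x - indicator X x * q x \<partial>lborel)"
      using ip[of X] X by simp
    also have "\<dots> = (\<integral>x. indicator X x * g x \<partial>lborel)"
      by (intro Bochner_Integration.integral_cong) (auto simp: p_def q_def indicator_def)
    also have "\<dots> = 0" unfolding X by (rule box0)
    finally show "emeasure ?P X = emeasure ?Q X" using eP[of X] eQ[of X] X by simp
  qed
  then have "emeasure ?P A = emeasure ?Q A" for A by simp
  then have z: "emeasure ?P {x. 0 < g x} = 0" "emeasure ?Q {x. g x < 0} = 0"
  proof -
    have "emeasure ?Q {x. 0 < g x} = 0"
      by (subst eQ) (auto simp: q_def indicator_def intro!: integral_eq_zero_AE)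
    then show "emeasure ?P {x. 0 < g x} = 0" using \<open>?P = ?Q\<close> by simp
    have "emeasure ?P {x. g x < 0} = 0"
      by (subst eP) (auto simp: p_def indicator_def intro!: integral_eq_zero_AE)
    then show "emeasure ?Q {x. g x < 0} = 0" using \<open>?P = ?Q\<close> by simp
  qed
  have "AE x in lborel. x \<in> {x. 0 < g x} \<longrightarrow> ennreal (p x) = 0"
    using z(1) by (subst (asm) emeasure_density) (auto simp: nn_integral_0_iff_AE indicator_def)
  moreover have "AE x in lborel. x \<in> {x. g x < 0} \<longrightarrow> ennreal (q x) = 0"
    using z(2) by (subst (asm) emeasure_density) (auto simp: nn_integral_0_iff_AE indicator_def)
  ultimately show ?thesis
  proof eventually_elim
    case (elim x)
    then show ?case by (auto simp: p_def q_def max_def split: if_splits) 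
  qed
qed

text \<open>
  Bumps approximate the indicators of open boxes, so by dominated convergence the integrals
  of \<open>h\<close> over boxes vanish; countably many closed boxes cover \<open>\<Omega>\<close>.
\<close>

lemma AE_zero_of_test_integrals:
  fixes h :: "real ^ 'n \<Rightarrow> real"
  assumes \<Omega>: "open \<Omega>" and h: "locally_integrable \<Omega> h"
    and test: "\<And>\<phi>. test_function \<Omega> \<phi> \<Longrightarrow> (LINT x:\<Omega>|lebesgue. h x * \<phi> x) = 0"
  shows "AE x in lebesgue. x \<in> \<Omega> \<longrightarrow> h x = 0"
proof -
  have cb: "AE x in lebesgue. x \<in> cbox a b \<longrightarrow> h x = 0" if ab: "cbox a b \<subseteq> \<Omega>" for a b
  proof -
    let ?k = "\<lambda>x. indicator (cbox a b) x * h x"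
    have hi: "integrable lebesgue ?k"
      using h ab unfolding locally_integrable_def set_integrable_def by (simp add: compact_cbox)
    \<comment> \<open>The box criterion is about Borel measures, so \<open>h\<close> is replaced by a Borel version.\<close>
    then obtain g where g: "g \<in> borel_measurable lborel" "AE x in lborel. ?k x = g x"
      using completion_ex_borel_measurable_real[of ?k lborel] by auto
    have gk: "AE x in lebesgue. g x = ?k x" using AE_completion[OF g(2)] by eventually_elim simp
    have gl: "g \<in> borel_measurable lebesgue" using g(1) by (rule measurable_completion)
    have gi: "integrable lborel g"
    proof -
      have "integrable lebesgue g"
        using hi by (subst integrable_cong_AE[OF gl _ gk]) auto
      then show ?thesis using integrable_completion[OF g(1)] by simp
    qed
    have sub0: "(\<integral>x. indicator (box c d) x * h x \<partial>lebesgue) = 0" if cd: "cbox c d \<subseteq> cbox a b" for c d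
    proof -
      have "(\<lambda>k. \<integral>x. box_bump (real (Suc k)) c d x * h x \<partial>lebesgue) \<longlonglongrightarrow> (\<integral>x. indicator (box c d) x * h x \<partial>lebesgue)"
      proof (rule integral_dominated_convergence[where w = "\<lambda>x. \<bar>?k x\<bar>"])
        have hm: "?k \<in> borel_measurable lebesgue" using hi by auto
        have eq: "box_bump (real (Suc k)) c d x * h x = box_bump (real (Suc k)) c d x * ?k x" for k x
          using box_bump_eq_0[of "real (Suc k)" c d x] cd box_subset_cbox[of c d]
          by (auto simp: indicator_def simp del: of_nat_Suc)
        have bm: "box_bump (real (Suc k)) c d \<in> borel_measurable lebesgue" for k
          using borel_measurable_test[OF C_k_box_bump] by (intro measurable_completion) simp
        show "(\<lambda>x. box_bump (real (Suc k)) c d x * h x) \<in> borel_measurable lebesgue" for k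
          unfolding eq by (rule borel_measurable_times[OF bm hm])
        have "(\<lambda>x. indicator (box c d) x * ?k x) \<in> borel_measurable lebesgue"
          by (intro borel_measurable_times[OF _ hm] borel_measurable_indicator) auto
        moreover have "indicator (box c d) x * ?k x = indicator (box c d) x * h x" for x
          using cd box_subset_cbox[of c d] by (auto simp: indicator_def)
        ultimately show "(\<lambda>x. indicator (box c d) x * h x) \<in> borel_measurable lebesgue" by simp
        show "integrable lebesgue (\<lambda>x. \<bar>?k x\<bar>)" using hi by (rule integrable_abs)
        show "AE x in lebesgue. (\<lambda>k. box_bump (real (Suc k)) c d x * h x) \<longlonglongrightarrow> indicator (box c d) x * h x"
          by (intro AE_I2 tendsto_mult box_bump_tendsto tendsto_const)
        show "AE x in lebesgue. norm (box_bump (real (Suc k)) c d x * h x) \<le> \<bar>?k x\<bar>" for k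
          unfolding eq real_norm_def abs_mult
          by (intro AE_I2 mult_left_le_one_le) (simp_all add: box_bump_nonneg box_bump_le_1 abs_le_iff order_trans[OF _ box_bump_nonneg])
      qed
      moreover have "(\<integral>x. box_bump (real (Suc k)) c d x * h x \<partial>lebesgue) = 0" for k
      proof -
        have t: "test_function \<Omega> (box_bump (real (Suc k)) c d)"
          using cd ab by (intro test_function_box_bump) auto
        have "(\<integral>x. box_bump (real (Suc k)) c d x * h x \<partial>lebesgue) = (LINT x:\<Omega>|lebesgue. h x * box_bump (real (Suc k)) c d x)"
          unfolding set_lebesgue_integral_def
        proof (rule Bochner_Integration.integral_cong[OF refl])
          fix x show "box_bump (real (Suc k)) c d x * h x = indicat_real \<Omega> x *\<^sub>R (h x * box_bump (real (Suc k)) c d x)"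
            using box_bump_eq_0[of "real (Suc k)" c d x] cd ab box_subset_cbox[of c d]
            by (auto simp: indicator_def simp del: of_nat_Suc)
        qed
        then show ?thesis using test[OF t] by simp
      qed
      ultimately show ?thesis using LIMSEQ_unique[OF _ tendsto_const] by simp
    qed
    have "AE x in lborel. g x = 0"
    proof (rule AE_zero_of_box_integrals[OF gi])
      fix c d :: "real ^ 'n"
      have [measurable]: "(\<lambda>x. indicator (box c d) x * g x) \<in> borel_measurable lborel"
        using g(1) by (intro borel_measurable_times borel_measurable_indicator) auto
      obtain c' d' where cd': "box c d \<inter> box a b = box c' d'" using box_Int_box[of c d a b] by blast
      have "(\<integral>x. indicator (box c d) x * g x \<partial>lborel) = (\<integral>x. indicator (box c d) x * g x \<partial>lebesgue)"
        by (rule integral_completion[symmetric]) measurable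
      also have "\<dots> = (\<integral>x. indicator (box c' d') x * h x \<partial>lebesgue)"
      proof (rule integral_cong_AE)
        show "(\<lambda>x. indicator (box c d) x * g x) \<in> borel_measurable lebesgue"
          by (rule measurable_completion) measurable
        have "(\<lambda>x. indicator (box c' d') x * ?k x) \<in> borel_measurable lebesgue"
          by (intro borel_measurable_times[OF _ borel_measurable_integrable[OF hi]] borel_measurable_indicator) auto
        moreover have "indicator (box c' d') x * ?k x = indicator (box c' d') x * h x" for x
          using cd' box_subset_cbox[of a b] by (auto simp: indicator_def)
        ultimately show "(\<lambda>x. indicator (box c' d') x * h x) \<in> borel_measurable lebesgue" by simp
        have "AE x in lebesgue. x \<notin> cbox a b - box a b"
          using negligible_frontier_interval[of a b]
          by (intro AE_not_in) (simp add: negligible_iff_null_sets)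
        then show "AE x in lebesgue. indicator (box c d) x * g x = indicator (box c' d') x * h x"
          using gk
        proof eventually_elim
          case (elim x)
          have "x \<in> box c' d' \<longleftrightarrow> x \<in> box c d \<and> x \<in> box a b" using cd' by auto
          then show ?case using elim box_subset_cbox[of a b] by (auto simp: indicator_def)
        qed
      qed
      also have "\<dots> = 0"
      proof (cases "box c' d' = {}")
        case False
        then have "cbox c' d' = closure (box c' d')" by simp
        also have "\<dots> \<subseteq> cbox a b" using cd' box_subset_cbox[of a b] by (intro closure_minimal) auto
        finally show ?thesis by (rule sub0)
      qed simp
      finally show "(\<integral>x. indicator (box c d) x * g x \<partial>lborel) = 0" .
    qed
    from AE_completion[OF this] gk show ?thesis by eventually_elim (auto simp: indicator_def)
  qed
  obtain \<D> where \<D>: "countable \<D>" "\<And>X. X \<in> \<D> \<Longrightarrow> X \<subseteq> \<Omega> \<and> (\<exists>a b. X = cbox a b)" "\<Union>\<D> = \<Omega>"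
    using open_countable_Union_open_cbox[OF \<Omega>] by (metis Pow_iff subsetD)
  have "AE x in lebesgue. \<forall>X\<in>\<D>. x \<in> X \<longrightarrow> h x = 0"
    using \<D> cb by (subst AE_ball_countable) blast+
  then show ?thesis by eventually_elim (use \<D>(3) in blast)
qed

lemma locally_integrable_diff:
  "locally_integrable \<Omega> f \<Longrightarrow> locally_integrable \<Omega> g \<Longrightarrow> locally_integrable \<Omega> (\<lambda>x. f x - g x)"
  unfolding locally_integrable_def by (auto intro!: set_integral_diff)

lemma weak_gradient_unique:
  fixes \<Omega> :: "(real ^ 'n) set"
  assumes \<Omega>: "open \<Omega>" and G: "weak_gradient \<Omega> F G" and G': "weak_gradient \<Omega> F G'"
  shows "AE x in lebesgue. x \<in> \<Omega> \<longrightarrow> G x = G' x"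
proof -
  have "AE x in lebesgue. x \<in> \<Omega> \<longrightarrow> G x $ i - G' x $ i = 0" for i
  proof (rule AE_zero_of_test_integrals[OF \<Omega>])
    have l: "locally_integrable \<Omega> (\<lambda>x. G x $ i)" "locally_integrable \<Omega> (\<lambda>x. G' x $ i)"
      using G G' by (auto simp: weak_gradient_def)
    then show "locally_integrable \<Omega> (\<lambda>x. G x $ i - G' x $ i)" by (rule locally_integrable_diff)
    fix \<phi> assume \<phi>: "test_function \<Omega> \<phi>"
    have "(LINT x:\<Omega>|lebesgue. (G x $ i - G' x $ i) * \<phi> x)
       = (LINT x:\<Omega>|lebesgue. G x $ i * \<phi> x - G' x $ i * \<phi> x)" by (simp add: left_diff_distrib)
    also have "\<dots> = (LINT x:\<Omega>|lebesgue. G x $ i * \<phi> x) - (LINT x:\<Omega>|lebesgue. G' x $ i * \<phi> x)"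
      using locally_integrable_mult[OF _ \<Omega> \<phi>] l by (intro set_integral_diff(2)) auto
    also have "\<dots> = 0" using G G' \<phi> by (simp add: weak_gradient_def)
    finally show "(LINT x:\<Omega>|lebesgue. (G x $ i - G' x $ i) * \<phi> x) = 0" .
  qed
  then have "AE x in lebesgue. \<forall>i. x \<in> \<Omega> \<longrightarrow> G x $ i - G' x $ i = 0"
    by (subst AE_all_countable) blast
  then show ?thesis by eventually_elim (auto simp: vec_eq_iff)
qed

section \<open>Classical gradients are weak gradients\<close>

text \<open>
  By translation invariance of Lebesgue measure the difference quotients of \<open>u\<close> have
  integral zero; they are dominated since \<open>u\<close> is Lipschitz with bounded support.
\<close>

lemma integral_gradient_zero:
  fixes u :: "real ^ 'n \<Rightarrow> real"
  assumes der: "\<And>x. (u has_derivative (\<lambda>v. D x \<bullet> v)) (at x)"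
    and bd: "\<And>x. norm (D x) \<le> M" and supp: "\<And>x. x \<notin> cbox a b \<Longrightarrow> u x = 0"
  shows "integrable lborel (\<lambda>x. D x $ i)" "(\<integral>x. D x $ i \<partial>lborel) = 0"
proof -
  define e :: "real ^ 'n" where "e = axis i 1"
  define h where "h k = 1 / real (Suc k)" for k
  define q where "q k x = (u (x + h k *\<^sub>R e) - u x) / h k" for k x
  have h: "0 < h k" "h k \<le> 1" for k by (auto simp: h_def)
  have h0: "h \<longlonglongrightarrow> 0"
    using LIMSEQ_inverse_real_of_nat by (simp add: h_def[abs_def] inverse_eq_divide)
  have De: "D x $ i = D x \<bullet> e" for x by (simp add: e_def inner_axis)
  have ne: "norm e = 1" by (simp add: e_def)
  have cu: "continuous_on S u" for S
    by (rule continuous_at_imp_continuous_on) (use der has_derivative_continuous in blast)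
  have um: "u \<in> borel_measurable borel" by (rule borel_measurable_continuous_onI[OF cu])
  have "(\<lambda>x. indicator (cbox a b) x *\<^sub>R u x) = u"
  proof
    fix x show "indicator (cbox a b) x *\<^sub>R u x = u x"
      by (cases "x \<in> cbox a b") (simp_all add: supp)
  qed
  then have ui: "integrable lborel u"
    using borel_integrable_compact[OF compact_cbox cu, of a b] by simp
  have shift: "integrable lborel (\<lambda>x. u (x + c)) \<and> (\<integral>x. u (x + c) \<partial>lborel) = (\<integral>x. u x \<partial>lborel)" for c
  proof -
    have "integrable (distr lborel borel ((+) c)) u" using ui by (simp add: lborel_distr_plus)
    then have "integrable lborel (\<lambda>x. u (c + x))" by (subst (asm) integrable_distr_eq) (use um in auto)
    moreover have "(\<integral>x. u x \<partial>lborel) = (\<integral>x. u (c + x) \<partial>lborel)"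
      by (subst lborel_distr_plus[of c, symmetric], rule integral_distr) (use um in auto)
    ultimately show ?thesis by (simp add: add.commute)
  qed
  have qi: "integrable lborel (q k)" "(\<integral>x. q k x \<partial>lborel) = 0" for k
    using shift[of "h k *\<^sub>R e"] ui unfolding q_def[abs_def] by auto
  have lim: "(\<lambda>k. q k x) \<longlonglongrightarrow> D x $ i" for x
  proof -
    have "((\<lambda>t. x + t *\<^sub>R e) has_derivative (\<lambda>t. 0 + t *\<^sub>R e)) (at 0)"
      by (intro has_derivative_add has_derivative_const has_derivative_scaleR_left has_derivative_ident)
    then have "((\<lambda>t. u (x + t *\<^sub>R e)) has_derivative (\<lambda>t. D x \<bullet> (t *\<^sub>R e))) (at 0)"
      using has_derivative_compose[of "\<lambda>t. x + t *\<^sub>R e" "\<lambda>t. t *\<^sub>R e" 0 UNIV u "\<lambda>v. D x \<bullet> v"] der[of x]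
      by simp
    then have "((\<lambda>t. u (x + t *\<^sub>R e)) has_real_derivative D x \<bullet> e) (at 0)"
      by (simp add: has_field_derivative_def mult_commute_abs)
    then have "((\<lambda>t. (u (x + t *\<^sub>R e) - u x) / t) \<longlongrightarrow> D x \<bullet> e) (at 0)"
      by (simp add: has_field_derivative_iff)
    moreover have "filterlim h (at 0) sequentially"
      using h0 h(1) by (auto simp: filterlim_at intro!: always_eventually) (metis less_irrefl)
    ultimately show ?thesis unfolding q_def De by (rule filterlim_compose)
  qed
  have lip: "norm (u y - u x) \<le> M * norm (y - x)" for x y
  proof (rule differentiable_bound[of UNIV])
    show "(u has_derivative (\<lambda>v. D x \<bullet> v)) (at x within UNIV)" for x using der by simp
    show "onorm (\<lambda>v. D x \<bullet> v) \<le> M" for x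
    proof (rule onorm_le)
      fix v
      have "norm (D x \<bullet> v) \<le> norm (D x) * norm v" by (simp add: Cauchy_Schwarz_ineq2)
      also have "\<dots> \<le> M * norm v" using bd by (intro mult_right_mono) auto
      finally show "norm (D x \<bullet> v) \<le> M * norm v" .
    qed
  qed auto
  define a' where "a' = a - (\<chi> i. 1)"
  define b' where "b' = b + (\<chi> i. 1)"
  have dom: "norm (q k x) \<le> M * indicator (cbox a' b') x" for k x
  proof (cases "x \<in> cbox a' b'")
    case True
    have "norm (q k x) = norm (u (x + h k *\<^sub>R e) - u x) / h k"
      using h(1)[of k] by (simp add: q_def)
    also have "\<dots> \<le> (M * norm ((x + h k *\<^sub>R e) - x)) / h k"
      using h(1)[of k] by (intro divide_right_mono lip) auto
    also have "\<dots> = M" using h(1)[of k] ne by simp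
    finally show ?thesis using True by simp
  next
    case False
    have sub: "y \<in> cbox a' b'" if "y \<in> cbox a b \<or> y + h k *\<^sub>R e \<in> cbox a b" for y
    proof -
      have "\<bar>(h k *\<^sub>R e) $ j\<bar> \<le> 1" for j
        using h(1)[of k] h(2)[of k] component_le_norm_cart[of "h k *\<^sub>R e" j] ne by simp
      then have "- 1 \<le> (h k *\<^sub>R e) $ j \<and> (h k *\<^sub>R e) $ j \<le> 1" for j by (simp add: abs_le_iff minus_le_iff)
      moreover have "(\<forall>j. a $ j \<le> y $ j \<and> y $ j \<le> b $ j) \<or>
          (\<forall>j. a $ j \<le> y $ j + (h k *\<^sub>R e) $ j \<and> y $ j + (h k *\<^sub>R e) $ j \<le> b $ j)"
        using that by (simp add: mem_box_cart)
      ultimately have "a $ j - 1 \<le> y $ j \<and> y $ j \<le> b $ j + 1" for j by (smt (verit))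
      then show ?thesis by (simp add: a'_def b'_def mem_box_cart)
    qed
    have "u x = 0" "u (x + h k *\<^sub>R e) = 0" using sub[of x] False by (auto intro: supp)
    then show ?thesis by (simp add: q_def False)
  qed
  have wi: "integrable lborel (\<lambda>x. M * indicator (cbox a' b') x)"
    by (intro integrable_mult_right integrable_real_indicator) (auto simp: emeasure_lborel_cbox_eq)
  have Dm: "(\<lambda>x. D x $ i) \<in> borel_measurable lborel"
    by (rule borel_measurable_LIMSEQ_real[OF lim]) (use qi(1) in auto)
  have qm: "q k \<in> borel_measurable lborel" for k using qi(1) by auto
  have ae1: "AE x in lborel. (\<lambda>k. q k x) \<longlonglongrightarrow> D x $ i" by (rule AE_I2) (rule lim)
  have ae2: "AE x in lborel. norm (q k x) \<le> M * indicator (cbox a' b') x" for k by (rule AE_I2) (rule dom)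
  show "integrable lborel (\<lambda>x. D x $ i)" by (rule integrable_dominated_convergence[OF Dm qm wi ae1 ae2])
  have "(\<lambda>k. \<integral>x. q k x \<partial>lborel) \<longlonglongrightarrow> (\<integral>x. D x $ i \<partial>lborel)"
    by (rule integral_dominated_convergence[OF Dm qm wi ae1 ae2])
  then show "(\<integral>x. D x $ i \<partial>lborel) = 0" unfolding qi using LIMSEQ_unique[OF _ tendsto_const] by blast
qed

lemma set_integrable_lebesgue_continuous:
  fixes F :: "real ^ 'n \<Rightarrow> real"
  assumes "compact K" "continuous_on K F"
  shows "set_integrable lebesgue K F"
proof -
  have i: "integrable lborel (\<lambda>x. indicator K x *\<^sub>R F x)" by (rule borel_integrable_compact[OF assms])
  then have "(\<lambda>x. indicator K x *\<^sub>R F x) \<in> borel_measurable lborel" by auto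
  then show ?thesis unfolding set_integrable_def using i by (simp add: integrable_completion)
qed

lemma locally_integrable_continuous:
  fixes F :: "real ^ 'n \<Rightarrow> real"
  shows "continuous_on \<Omega> F \<Longrightarrow> locally_integrable \<Omega> F"
  unfolding locally_integrable_def by (auto intro!: set_integrable_lebesgue_continuous intro: continuous_on_subset)

lemma has_derivative_partials:
  fixes \<phi> :: "real ^ 'n \<Rightarrow> real"
  assumes "\<phi> differentiable (at x)"
  shows "(\<phi> has_derivative (\<lambda>v. (\<chi> i. partial i \<phi> x) \<bullet> v)) (at x)"
proof -
  let ?d = "frechet_derivative \<phi> (at x)"
  have d: "(\<phi> has_derivative ?d) (at x)" using assms by (simp add: frechet_derivative_works[symmetric])
  then have lin: "linear ?d" by (rule has_derivative_linear)
  have "?d v = (\<chi> i. partial i \<phi> x) \<bullet> v" for v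
  proof -
    have "?d v = ?d (\<Sum>i\<in>UNIV. v $ i *\<^sub>R axis i 1)"
      using basis_expansion[of v] by (simp add: scalar_mult_eq_scaleR)
    also have "\<dots> = (\<Sum>i\<in>UNIV. v $ i * partial i \<phi> x)"
      by (simp add: linear_sum[OF lin] linear_scale[OF lin] partial_def)
    finally show ?thesis by (simp add: inner_vec_def mult.commute)
  qed
  then show ?thesis using d by (simp add: has_derivative_eq_rhs[OF d] ext)
qed

lemma test_function_partial_support:
  assumes "x \<notin> closure {x. \<phi> x \<noteq> 0}"
  shows "partial i \<phi> x = 0"
proof -
  have "(\<phi> has_derivative (\<lambda>_. 0)) (at x)"
    by (rule has_derivative_transform_within_open[of "\<lambda>_. 0" _ _ _ "- closure {x. \<phi> x \<noteq> 0}"])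
      (use assms closure_subset[of "{x. \<phi> x \<noteq> 0}"] in auto)
  from partial_eqI[OF this] show ?thesis .
qed

lemma test_function_partial:
  assumes \<phi>: "test_function \<Omega> \<phi>"
  shows "test_function \<Omega> (partial i \<phi>)"
proof -
  let ?K = "closure {x. \<phi> x \<noteq> 0}"
  have "{x. partial i \<phi> x \<noteq> 0} \<subseteq> ?K" using test_function_partial_support by blast
  then have cl: "closure {x. partial i \<phi> x \<noteq> 0} \<subseteq> ?K" by (rule closure_minimal) simp
  have K: "compact ?K" "?K \<subseteq> \<Omega>" using \<phi> by (auto simp: test_function_def)
  have "compact (closure {x. partial i \<phi> x \<noteq> 0})"
    using bounded_subset[OF compact_imp_bounded[OF K(1)] cl] by (simp add: compact_eq_bounded_closed)
  moreover have "C_k k (partial i \<phi>)" for k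
  proof -
    have "C_k (Suc k) \<phi>" using \<phi> unfolding test_function_def by blast
    then show ?thesis by simp
  qed
  ultimately show ?thesis unfolding test_function_def using order_trans[OF cl K(2)] by blast
qed

text \<open>
  Integration by parts: extended by zero, \<open>F \<phi>\<close> is continuously differentiable with compact
  support on the whole space, so the integral of each of its partial derivatives vanishes.
\<close>

lemma weak_gradient_of_C1:
  fixes F :: "real ^ 'n \<Rightarrow> real"
  assumes \<Omega>: "open \<Omega>" and der: "\<And>x. x \<in> \<Omega> \<Longrightarrow> (F has_derivative (\<lambda>v. G x \<bullet> v)) (at x)"
    and G: "continuous_on \<Omega> G"
  shows "weak_gradient \<Omega> F G"
  unfolding weak_gradient_def
proof (intro conjI allI impI)
  have F: "continuous_on \<Omega> F"
    by (rule continuous_at_imp_continuous_on) (use der has_derivative_continuous in blast)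
  have Gi: "continuous_on \<Omega> (\<lambda>x. G x $ i)" for i using G by (intro continuous_intros)
  show lF: "locally_integrable \<Omega> F" by (rule locally_integrable_continuous[OF F])
  show lG: "locally_integrable \<Omega> (\<lambda>x. G x $ i)" for i by (rule locally_integrable_continuous[OF Gi])
  fix \<phi> i assume \<phi>: "test_function \<Omega> \<phi>"
  let ?K = "closure {x. \<phi> x \<noteq> 0}"
  have K: "compact ?K" "?K \<subseteq> \<Omega>" using \<phi> by (auto simp: test_function_def)
  have \<phi>0: "\<phi> x = 0" if "x \<notin> ?K" for x using that closure_subset[of "{x. \<phi> x \<noteq> 0}"] by auto
  have "C_k (Suc 0) \<phi>" using \<phi> unfolding test_function_def by blast
  then have diff: "\<phi> differentiable (at x)" and cp: "continuous_on UNIV (partial i \<phi>)" for x i by auto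
  have c\<phi>: "continuous_on UNIV \<phi>"
    by (rule continuous_at_imp_continuous_on) (use diff differentiable_imp_continuous_within in blast)
  define g where "g x = (\<chi> i. partial i \<phi> x)" for x
  have g0: "g x = 0" if "x \<notin> ?K" for x
    using test_function_partial_support[OF that] by (simp add: g_def vec_eq_iff)
  define u where "u x = (if x \<in> \<Omega> then F x * \<phi> x else 0)" for x
  define D where "D x = (if x \<in> \<Omega> then \<phi> x *\<^sub>R G x + F x *\<^sub>R g x else 0)" for x
  have du: "(u has_derivative (\<lambda>v. D x \<bullet> v)) (at x)" for x
  proof (cases "x \<in> ?K")
    case True
    then have x: "x \<in> \<Omega>" using K by auto
    have "((\<lambda>x. F x * \<phi> x) has_derivative (\<lambda>v. F x * (g x \<bullet> v) + (G x \<bullet> v) * \<phi> x)) (at x)"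
      unfolding g_def by (intro has_derivative_mult der x has_derivative_partials diff)
    moreover have "(\<lambda>v. F x * (g x \<bullet> v) + (G x \<bullet> v) * \<phi> x) = (\<lambda>v. D x \<bullet> v)"
      using x by (simp add: D_def inner_add_left fun_eq_iff)
    ultimately show ?thesis
      by (intro has_derivative_transform_within_open[of "\<lambda>x. F x * \<phi> x" _ x UNIV \<Omega> u]) (use \<Omega> x in \<open>auto simp: u_def\<close>)
  next
    case False
    have zero: "0 = u y" if "y \<in> - ?K" for y using \<phi>0[of y] that by (simp add: u_def)
    have "(u has_derivative (\<lambda>_. 0)) (at x)"
      by (rule has_derivative_transform_within_open[where s = "- ?K", OF has_derivative_const _ _ zero])
        (use False in \<open>simp_all add: open_Compl\<close>)
    moreover have "D x = 0" using \<phi>0[OF False] g0[OF False] by (simp add: D_def)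
    ultimately show ?thesis by simp
  qed
  have "continuous_on ?K (\<lambda>x. \<phi> x *\<^sub>R G x + F x *\<^sub>R g x)"
    unfolding g_def using K(2)
    by (intro continuous_intros continuous_on_subset[OF c\<phi>] continuous_on_subset[OF cp]
        continuous_on_subset[OF F] continuous_on_subset[OF G]) auto
  then have "bounded ((\<lambda>x. \<phi> x *\<^sub>R G x + F x *\<^sub>R g x) ` ?K)"
    using K(1) by (intro compact_imp_bounded compact_continuous_image)
  then obtain M where "\<forall>y\<in>(\<lambda>x. \<phi> x *\<^sub>R G x + F x *\<^sub>R g x) ` ?K. norm y \<le> M" unfolding bounded_iff by blast
  then have M': "norm (\<phi> x *\<^sub>R G x + F x *\<^sub>R g x) \<le> M" if "x \<in> ?K" for x using that by blast
  have M: "norm (D x) \<le> \<bar>M\<bar>" for x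
  proof (cases "x \<in> ?K")
    case True
    then show ?thesis using K(2) M'[OF True] by (auto simp: D_def)
  next
    case False
    then show ?thesis using \<phi>0[OF False] g0[OF False] by (simp add: D_def)
  qed
  obtain b where b: "?K \<subseteq> cbox (- b) b" using bounded_subset_cbox_symmetric[OF compact_imp_bounded[OF K(1)]] .
  have u0: "u x = 0" if "x \<notin> cbox (- b) b" for x
    using \<phi>0[of x] that b by (auto simp: u_def)
  note z = integral_gradient_zero[OF du M u0, where i = i]
  have int: "set_integrable lebesgue \<Omega> (\<lambda>x. F x * partial i \<phi> x)" "set_integrable lebesgue \<Omega> (\<lambda>x. G x $ i * \<phi> x)"
    using locally_integrable_mult[OF lF \<Omega> test_function_partial[OF \<phi>]] locally_integrable_mult[OF lG \<Omega> \<phi>] by auto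
  have "(LINT x:\<Omega>|lebesgue. F x * partial i \<phi> x) + (LINT x:\<Omega>|lebesgue. G x $ i * \<phi> x)
      = (LINT x:\<Omega>|lebesgue. F x * partial i \<phi> x + G x $ i * \<phi> x)"
    by (rule set_integral_add(2)[OF int, symmetric])
  also have "\<dots> = (\<integral>x. D x $ i \<partial>lebesgue)"
    unfolding set_lebesgue_integral_def
    by (rule Bochner_Integration.integral_cong) (auto simp: D_def g_def indicator_def)
  also have "\<dots> = (\<integral>x. D x $ i \<partial>lborel)" using z(1) by (intro integral_completion) auto
  also have "\<dots> = 0" by (rule z(2))
  finally show "(LINT x:\<Omega>|lebesgue. F x * partial i \<phi> x) = - (LINT x:\<Omega>|lebesgue. G x $ i * \<phi> x)" by simp
qed

section \<open>Borel representatives of weak gradients\<close>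

lemma vec_nth_borel [measurable]: "(\<lambda>x :: real ^ 'n. x $ i) \<in> borel_measurable borel"
  by (intro borel_measurable_continuous_onI continuous_intros)

lemma infnorm_borel [measurable]: "(infnorm :: real ^ 'n \<Rightarrow> real) \<in> borel_measurable borel"
  by (intro borel_measurable_continuous_onI continuous_intros)

lemma borel_measurable_vec_lambda:
  fixes f :: "'a \<Rightarrow> real ^ 'n"
  assumes "\<And>i. (\<lambda>x. f x $ i) \<in> borel_measurable M"
  shows "f \<in> borel_measurable M"
  using assms by (subst borel_measurable_euclidean_space) (auto simp: Basis_vec_def inner_axis)

text \<open>
  An open set is a countable increasing union of compact sets.
\<close>

lemma locally_integrable_measurable:
  fixes h :: "real ^ 'n \<Rightarrow> real"
  assumes \<Omega>: "open \<Omega>" and h: "locally_integrable \<Omega> h"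
  shows "(\<lambda>x. indicator \<Omega> x * h x) \<in> borel_measurable lebesgue"
proof -
  obtain \<D> where \<D>: "countable \<D>" "\<And>X. X \<in> \<D> \<Longrightarrow> X \<subseteq> \<Omega> \<and> (\<exists>a b. X = cbox a b)" "\<Union>\<D> = \<Omega>"
    using open_countable_Union_open_cbox[OF \<Omega>] by (metis Pow_iff subsetD)
  define D where "D = from_nat_into (insert {} \<D>)"
  have D: "range D = insert {} \<D>" unfolding D_def using \<D>(1) by (intro range_from_nat_into) auto
  define K where "K m = (\<Union>k<m. D k)" for m :: nat
  have Dk: "compact (D k) \<and> D k \<subseteq> \<Omega>" for k
  proof -
    have "D k \<in> insert {} \<D>" using D by blast
    then show ?thesis using \<D>(2)[of "D k"] compact_cbox by (metis compact_empty empty_subsetI insertE)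
  qed
  then have K: "compact (K m)" "K m \<subseteq> \<Omega>" for m unfolding K_def by (auto intro!: compact_UN)
  have meas: "(\<lambda>x. indicator (K m) x * h x) \<in> borel_measurable lebesgue" for m
  proof -
    have "integrable lebesgue (\<lambda>x. indicator (K m) x * h x)"
      using h K[of m] unfolding locally_integrable_def set_integrable_def by simp
    then show ?thesis by (rule borel_measurable_integrable)
  qed
  have lim: "(\<lambda>m. indicator (K m) x * h x) \<longlonglongrightarrow> indicator \<Omega> x * h x" for x
  proof (cases "x \<in> \<Omega>")
    case True
    then have "x \<in> \<Union>(range D)" unfolding D using \<D>(3) by auto
    then obtain k where k: "x \<in> D k" by auto
    have "indicator (K m) x * h x = indicator \<Omega> x * h x" if "k < m" for m
      using k that True by (auto simp: K_def indicator_def)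
    then show ?thesis
      by (intro tendsto_eventually) (auto simp: eventually_sequentially intro!: exI[of _ "Suc k"])
  next
    case False
    then have "x \<notin> K m" for m using K(2) by auto
    then show ?thesis using False by simp
  qed
  show ?thesis by (rule borel_measurable_LIMSEQ_real[OF lim meas])
qed

text \<open>
  The estimates integrate the gradient jointly in a scale parameter and a point, with
  respect to products of Borel measures; this needs a representative that is Borel
  measurable on the whole space.
\<close>

lemma weak_gradient_borel_version:
  fixes \<Omega> :: "(real ^ 'n) set"
  assumes \<Omega>: "open \<Omega>" and G: "weak_gradient \<Omega> F G"
  obtains g where "g \<in> borel_measurable borel" "\<And>x. x \<notin> \<Omega> \<Longrightarrow> g x = 0"
    "weak_gradient \<Omega> F g" "AE x in lebesgue. x \<in> \<Omega> \<longrightarrow> G x = g x"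
proof -
  have m: "(\<lambda>x. indicator \<Omega> x * G x $ i) \<in> borel_measurable lebesgue" for i
    using G by (intro locally_integrable_measurable[OF \<Omega>]) (simp add: weak_gradient_def)
  have "\<exists>g'\<in>borel_measurable lborel. AE x in lborel. indicator \<Omega> x * G x $ i = g' x" for i
    using completion_ex_borel_measurable_real[OF m] .
  then obtain \<gamma> where \<gamma>: "\<And>i. \<gamma> i \<in> borel_measurable lborel"
      "\<And>i. AE x in lborel. indicator \<Omega> x * G x $ i = \<gamma> i x" by metis
  define g where "g x = (\<chi> i. indicator \<Omega> x * \<gamma> i x)" for x
  have gm: "g \<in> borel_measurable borel"
  proof (rule borel_measurable_vec_lambda)
    have "\<Omega> \<in> sets borel" using \<Omega> by simp
    then show "(\<lambda>x. g x $ i) \<in> borel_measurable borel" for i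
      using \<gamma>(1)[of i] by (simp add: g_def borel_measurable_times borel_measurable_indicator)
  qed
  have ae: "AE x in lebesgue. x \<in> \<Omega> \<longrightarrow> G x = g x"
  proof -
    have "AE x in lborel. \<forall>i. indicator \<Omega> x * G x $ i = \<gamma> i x"
      using \<gamma>(2) by (subst AE_all_countable) blast
    from AE_completion[OF this] show ?thesis
      by eventually_elim (auto simp: g_def vec_eq_iff)
  qed
  have "weak_gradient \<Omega> F g"
    unfolding weak_gradient_def
  proof (intro conjI allI impI)
    show "locally_integrable \<Omega> F" using G by (simp add: weak_gradient_def)
    have gi: "(\<lambda>x. g x $ i) \<in> borel_measurable lebesgue" for i
      using measurable_compose[OF gm vec_nth_borel[of i]] by (intro measurable_completion) simp
    show "locally_integrable \<Omega> (\<lambda>x. g x $ i)" for i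
      unfolding locally_integrable_def
    proof (intro allI impI)
      fix K assume K: "compact K \<and> K \<subseteq> \<Omega>"
      then have "integrable lebesgue (\<lambda>x. indicator K x *\<^sub>R G x $ i)"
        using G unfolding weak_gradient_def locally_integrable_def set_integrable_def by blast
      moreover have "integrable lebesgue (\<lambda>x. indicator K x *\<^sub>R G x $ i) \<longleftrightarrow> integrable lebesgue (\<lambda>x. indicator K x *\<^sub>R g x $ i)"
      proof (rule integrable_cong_AE)
        show "(\<lambda>x. indicator K x *\<^sub>R G x $ i) \<in> borel_measurable lebesgue" using calculation by auto
        have "K \<in> sets borel" using K by (simp add: borel_compact)
        then show "(\<lambda>x. indicator K x *\<^sub>R g x $ i) \<in> borel_measurable lebesgue"
          using gi by (intro borel_measurable_scaleR borel_measurable_indicator) auto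
        show "AE x in lebesgue. indicator K x *\<^sub>R G x $ i = indicator K x *\<^sub>R g x $ i"
          using ae by eventually_elim (use K in \<open>auto simp: indicator_def\<close>)
      qed
      ultimately show "set_integrable lebesgue K (\<lambda>x. g x $ i)" by (simp add: set_integrable_def)
    qed
    fix \<phi> i assume \<phi>: "test_function \<Omega> \<phi>"
    have "C_k 0 \<phi>" using \<phi> unfolding test_function_def by blast
    then have \<phi>m: "\<phi> \<in> borel_measurable lebesgue"
      using borel_measurable_test by (intro measurable_completion) simp
    have "(LINT x:\<Omega>|lebesgue. G x $ i * \<phi> x) = (LINT x:\<Omega>|lebesgue. g x $ i * \<phi> x)"
      unfolding set_lebesgue_integral_def
    proof (rule integral_cong_AE)
      have "(\<lambda>x. (indicator \<Omega> x * G x $ i) * \<phi> x) \<in> borel_measurable lebesgue"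
        by (rule borel_measurable_times[OF m \<phi>m])
      then show "(\<lambda>x. indicator \<Omega> x *\<^sub>R (G x $ i * \<phi> x)) \<in> borel_measurable lebesgue" by (simp add: mult.assoc)
      have "\<Omega> \<in> sets borel" using \<Omega> by simp
      then show "(\<lambda>x. indicator \<Omega> x *\<^sub>R (g x $ i * \<phi> x)) \<in> borel_measurable lebesgue"
        using gi \<phi>m by (intro borel_measurable_scaleR borel_measurable_times borel_measurable_indicator) auto
      show "AE x in lebesgue. indicator \<Omega> x *\<^sub>R (G x $ i * \<phi> x) = indicator \<Omega> x *\<^sub>R (g x $ i * \<phi> x)"
        using ae by eventually_elim (auto simp: indicator_def)
    qed
    then show "(LINT x:\<Omega>|lebesgue. F x * partial i \<phi> x) = - (LINT x:\<Omega>|lebesgue. g x $ i * \<phi> x)"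
      using G \<phi> by (simp add: weak_gradient_def)
  qed
  moreover have "g x = 0" if "x \<notin> \<Omega>" for x using that by (simp add: g_def vec_eq_iff)
  ultimately show ?thesis using that gm ae by blast
qed

lemma weak_gradient_add_const:
  fixes \<Omega> :: "(real ^ 'n) set"
  assumes \<Omega>: "open \<Omega>" and G: "weak_gradient \<Omega> F G"
  shows "weak_gradient \<Omega> (\<lambda>x. F x - c) G"
proof -
  have c: "weak_gradient \<Omega> (\<lambda>_. c) (\<lambda>_. 0)"
    by (rule weak_gradient_of_C1[OF \<Omega>]) auto
  have "(LINT x:\<Omega>|lebesgue. (F x - c) * partial i \<phi> x) = (LINT x:\<Omega>|lebesgue. F x * partial i \<phi> x)"
    if \<phi>: "test_function \<Omega> \<phi>" for \<phi> i
  proof -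
    have int: "set_integrable lebesgue \<Omega> (\<lambda>x. F x * partial i \<phi> x)" "set_integrable lebesgue \<Omega> (\<lambda>x. c * partial i \<phi> x)"
      using G c by (auto intro!: locally_integrable_mult[OF _ \<Omega> test_function_partial[OF \<phi>]] simp: weak_gradient_def)
    have "(LINT x:\<Omega>|lebesgue. (F x - c) * partial i \<phi> x)
       = (LINT x:\<Omega>|lebesgue. F x * partial i \<phi> x - c * partial i \<phi> x)" by (simp add: left_diff_distrib)
    also have "\<dots> = (LINT x:\<Omega>|lebesgue. F x * partial i \<phi> x) - (LINT x:\<Omega>|lebesgue. c * partial i \<phi> x)"
      by (rule set_integral_diff(2)[OF int])
    also have "(LINT x:\<Omega>|lebesgue. c * partial i \<phi> x) = - (LINT x:\<Omega>|lebesgue. 0 $ i * \<phi> x)"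
      using c \<phi> unfolding weak_gradient_def by blast
    finally show ?thesis by simp
  qed
  moreover have "locally_integrable \<Omega> (\<lambda>x. F x - c)"
    using G c by (intro locally_integrable_diff) (auto simp: weak_gradient_def)
  ultimately show ?thesis using G unfolding weak_gradient_def by simp
qed

section \<open>Averages along a homothety\<close>

lemma box_bump_homothety:
  assumes "s \<noteq> 0"
  shows "box_bump m a b (l + (1 / s) *\<^sub>R (z - l)) = box_bump (m / s) (l + s *\<^sub>R (a - l)) (l + s *\<^sub>R (b - l)) z"
proof -
  have "m * ((l + (1 / s) *\<^sub>R (z - l)) $ i - y $ i) = (m / s) * (z $ i - (l + s *\<^sub>R (y - l)) $ i)" for i y
    using assms by (simp add: field_simps)
  then show ?thesis unfolding box_bump_def by (metis (no_types, lifting) minus_divide_left minus_mult_left)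
qed

lemma partial_homothety:
  fixes \<psi> :: "real ^ 'n \<Rightarrow> real"
  assumes d: "\<And>x. \<psi> differentiable (at x)"
  shows "partial i (\<lambda>z. (z $ i - l $ i) * \<psi> (l + (1 / s) *\<^sub>R (z - l))) z
    = \<psi> (l + (1 / s) *\<^sub>R (z - l)) + (z $ i - l $ i) / s * partial i \<psi> (l + (1 / s) *\<^sub>R (z - l))"
proof -
  let ?W = "\<lambda>z. l + (1 / s) *\<^sub>R (z - l)"
  have W: "(?W has_derivative (\<lambda>v. (1 / s) *\<^sub>R v)) (at z)"
    by (auto intro!: derivative_eq_intros)
  have "((\<lambda>z. \<psi> (?W z)) has_derivative (\<lambda>v. (\<chi> i. partial i \<psi> (?W z)) \<bullet> ((1 / s) *\<^sub>R v))) (at z)"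
    using has_derivative_compose[OF W has_derivative_partials[OF d]] .
  moreover have "((\<lambda>z. z $ i - l $ i) has_derivative (\<lambda>h. h $ i)) (at z)"
    using has_derivative_diff[OF has_derivative_component[of i z] has_derivative_const] by simp
  ultimately have "((\<lambda>z. (z $ i - l $ i) * \<psi> (?W z)) has_derivative
     (\<lambda>v. (z $ i - l $ i) * ((\<chi> i. partial i \<psi> (?W z)) \<bullet> ((1 / s) *\<^sub>R v)) + v $ i * \<psi> (?W z))) (at z)"
    by (intro has_derivative_mult)
  from partial_eqI[OF this, of i] show ?thesis by (simp add: inner_axis)
qed

text \<open>
  The homothety with centre \<open>l\<close> and ratio \<open>1 / s\<close>, which maps the copy of a set with
  parameter \<open>s\<close> back to the set.
\<close>

definition blow_up :: "real ^ 'n \<Rightarrow> real \<Rightarrow> real ^ 'n \<Rightarrow> real ^ 'n" where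
  "blow_up l s z = l + (1 / s) *\<^sub>R (z - l)"

definition pulled_bump :: "real ^ 'n \<Rightarrow> real \<Rightarrow> real ^ 'n \<Rightarrow> real ^ 'n \<Rightarrow> real \<Rightarrow> real ^ 'n \<Rightarrow> real" where
  "pulled_bump l m a b s z = box_bump m a b (blow_up l s z)"

definition restr :: "(real ^ 'n) set \<Rightarrow> (real ^ 'n \<Rightarrow> real) \<Rightarrow> real ^ 'n \<Rightarrow> real" where
  "restr \<Omega> F z = indicator \<Omega> z * F z"

text \<open>
  If \<open>f\<close> is not integrable, the Bochner integral on the left is 0.
\<close>

lemma norm_integral_le_nn:
  fixes f :: "'a \<Rightarrow> real"
  shows "ennreal \<bar>integral\<^sup>L M f\<bar> \<le> (\<integral>\<^sup>+x. ennreal \<bar>f x\<bar> \<partial>M)"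
  using integral_norm_bound_ennreal[of M f] not_integrable_integral_eq[of M f] by (cases "integrable M f") auto

context
  fixes \<Omega> :: "(real ^ 'n) set" and F :: "real ^ 'n \<Rightarrow> real" and g :: "real ^ 'n \<Rightarrow> real ^ 'n"
    and l a b :: "real ^ 'n" and m t :: real
  assumes \<Omega>: "open \<Omega>" and F: "continuous_on \<Omega> F" and g: "g \<in> borel_measurable borel"
    and g0: "\<And>x. x \<notin> \<Omega> \<Longrightarrow> g x = 0" and wg: "weak_gradient \<Omega> F g" and m: "0 < m" and t: "0 < t" "t \<le> 1"
    and box: "\<And>s y. t \<le> s \<Longrightarrow> s \<le> 1 \<Longrightarrow> y \<in> cbox a b \<Longrightarrow> l + s *\<^sub>R (y - l) \<in> \<Omega>"
begin

text \<open>
  Up to the power of \<open>s\<close>, this is the divergence of the vector field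
  \<open>z \<mapsto> pulled_bump l m a b s z * (z - l)\<close>. The normalised bumps
  \<open>pulled_bump l m a b s z / s ^ n\<close> are transported by the homotheties, so minus this
  function is their derivative in \<open>s\<close>. This identity lets the derivative in \<open>s\<close> be moved
  onto \<open>F\<close>.
\<close>

definition bump_flux :: "real \<Rightarrow> real ^ 'n \<Rightarrow> real" where
  "bump_flux s z = (\<Sum>i\<in>UNIV. pulled_bump l m a b s z + (z $ i - l $ i) / s * partial i (box_bump m a b) (blow_up l s z)) / s ^ Suc CARD('n)"

lemma box_bump_differentiable: "box_bump m a b differentiable (at x)"
  using C_k_box_bump[of "Suc 0" m a b] by simp

lemma box_bump_partial_continuous: "continuous_on UNIV (partial i (box_bump m a b))"
  using C_k_box_bump[of "Suc 0" m a b] by simp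

lemma box_bump_continuous: "continuous_on UNIV (box_bump m a b)"
  using C_k_box_bump[of 0 m a b] by simp

lemma blow_up_inverse: "s \<noteq> 0 \<Longrightarrow> l + s *\<^sub>R (blow_up l s z - l) = z"
  by (simp add: blow_up_def)

lemma pulled_bump_test:
  assumes s: "t \<le> s" "s \<le> 1"
  shows "test_function \<Omega> (\<lambda>z. (z $ i - l $ i) * pulled_bump l m a b s z)"
proof -
  have s0: "0 < s" using s t by simp
  have "cbox (l + s *\<^sub>R (a - l)) (l + s *\<^sub>R (b - l)) \<subseteq> \<Omega>"
  proof
    fix z assume z: "z \<in> cbox (l + s *\<^sub>R (a - l)) (l + s *\<^sub>R (b - l))"
    have "blow_up l s z \<in> cbox a b"
      unfolding mem_box_cart
    proof
      fix i
      have "l $ i + s * (a $ i - l $ i) \<le> z $ i" "z $ i \<le> l $ i + s * (b $ i - l $ i)"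
        using z by (auto simp: mem_box_cart)
      then have "s * (a $ i - l $ i) \<le> z $ i - l $ i" "z $ i - l $ i \<le> s * (b $ i - l $ i)" by auto
      then have "a $ i - l $ i \<le> (z $ i - l $ i) / s" "(z $ i - l $ i) / s \<le> b $ i - l $ i"
        using s0 by (auto simp: pos_le_divide_eq pos_divide_le_eq mult.commute)
      then show "a $ i \<le> blow_up l s z $ i \<and> blow_up l s z $ i \<le> b $ i" by (simp add: blow_up_def)
    qed
    from box[OF s this] show "z \<in> \<Omega>" using blow_up_inverse[of s z] s0 by simp
  qed
  then show ?thesis unfolding pulled_bump_def blow_up_def using s0 m
    by (subst box_bump_homothety) (auto intro!: test_function_box_bump_mult C_k_component)
qed

lemma pulled_bump_partial:
  "partial i (\<lambda>z. (z $ i - l $ i) * pulled_bump l m a b s z) z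
    = pulled_bump l m a b s z + (z $ i - l $ i) / s * partial i (box_bump m a b) (blow_up l s z)"
  unfolding pulled_bump_def blow_up_def by (rule partial_homothety[OF box_bump_differentiable])

lemma pulled_bump_has_derivative:
  assumes s: "0 < s"
  shows "((\<lambda>s. pulled_bump l m a b s z / s ^ CARD('n)) has_real_derivative - bump_flux s z) (at s)"
proof -
  let ?P = "\<chi> i. partial i (box_bump m a b) (blow_up l s z)"
  let ?n = "CARD('n)"
  have "((\<lambda>s. blow_up l s z) has_derivative (\<lambda>h. (- h / s\<^sup>2) *\<^sub>R (z - l))) (at s)"
    unfolding blow_up_def using s by (auto intro!: derivative_eq_intros simp: power2_eq_square)
  from has_derivative_compose[OF this has_derivative_partials[OF box_bump_differentiable]]
  have "((\<lambda>s. pulled_bump l m a b s z) has_derivative (\<lambda>h. ?P \<bullet> ((- h / s\<^sup>2) *\<^sub>R (z - l)))) (at s)"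
    unfolding pulled_bump_def .
  moreover have "(\<lambda>h. ?P \<bullet> ((- h / s\<^sup>2) *\<^sub>R (z - l))) = (*) (- (?P \<bullet> (z - l)) / s\<^sup>2)"
    by (rule ext) simp
  ultimately have 1: "((\<lambda>s. pulled_bump l m a b s z) has_real_derivative - (?P \<bullet> (z - l)) / s\<^sup>2) (at s)"
    unfolding has_field_derivative_def by metis
  have "((\<lambda>s. pulled_bump l m a b s z / s ^ ?n) has_real_derivative
     ((- (?P \<bullet> (z - l)) / s\<^sup>2) * s ^ ?n - pulled_bump l m a b s z * (real ?n * s ^ (?n - Suc 0))) / (s ^ ?n * s ^ ?n)) (at s)"
    using s by (auto intro!: derivative_eq_intros 1)
  also have "((- (?P \<bullet> (z - l)) / s\<^sup>2) * s ^ ?n - pulled_bump l m a b s z * (real ?n * s ^ (?n - Suc 0))) / (s ^ ?n * s ^ ?n)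
     = - bump_flux s z"
  proof -
    have n: "s ^ ?n = s * s ^ (?n - Suc 0)"
      by (metis One_nat_def Suc_pred power_Suc zero_less_card_finite)
    define q where "q = s ^ (?n - Suc 0)"
    have q: "0 < q" using s by (simp add: q_def)
    have nq: "s ^ ?n = s * q" using n by (simp add: q_def)
    have hd: "bump_flux s z = (real ?n * pulled_bump l m a b s z + (?P \<bullet> (z - l)) / s) / (s * (s * q))"
      unfolding nq[symmetric] by (simp add: bump_flux_def sum.distrib inner_vec_def sum_divide_distrib mult.commute)
    show ?thesis unfolding hd nq q_def[symmetric] using s q by (simp add: field_simps power2_eq_square)
  qed
  finally show ?thesis .
qed

lemma bump_flux_integral:
  "(\<integral>s. bump_flux s z * indicator {t..1} s \<partial>lborel) = pulled_bump l m a b t z / t ^ CARD('n) - pulled_bump l m a b 1 z"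
proof -
  have "continuous_on {0<..} (\<lambda>s. - bump_flux s z)"
    unfolding bump_flux_def pulled_bump_def blow_up_def
    by (intro continuous_intros continuous_on_compose2[OF box_bump_partial_continuous]
        continuous_on_compose2[OF box_bump_continuous]) auto
  then have c: "isCont (\<lambda>s. - bump_flux s z) s" if "0 < s" for s
    using that by (simp add: continuous_on_eq_continuous_at)
  have "(\<integral>s. - bump_flux s z * indicator {t..1} s \<partial>lborel) = pulled_bump l m a b 1 z / 1 ^ CARD('n) - pulled_bump l m a b t z / t ^ CARD('n)"
    by (rule integral_FTC_Icc_real[OF t(2) pulled_bump_has_derivative c]) (use t in auto)
  then show ?thesis by simp
qed

text \<open>
  Fubini's theorem requires integrability, which holds because the copies of the box with
  parameters in \<open>[t, 1]\<close> stay in this compact subset of \<open>\<Omega>\<close>, where everything is bounded.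
\<close>

definition swept_set :: "(real ^ 'n) set" where
  "swept_set = (\<lambda>p. l + fst p *\<^sub>R (snd p - l)) ` ({t..1} \<times> cbox a b)"

lemma swept_set: "compact swept_set" "swept_set \<subseteq> \<Omega>"
proof -
  show "compact swept_set" unfolding swept_set_def
    by (intro compact_continuous_image compact_Times compact_cbox continuous_intros) simp
  show "swept_set \<subseteq> \<Omega>" unfolding swept_set_def using box by auto
qed

lemma blow_up_in_swept_set: "t \<le> s \<Longrightarrow> s \<le> 1 \<Longrightarrow> blow_up l s z \<in> cbox a b \<Longrightarrow> z \<in> swept_set"
  unfolding swept_set_def using blow_up_inverse[of s z] t by (intro image_eqI[of _ _ "(s, blow_up l s z)"]) auto

lemma box_bump_zero_outside: "x \<notin> cbox a b \<Longrightarrow> box_bump m a b x = 0"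
  using box_bump_eq_0[OF m] box_subset_cbox by blast

lemma box_bump_partial_zero_outside:
  assumes "x \<notin> cbox a b"
  shows "partial i (box_bump m a b) x = 0"
proof (rule test_function_partial_support)
  have "closure {x. box_bump m a b x \<noteq> 0} \<subseteq> cbox a b"
    using box_bump_zero_outside by (intro closure_minimal) auto
  then show "x \<notin> closure {x. box_bump m a b x \<noteq> 0}" using assms by auto
qed

lemma bump_flux_zero: "blow_up l s z \<notin> cbox a b \<Longrightarrow> bump_flux s z = 0"
  by (simp add: bump_flux_def pulled_bump_def box_bump_zero_outside box_bump_partial_zero_outside)

lemma restr_measurable [measurable]: "restr \<Omega> F \<in> borel_measurable borel"
  using borel_measurable_continuous_on_indicator[OF _ F] \<Omega> by (simp add: restr_def[abs_def])

lemma box_bump_measurable [measurable]: "box_bump m a b \<in> borel_measurable borel"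
  by (rule borel_measurable_continuous_onI[OF box_bump_continuous])

lemma box_bump_partial_measurable [measurable]: "partial i (box_bump m a b) \<in> borel_measurable borel"
  by (rule borel_measurable_continuous_onI[OF box_bump_partial_continuous])

lemma bump_flux_integrable:
  "integrable (lborel \<Otimes>\<^sub>M lborel) (\<lambda>(s, z). indicator {t..1} s * (restr \<Omega> F z * bump_flux s z))"
proof -
  have "continuous_on ({t..1} \<times> swept_set) (\<lambda>p. F (snd p) * bump_flux (fst p) (snd p))"
    unfolding bump_flux_def pulled_bump_def blow_up_def using t swept_set(2)
    by (intro continuous_intros continuous_on_compose2[OF box_bump_partial_continuous]
        continuous_on_compose2[OF box_bump_continuous] continuous_on_compose2[OF F]) auto
  then have "bounded ((\<lambda>p. F (snd p) * bump_flux (fst p) (snd p)) ` ({t..1} \<times> swept_set))"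
    by (intro compact_imp_bounded compact_continuous_image compact_Times swept_set(1)) simp_all
  then obtain B where "\<forall>v\<in>(\<lambda>p. F (snd p) * bump_flux (fst p) (snd p)) ` ({t..1} \<times> swept_set). norm v \<le> B"
    unfolding bounded_iff by blast
  then have B: "\<bar>F z * bump_flux s z\<bar> \<le> B" if "t \<le> s" "s \<le> 1" "z \<in> swept_set" for s z using that by force
  have hs: "swept_set \<in> sets borel" using swept_set(1) by (simp add: borel_compact)
  have fin: "emeasure lborel swept_set < \<infinity>" by (rule emeasure_compact_finite[OF swept_set(1)])
  show ?thesis
  proof (rule Bochner_Integration.integrable_bound)
    have "emeasure (lborel \<Otimes>\<^sub>M lborel) ({t..1} \<times> swept_set) = emeasure lborel {t..1} * emeasure lborel swept_set"
      using hs by (intro lborel.emeasure_pair_measure_Times) auto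
    also have "\<dots> < \<infinity>" using fin t by (simp add: ennreal_mult_less_top)
    finally show "integrable (lborel \<Otimes>\<^sub>M lborel) (\<lambda>p. indicator ({t..1} \<times> swept_set) p *\<^sub>R B)"
      using hs by (intro integrable_scaleR_left integrable_real_indicator) (auto intro!: pair_measureI)
    show "(\<lambda>(s, z). indicator {t..1} s * (restr \<Omega> F z * bump_flux s z)) \<in> borel_measurable (lborel \<Otimes>\<^sub>M lborel)"
      unfolding bump_flux_def pulled_bump_def blow_up_def by measurable
    show "AE p in lborel \<Otimes>\<^sub>M lborel. norm (case p of (s, z) \<Rightarrow> indicator {t..1} s * (restr \<Omega> F z * bump_flux s z))
        \<le> norm (indicator ({t..1} \<times> swept_set) p *\<^sub>R B)"
    proof (rule AE_I2, clarify)
      fix s z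
      show "norm (indicator {t..1} s * (restr \<Omega> F z * bump_flux s z)) \<le> norm (indicator ({t..1} \<times> swept_set) (s, z) *\<^sub>R B)"
      proof (cases "s \<in> {t..1} \<and> z \<in> swept_set")
        case True
        then have "z \<in> \<Omega>" using swept_set(2) by auto
        then show ?thesis using True B[of s z] by (simp add: restr_def)
      next
        case False
        then have "s \<notin> {t..1} \<or> bump_flux s z = 0" using bump_flux_zero blow_up_in_swept_set by auto
        then show ?thesis by auto
      qed
    qed
  qed
qed

lemma test_integral_lborel:
  assumes \<phi>: "test_function \<Omega> \<phi>"
  shows "integrable lborel (\<lambda>z. restr \<Omega> F z * partial i \<phi> z)"
    "(\<integral>z. restr \<Omega> F z * partial i \<phi> z \<partial>lborel) = - (\<integral>z. g z $ i * \<phi> z \<partial>lborel)"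
proof -
  have c: "C_k 0 (partial i \<phi>)" "C_k 0 \<phi>"
    using test_function_partial[OF \<phi>] \<phi> unfolding test_function_def by blast+
  have [measurable]: "partial i \<phi> \<in> borel_measurable borel" "\<phi> \<in> borel_measurable borel"
    using c by (auto intro: borel_measurable_test simp del: C_k.simps)
  note [measurable] = g
  have "set_integrable lebesgue \<Omega> (\<lambda>x. F x * partial i \<phi> x)"
    by (rule locally_integrable_mult[OF locally_integrable_continuous[OF F] \<Omega> test_function_partial[OF \<phi>]])
  then have "integrable lebesgue (\<lambda>z. restr \<Omega> F z * partial i \<phi> z)"
    by (simp add: set_integrable_def restr_def mult.assoc)
  then show "integrable lborel (\<lambda>z. restr \<Omega> F z * partial i \<phi> z)"
    by (subst (asm) integrable_completion) measurable
  have "(\<integral>z. restr \<Omega> F z * partial i \<phi> z \<partial>lborel) = (\<integral>z. restr \<Omega> F z * partial i \<phi> z \<partial>lebesgue)"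
    by (rule integral_completion[symmetric]) measurable
  also have "\<dots> = (LINT x:\<Omega>|lebesgue. F x * partial i \<phi> x)"
    by (simp add: set_lebesgue_integral_def restr_def mult.assoc)
  also have "\<dots> = - (LINT x:\<Omega>|lebesgue. g x $ i * \<phi> x)" using wg \<phi> by (simp add: weak_gradient_def)
  also have "(LINT x:\<Omega>|lebesgue. g x $ i * \<phi> x) = (\<integral>z. g z $ i * \<phi> z \<partial>lebesgue)"
    unfolding set_lebesgue_integral_def
    by (rule Bochner_Integration.integral_cong) (use g0 in \<open>auto simp: indicator_def\<close>)
  also have "\<dots> = (\<integral>z. g z $ i * \<phi> z \<partial>lborel)"
    by (rule integral_completion) measurable
  finally show "(\<integral>z. restr \<Omega> F z * partial i \<phi> z \<partial>lborel) = - (\<integral>z. g z $ i * \<phi> z \<partial>lborel)" .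
qed

lemma pulled_bump_integrable:
  assumes "t \<le> s" "s \<le> 1"
  shows "integrable lborel (\<lambda>z. restr \<Omega> F z * pulled_bump l m a b s z)"
proof -
  have [measurable]: "pulled_bump l m a b s \<in> borel_measurable borel" unfolding pulled_bump_def[abs_def] blow_up_def by measurable
  have "bounded (F ` swept_set)"
    by (intro compact_imp_bounded compact_continuous_image swept_set(1) continuous_on_subset[OF F swept_set(2)])
  then obtain B where "\<forall>v\<in>F ` swept_set. norm v \<le> B" unfolding bounded_iff by blast
  then have B: "\<bar>F z\<bar> \<le> B" if "z \<in> swept_set" for z using that by simp
  show ?thesis
  proof (rule Bochner_Integration.integrable_bound)
    show "integrable lborel (\<lambda>z. indicator swept_set z *\<^sub>R B)"
      using emeasure_compact_finite[OF swept_set(1)] swept_set(1)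
      by (intro integrable_scaleR_left integrable_real_indicator) (auto simp: borel_compact)
    show "AE z in lborel. norm (restr \<Omega> F z * pulled_bump l m a b s z) \<le> norm (indicator swept_set z *\<^sub>R B)"
    proof (rule AE_I2)
      fix z
      show "norm (restr \<Omega> F z * pulled_bump l m a b s z) \<le> norm (indicator swept_set z *\<^sub>R B)"
      proof (cases "z \<in> swept_set")
        case True
        have "\<bar>restr \<Omega> F z\<bar> * \<bar>pulled_bump l m a b s z\<bar> \<le> B * 1"
          using B[OF True] True swept_set(2) box_bump_nonneg[of m a b "blow_up l s z"] box_bump_le_1[of m a b "blow_up l s z"]
          by (intro mult_mono) (auto simp: restr_def pulled_bump_def)
        then show ?thesis using True by (simp add: abs_mult)
      next
        case False
        then have "pulled_bump l m a b s z = 0" using blow_up_in_swept_set[OF assms] box_bump_zero_outside by (auto simp: pulled_bump_def)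
        then show ?thesis by simp
      qed
    qed
  qed measurable
qed

text \<open>
  The fundamental theorem of calculus in \<open>s\<close> and Fubini's theorem write the difference of
  the averages as an integral of \<open>F\<close> against a divergence; the definition of the weak
  gradient moves the derivative to \<open>F\<close>. The factor \<open>R\<close> comes from \<open>|z - l| \<le> s R\<close> on the
  copy with parameter \<open>s\<close>.
\<close>

lemma average_difference:
  assumes R: "\<And>y. y \<in> cbox a b \<Longrightarrow> infnorm (y - l) \<le> R"
  shows "ennreal \<bar>(\<integral>z. restr \<Omega> F z * pulled_bump l m a b 1 z \<partial>lborel) - (\<integral>z. restr \<Omega> F z * pulled_bump l m a b t z \<partial>lborel) / t ^ CARD('n)\<bar>
    \<le> (\<integral>\<^sup>+s. \<integral>\<^sup>+z. ennreal (real CARD('n) * R * (indicator {t..1} s * indicator (cbox a b) (blow_up l s z)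
          * infnorm (g z) / s ^ CARD('n))) \<partial>lborel \<partial>lborel)"
proof -
  let ?n = "CARD('n)"
  let ?f = "\<lambda>s z. indicator {t..1} s * (restr \<Omega> F z * bump_flux s z)"
  note [measurable] = g
  have gi[measurable]: "(\<lambda>z. g z $ i) \<in> borel_measurable borel" for i
    by (rule measurable_compose[OF g vec_nth_borel])
  have "(\<integral>z. restr \<Omega> F z * pulled_bump l m a b t z \<partial>lborel) / t ^ ?n - (\<integral>z. restr \<Omega> F z * pulled_bump l m a b 1 z \<partial>lborel)
      = (\<integral>z. restr \<Omega> F z * pulled_bump l m a b t z / t ^ ?n - restr \<Omega> F z * pulled_bump l m a b 1 z \<partial>lborel)"
    using pulled_bump_integrable t by simp
  also have "\<dots> = (\<integral>z. (\<integral>s. ?f s z \<partial>lborel) \<partial>lborel)"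
  proof (rule Bochner_Integration.integral_cong[OF refl])
    fix z
    have "(\<integral>s. ?f s z \<partial>lborel) = restr \<Omega> F z * (\<integral>s. bump_flux s z * indicator {t..1} s \<partial>lborel)"
      by (subst integral_mult_right_zero[symmetric]) (simp add: mult_ac)
    then show "restr \<Omega> F z * pulled_bump l m a b t z / t ^ ?n - restr \<Omega> F z * pulled_bump l m a b 1 z = (\<integral>s. ?f s z \<partial>lborel)"
      unfolding bump_flux_integral by (simp add: right_diff_distrib)
  qed
  also have "\<dots> = (\<integral>s. (\<integral>z. ?f s z \<partial>lborel) \<partial>lborel)"
    by (rule lborel_pair.Fubini_integral[OF bump_flux_integrable])
  finally have eq: "(\<integral>z. restr \<Omega> F z * pulled_bump l m a b t z \<partial>lborel) / t ^ ?n - (\<integral>z. restr \<Omega> F z * pulled_bump l m a b 1 z \<partial>lborel)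
      = (\<integral>s. (\<integral>z. ?f s z \<partial>lborel) \<partial>lborel)" .
  have inner: "ennreal \<bar>\<integral>z. ?f s z \<partial>lborel\<bar> \<le> (\<integral>\<^sup>+z. ennreal (real ?n * R * (indicator {t..1} s * indicator (cbox a b) (blow_up l s z)
          * infnorm (g z) / s ^ ?n)) \<partial>lborel)" for s
  proof (cases "s \<in> {t..1}")
    case True
    then have s: "t \<le> s" "s \<le> 1" "0 < s" using t by auto
    let ?\<phi> = "\<lambda>i z. (z $ i - l $ i) * pulled_bump l m a b s z"
    have [measurable]: "pulled_bump l m a b s \<in> borel_measurable borel" unfolding pulled_bump_def[abs_def] blow_up_def by measurable
    have "?f s z = (\<Sum>i\<in>UNIV. restr \<Omega> F z * partial i (?\<phi> i) z) / s ^ Suc ?n" for z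
      using True by (simp add: bump_flux_def pulled_bump_partial sum_distrib_left)
    then have "(\<integral>z. ?f s z \<partial>lborel) = (\<integral>z. (\<Sum>i\<in>UNIV. restr \<Omega> F z * partial i (?\<phi> i) z) / s ^ Suc ?n \<partial>lborel)" by simp
    also have "\<dots> = (\<Sum>i\<in>UNIV. - (\<integral>z. g z $ i * ?\<phi> i z \<partial>lborel)) / s ^ Suc ?n"
      using test_integral_lborel[OF pulled_bump_test[OF s(1,2)]]
      by (subst integral_divide_zero, subst Bochner_Integration.integral_sum) (auto simp del: power_Suc)
    finally have "\<bar>\<integral>z. ?f s z \<partial>lborel\<bar> = \<bar>\<Sum>i\<in>UNIV. - (\<integral>z. g z $ i * ?\<phi> i z \<partial>lborel)\<bar> / s ^ Suc ?n"
      using s by (simp add: abs_divide del: power_Suc)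
    also have "\<dots> \<le> (\<Sum>i\<in>UNIV. \<bar>\<integral>z. g z $ i * ?\<phi> i z \<partial>lborel\<bar>) / s ^ Suc ?n"
      using s by (intro divide_right_mono order_trans[OF sum_abs]) auto
    finally have "ennreal \<bar>\<integral>z. ?f s z \<partial>lborel\<bar> \<le> ennreal ((\<Sum>i\<in>UNIV. \<bar>\<integral>z. g z $ i * ?\<phi> i z \<partial>lborel\<bar>) / s ^ Suc ?n)"
      by (rule ennreal_leI)
    also have "\<dots> = (\<Sum>i\<in>UNIV. ennreal \<bar>\<integral>z. g z $ i * ?\<phi> i z \<partial>lborel\<bar>) * ennreal (1 / s ^ Suc ?n)"
      using s by (subst sum_ennreal) (auto simp: ennreal_mult[symmetric] sum_nonneg simp del: power_Suc)
    also have "\<dots> \<le> (\<Sum>i\<in>(UNIV :: 'n set). \<integral>\<^sup>+z. ennreal (R * s * (indicator (cbox a b) (blow_up l s z) * infnorm (g z))) \<partial>lborel) * ennreal (1 / s ^ Suc ?n)"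
    proof (intro mult_right_mono sum_mono)
      fix i :: 'n
      have "ennreal \<bar>\<integral>z. g z $ i * ?\<phi> i z \<partial>lborel\<bar> \<le> (\<integral>\<^sup>+z. ennreal \<bar>g z $ i * ?\<phi> i z\<bar> \<partial>lborel)"
        by (rule norm_integral_le_nn)
      also have "\<dots> \<le> (\<integral>\<^sup>+z. ennreal (R * s * (indicator (cbox a b) (blow_up l s z) * infnorm (g z))) \<partial>lborel)"
      proof (intro nn_integral_mono ennreal_leI)
        fix z
        show "\<bar>g z $ i * ?\<phi> i z\<bar> \<le> R * s * (indicator (cbox a b) (blow_up l s z) * infnorm (g z))"
        proof (cases "blow_up l s z \<in> cbox a b")
          case True
          have "z $ i - l $ i = s * (blow_up l s z - l) $ i" using s by (simp add: blow_up_def)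
          then have "\<bar>z $ i - l $ i\<bar> = s * \<bar>(blow_up l s z - l) $ i\<bar>" using s by (simp add: abs_mult)
          also have "\<dots> \<le> s * R"
            using component_le_infnorm_cart[of "blow_up l s z - l" i] R[OF True] s by (intro mult_left_mono) auto
          finally have "\<bar>z $ i - l $ i\<bar> * \<bar>pulled_bump l m a b s z\<bar> \<le> (s * R) * 1"
            using box_bump_nonneg[of m a b "blow_up l s z"] box_bump_le_1[of m a b "blow_up l s z"]
            by (intro mult_mono) (auto simp: pulled_bump_def intro: order_trans[OF abs_ge_zero])
          then have "\<bar>g z $ i\<bar> * (\<bar>z $ i - l $ i\<bar> * \<bar>pulled_bump l m a b s z\<bar>) \<le> infnorm (g z) * (s * R)"
            using component_le_infnorm_cart[of "g z" i]
              mult_mono[of "\<bar>g z $ i\<bar>" "infnorm (g z)" "\<bar>z $ i - l $ i\<bar> * \<bar>pulled_bump l m a b s z\<bar>" "s * R"] by simp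
          then show ?thesis using True by (simp add: abs_mult mult_ac)
        next
          case False
          then show ?thesis by (simp add: pulled_bump_def box_bump_zero_outside)
        qed
      qed
      finally show "ennreal \<bar>\<integral>z. g z $ i * ?\<phi> i z \<partial>lborel\<bar>
         \<le> (\<integral>\<^sup>+z. ennreal (R * s * (indicator (cbox a b) (blow_up l s z) * infnorm (g z))) \<partial>lborel)" .
    qed simp
    also have "\<dots> = ennreal (real ?n / s ^ Suc ?n) * (\<integral>\<^sup>+z. ennreal (R * s * (indicator (cbox a b) (blow_up l s z) * infnorm (g z))) \<partial>lborel)"
      using s by (simp add: ennreal_of_nat_eq_real_of_nat mult_ac ennreal_mult[symmetric] del: power_Suc)
         (simp add: ennreal_mult[symmetric] mult.assoc[symmetric] del: power_Suc)
    also have "\<dots> = (\<integral>\<^sup>+z. ennreal (real ?n / s ^ Suc ?n) * ennreal (R * s * (indicator (cbox a b) (blow_up l s z) * infnorm (g z))) \<partial>lborel)"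
      by (rule nn_integral_cmult[symmetric]) (simp add: blow_up_def, measurable)
    also have "\<dots> = (\<integral>\<^sup>+z. ennreal (real ?n * R * (indicator {t..1} s * indicator (cbox a b) (blow_up l s z) * infnorm (g z) / s ^ ?n)) \<partial>lborel)"
      using s True by (intro nn_integral_cong) (simp add: ennreal_mult'[symmetric] field_simps)
    finally show ?thesis .
  qed simp
  have "ennreal \<bar>(\<integral>z. restr \<Omega> F z * pulled_bump l m a b 1 z \<partial>lborel) - (\<integral>z. restr \<Omega> F z * pulled_bump l m a b t z \<partial>lborel) / t ^ ?n\<bar>
     = ennreal \<bar>\<integral>s. (\<integral>z. ?f s z \<partial>lborel) \<partial>lborel\<bar>"
    unfolding eq[symmetric] by (simp add: abs_minus_commute)
  also have "\<dots> \<le> (\<integral>\<^sup>+s. ennreal \<bar>\<integral>z. ?f s z \<partial>lborel\<bar> \<partial>lborel)" by (rule norm_integral_le_nn)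
  also have "\<dots> \<le> (\<integral>\<^sup>+s. \<integral>\<^sup>+z. ennreal (real ?n * R * (indicator {t..1} s * indicator (cbox a b) (blow_up l s z)
          * infnorm (g z) / s ^ ?n)) \<partial>lborel \<partial>lborel)"
    by (rule nn_integral_mono) (rule inner)
  finally show ?thesis .
qed

end

section \<open>Jensen's inequality with a weight\<close>

text \<open>
  Young's inequality bounds \<open>x * v powr (p - 1)\<close> by \<open>x powr p / p + v powr p / q\<close>.
  Integrated against \<open>k\<close>, it is optimal for the mean value \<open>v = X / B\<close>; the case \<open>v = 1\<close>
  shows that the integral \<open>X\<close> is finite.
\<close>

lemma nn_integral_Jensen:
  fixes f k :: "'a \<Rightarrow> real"
  assumes [measurable]: "f \<in> borel_measurable M" "k \<in> borel_measurable M"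
    and f: "\<And>x. 0 \<le> f x" and k: "\<And>x. 0 \<le> k x" and p: "1 < p" and B: "0 < B" and A: "0 \<le> A"
    and kB: "(\<integral>\<^sup>+x. ennreal (k x) \<partial>M) \<le> ennreal B"
    and fA: "(\<integral>\<^sup>+x. ennreal (f x powr p * k x) \<partial>M) \<le> ennreal A"
  shows "\<exists>X\<ge>0. (\<integral>\<^sup>+x. ennreal (f x * k x) \<partial>M) = ennreal X \<and> X powr p \<le> A * B powr (p - 1)"
proof -
  define q where "q = p / (p - 1)"
  have q: "1 < q" "1 / p + 1 / q = 1" "(p - 1) * q = p" using p by (auto simp: q_def field_simps)
  have pt: "x * v powr (p - 1) \<le> x powr p / p + v powr p / q" if "0 \<le> x" "0 \<le> v" for x v :: real
    using Youngs_inequality[OF p q(1,2) that(1), of "v powr (p - 1)"] q(3) by (simp add: powr_powr)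
  have main: "(\<integral>\<^sup>+x. ennreal (f x * k x) \<partial>M) * ennreal (v powr (p - 1)) \<le> ennreal (A / p + v powr p / q * B)"
    if v: "0 < v" for v
  proof -
    have "(\<integral>\<^sup>+x. ennreal (f x * k x) \<partial>M) * ennreal (v powr (p - 1))
        = (\<integral>\<^sup>+x. ennreal (f x * v powr (p - 1) * k x) \<partial>M)"
      using f k by (subst nn_integral_multc[symmetric]) (auto simp: ennreal_mult'[symmetric] mult_ac intro!: nn_integral_cong)
    also have "\<dots> \<le> (\<integral>\<^sup>+x. ennreal (1 / p) * ennreal (f x powr p * k x) + ennreal (v powr p / q) * ennreal (k x) \<partial>M)"
    proof (rule nn_integral_mono)
      fix x
      have "f x * v powr (p - 1) * k x \<le> (f x powr p / p + v powr p / q) * k x"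
        using pt[OF f, of v x] v k by (intro mult_right_mono) auto
      also have "\<dots> = 1 / p * (f x powr p * k x) + v powr p / q * k x" by (simp add: algebra_simps)
      finally have "ennreal (f x * v powr (p - 1) * k x) \<le> ennreal (1 / p * (f x powr p * k x) + v powr p / q * k x)"
        by (rule ennreal_leI)
      also have "\<dots> = ennreal (1 / p) * ennreal (f x powr p * k x) + ennreal (v powr p / q) * ennreal (k x)"
        using p q k[of x] by (simp add: ennreal_mult''[symmetric] ennreal_plus[symmetric] del: ennreal_plus)
      finally show "ennreal (f x * v powr (p - 1) * k x)
          \<le> ennreal (1 / p) * ennreal (f x powr p * k x) + ennreal (v powr p / q) * ennreal (k x)" .
    qed
    also have "\<dots> = ennreal (1 / p) * (\<integral>\<^sup>+x. ennreal (f x powr p * k x) \<partial>M) + ennreal (v powr p / q) * (\<integral>\<^sup>+x. ennreal (k x) \<partial>M)"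
      by (subst nn_integral_add) (auto simp: nn_integral_cmult)
    also have "\<dots> \<le> ennreal (1 / p) * ennreal A + ennreal (v powr p / q) * ennreal B"
      by (intro add_mono mult_left_mono kB fA) auto
    also have "\<dots> = ennreal (A / p + v powr p / q * B)"
      using p q A B by (simp add: ennreal_mult''[symmetric] ennreal_plus[symmetric] del: ennreal_plus)
    finally show ?thesis .
  qed
  have "(\<integral>\<^sup>+x. ennreal (f x * k x) \<partial>M) \<le> ennreal (A / p + 1 / q * B)" using main[of 1] by simp
  also have "\<dots> < \<infinity>" by simp
  finally have "(\<integral>\<^sup>+x. ennreal (f x * k x) \<partial>M) < \<infinity>" .
  then obtain X where X: "0 \<le> X" "(\<integral>\<^sup>+x. ennreal (f x * k x) \<partial>M) = ennreal X"
    by (cases "\<integral>\<^sup>+x. ennreal (f x * k x) \<partial>M") auto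
  have "X powr p \<le> A * B powr (p - 1)"
  proof (cases "X = 0")
    case False
    then have X0: "0 < X" using X by simp
    define v where "v = X / B"
    have v: "0 < v" using X0 B by (simp add: v_def)
    have "ennreal (X * v powr (p - 1)) \<le> ennreal (A / p + v powr p / q * B)"
      using main[OF v] X by (simp add: ennreal_mult'[symmetric])
    then have "X * v powr (p - 1) \<le> A / p + v powr p / q * B"
      using A B p q by (subst (asm) ennreal_le_iff) auto
    moreover have "v powr p * B = X * v powr (p - 1)"
    proof -
      have "v powr p = v powr (p - 1) * v" using powr_add[of v "p - 1" 1] v by simp
      then show ?thesis using B by (simp add: v_def)
    qed
    ultimately have "X * v powr (p - 1) \<le> A / p + X * v powr (p - 1) / q" by (simp add: field_simps)
    then have "X * v powr (p - 1) * (1 - 1 / q) \<le> A / p" by (simp add: algebra_simps)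
    moreover have "1 - 1 / q = 1 / p" using q by simp
    ultimately have le: "X * v powr (p - 1) \<le> A" using p by (simp add: field_simps)
    have "X powr p = X powr (p - 1) * X" using powr_add[of X "p - 1" 1] X0 by simp
    also have "\<dots> = X * v powr (p - 1) * B powr (p - 1)"
      using X0 B by (simp add: v_def powr_divide)
    also have "\<dots> \<le> A * B powr (p - 1)" using le by (intro mult_right_mono) auto
    finally show ?thesis .
  qed (use A in simp)
  then show ?thesis using X by blast
qed

section \<open>Counting disjoint cubes by scale\<close>

text \<open>
  Group the cubes by the dyadic size of \<open>r i / d\<close>. Those of size about \<open>2 ^ m\<close> fit into a
  cube around \<open>z\<close> of radius comparable to theirs, so their number is bounded independently
  of \<open>m\<close>, and each contributes at most \<open>2 powr (- m e)\<close>.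
\<close>

lemma sum_disjoint_cubes_scale:
  fixes c :: "'i \<Rightarrow> real ^ 'n"
  assumes fin: "finite I" and dj: "disjoint_family_on (\<lambda>i. cube (c i) (r i)) I"
    and r: "\<And>i. i \<in> I \<Longrightarrow> d \<le> r i" and near: "\<And>i. i \<in> I \<Longrightarrow> infnorm (z - c i) \<le> K * r i"
    and d: "0 < d" and K: "0 \<le> K" and e: "0 < e"
  shows "(\<Sum>i\<in>I. (d / r i) powr e) \<le> (2 * (K + 1)) ^ CARD('n) / (1 - 2 powr - e)"
proof -
  define lev where "lev i = nat \<lfloor>log 2 (r i / d)\<rfloor>" for i
  define M where "M = (2 * (K + 1)) ^ CARD('n)"
  define x where "x = 2 powr - e"
  have x: "0 < x" "x < 1" using e by (auto simp: x_def powr_less_one)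
  have lev: "2 ^ lev i * d \<le> r i" "r i < 2 ^ Suc (lev i) * d" if "i \<in> I" for i
  proof -
    have q: "1 \<le> r i / d" using r[OF that] d by simp
    then have l0: "0 \<le> log 2 (r i / d)" by simp
    then have l: "real (lev i) \<le> log 2 (r i / d)" "log 2 (r i / d) < real (lev i) + 1"
      unfolding lev_def by linarith+
    have "2 powr real (lev i) \<le> r i / d" using l(1) q by (simp add: le_log_iff)
    then show "2 ^ lev i * d \<le> r i" using d by (simp add: powr_realpow field_simps)
    have "r i / d < 2 powr (real (lev i) + 1)" using l(2) q by (simp add: log_less_iff)
    also have "\<dots> = 2 ^ Suc (lev i)" by (simp add: powr_add powr_realpow)
    finally show "r i < 2 ^ Suc (lev i) * d" using d by (simp add: field_simps)
  qed
  have grp: "(\<Sum>i\<in>{i \<in> I. lev i = m}. (d / r i) powr e) \<le> M * x ^ m" for m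
  proof -
    let ?J = "{i \<in> I. lev i = m}"
    have "real (card ?J) \<le> ((K + 1) * (2 ^ Suc m * d) / (2 ^ m * d)) ^ CARD('n)"
    proof (rule card_disjoint_cubes[where c = c and r = r and z = z])
      show "disjoint_family_on (\<lambda>i. cube (c i) (r i)) ?J" using dj by (auto simp: disjoint_family_on_def)
      fix i assume i: "i \<in> ?J"
      show "cube (c i) (r i) \<subseteq> cube z ((K + 1) * (2 ^ Suc m * d))"
      proof
        fix y assume y: "y \<in> cube (c i) (r i)"
        have "infnorm (y - z) \<le> infnorm (y - c i) + infnorm (z - c i)"
          using infnorm_triangle3[of y z "c i"] infnorm_sub[of z] by simp
        also have "\<dots> \<le> (K + 1) * r i" using y near[of i] i by (simp add: mem_cube algebra_simps)
        also have "\<dots> \<le> (K + 1) * (2 ^ Suc m * d)"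
          using lev[of i] i K by (intro mult_left_mono) auto
        finally show "y \<in> cube z ((K + 1) * (2 ^ Suc m * d))" by (simp add: mem_cube)
      qed
      show "2 ^ m * d \<le> r i" using lev[of i] i by simp
    qed (use fin d K in auto)
    also have "(K + 1) * (2 ^ Suc m * d) / (2 ^ m * d) = 2 * (K + 1)" using d by simp
    finally have card: "real (card ?J) \<le> M" by (simp add: M_def)
    have "(\<Sum>i\<in>?J. (d / r i) powr e) \<le> (\<Sum>i\<in>?J. x ^ m)"
    proof (rule sum_mono)
      fix i assume i: "i \<in> ?J"
      then have ri: "2 ^ m * d \<le> r i" using lev[of i] by simp
      then have "0 < r i" using d by (smt (verit) mult_pos_pos zero_less_power)
      then have "d / r i \<le> 1 / 2 ^ m" using ri by (simp add: field_simps)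
      then have "(d / r i) powr e \<le> (1 / 2 ^ m) powr e"
        using d \<open>0 < r i\<close> e by (intro powr_mono2) auto
      also have "(1 / 2 ^ m :: real) = 2 powr (- real m)" by (simp add: powr_minus powr_realpow inverse_eq_divide)
      also have "(2 powr (- real m)) powr e = x ^ m"
        unfolding x_def by (simp add: powr_powr powr_power mult.commute)
      finally show "(d / r i) powr e \<le> x ^ m" .
    qed
    also have "\<dots> = real (card ?J) * x ^ m" by simp
    also have "\<dots> \<le> M * x ^ m" using card x by (intro mult_right_mono) auto
    finally show ?thesis .
  qed
  have M0: "0 \<le> M" using K by (simp add: M_def)
  have "(\<Sum>i\<in>I. (d / r i) powr e) = (\<Sum>m\<in>lev ` I. \<Sum>i\<in>{i \<in> I. lev i = m}. (d / r i) powr e)"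
    using fin by (simp add: sum.group[symmetric, OF fin finite_imageI[OF fin], of lev] )
  also have "\<dots> \<le> (\<Sum>m\<in>lev ` I. M * x ^ m)" by (intro sum_mono grp)
  also have "\<dots> = M * (\<Sum>m\<in>lev ` I. x ^ m)" by (simp add: sum_distrib_left)
  also have "(\<Sum>m\<in>lev ` I. x ^ m) \<le> (\<Sum>m. x ^ m)"
    using x fin by (intro sum_le_suminf summable_geometric) auto
  also have "(\<Sum>m. x ^ m) = 1 / (1 - x)" using x by (intro suminf_geometric) auto
  finally show ?thesis using M0 by (simp add: M_def x_def mult_left_mono)
qed

section \<open>Traces satisfy the variational bound\<close>

text \<open>
  A lower bound of cube bumps on the concentric cube of half the radius, where the arguments
  of all step functions are at least \<open>1 / 2\<close>.
\<close>

definition bump_min :: "nat \<Rightarrow> real" where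
  "bump_min n = (step (1 / 2) * step (1 / 2)) ^ n"

lemma bump_min_pos: "0 < bump_min n"
  by (simp add: bump_min_def step_pos_iff)

text \<open>
  The slope \<open>1 / r\<close> makes all these bumps rescaled copies of a single one.
\<close>

definition cube_bump :: "real ^ 'n \<Rightarrow> real \<Rightarrow> real ^ 'n \<Rightarrow> real" where
  "cube_bump c r = box_bump (1 / r) (c - (\<chi> i. r)) (c + (\<chi> i. r))"

lemma cube_bump_lower:
  assumes r: "0 < r" and z: "z \<in> cube c (r / 2)"
  shows "bump_min CARD('n) \<le> cube_bump c r (z :: real ^ 'n)"
proof -
  have "step (1 / 2) * step (1 / 2) \<le> step ((1 / r) * (z $ i - (c - (\<chi> i. r)) $ i)) * step (- (1 / r) * (z $ i - (c + (\<chi> i. r)) $ i))" for i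
  proof -
    have "\<bar>z $ i - c $ i\<bar> \<le> r / 2" using z by (simp add: mem_cube_iff)
    then have "- (r / 2) \<le> z $ i - c $ i" "z $ i - c $ i \<le> r / 2" by linarith+
    then have "1 / 2 \<le> (1 / r) * (z $ i - (c - (\<chi> i. r)) $ i)" "1 / 2 \<le> - (1 / r) * (z $ i - (c + (\<chi> i. r)) $ i)"
      using r by (auto simp: field_simps)
    then show ?thesis by (intro mult_mono step_mono) (auto simp: step_nonneg)
  qed
  then have "(\<Prod>i\<in>(UNIV :: 'n set). step (1 / 2) * step (1 / 2)) \<le> cube_bump c r z"
    unfolding cube_bump_def box_bump_def by (intro prod_mono) (auto simp: step_nonneg)
  then show ?thesis by (simp add: bump_min_def)
qed

lemma cube_bump_measurable [measurable]: "cube_bump c r \<in> borel_measurable borel"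
  unfolding cube_bump_def using C_k_box_bump[of 0] by (intro borel_measurable_continuous_onI) simp

lemma cube_bump_zero: "0 < r \<Longrightarrow> z \<notin> cube c r \<Longrightarrow> cube_bump c r z = 0"
  unfolding cube_bump_def cube_eq_cbox using box_bump_eq_0[of "1 / r"] box_subset_cbox by fastforce

lemma cube_bump_nonneg: "0 \<le> cube_bump c r z" and cube_bump_le_1: "cube_bump c r z \<le> 1"
  unfolding cube_bump_def by (rule box_bump_nonneg box_bump_le_1)+

lemma integrable_cube_bump:
  assumes r: "0 < r"
  shows "integrable lborel (cube_bump c (r :: real) :: real ^ 'n \<Rightarrow> real)"
proof (rule Bochner_Integration.integrable_bound)
  show "integrable lborel (\<lambda>z. indicator (cube c r) z :: real)"
    using r by (intro integrable_real_indicator) (auto simp: emeasure_cube)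
  show "AE z in lborel. norm (cube_bump c r z) \<le> norm (indicator (cube c r) z :: real)"
    using cube_bump_zero[OF r, of _ c] cube_bump_nonneg[of c r] cube_bump_le_1[of c r]
    by (intro AE_I2) (auto simp: indicator_def)
qed measurable

lemma integral_cube_bump_lower:
  assumes r: "0 < r"
  shows "bump_min CARD('n) * r ^ CARD('n) \<le> (\<integral>z. cube_bump c r (z :: real ^ 'n) \<partial>lborel)"
proof -
  have "bump_min CARD('n) * r ^ CARD('n) = (\<integral>z. bump_min CARD('n) * indicator (cube c (r / 2)) z \<partial>lborel)"
    using r by (simp add: measure_cube)
  also have "\<dots> \<le> (\<integral>z. cube_bump c r z \<partial>lborel)"
  proof (rule integral_mono)
    show "integrable lborel (\<lambda>z. bump_min CARD('n) * indicator (cube c (r / 2)) z)"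
      using r by (intro integrable_mult_right integrable_real_indicator) (auto simp: emeasure_cube)
    show "bump_min CARD('n) * indicator (cube c (r / 2)) z \<le> cube_bump c r z" for z
      using cube_bump_lower[OF r, of z c] cube_bump_nonneg[of c r z] by (auto simp: indicator_def)
  qed (rule integrable_cube_bump[OF r])
  finally show ?thesis .
qed

lemma blow_up_1 [simp]: "blow_up l 1 z = z" by (simp add: blow_up_def)

lemma blow_up_mem_cube:
  assumes s: "0 < s"
  shows "blow_up l s z \<in> cube c \<rho> \<longleftrightarrow> z \<in> cube (l + s *\<^sub>R (c - l)) (s * \<rho>)"
proof -
  have "z - (l + s *\<^sub>R (c - l)) = s *\<^sub>R (blow_up l s z - c)"
    using s by (simp add: blow_up_def algebra_simps)
  then show ?thesis using s by (simp add: mem_cube infnorm_mul)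
qed

context alpha_domain
begin

text \<open>
  Apply \<open>average_difference\<close> to \<open>F - f \<omega>\<close>, whose gradient is the same, with \<open>t\<close> running
  through the ratios of \<open>alpha_visible_sequences\<close>. The average at ratio \<open>t\<close> is bounded by
  the maximum of \<open>|F - f \<omega>|\<close> over the copy; the points where the maxima are attained
  represent \<open>\<omega>\<close>, so the averages tend to 0.
\<close>

lemma trace_average_estimate:
  assumes F: "continuous_on \<Omega> F" and g: "g \<in> borel_measurable borel" and g0: "\<And>x. x \<notin> \<Omega> \<Longrightarrow> g x = 0"
    and wg: "weak_gradient \<Omega> F g" and tr: "has_trace \<alpha> \<Omega> F f"
    and vis: "alpha_visible \<alpha> \<Omega> c r \<omega>" and r: "0 < r"
    and R: "\<And>y. y \<in> cube c (r / 2) \<Longrightarrow> infnorm (y - ell \<omega>) \<le> R"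
  shows "ennreal \<bar>(\<integral>z. restr \<Omega> F z * cube_bump c (r / 2) z \<partial>lborel) - f \<omega> * (\<integral>z. cube_bump c (r / 2) z \<partial>lborel)\<bar>
     \<le> (\<integral>\<^sup>+s. \<integral>\<^sup>+z. ennreal (real CARD('n) * R * (indicator {0<..1} s * indicator (cube c (r / 2)) (blow_up (ell \<omega>) s z)
          * infnorm (g z) / s ^ CARD('n))) \<partial>lborel \<partial>lborel)" (is "ennreal \<bar>?A\<bar> \<le> ?RHS")
proof -
  let ?l = "ell \<omega>" and ?n = "CARD('n)"
  define \<rho> where "\<rho> = r / 2"
  have \<rho>: "0 < \<rho>" using r by (simp add: \<rho>_def)
  define a where "a = c - (\<chi> i. \<rho>)"
  define b where "b = c + (\<chi> i. \<rho>)"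
  have ab: "cbox a b = cube c \<rho>" by (simp add: a_def b_def cube_eq_cbox)
  have cb: "cube_bump c \<rho> = box_bump (1 / \<rho>) a b" by (simp add: cube_bump_def a_def b_def)
  obtain t :: "nat \<Rightarrow> real" where ts: "\<forall>i. 0 < t i \<and> t i \<le> 1" "t \<longlonglongrightarrow> 0"
    and seq: "\<forall>w. (\<forall>i. w i \<in> cube c (r / 2)) \<longrightarrow> (\<lambda>i. ?l + t i *\<^sub>R (w i - ?l)) \<in> \<omega>"
    and in\<Omega>': "\<forall>s y. 0 < s \<longrightarrow> s \<le> 1 \<longrightarrow> y \<in> cube c r \<longrightarrow> ?l + s *\<^sub>R (y - ?l) \<in> \<Omega>"
    using alpha_visible_sequences[OF vis r] by (elim exE conjE)
  have t: "\<And>i. 0 < t i" "\<And>i. t i \<le> 1" "t \<longlonglongrightarrow> 0" using ts by auto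
  have in\<Omega>: "?l + s *\<^sub>R (y - ?l) \<in> \<Omega>" if "0 < s" "s \<le> 1" "y \<in> cube c r" for s y
    using in\<Omega>' that by blast
  have \<omega>: "\<omega> \<in> boundary" using vis by (simp add: alpha_visible_def)
  have sub: "cube c \<rho> \<subseteq> cube c r" using r by (intro cube_mono) (simp add: \<rho>_def)
  define F' where "F' x = F x - f \<omega>" for x
  have F': "continuous_on \<Omega> F'" unfolding F'_def using F by (intro continuous_intros)
  have wg': "weak_gradient \<Omega> F' g" unfolding F'_def[abs_def] by (rule weak_gradient_add_const[OF open_dom wg])
  have box: "?l + s *\<^sub>R (y - ?l) \<in> \<Omega>" if "t k \<le> s" "s \<le> 1" "y \<in> cbox a b" for k s y
    using that t(1)[of k] sub ab by (intro in\<Omega>) auto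
  have Ra: "infnorm (y - ?l) \<le> R" if "y \<in> cbox a b" for y using that R ab by (simp add: \<rho>_def)
  have m: "0 < 1 / \<rho>" using \<rho> by simp
  define h where "h k = (\<integral>z. restr \<Omega> F' z * pulled_bump ?l (1 / \<rho>) a b (t k) z \<partial>lborel) / t k ^ ?n" for k
  have A: "(\<integral>z. restr \<Omega> F' z * pulled_bump ?l (1 / \<rho>) a b 1 z \<partial>lborel) = ?A"
  proof -
    have c\<Omega>: "cube c \<rho> \<subseteq> \<Omega>" using in\<Omega>[of 1] sub by auto
    have i1: "integrable lborel (\<lambda>z. restr \<Omega> F z * pulled_bump ?l (1 / \<rho>) a b 1 z)"
      by (rule pulled_bump_integrable[OF open_dom F g g0 wg m t(1,2) box]) (use t in auto)
    have "restr \<Omega> F' z * pulled_bump ?l (1 / \<rho>) a b 1 z = restr \<Omega> F z * cube_bump c \<rho> z - f \<omega> * cube_bump c \<rho> z" for z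
    proof (cases "z \<in> \<Omega>")
      case True
      then show ?thesis by (simp add: restr_def pulled_bump_def cb F'_def algebra_simps)
    next
      case False
      then have "cube_bump c \<rho> z = 0" using c\<Omega> \<rho> by (intro cube_bump_zero) auto
      then show ?thesis using False by (simp add: restr_def)
    qed
    then have "(\<integral>z. restr \<Omega> F' z * pulled_bump ?l (1 / \<rho>) a b 1 z \<partial>lborel)
       = (\<integral>z. restr \<Omega> F z * cube_bump c \<rho> z - f \<omega> * cube_bump c \<rho> z \<partial>lborel)" by simp
    also have "\<dots> = (\<integral>z. restr \<Omega> F z * cube_bump c \<rho> z \<partial>lborel) - (\<integral>z. f \<omega> * cube_bump c \<rho> z \<partial>lborel)"
      using i1 integrable_cube_bump[OF \<rho>, of c] by (intro Bochner_Integration.integral_diff) (auto simp: pulled_bump_def cb)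
    finally show ?thesis by (simp add: \<rho>_def)
  qed
  have le: "ennreal \<bar>?A - h k\<bar> \<le> ?RHS" for k
  proof -
    have "ennreal \<bar>?A - h k\<bar> \<le> (\<integral>\<^sup>+s. \<integral>\<^sup>+z. ennreal (real ?n * R * (indicator {t k..1} s * indicator (cbox a b) (blow_up ?l s z)
          * infnorm (g z) / s ^ ?n)) \<partial>lborel \<partial>lborel)"
      unfolding A[symmetric] h_def
      by (rule average_difference[OF open_dom F' g g0 wg' m t(1,2) box Ra])
    also have "\<dots> \<le> ?RHS"
    proof (intro nn_integral_mono ennreal_leI)
      fix s :: real and z :: "real ^ 'n"
      have "c \<in> cube c (r / 2)" using r by (intro center_in_cube) simp
      then have R0: "0 \<le> R" using order_trans[OF infnorm_pos_le R] by blast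
      show "real ?n * R * (indicator {t k..1} s * indicator (cbox a b) (blow_up ?l s z) * infnorm (g z) / s ^ ?n)
        \<le> real ?n * R * (indicator {0<..1} s * indicator (cube c (r / 2)) (blow_up ?l s z) * infnorm (g z) / s ^ ?n)"
        using t(1)[of k] R0 ab by (intro mult_left_mono) (auto simp: indicator_def \<rho>_def)
    qed
    finally show ?thesis .
  qed
  have h0: "h \<longlonglongrightarrow> 0"
  proof -
    define G where "G k w = \<bar>F (?l + t k *\<^sub>R (w - ?l)) - f \<omega>\<bar>" for k w
    have "\<exists>w\<in>cube c \<rho>. \<forall>y\<in>cube c \<rho>. G k y \<le> G k w" for k
    proof (rule continuous_attains_sup)
      show "cube c \<rho> \<noteq> {}" using center_in_cube[of \<rho> c] \<rho> by auto
      show "continuous_on (cube c \<rho>) (G k)"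
        unfolding G_def using in\<Omega> t sub by (intro continuous_intros continuous_on_compose2[OF F]) auto
    qed simp
    then obtain w where w: "\<And>k. w k \<in> cube c \<rho>" "\<And>k y. y \<in> cube c \<rho> \<Longrightarrow> G k y \<le> G k (w k)" by metis
    have "(\<lambda>i. ?l + t i *\<^sub>R (w i - ?l)) \<in> \<omega>" using w(1) seq by (simp add: \<rho>_def)
    then have "(\<lambda>i. F (?l + t i *\<^sub>R (w i - ?l))) \<longlonglongrightarrow> f \<omega>" using tr \<omega> by (simp add: has_trace_def)
    then have "(\<lambda>i. F (?l + t i *\<^sub>R (w i - ?l)) - f \<omega>) \<longlonglongrightarrow> 0" by (simp add: LIM_zero)
    then have "(\<lambda>i. G i (w i)) \<longlonglongrightarrow> 0" unfolding G_def by (rule tendsto_rabs_zero)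
    from tendsto_mult_left_zero[OF this]
    have lim: "(\<lambda>i. G i (w i) * (2 * \<rho>) ^ ?n) \<longlonglongrightarrow> 0" .
    show ?thesis
    proof (rule Lim_null_comparison[OF always_eventually[OF allI] lim])
      fix k
      let ?Q = "cube (?l + t k *\<^sub>R (c - ?l)) (t k * \<rho>)"
      have "ennreal \<bar>\<integral>z. restr \<Omega> F' z * pulled_bump ?l (1 / \<rho>) a b (t k) z \<partial>lborel\<bar>
          \<le> (\<integral>\<^sup>+z. ennreal \<bar>restr \<Omega> F' z * pulled_bump ?l (1 / \<rho>) a b (t k) z\<bar> \<partial>lborel)" by (rule norm_integral_le_nn)
      also have "\<dots> \<le> (\<integral>\<^sup>+z. ennreal (G k (w k)) * indicator ?Q z \<partial>lborel)"
      proof (rule nn_integral_mono)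
        fix z
        show "ennreal \<bar>restr \<Omega> F' z * pulled_bump ?l (1 / \<rho>) a b (t k) z\<bar> \<le> ennreal (G k (w k)) * indicator ?Q z"
        proof (cases "z \<in> ?Q")
          case True
          then have hz: "blow_up ?l (t k) z \<in> cube c \<rho>" using blow_up_mem_cube[OF t(1)] by blast
          have z: "z = ?l + t k *\<^sub>R (blow_up ?l (t k) z - ?l)" using t(1)[of k] by (simp add: blow_up_def)
          have "\<bar>restr \<Omega> F' z\<bar> \<le> G k (blow_up ?l (t k) z)"
            using z by (auto simp: restr_def G_def F'_def indicator_def)
          also have "\<dots> \<le> G k (w k)" by (rule w(2)[OF hz])
          finally have "\<bar>restr \<Omega> F' z\<bar> * \<bar>pulled_bump ?l (1 / \<rho>) a b (t k) z\<bar> \<le> G k (w k) * 1"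
            using box_bump_nonneg[of "1 / \<rho>" a b "blow_up ?l (t k) z"] box_bump_le_1[of "1 / \<rho>" a b "blow_up ?l (t k) z"]
            by (intro mult_mono) (auto simp: pulled_bump_def G_def)
          then show ?thesis using True by (simp add: abs_mult ennreal_leI)
        next
          case False
          then have "blow_up ?l (t k) z \<notin> cube c \<rho>" using blow_up_mem_cube[OF t(1)] by blast
          then have "pulled_bump ?l (1 / \<rho>) a b (t k) z = 0"
            using cube_bump_zero[OF \<rho>, of "blow_up ?l (t k) z" c] by (simp add: pulled_bump_def cb)
          then show ?thesis by simp
        qed
      qed
      also have "\<dots> = ennreal (G k (w k)) * emeasure lborel ?Q"
        by (rule nn_integral_cmult_indicator) simp
      also have "\<dots> = ennreal (G k (w k) * (2 * \<rho>) ^ ?n * t k ^ ?n)"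
        using \<rho> t(1)[of k] by (simp add: emeasure_cube G_def ennreal_mult'[symmetric] power_mult_distrib mult_ac)
      finally have "\<bar>\<integral>z. restr \<Omega> F' z * pulled_bump ?l (1 / \<rho>) a b (t k) z \<partial>lborel\<bar> \<le> G k (w k) * (2 * \<rho>) ^ ?n * t k ^ ?n"
        using \<rho> t(1)[of k] by (subst (asm) ennreal_le_iff) (auto simp: G_def)
      then show "norm (h k) \<le> G k (w k) * (2 * \<rho>) ^ ?n"
        using t(1)[of k] by (simp add: h_def abs_divide field_simps)
    qed
  qed
  have "(\<lambda>k. \<bar>?A - h k\<bar>) \<longlonglongrightarrow> \<bar>?A - 0\<bar>" by (intro tendsto_intros h0)
  then have "(\<lambda>k. ennreal \<bar>?A - h k\<bar>) \<longlonglongrightarrow> ennreal \<bar>?A\<bar>" by (intro tendsto_ennrealI) simp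
  then show ?thesis by (rule LIMSEQ_le_const2) (use le in blast)
qed

text \<open>
  The integral of \<open>s powr (\<epsilon> - 1)\<close> over the parameters \<open>0 < s \<le> 2 * bdist z / r\<close>, outside of
  which the copies of a visible half cube do not contain \<open>z\<close>.
\<close>

definition scale_weight :: "real \<Rightarrow> real \<Rightarrow> real ^ 'n \<Rightarrow> real \<Rightarrow> real ^ 'n \<Rightarrow> real" where
  "scale_weight \<eta> \<epsilon> c r z = (if z \<in> \<Omega> \<and> infnorm (z - c) \<le> 3 * \<eta> * r \<and> bdist z \<le> 2 * \<eta> * r
     then (2 * bdist z / r) powr \<epsilon> / \<epsilon> else 0)"

lemma scale_weight_measurable [measurable]: "scale_weight \<eta> \<epsilon> c r \<in> borel_measurable borel"
proof -
  have [measurable]: "bdist \<in> borel_measurable borel"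
    by (rule borel_measurable_continuous_onI[OF continuous_on_bdist])
  have [measurable]: "\<Omega> \<in> sets borel" using open_dom by simp
  show ?thesis unfolding scale_weight_def[abs_def] by measurable
qed

lemma scale_weight_nonneg: "0 < \<epsilon> \<Longrightarrow> 0 \<le> scale_weight \<eta> \<epsilon> c r z"
  by (simp add: scale_weight_def)

text \<open>
  A copy with parameter \<open>s\<close> lies at distance at least \<open>s r / 2\<close> from the boundary and, as it
  contains \<open>z\<close>, this restricts \<open>s\<close>; moreover \<open>z\<close> is within \<open>2 \<eta> r\<close> of \<open>l\<close>, hence within
  \<open>3 \<eta> r\<close> of the centre.
\<close>

lemma visible_scale_integral:
  assumes vis: "\<And>s y. 0 < s \<Longrightarrow> s \<le> 1 \<Longrightarrow> y \<in> cube c r \<Longrightarrow> l + s *\<^sub>R (y - l) \<in> \<Omega>"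
    and l: "l \<in> frontier \<Omega>" "l \<in> cube c (\<eta> * r)" and r: "0 < r" and \<eta>: "1 \<le> \<eta>" and e: "-1 < e"
  shows "(\<integral>\<^sup>+s. ennreal (indicator {0<..1} s * indicator (cube c (r / 2)) (blow_up l s z) * s powr e) \<partial>lborel)
    \<le> ennreal (scale_weight \<eta> (e + 1) c r z)" (is "?I \<le> _")
proof -
  have key: "z \<in> \<Omega> \<and> infnorm (z - c) \<le> 3 * \<eta> * r \<and> bdist z \<le> 2 * \<eta> * r \<and> s \<le> 2 * bdist z / r"
    if s: "0 < s" "s \<le> 1" and h: "blow_up l s z \<in> cube c (r / 2)" for s
  proof -
    let ?y = "blow_up l s z"
    have z: "z = l + s *\<^sub>R (?y - l)" using s by (simp add: blow_up_def)
    have yc: "infnorm (?y - c) \<le> r / 2" using h by (simp add: mem_cube)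
    have "?y \<in> cube c r" using yc r by (simp add: mem_cube)
    then have z\<Omega>: "z \<in> \<Omega>" using vis[OF s] z by metis
    have lc: "infnorm (l - c) \<le> \<eta> * r" using l by (simp add: mem_cube)
    have \<eta>r: "r \<le> \<eta> * r" using \<eta> r by simp
    have "infnorm (?y - l) \<le> 2 * \<eta> * r"
      using infnorm_triangle3[of ?y l c] yc lc infnorm_sub[of c l] \<eta>r r by linarith
    moreover have "infnorm (z - l) = s * infnorm (?y - l)" using s by (subst z) (simp add: infnorm_mul)
    moreover have "s * infnorm (?y - l) \<le> infnorm (?y - l)" using s by (simp add: mult_left_le_one_le)
    ultimately have zl: "infnorm (z - l) \<le> 2 * \<eta> * r" by linarith
    have "infnorm (z - c) \<le> 3 * \<eta> * r"
      using infnorm_triangle3[of z c l] zl lc by linarith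
    moreover have "bdist z \<le> 2 * \<eta> * r" using bdist_le[OF l(1), of z] zl by simp
    moreover have "s * (r / 2) \<le> bdist z"
    proof -
      have "s * (r / 2) \<le> s * (r - infnorm (?y - c))" using yc s by (intro mult_left_mono) auto
      also have "\<dots> \<le> bdist (l + s *\<^sub>R (?y - l))"
        by (rule bdist_homothety) (use vis s in auto)
      finally show ?thesis using z by simp
    qed
    then have "s \<le> 2 * bdist z / r" using r by (simp add: field_simps)
    ultimately show ?thesis using z\<Omega> by simp
  qed
  show ?thesis
  proof (cases "z \<in> \<Omega> \<and> infnorm (z - c) \<le> 3 * \<eta> * r \<and> bdist z \<le> 2 * \<eta> * r")
    case True
    let ?u = "2 * bdist z / r"
    have u: "0 \<le> ?u" using bdist_nonneg[of z] r by simp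
    have "?I \<le> (\<integral>\<^sup>+s. ennreal (s powr e) * indicator {0..?u} s \<partial>lborel)"
    proof (rule nn_integral_mono)
      fix s :: real
      show "ennreal (indicator {0<..1} s * indicator (cube c (r / 2)) (blow_up l s z) * s powr e)
          \<le> ennreal (s powr e) * indicator {0..?u} s"
      proof (cases "0 < s \<and> s \<le> 1 \<and> blow_up l s z \<in> cube c (r / 2)")
        case True
        then have "s \<le> ?u" using key[of s] by blast
        then show ?thesis using True by simp
      qed (auto simp: indicator_def)
    qed
    also have "\<dots> = ennreal (?u powr (e + 1) / (e + 1))"
      by (rule nn_integral_has_integral_lebesgue'[OF _ has_integral_powr_from_0[OF e u]]) simp
    finally show ?thesis using True by (simp add: scale_weight_def)
  next
    case False
    then have "ennreal (indicator {0<..1} s * indicator (cube c (r / 2)) (blow_up l s z) * s powr e) = 0" for s :: real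
      using key[of s] by (auto simp: indicator_def)
    then have "?I = (\<integral>\<^sup>+s. 0 \<partial>(lborel :: real measure))" by (rule nn_integral_cong)
    then show ?thesis by simp
  qed
qed

text \<open>
  Write the integrand \<open>|g| / s ^ n\<close> as \<open>|g| s powr \<gamma>\<close> times the weight \<open>s powr (- n - \<gamma>)\<close>.
  As the copy with parameter \<open>s\<close> has volume \<open>(s r) ^ n\<close>, the total weight is finite for
  \<open>\<gamma> < 1\<close>. In Jensen's inequality the \<open>p\<close>-th power leaves \<open>s powr (\<gamma> (p - 1) - n)\<close>, which
  has an integrable singularity under hypothesis \<open>e\<close>.
\<close>

lemma trace_average_bound:
  assumes F: "continuous_on \<Omega> F" and g [measurable]: "g \<in> borel_measurable borel" and g0: "\<And>x. x \<notin> \<Omega> \<Longrightarrow> g x = 0"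
    and wg: "weak_gradient \<Omega> F g" and tr: "has_trace \<alpha> \<Omega> F f"
    and vis: "alpha_visible \<alpha> \<Omega> c r \<omega>" and r: "0 < r" and \<eta>: "1 \<le> \<eta>"
    and l: "ell \<omega> \<in> cube c (\<eta> * r) \<inter> frontier \<Omega>" and p: "1 < p" and \<gamma>: "\<gamma> < 1"
    and e: "-1 < \<gamma> * (p - 1) - real CARD('n)" and A: "0 \<le> A"
    and int: "(\<integral>\<^sup>+z. ennreal (infnorm (g z) powr p * scale_weight \<eta> (\<gamma> * (p - 1) - real CARD('n) + 1) c r z) \<partial>lborel) \<le> ennreal A"
  shows "\<exists>X\<ge>0. \<bar>(\<integral>z. restr \<Omega> F z * cube_bump c (r / 2) z \<partial>lborel) - f \<omega> * (\<integral>z. cube_bump c (r / 2) z \<partial>lborel)\<bar>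
      \<le> real CARD('n) * (2 * \<eta> * r) * X \<and> X powr p \<le> A * (r ^ CARD('n) / (1 - \<gamma>)) powr (p - 1)"
proof -
  let ?l = "ell \<omega>" and ?n = "real CARD('n)"
  define E :: "real \<Rightarrow> real ^ 'n \<Rightarrow> real" where "E s z = indicator {0<..1} s * indicator (cube c (r / 2)) (blow_up ?l s z)" for s z
  have E01: "E s z = 0 \<or> (0 < s \<and> s \<le> 1 \<and> E s z = 1)" for s z by (auto simp: E_def indicator_def)
  have E0: "0 \<le> E s z" for s z using E01[of s z] by auto
  define k :: "real \<times> (real ^ 'n) \<Rightarrow> real" where "k q = E (fst q) (snd q) * fst q powr (- ?n - \<gamma>)" for q
  define h :: "real \<times> (real ^ 'n) \<Rightarrow> real" where "h q = infnorm (g (snd q)) * fst q powr \<gamma>" for q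
  have Em [measurable]: "(\<lambda>q. E (fst q) (snd q)) \<in> borel_measurable (lborel \<Otimes>\<^sub>M lborel)"
    unfolding E_def blow_up_def by measurable
  have [measurable]: "k \<in> borel_measurable (lborel \<Otimes>\<^sub>M lborel)" "h \<in> borel_measurable (lborel \<Otimes>\<^sub>M lborel)"
    unfolding k_def[abs_def] h_def[abs_def] by measurable
  have in\<Omega>: "?l + s *\<^sub>R (y - ?l) \<in> \<Omega>" if "0 < s" "s \<le> 1" "y \<in> cube c r" for s y
    using alpha_visible_sequences[OF vis r] that by blast
  have rn: "0 < r ^ CARD('n)" using r by simp
  have kB: "(\<integral>\<^sup>+q. ennreal (k q) \<partial>(lborel \<Otimes>\<^sub>M lborel)) \<le> ennreal (r ^ CARD('n) / (1 - \<gamma>))"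
  proof -
    have "(\<integral>\<^sup>+q. ennreal (k q) \<partial>(lborel \<Otimes>\<^sub>M lborel)) = (\<integral>\<^sup>+s. \<integral>\<^sup>+z. ennreal (k (s, z)) \<partial>lborel \<partial>lborel)"
      by (rule lborel.nn_integral_fst[symmetric]) measurable
    also have "\<dots> \<le> (\<integral>\<^sup>+s. ennreal (r ^ CARD('n)) * (ennreal (s powr - \<gamma>) * indicator {0..1} s) \<partial>lborel)"
    proof (rule nn_integral_mono)
      fix s :: real
      show "(\<integral>\<^sup>+z. ennreal (k (s, z)) \<partial>lborel) \<le> ennreal (r ^ CARD('n)) * (ennreal (s powr - \<gamma>) * indicator {0..1} s)"
      proof (cases "0 < s \<and> s \<le> 1")
        case True
        let ?Q = "cube (?l + s *\<^sub>R (c - ?l)) (s * (r / 2))"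
        have "(\<integral>\<^sup>+z. ennreal (k (s, z)) \<partial>lborel) = (\<integral>\<^sup>+z. ennreal (s powr (- ?n - \<gamma>)) * indicator ?Q z \<partial>lborel)"
          using True blow_up_mem_cube[of s ?l _ c "r / 2"]
          by (intro nn_integral_cong) (auto simp: k_def E_def indicator_def)
        also have "\<dots> = ennreal (s powr (- ?n - \<gamma>)) * emeasure lborel ?Q"
          by (rule nn_integral_cmult_indicator) simp
        also have "\<dots> = ennreal (s powr (- ?n - \<gamma>) * (s ^ CARD('n) * r ^ CARD('n)))"
          using True r by (simp add: emeasure_cube ennreal_mult'[symmetric] power_mult_distrib)
        also have "s powr (- ?n - \<gamma>) * (s ^ CARD('n) * r ^ CARD('n)) = r ^ CARD('n) * s powr - \<gamma>"
        proof -
          have "s powr (- ?n - \<gamma>) * s ^ CARD('n) = s powr - \<gamma>"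
            using True powr_add[of s "- ?n - \<gamma>" ?n] by (simp add: powr_realpow)
          then show ?thesis by (simp add: mult.assoc[symmetric])
        qed
        finally show ?thesis using True rn by (simp add: ennreal_mult)
      next
        case False
        then have "k (s, z) = 0" for z by (auto simp: k_def E_def)
        then show ?thesis by simp
      qed
    qed
    also have "\<dots> = ennreal (r ^ CARD('n)) * (\<integral>\<^sup>+s. ennreal (s powr - \<gamma>) * indicator {0..1} s \<partial>lborel)"
      by (rule nn_integral_cmult) measurable
    also have "(\<integral>\<^sup>+s. ennreal (s powr - \<gamma>) * indicator {0..1} s \<partial>lborel) = ennreal (1 powr (- \<gamma> + 1) / (- \<gamma> + 1))"
      by (rule nn_integral_has_integral_lebesgue'[OF _ has_integral_powr_from_0]) (use \<gamma> in auto)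
    also have "ennreal (r ^ CARD('n)) * \<dots> = ennreal (r ^ CARD('n) / (1 - \<gamma>))"
      using rn \<gamma> by (simp add: ennreal_mult'[symmetric])
    finally show ?thesis .
  qed
  have hA: "(\<integral>\<^sup>+q. ennreal (h q powr p * k q) \<partial>(lborel \<Otimes>\<^sub>M lborel)) \<le> ennreal A"
  proof -
    let ?e = "\<gamma> * (p - 1) - ?n"
    have eq: "h (s, z) powr p * k (s, z) = infnorm (g z) powr p * (E s z * s powr ?e)" for s z
    proof (cases "E s z = 0")
      case False
      then have s: "0 < s" using E01[of s z] by auto
      have "(s powr \<gamma>) powr p * s powr (- ?n - \<gamma>) = s powr ?e"
        by (simp add: powr_powr powr_add[symmetric] algebra_simps)
      then show ?thesis using s by (simp add: h_def k_def powr_mult mult_ac)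
    qed (simp add: k_def)
    have "(\<integral>\<^sup>+q. ennreal (h q powr p * k q) \<partial>(lborel \<Otimes>\<^sub>M lborel))
        = (\<integral>\<^sup>+z. \<integral>\<^sup>+s. ennreal (h (s, z) powr p * k (s, z)) \<partial>lborel \<partial>lborel)"
      by (rule lborel_pair.nn_integral_snd[symmetric]) measurable
    also have "\<dots> \<le> (\<integral>\<^sup>+z. ennreal (infnorm (g z) powr p * scale_weight \<eta> (?e + 1) c r z) \<partial>lborel)"
    proof (rule nn_integral_mono)
      fix z :: "real ^ 'n"
      have Ez [measurable]: "(\<lambda>s. E s z) \<in> borel_measurable borel" unfolding E_def blow_up_def by measurable
      have "(\<integral>\<^sup>+s. ennreal (h (s, z) powr p * k (s, z)) \<partial>lborel)
          = (\<integral>\<^sup>+s. ennreal (infnorm (g z) powr p) * ennreal (E s z * s powr ?e) \<partial>lborel)"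
        unfolding eq using E0 by (simp add: ennreal_mult)
      also have "\<dots> = ennreal (infnorm (g z) powr p) * (\<integral>\<^sup>+s. ennreal (E s z * s powr ?e) \<partial>lborel)"
        by (rule nn_integral_cmult) measurable
      also have "\<dots> \<le> ennreal (infnorm (g z) powr p) * ennreal (scale_weight \<eta> (?e + 1) c r z)"
        unfolding E_def
        by (intro mult_left_mono visible_scale_integral[OF in\<Omega> _ _ r \<eta> e]) (use l in auto)
      also have "\<dots> = ennreal (infnorm (g z) powr p * scale_weight \<eta> (?e + 1) c r z)"
        by (rule ennreal_mult[symmetric]) (use e scale_weight_nonneg in auto)
      finally show "(\<integral>\<^sup>+s. ennreal (h (s, z) powr p * k (s, z)) \<partial>lborel)
          \<le> ennreal (infnorm (g z) powr p * scale_weight \<eta> (?e + 1) c r z)" .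
    qed
    also have "\<dots> \<le> ennreal A" by (rule int)
    finally show ?thesis .
  qed
  obtain X where X: "0 \<le> X" "(\<integral>\<^sup>+q. ennreal (h q * k q) \<partial>(lborel \<Otimes>\<^sub>M lborel)) = ennreal X"
      "X powr p \<le> A * (r ^ CARD('n) / (1 - \<gamma>)) powr (p - 1)"
    using nn_integral_Jensen[of h "lborel \<Otimes>\<^sub>M lborel" k p "r ^ CARD('n) / (1 - \<gamma>)" A] kB hA p A rn \<gamma> E0
    by (auto simp: h_def k_def)
  have R: "infnorm (y - ?l) \<le> 2 * \<eta> * r" if y: "y \<in> cube c (r / 2)" for y
  proof -
    have "infnorm (?l - c) \<le> \<eta> * r" using l by (simp add: mem_cube)
    moreover have "r \<le> \<eta> * r" using \<eta> r by simp
    ultimately show ?thesis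
      using infnorm_triangle3[of y ?l c] y infnorm_sub[of c ?l] r unfolding mem_cube by linarith
  qed
  have "ennreal \<bar>(\<integral>z. restr \<Omega> F z * cube_bump c (r / 2) z \<partial>lborel) - f \<omega> * (\<integral>z. cube_bump c (r / 2) z \<partial>lborel)\<bar>
     \<le> (\<integral>\<^sup>+s. \<integral>\<^sup>+z. ennreal (real CARD('n) * (2 * \<eta> * r) * (E s z * infnorm (g z) / s ^ CARD('n))) \<partial>lborel \<partial>lborel)"
    unfolding E_def by (rule trace_average_estimate[OF F g g0 wg tr vis r R])
  also have "\<dots> = (\<integral>\<^sup>+s. \<integral>\<^sup>+z. ennreal (real CARD('n) * (2 * \<eta> * r)) * ennreal (h (s, z) * k (s, z)) \<partial>lborel \<partial>lborel)"
  proof (intro nn_integral_cong)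
    fix s :: real and z :: "real ^ 'n"
    have "h (s, z) * k (s, z) = E s z * infnorm (g z) / s ^ CARD('n)"
    proof (cases "E s z = 0")
      case False
      then have s: "0 < s" using E01[of s z] by auto
      have "s powr \<gamma> * s powr (- ?n - \<gamma>) = 1 / s ^ CARD('n)"
        using s by (simp add: powr_add[symmetric] powr_minus powr_realpow inverse_eq_divide)
      then show ?thesis by (simp add: h_def k_def mult_ac)
    qed (simp add: k_def)
    moreover have "0 \<le> h (s, z) * k (s, z)" using E0 by (simp add: h_def k_def)
    ultimately show "ennreal (real CARD('n) * (2 * \<eta> * r) * (E s z * infnorm (g z) / s ^ CARD('n)))
        = ennreal (real CARD('n) * (2 * \<eta> * r)) * ennreal (h (s, z) * k (s, z))"
      using \<eta> r ennreal_mult[of "real CARD('n) * (2 * \<eta> * r)" "h (s, z) * k (s, z)"] by simp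
  qed
  also have "\<dots> = (\<integral>\<^sup>+q. ennreal (real CARD('n) * (2 * \<eta> * r)) * ennreal (h q * k q) \<partial>(lborel \<Otimes>\<^sub>M lborel))"
    by (rule lborel.nn_integral_fst) measurable
  also have "\<dots> = ennreal (real CARD('n) * (2 * \<eta> * r)) * ennreal X"
    by (subst nn_integral_cmult) (use X in auto)
  also have "\<dots> = ennreal (real CARD('n) * (2 * \<eta> * r) * X)"
    using X \<eta> r by (intro ennreal_mult[symmetric]) auto
  finally have "\<bar>(\<integral>z. restr \<Omega> F z * cube_bump c (r / 2) z \<partial>lborel) - f \<omega> * (\<integral>z. cube_bump c (r / 2) z \<partial>lborel)\<bar>
      \<le> real CARD('n) * (2 * \<eta> * r) * X"
    using X \<eta> r by (subst (asm) ennreal_le_iff) auto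
  then show ?thesis using X by blast
qed

lemma sum_scale_weight:
  assumes fin: "finite I" and dj: "disjoint_family_on (\<lambda>i. cube (c i) (r i)) I"
    and r: "\<And>i. i \<in> I \<Longrightarrow> 0 < r i" and \<eta>: "1 \<le> \<eta>" and \<epsilon>: "0 < \<epsilon>"
  shows "(\<Sum>i\<in>I. scale_weight \<eta> \<epsilon> (c i) (r i) z)
    \<le> (4 * \<eta>) powr \<epsilon> / \<epsilon> * ((2 * (3 * \<eta> + 1)) ^ CARD('n) / (1 - 2 powr - \<epsilon>))" (is "_ \<le> ?B")
proof -
  have e1: "2 powr - \<epsilon> < 1" using \<epsilon> by (simp add: powr_less_one)
  then have B0: "0 \<le> ?B" using \<eta> \<epsilon> by simp
  show ?thesis
  proof (cases "z \<in> \<Omega>")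
    case True
    define d where "d = bdist z / (2 * \<eta>)"
    have d: "0 < d" using bdist_pos[OF True] \<eta> by (simp add: d_def)
    let ?J = "{i \<in> I. infnorm (z - c i) \<le> 3 * \<eta> * r i \<and> bdist z \<le> 2 * \<eta> * r i}"
    have "(\<Sum>i\<in>I. scale_weight \<eta> \<epsilon> (c i) (r i) z) = (\<Sum>i\<in>?J. scale_weight \<eta> \<epsilon> (c i) (r i) z)"
      using fin by (intro sum.mono_neutral_right) (auto simp: scale_weight_def)
    also have "\<dots> = (\<Sum>i\<in>?J. (4 * \<eta>) powr \<epsilon> / \<epsilon> * (d / r i) powr \<epsilon>)"
    proof (rule sum.cong)
      fix i assume i: "i \<in> ?J"
      then have "0 < r i" using r by auto
      then have "2 * bdist z / r i = (4 * \<eta>) * (d / r i)" using \<eta> by (simp add: d_def)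
      then have "(2 * bdist z / r i) powr \<epsilon> = (4 * \<eta>) powr \<epsilon> * (d / r i) powr \<epsilon>"
        using \<eta> d \<open>0 < r i\<close> by (simp only: powr_mult[of "4 * \<eta>"])
      then show "scale_weight \<eta> \<epsilon> (c i) (r i) z = (4 * \<eta>) powr \<epsilon> / \<epsilon> * (d / r i) powr \<epsilon>"
        using i True by (simp add: scale_weight_def)
    qed simp
    also have "\<dots> = (4 * \<eta>) powr \<epsilon> / \<epsilon> * (\<Sum>i\<in>?J. (d / r i) powr \<epsilon>)" by (simp add: sum_distrib_left)
    also have "\<dots> \<le> ?B"
    proof (rule mult_left_mono)
      show "(\<Sum>i\<in>?J. (d / r i) powr \<epsilon>) \<le> (2 * (3 * \<eta> + 1)) ^ CARD('n) / (1 - 2 powr - \<epsilon>)"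
      proof (rule sum_disjoint_cubes_scale[where c = c and z = z])
        show "disjoint_family_on (\<lambda>i. cube (c i) (r i)) ?J" using dj by (auto simp: disjoint_family_on_def)
        show "d \<le> r i" if "i \<in> ?J" for i using that \<eta> by (auto simp: d_def field_simps)
      qed (use fin d \<eta> \<epsilon> in auto)
    qed (use \<eta> \<epsilon> in simp)
    finally show ?thesis .
  next
    case False
    then show ?thesis using B0 by (simp add: scale_weight_def)
  qed
qed

end

text \<open>
  The conditions \<open>\<gamma> < 1\<close> and \<open>\<epsilon> > 0\<close> mean that \<open>\<gamma>\<close> lies between \<open>(n - 1) / (p - 1)\<close> and 1,
  an interval that is nonempty since \<open>n < p\<close>; its midpoint is taken. The last factor bounds
  the sum of the weights.
\<close>

definition upper_const :: "real \<Rightarrow> real \<Rightarrow> real \<Rightarrow> real" where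
  "upper_const n p \<eta> = (let \<gamma> = ((n - 1) / (p - 1) + 1) / 2; \<epsilon> = \<gamma> * (p - 1) - n + 1 in
     (4 * n * \<eta> * 2 powr n / bump_min (nat \<lfloor>n\<rfloor>)) powr p * (1 / (1 - \<gamma>)) powr (p - 1) / 2 powr (p - n)
     * ((4 * \<eta>) powr \<epsilon> / \<epsilon> * ((2 * (3 * \<eta> + 1)) powr n / (1 - 2 powr - \<epsilon>))))"

context alpha_domain
begin

text \<open>
  Both boundary values of a cube are compared with the same average of \<open>F\<close>. The powers of
  \<open>r\<close> combine to \<open>r powr (p - n)\<close>, which is what the denominator of the variational sum
  cancels.
\<close>

lemma variational_bound_of_trace:
  assumes p: "real CARD('n) < p" and \<eta>: "1 \<le> \<eta>"
    and F: "continuous_on \<Omega> F" and G: "weak_gradient \<Omega> F G"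
    and Gp: "set_integrable lebesgue \<Omega> (\<lambda>x. infnorm (G x) powr p)" and tr: "has_trace \<alpha> \<Omega> F f"
  shows "variational_bound p \<alpha> \<eta> \<Omega> f
    (upper_const (real CARD('n)) p \<eta> * (LINT x:\<Omega>|lebesgue. infnorm (G x) powr p))"
proof -
  let ?n = "real CARD('n)"
  have n1: "1 \<le> ?n" by (simp add: Suc_le_eq)
  have p1: "1 < p" using p n1 by linarith
  define \<gamma> where "\<gamma> = ((?n - 1) / (p - 1) + 1) / 2"
  define \<epsilon> where "\<epsilon> = \<gamma> * (p - 1) - ?n + 1"
  have \<gamma>: "\<gamma> < 1" using p p1 by (simp add: \<gamma>_def field_simps)
  have \<gamma>p: "\<gamma> * (p - 1) = ((?n - 1) + (p - 1)) / 2" using p1 by (simp add: \<gamma>_def field_simps)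
  have \<epsilon>: "0 < \<epsilon>" using p unfolding \<epsilon>_def \<gamma>p by (simp add: field_simps)
  obtain g where g [measurable]: "g \<in> borel_measurable borel" and g0: "\<And>x. x \<notin> \<Omega> \<Longrightarrow> g x = 0"
    and wg: "weak_gradient \<Omega> F g" and gG: "AE x in lebesgue. x \<in> \<Omega> \<longrightarrow> G x = g x"
    using weak_gradient_borel_version[OF open_dom G] by blast
  define I where "I = (LINT x:\<Omega>|lebesgue. infnorm (G x) powr p)"
  have I: "(\<integral>\<^sup>+z. ennreal (infnorm (g z) powr p) \<partial>lborel) = ennreal I"
  proof -
    have "(\<integral>\<^sup>+z. ennreal (infnorm (g z) powr p) \<partial>lborel) = (\<integral>\<^sup>+z. ennreal (infnorm (g z) powr p) \<partial>lebesgue)"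
      by (rule nn_integral_completion[symmetric])
    also have "\<dots> = (\<integral>\<^sup>+z. ennreal (indicator \<Omega> z *\<^sub>R infnorm (G z) powr p) \<partial>lebesgue)"
      by (rule nn_integral_cong_AE) (use gG in eventually_elim, use g0 in \<open>auto simp: indicator_def\<close>)
    also have "\<dots> = ennreal I" unfolding I_def set_lebesgue_integral_def
      using Gp by (intro nn_integral_eq_integral) (auto simp: set_integrable_def)
    finally show ?thesis .
  qed
  have I0: "0 \<le> I" unfolding I_def set_lebesgue_integral_def by (intro integral_nonneg_AE) auto
  define Cs where "Cs = (4 * \<eta>) powr \<epsilon> / \<epsilon> * ((2 * (3 * \<eta> + 1)) ^ CARD('n) / (1 - 2 powr - \<epsilon>))"
  have e1: "2 powr - \<epsilon> < 1" using \<epsilon> by (simp add: powr_less_one)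
  have Cs0: "0 \<le> Cs" using \<eta> \<epsilon> e1 by (simp add: Cs_def)
  define \<kappa> where "\<kappa> = bump_min CARD('n)"
  have \<kappa>: "0 < \<kappa>" by (simp add: \<kappa>_def bump_min_pos)
  define Q where "Q = 4 * ?n * \<eta> * 2 powr ?n / \<kappa>"
  have Q: "0 < Q" using \<kappa> \<eta> n1 by (simp add: Q_def)
  define K where "K = Q powr p * (1 / (1 - \<gamma>)) powr (p - 1) / 2 powr (p - ?n)"
  have K0: "0 \<le> K" by (simp add: K_def)
  have const: "upper_const ?n p \<eta> = K * Cs"
  proof -
    have "(2 * (3 * \<eta> + 1)) powr ?n = (2 * (3 * \<eta> + 1)) ^ CARD('n)" using \<eta> by (intro powr_realpow) simp
    moreover have "nat \<lfloor>?n\<rfloor> = CARD('n)" by simp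
    ultimately show ?thesis
      unfolding upper_const_def Let_def \<gamma>_def[symmetric] \<epsilon>_def[symmetric] K_def Q_def Cs_def \<kappa>_def by metis
  qed
  show ?thesis
    unfolding variational_bound_def I_def[symmetric]
  proof (intro allI impI)
    fix m :: nat and c r \<omega>1 \<omega>2
    assume 1: "\<forall>i\<in>{1..m}. 0 < r i \<and> cube (c i) (r i) \<subseteq> \<Omega>"
      and dj: "disjoint_family_on (\<lambda>i. cube (c i) (r i)) {1..m}"
      and 2: "\<forall>i\<in>{1..m}. alpha_visible \<alpha> \<Omega> (c i) (r i) (\<omega>1 i) \<and> alpha_visible \<alpha> \<Omega> (c i) (r i) (\<omega>2 i) \<and>
         ell (\<omega>1 i) \<in> cube (c i) (\<eta> * r i) \<inter> frontier \<Omega> \<and> ell (\<omega>2 i) \<in> cube (c i) (\<eta> * r i) \<inter> frontier \<Omega>"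
    define AA where "AA i = (\<integral>\<^sup>+z. ennreal (infnorm (g z) powr p * scale_weight \<eta> \<epsilon> (c i) (r i) z) \<partial>lborel)" for i
    \<comment> \<open>The weights of disjoint cubes have a bounded sum, so the total energy is controlled once.\<close>
    have sumAA: "(\<Sum>i\<in>{1..m}. AA i) \<le> ennreal (Cs * I)"
    proof -
      have "(\<Sum>i\<in>{1..m}. AA i) = (\<integral>\<^sup>+z. (\<Sum>i\<in>{1..m}. ennreal (infnorm (g z) powr p * scale_weight \<eta> \<epsilon> (c i) (r i) z)) \<partial>lborel)"
        unfolding AA_def by (rule nn_integral_sum[symmetric]) measurable
      also have "\<dots> \<le> (\<integral>\<^sup>+z. ennreal Cs * ennreal (infnorm (g z) powr p) \<partial>lborel)"
      proof (rule nn_integral_mono)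
        fix z
        have "(\<Sum>i\<in>{1..m}. ennreal (infnorm (g z) powr p * scale_weight \<eta> \<epsilon> (c i) (r i) z))
           = ennreal (infnorm (g z) powr p * (\<Sum>i\<in>{1..m}. scale_weight \<eta> \<epsilon> (c i) (r i) z))"
          using scale_weight_nonneg[OF \<epsilon>] by (subst sum_ennreal) (auto simp: sum_distrib_left)
        also have "\<dots> \<le> ennreal (infnorm (g z) powr p * Cs)"
          unfolding Cs_def by (intro ennreal_leI mult_left_mono sum_scale_weight dj \<eta> \<epsilon>) (use 1 in auto)
        also have "\<dots> = ennreal Cs * ennreal (infnorm (g z) powr p)"
          using Cs0 by (simp add: ennreal_mult'[symmetric] mult.commute)
        finally show "(\<Sum>i\<in>{1..m}. ennreal (infnorm (g z) powr p * scale_weight \<eta> \<epsilon> (c i) (r i) z))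
          \<le> ennreal Cs * ennreal (infnorm (g z) powr p)" .
      qed
      also have "\<dots> = ennreal Cs * ennreal I" unfolding I[symmetric] by (rule nn_integral_cmult) measurable
      also have "\<dots> = ennreal (Cs * I)" using Cs0 I0 by (simp add: ennreal_mult)
      finally show ?thesis .
    qed
    have AAfin: "AA i < \<infinity>" if "i \<in> {1..m}" for i
    proof -
      have "AA i \<le> (\<Sum>i\<in>{1..m}. AA i)" using that by (intro member_le_sum) auto
      also have "\<dots> < \<infinity>" using sumAA by (rule le_less_trans) simp
      finally show ?thesis .
    qed
    define A where "A i = enn2real (AA i)" for i
    have A: "0 \<le> A i" "i \<in> {1..m} \<Longrightarrow> AA i = ennreal (A i)" for i
      using AAfin[of i] by (auto simp: A_def less_top)
    have sumA: "(\<Sum>i\<in>{1..m}. A i) \<le> Cs * I"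
    proof -
      have "ennreal (\<Sum>i\<in>{1..m}. A i) = (\<Sum>i\<in>{1..m}. AA i)"
        using A by (subst sum_ennreal[symmetric]) auto
      then have "ennreal (\<Sum>i\<in>{1..m}. A i) \<le> ennreal (Cs * I)" using sumAA by (simp only:)
      then show ?thesis using Cs0 I0 by (subst (asm) ennreal_le_iff) auto
    qed
    have each: "\<bar>f (\<omega>1 i) - f (\<omega>2 i)\<bar> powr p / udiam (cube (c i) (r i)) powr (p - ?n) \<le> K * A i" if i: "i \<in> {1..m}" for i
    proof -
      define R where "R = r i"
      have R: "0 < R" using 1 i by (simp add: R_def)
      define Y where "Y = A i * (R ^ CARD('n) / (1 - \<gamma>)) powr (p - 1)"
      have Y0: "0 \<le> Y" using A by (simp add: Y_def)
      let ?P = "\<integral>z. restr \<Omega> F z * cube_bump (c i) (R / 2) z \<partial>lborel" and ?S = "\<integral>z. cube_bump (c i) (R / 2) z \<partial>lborel"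
      have est: "\<bar>?P - f \<omega> * ?S\<bar> \<le> ?n * (2 * \<eta> * R) * Y powr (1 / p)"
        if v: "alpha_visible \<alpha> \<Omega> (c i) (r i) \<omega>" "ell \<omega> \<in> cube (c i) (\<eta> * r i) \<inter> frontier \<Omega>" for \<omega>
      proof -
        have ge: "-1 < \<gamma> * (p - 1) - ?n" using \<epsilon> by (simp add: \<epsilon>_def)
        have "\<exists>X\<ge>0. \<bar>?P - f \<omega> * ?S\<bar> \<le> ?n * (2 * \<eta> * R) * X \<and> X powr p \<le> Y"
          unfolding R_def Y_def
          by (rule trace_average_bound[OF F g g0 wg tr v(1) _ \<eta> v(2) p1 \<gamma> ge A(1)])
            (use R A(2)[OF i] in \<open>auto simp: R_def AA_def \<epsilon>_def\<close>)
        then obtain X where X: "0 \<le> X" "\<bar>?P - f \<omega> * ?S\<bar> \<le> ?n * (2 * \<eta> * R) * X" "X powr p \<le> Y" by blast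
        have "X = (X powr p) powr (1 / p)" using X p1 by (simp add: powr_powr)
        also have "\<dots> \<le> Y powr (1 / p)" using X p1 by (intro powr_mono2) auto
        finally have "?n * (2 * \<eta> * R) * X \<le> ?n * (2 * \<eta> * R) * Y powr (1 / p)"
          using \<eta> R by (intro mult_left_mono) auto
        then show ?thesis using X(2) by (rule order_trans[rotated])
      qed
      define D where "D = \<bar>f (\<omega>1 i) - f (\<omega>2 i)\<bar>"
      have "D * (\<kappa> * (R / 2) ^ CARD('n)) \<le> D * ?S"
        unfolding \<kappa>_def using R by (intro mult_left_mono integral_cube_bump_lower) (auto simp: D_def)
      also have "\<dots> = \<bar>f (\<omega>1 i) * ?S - f (\<omega>2 i) * ?S\<bar>"
      proof -
        have "0 \<le> ?S" by (intro integral_nonneg_AE AE_I2 cube_bump_nonneg)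
        then show ?thesis by (simp add: D_def left_diff_distrib[symmetric] abs_mult)
      qed
      also have "\<dots> \<le> \<bar>?P - f (\<omega>1 i) * ?S\<bar> + \<bar>?P - f (\<omega>2 i) * ?S\<bar>" by linarith
      also have "\<dots> \<le> ?n * (2 * \<eta> * R) * Y powr (1 / p) + ?n * (2 * \<eta> * R) * Y powr (1 / p)"
        using 2 i by (intro add_mono est) auto
      finally have "D * (\<kappa> * (R / 2) ^ CARD('n)) \<le> 4 * ?n * \<eta> * R * Y powr (1 / p)"
        by (simp add: mult_ac)
      moreover have "\<kappa> * (R / 2) ^ CARD('n) = \<kappa> * R powr ?n / 2 powr ?n"
        using R by (simp add: powr_realpow power_divide)
      ultimately have "D * (\<kappa> * R powr ?n / 2 powr ?n) \<le> 4 * ?n * \<eta> * R * Y powr (1 / p)" by simp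
      then have "D \<le> Q * (R / R powr ?n) * Y powr (1 / p)"
        using \<kappa> R by (simp add: Q_def field_simps)
      also have "R / R powr ?n = R powr (1 - ?n)" using R by (simp add: powr_diff)
      finally have "D powr p \<le> (Q * R powr (1 - ?n) * Y powr (1 / p)) powr p"
        using p1 by (intro powr_mono2) (auto simp: D_def)
      also have "\<dots> = Q powr p * R powr ((1 - ?n) * p) * Y"
        using Q Y0 p1 by (simp add: powr_mult powr_powr)
      also have "Y = A i * (1 / (1 - \<gamma>)) powr (p - 1) * R powr (?n * (p - 1))"
      proof -
        have "R ^ CARD('n) / (1 - \<gamma>) = R powr ?n * (1 / (1 - \<gamma>))" using R by (simp add: powr_realpow)
        then have "(R ^ CARD('n) / (1 - \<gamma>)) powr (p - 1) = (R powr ?n) powr (p - 1) * (1 / (1 - \<gamma>)) powr (p - 1)"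
          using \<gamma> by (simp only: powr_mult[of "R powr ?n"])
        then show ?thesis by (simp add: Y_def powr_powr mult_ac)
      qed
      also have "Q powr p * R powr ((1 - ?n) * p) * (A i * (1 / (1 - \<gamma>)) powr (p - 1) * R powr (?n * (p - 1)))
         = Q powr p * (1 / (1 - \<gamma>)) powr (p - 1) * A i * (R powr ((1 - ?n) * p) * R powr (?n * (p - 1)))"
        by (simp add: mult_ac)
      also have "R powr ((1 - ?n) * p) * R powr (?n * (p - 1)) = R powr (p - ?n)"
        by (simp add: powr_add[symmetric] algebra_simps)
      finally have "D powr p \<le> Q powr p * (1 / (1 - \<gamma>)) powr (p - 1) * A i * R powr (p - ?n)" .
      moreover have "udiam (cube (c i) (r i)) powr (p - ?n) = 2 powr (p - ?n) * R powr (p - ?n)"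
        using R by (simp add: udiam_cube R_def powr_mult)
      ultimately show ?thesis using R by (simp add: K_def D_def field_simps)
    qed
    have "(\<Sum>i = 1..m. \<bar>f (\<omega>1 i) - f (\<omega>2 i)\<bar> powr p / udiam (cube (c i) (r i)) powr (p - ?n))
        \<le> (\<Sum>i\<in>{1..m}. K * A i)" by (rule sum_mono) (rule each)
    also have "\<dots> = K * (\<Sum>i\<in>{1..m}. A i)" by (simp add: sum_distrib_left)
    also have "\<dots> \<le> K * (Cs * I)" using sumA K0 by (rule mult_left_mono)
    finally show "(\<Sum>i = 1..m. \<bar>f (\<omega>1 i) - f (\<omega>2 i)\<bar> powr p / udiam (cube (c i) (r i)) powr (p - ?n))
        \<le> upper_const ?n p \<eta> * I" by (simp add: const mult.assoc)
  qed
qed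

end

section \<open>A multiscale lattice\<close>

text \<open>
  A cell is a level \<open>k\<close> together with integer coordinates of a point in the lattice of mesh
  \<open>2 powr (- k)\<close>. Unlike in a Whitney decomposition, the cubes attached to the cells
  overlap, also within a level; the colouring compensates for this.
\<close>

type_synonym 'n cell = "int \<times> ('n \<Rightarrow> int)"

definition side :: "'n cell \<Rightarrow> real" where
  "side j = 2 powr (- real_of_int (fst j))"

definition node :: "'n cell \<Rightarrow> real ^ 'n" where
  "node j = (\<chi> i. real_of_int (snd j i) * side j)"

text \<open>
  Overlapping patches have levels that differ by at most 1 and, at equal levels, coordinates
  that differ by at most 4. Residues modulo 2 and 5 thus separate them.
\<close>

definition colour :: "'n cell \<Rightarrow> 'n cell" where
  "colour j = (fst j mod 2, \<lambda>i. snd j i mod 5)"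

lemma side_pos [simp]: "0 < side j"
  by (simp add: side_def)

lemma side_nonzero [simp]: "side j \<noteq> 0" and side_nonneg [simp]: "0 \<le> side j" and abs_side [simp]: "\<bar>side j\<bar> = side j"
  using side_pos[of j] by linarith+

lemma finite_colours: "finite (range (colour :: 'n::finite cell \<Rightarrow> 'n cell))"
  and card_colours: "card (range (colour :: 'n cell \<Rightarrow> 'n cell)) \<le> 2 * 5 ^ CARD('n)"
proof -
  let ?C = "{0..<2 :: int} \<times> (UNIV \<rightarrow>\<^sub>E {0..<5 :: int}) :: 'n cell set"
  have sub: "range (colour :: 'n cell \<Rightarrow> 'n cell) \<subseteq> ?C" by (auto simp: colour_def)
  have fin: "finite ?C" by (intro finite_cartesian_product finite_PiE) auto
  show "finite (range (colour :: 'n cell \<Rightarrow> 'n cell))" by (rule finite_subset[OF sub fin])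
  have "card (range (colour :: 'n cell \<Rightarrow> 'n cell)) \<le> card ?C" by (rule card_mono[OF fin sub])
  also have "\<dots> = 2 * 5 ^ CARD('n)" by (simp add: card_cartesian_product card_PiE)
  finally show "card (range (colour :: 'n cell \<Rightarrow> 'n cell)) \<le> 2 * 5 ^ CARD('n)" .
qed

context alpha_domain
begin

text \<open>
  The bounds 15 and 33 leave room for moving by half a side from points \<open>x\<close> with
  \<open>16 h \<le> bdist x < 32 h\<close>, where \<open>h\<close> is a power of 2; such \<open>h\<close> exists for each \<open>x\<close>.
\<close>

definition cells :: "'n cell set" where
  "cells = {j. node j \<in> \<Omega> \<and> 15 * side j \<le> bdist (node j) \<and> bdist (node j) \<le> 33 * side j}"

abbreviation patch :: "'n cell \<Rightarrow> (real ^ 'n) set" where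
  "patch j \<equiv> cube (node j) (2 * side j)"

text \<open>
  Round the coordinates of \<open>x\<close> to the lattice of mesh \<open>h\<close>, where \<open>16 h \<le> bdist x < 32 h\<close>.
\<close>

lemma cells_cover:
  assumes x: "x \<in> \<Omega>"
  shows "\<exists>j\<in>cells. x \<in> cube (node j) (side j / 2)"
proof -
  have d: "0 < bdist x" by (rule bdist_pos[OF x])
  define k where "k = - \<lfloor>log 2 (bdist x / 16)\<rfloor>"
  define h where "h = 2 powr (- real_of_int k)"
  have h0: "0 < h" by (simp add: h_def)
  have "real_of_int (- k) \<le> log 2 (bdist x / 16)" "log 2 (bdist x / 16) < real_of_int (- k) + 1"
    by (simp_all add: k_def)
  then have "2 powr real_of_int (- k) \<le> bdist x / 16" "bdist x / 16 < 2 powr (real_of_int (- k) + 1)"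
    using d by (simp_all add: le_log_iff log_less_iff)
  then have "h \<le> bdist x / 16" "bdist x / 16 < h * 2" unfolding powr_add by (simp_all add: h_def)
  then have h: "16 * h \<le> bdist x" "bdist x < 32 * h" by simp_all
  define m where "m i = round (x $ i / h)" for i
  define j :: "'n cell" where "j = (k, m)"
  have sj: "side j = h" by (simp add: side_def j_def h_def)
  have "\<bar>x $ i - node j $ i\<bar> \<le> h / 2" for i
  proof -
    have "\<bar>real_of_int (m i) - x $ i / h\<bar> \<le> 1 / 2" unfolding m_def by (rule of_int_round_abs_le)
    then have "\<bar>real_of_int (m i) - x $ i / h\<bar> * h \<le> 1 / 2 * h" using h0 by (intro mult_right_mono) auto
    moreover have "\<bar>real_of_int (m i) - x $ i / h\<bar> * h = \<bar>x $ i - node j $ i\<bar>"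
    proof -
      have "\<bar>real_of_int (m i) - x $ i / h\<bar> * h = \<bar>(real_of_int (m i) - x $ i / h) * h\<bar>"
        using h0 by (simp add: abs_mult)
      also have "(real_of_int (m i) - x $ i / h) * h = node j $ i - x $ i"
        unfolding node_def sj using h0 by (simp add: j_def left_diff_distrib)
      finally show ?thesis by (simp add: abs_minus_commute)
    qed
    ultimately show ?thesis by simp
  qed
  then have xj: "infnorm (x - node j) \<le> h / 2" unfolding infnorm_le_iff by simp
  have "node j \<in> \<Omega>"
    by (rule near_point_in_dom[OF x]) (use xj h h0 infnorm_sub[of x "node j"] in linarith)
  moreover have "15 * h \<le> bdist (node j)" "bdist (node j) \<le> 33 * h"
    using bdist_lipschitz[of x "node j"] bdist_lipschitz[of "node j" x] xj h h0 infnorm_sub[of x "node j"] by linarith+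
  ultimately have "j \<in> cells" by (simp add: cells_def sj)
  then show ?thesis using xj sj by (intro bexI[of _ j]) (auto simp: mem_cube)
qed

lemma bdist_in_cell:
  assumes j: "j \<in> cells" and x: "x \<in> cube (node j) (t * side j)"
  shows "(15 - t) * side j \<le> bdist x" "bdist x \<le> (33 + t) * side j"
proof -
  have "15 * side j \<le> bdist (node j)" "bdist (node j) \<le> 33 * side j" using j by (auto simp: cells_def)
  moreover have "infnorm (x - node j) \<le> t * side j" "infnorm (node j - x) \<le> t * side j"
    using x infnorm_sub[of x "node j"] by (auto simp: mem_cube)
  ultimately show "(15 - t) * side j \<le> bdist x" "bdist x \<le> (33 + t) * side j"
    using bdist_lipschitz[of x "node j"] bdist_lipschitz[of "node j" x]
    unfolding left_diff_distrib distrib_right by linarith+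
qed

text \<open>
  The distance of \<open>x\<close> to the boundary lies between 13 and 35 times the side of each cell,
  and \<open>35 < 4 \<cdot> 13\<close>, so the sides differ by a factor less than 4.
\<close>

lemma overlap_levels:
  assumes "j \<in> cells" "l \<in> cells" "x \<in> patch j" "x \<in> patch l"
  shows "fst j \<le> fst l + 1"
proof -
  have "13 * side l \<le> bdist x" "bdist x \<le> 35 * side j"
    using bdist_in_cell(1)[OF assms(2,4)] bdist_in_cell(2)[OF assms(1,3)] by simp_all
  then have "side l < 4 * side j" using side_pos[of j] side_pos[of l] by linarith
  then have "2 powr (- real_of_int (fst l)) < 2 powr (2 + - real_of_int (fst j))"
    unfolding powr_add by (simp add: side_def)
  then have "- real_of_int (fst l) < 2 + - real_of_int (fst j)" by (subst (asm) powr_less_cancel_iff) auto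
  then show ?thesis by linarith
qed

lemma overlap_side:
  assumes "j \<in> cells" "l \<in> cells" "patch j \<inter> patch l \<noteq> {}"
  shows "side l \<le> 2 * side j"
proof -
  obtain x where "x \<in> patch j" "x \<in> patch l" using assms by auto
  then have "fst j \<le> fst l + 1" using overlap_levels assms by blast
  then have "- real_of_int (fst l) \<le> 1 + - real_of_int (fst j)" by linarith
  then have "2 powr (- real_of_int (fst l)) \<le> 2 powr (1 + - real_of_int (fst j))" by (intro powr_mono) auto
  then show ?thesis unfolding powr_add by (simp add: side_def)
qed

lemma overlap_dist:
  assumes "patch j \<inter> patch l \<noteq> {}"
  shows "infnorm (node j - node l) \<le> 2 * side j + 2 * side l"
proof -
  obtain x where "x \<in> patch j" "x \<in> patch l" using assms by auto
  then show ?thesis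
    using infnorm_triangle3[of "node j" "node l" x] infnorm_sub[of "node j" x] by (simp add: mem_cube)
qed

lemma colour_separates:
  assumes jl: "j \<in> cells" "l \<in> cells" "patch j \<inter> patch l \<noteq> {}" and c: "colour j = colour l"
  shows "j = l"
proof -
  obtain x where x: "x \<in> patch j" "x \<in> patch l" using jl by auto
  have "fst j \<le> fst l + 1" "fst l \<le> fst j + 1" using overlap_levels x jl by blast+
  moreover have "fst j mod 2 = fst l mod 2" using c by (simp add: colour_def)
  ultimately have k: "fst j = fst l" by presburger
  then have s: "side l = side j" by (simp add: side_def)
  have "snd j i = snd l i" for i
  proof -
    have "\<bar>(node j - node l) $ i\<bar> \<le> 4 * side j"
      using component_le_infnorm_cart[of "node j - node l" i] overlap_dist[OF jl(3)] s by simp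
    moreover have "(node j - node l) $ i = real_of_int (snd j i - snd l i) * side j"
      by (simp add: node_def s left_diff_distrib)
    ultimately have "\<bar>real_of_int (snd j i - snd l i)\<bar> * side j \<le> 4 * side j"
      by (simp add: abs_mult)
    then have "\<bar>real_of_int (snd j i - snd l i)\<bar> \<le> 4"
      by (rule mult_right_le_imp_le) (rule side_pos)
    then have "\<bar>snd j i - snd l i\<bar> \<le> 4" by linarith
    moreover have "snd j i mod 5 = snd l i mod 5" using c by (simp add: colour_def fun_eq_iff)
    ultimately show ?thesis by presburger
  qed
  then show ?thesis using k by (simp add: prod_eq_iff fun_eq_iff)
qed

text \<open>
  Patches have twice the radius of the supports of the bumps used below, so these cells
  include all that matter near \<open>x\<close>, and their set can be kept fixed when differentiating at
  \<open>x\<close>.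
\<close>

definition at_point :: "real ^ 'n \<Rightarrow> 'n cell set" where
  "at_point x = {j \<in> cells. x \<in> patch j}"

lemma colour_inj_at_point: "inj_on colour (at_point x)"
  unfolding inj_on_def at_point_def using colour_separates by blast

lemma finite_at_point: "finite (at_point x)"
  using colour_inj_at_point finite_subset[OF _ finite_colours] by (metis finite_imageD image_mono subset_UNIV)

lemma card_at_point: "card (at_point x) \<le> 2 * 5 ^ CARD('n)"
proof -
  have "card (at_point x) = card (colour ` at_point x)" by (simp add: card_image colour_inj_at_point)
  also have "\<dots> \<le> card (range (colour :: 'n cell \<Rightarrow> 'n cell))" by (intro card_mono finite_colours) auto
  also have "\<dots> \<le> 2 * 5 ^ CARD('n)" by (rule card_colours)
  finally show ?thesis .
qed

text \<open>
  The fraction 40 ensures that \<open>y\<close> is closer to \<open>x\<close> than one side of the cell, as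
  \<open>bdist x \<le> bdist y + |x - y|\<close> and \<open>bdist y \<le> 34 * side j\<close>.
\<close>

lemma active_near:
  assumes x: "x \<in> \<Omega>" and y: "infnorm (y - x) < bdist x / 40"
    and j: "j \<in> cells" "y \<in> cube (node j) (side j)"
  shows "j \<in> at_point x" "j \<in> at_point y"
proof -
  have "bdist y \<le> 34 * side j" using bdist_in_cell(2)[OF j(1), of y 1] j(2) by simp
  then have "infnorm (y - x) \<le> side j"
    using bdist_lipschitz[of x y] y infnorm_sub[of x y] side_pos[of j] by linarith
  then have "infnorm (x - node j) \<le> 2 * side j"
    using infnorm_triangle3[of x "node j" y] j(2) infnorm_sub[of x y] by (simp add: mem_cube)
  then show "j \<in> at_point x" using j by (simp add: at_point_def mem_cube)
  show "j \<in> at_point y" using j cube_mono[of "side j" "2 * side j" "node j"] by (auto simp: at_point_def less_imp_le)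
qed

lemma sum_active:
  fixes X :: "'n cell \<Rightarrow> 'b::comm_monoid_add"
  assumes x: "x \<in> \<Omega>" and y: "infnorm (y - x) < bdist x / 40"
    and X: "\<And>j. j \<in> cells \<Longrightarrow> y \<notin> cube (node j) (side j) \<Longrightarrow> X j = 0"
  shows "sum X (at_point y) = sum X (at_point x)"
proof -
  have *: "j \<in> cells" if "j \<in> at_point x \<union> at_point y" for j using that by (auto simp: at_point_def)
  have zero: "X j = 0" if "j \<in> at_point x \<union> at_point y" "j \<notin> at_point x \<or> j \<notin> at_point y" for j
  proof (rule X[OF *[OF that(1)]])
    show "y \<notin> cube (node j) (side j)" using active_near[OF x y *[OF that(1)]] that(2) by blast
  qed
  have "sum X (at_point y) = sum X (at_point x \<union> at_point y)"
    by (rule sum.mono_neutral_left) (use zero finite_at_point in auto)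
  also have "\<dots> = sum X (at_point x)"
    by (rule sum.mono_neutral_right) (use zero finite_at_point in auto)
  finally show ?thesis .
qed

section \<open>Nearest boundary elements\<close>

definition nearest :: "real ^ 'n \<Rightarrow> real ^ 'n" where
  "nearest z = (SOME a. a \<in> frontier \<Omega> \<and> bdist z = infnorm (z - a))"

lemma nearest: "nearest z \<in> frontier \<Omega>" "bdist z = infnorm (z - nearest z)"
proof -
  have "\<exists>a. a \<in> frontier \<Omega> \<and> bdist z = infnorm (z - a)" using bdist_attained by metis
  then have "nearest z \<in> frontier \<Omega> \<and> bdist z = infnorm (z - nearest z)"
    unfolding nearest_def by (rule someI_ex)
  then show "nearest z \<in> frontier \<Omega>" "bdist z = infnorm (z - nearest z)" by auto
qed

text \<open>
  The boundary element from which a cell takes its value.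
\<close>

definition boundary_elem :: "'n cell \<Rightarrow> (nat \<Rightarrow> real ^ 'n) set" where
  "boundary_elem j = alpha_class \<alpha> \<Omega> (ray (nearest (node j)) (node j))"

definition nbrs :: "'n cell \<Rightarrow> 'n cell set" where
  "nbrs j = {l \<in> cells. patch j \<inter> patch l \<noteq> {}}"

lemma self_nbr: "j \<in> cells \<Longrightarrow> j \<in> nbrs j"
  using center_in_cube[of "2 * side j" "node j"] by (auto simp: nbrs_def less_imp_le)

lemma patch_subset: "j \<in> cells \<Longrightarrow> patch j \<subseteq> \<Omega>"
proof (rule cube_subset_dom)
  assume j: "j \<in> cells"
  then show "node j \<in> \<Omega>" by (simp add: cells_def)
  have "15 * side j \<le> bdist (node j)" using j by (simp add: cells_def)
  then show "2 * side j < bdist (node j)" using side_pos[of j] by linarith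
qed

text \<open>
  Let \<open>h\<close> be the side of \<open>j\<close>. A neighbour has side at most \<open>2 h\<close>, so its node is within
  \<open>6 h\<close> of \<open>node j\<close> and its distance to the boundary is between \<open>9 h\<close> and \<open>39 h\<close>. Visibility
  requires \<open>2 h + 6 h < 9 h\<close>. The boundary point is within \<open>39 h + 6 h\<close> of \<open>node j\<close>, and the
  patch dilated by 41 has radius \<open>82 h\<close>.
\<close>

lemma nbr_visible:
  assumes j: "j \<in> cells" and l: "l \<in> nbrs j"
  shows "alpha_visible \<alpha> \<Omega> (node j) (2 * side j) (boundary_elem l)"
    and "41 \<le> \<eta> \<Longrightarrow> ell (boundary_elem l) \<in> cube (node j) (\<eta> * (2 * side j)) \<inter> frontier \<Omega>"
proof -
  have lc: "l \<in> cells" "patch j \<inter> patch l \<noteq> {}" using l by (auto simp: nbrs_def)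
  have s: "side l \<le> 2 * side j" by (rule overlap_side[OF j lc])
  have dist: "infnorm (node j - node l) \<le> 6 * side j" using overlap_dist[OF lc(2)] s by linarith
  have bj: "15 * side j \<le> bdist (node j)" "bdist (node j) \<le> 33 * side j" using j by (auto simp: cells_def)
  have l\<Omega>: "node l \<in> \<Omega>" using lc by (simp add: cells_def)
  have bl: "9 * side j \<le> bdist (node l)" "bdist (node l) \<le> 39 * side j"
    using bdist_lipschitz[of "node j" "node l"] bdist_lipschitz[of "node l" "node j"] bj dist
      infnorm_sub[of "node j" "node l"] by linarith+
  have pos: "0 < side j" by simp
  show "alpha_visible \<alpha> \<Omega> (node j) (2 * side j) (boundary_elem l)"
    unfolding boundary_elem_def by (rule alpha_visible_nearest[OF l\<Omega> nearest]) (use bl dist pos in linarith)+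
  assume \<eta>: "41 \<le> \<eta>"
  have e: "ell (boundary_elem l) = nearest (node l)" unfolding boundary_elem_def by (rule ell_ray_class[OF l\<Omega> nearest])
  have "infnorm (nearest (node l) - node j) \<le> bdist (node l) + infnorm (node j - node l)"
    using infnorm_triangle3[of "nearest (node l)" "node j" "node l"] nearest(2)[of "node l"]
      infnorm_sub[of "node l" "nearest (node l)"] infnorm_sub[of "node j" "node l"] by linarith
  also have "\<dots> \<le> 82 * side j" using bl dist pos by linarith
  also have "\<dots> \<le> \<eta> * (2 * side j)" using mult_right_mono[OF \<eta>, of "2 * side j"] pos by linarith
  finally show "ell (boundary_elem l) \<in> cube (node j) (\<eta> * (2 * side j)) \<inter> frontier \<Omega>"
    using nearest(1) by (simp add: e mem_cube)
qed

lemma boundary_elem_boundary: "j \<in> cells \<Longrightarrow> boundary_elem j \<in> boundary"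
  unfolding boundary_elem_def by (rule ray_class_boundary[OF _ nearest]) (simp add: cells_def)

section \<open>Consequences of the variational bound\<close>

text \<open>
  Equal colours make the patches disjoint, so they form an admissible family of cubes.
\<close>

lemma variational_bound_colour_class:
  assumes vb: "variational_bound p \<alpha> \<eta> \<Omega> f B" and \<eta>: "41 \<le> \<eta>"
    and J: "finite J" "J \<subseteq> cells" and col: "\<And>j l. j \<in> J \<Longrightarrow> l \<in> J \<Longrightarrow> colour j = colour l"
    and L: "\<And>j. j \<in> J \<Longrightarrow> L j \<in> nbrs j"
  shows "(\<Sum>j\<in>J. \<bar>f (boundary_elem j) - f (boundary_elem (L j))\<bar> powr p / (4 * side j) powr (p - real CARD('n))) \<le> B"
proof -
  obtain e where e: "bij_betw e {1..card J} J" using ex_bij_betw_nat_finite_1[OF J(1)] by blast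
  have eJ: "e i \<in> J" if "i \<in> {1..card J}" for i using e that by (auto simp: bij_betw_def)
  have "(\<Sum>j\<in>J. \<bar>f (boundary_elem j) - f (boundary_elem (L j))\<bar> powr p / (4 * side j) powr (p - real CARD('n)))
     = (\<Sum>i = 1..card J. \<bar>f (boundary_elem (e i)) - f (boundary_elem (L (e i)))\<bar> powr p / udiam (patch (e i)) powr (p - real CARD('n)))"
    unfolding sum.reindex_bij_betw[OF e, symmetric] by (simp add: udiam_cube)
  also have "\<dots> \<le> B"
  proof (rule vb[unfolded variational_bound_def, rule_format])
    fix i assume i: "i \<in> {1..card J}"
    then have c: "e i \<in> cells" using eJ J by auto
    show "0 < 2 * side (e i) \<and> patch (e i) \<subseteq> \<Omega>" using patch_subset[OF c] by simp
    show "alpha_visible \<alpha> \<Omega> (node (e i)) (2 * side (e i)) (boundary_elem (e i)) \<and>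
      alpha_visible \<alpha> \<Omega> (node (e i)) (2 * side (e i)) (boundary_elem (L (e i))) \<and>
      ell (boundary_elem (e i)) \<in> cube (node (e i)) (\<eta> * (2 * side (e i))) \<inter> frontier \<Omega> \<and>
      ell (boundary_elem (L (e i))) \<in> cube (node (e i)) (\<eta> * (2 * side (e i))) \<inter> frontier \<Omega>"
      using nbr_visible[OF c self_nbr[OF c]] nbr_visible[OF c L[OF eJ[OF i]]] \<eta> by blast
  next
    show "disjoint_family_on (\<lambda>i. patch (e i)) {1..card J}"
      unfolding disjoint_family_on_def
    proof (intro ballI impI)
      fix i k assume ik: "i \<in> {1..card J}" "k \<in> {1..card J}" "i \<noteq> k"
      then have "e i \<noteq> e k" using inj_on_contraD[OF bij_betw_imp_inj_on[OF e]] by blast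
      then show "patch (e i) \<inter> patch (e k) = {}"
        using colour_separates[of "e i" "e k"] col[of "e i" "e k"] eJ ik J by blast
    qed
  qed
  finally show ?thesis .
qed

lemma variational_bound_cells:
  assumes vb: "variational_bound p \<alpha> \<eta> \<Omega> f B" and B: "0 \<le> B" and \<eta>: "41 \<le> \<eta>"
    and J: "finite J" "J \<subseteq> cells" and L: "\<And>j. j \<in> J \<Longrightarrow> L j \<in> nbrs j"
  shows "(\<Sum>j\<in>J. \<bar>f (boundary_elem j) - f (boundary_elem (L j))\<bar> powr p / (4 * side j) powr (p - real CARD('n)))
    \<le> 2 * 5 ^ CARD('n) * B"
proof -
  let ?w = "\<lambda>j. \<bar>f (boundary_elem j) - f (boundary_elem (L j))\<bar> powr p / (4 * side j) powr (p - real CARD('n))"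
  have "sum ?w J = (\<Sum>c\<in>colour ` J. \<Sum>j\<in>{j \<in> J. colour j = c}. ?w j)"
    by (rule sum.group[symmetric]) (use J in auto)
  also have "\<dots> \<le> (\<Sum>c\<in>colour ` J. B)"
    by (intro sum_mono variational_bound_colour_class[OF vb \<eta>]) (use J L in auto)
  also have "\<dots> = real (card (colour ` J)) * B" by simp
  also have "\<dots> \<le> real (2 * 5 ^ CARD('n)) * B"
  proof (intro mult_right_mono B)
    have "card (colour ` J) \<le> card (range (colour :: 'n cell \<Rightarrow> 'n cell))" by (intro card_mono finite_colours) auto
    also have "\<dots> \<le> 2 * 5 ^ CARD('n)" by (rule card_colours)
    finally show "real (card (colour ` J)) \<le> real (2 * 5 ^ CARD('n))" by (rule of_nat_mono)
  qed
  finally show ?thesis by simp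
qed

text \<open>
  The supremum of the differences over the neighbours is finite by the variational bound for
  the single cell \<open>j\<close>, and some neighbour reaches half of it.
\<close>

lemma worst_neighbour:
  assumes vb: "variational_bound p \<alpha> \<eta> \<Omega> f B" and B: "0 \<le> B" and \<eta>: "41 \<le> \<eta>" and p: "0 < p" and j: "j \<in> cells"
  shows "\<exists>l\<in>nbrs j. \<forall>k\<in>nbrs j. \<bar>f (boundary_elem j) - f (boundary_elem k)\<bar> \<le> 2 * \<bar>f (boundary_elem j) - f (boundary_elem l)\<bar>"
proof -
  let ?D = "\<lambda>k. \<bar>f (boundary_elem j) - f (boundary_elem k)\<bar>"
  define q where "q = (4 * side j) powr (p - real CARD('n))"
  have q: "0 < q" using side_pos[of j] by (simp add: q_def)
  have bd: "?D k \<le> (2 * 5 ^ CARD('n) * B * q) powr (1 / p)" if k: "k \<in> nbrs j" for k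
  proof -
    have "?D k powr p / q \<le> 2 * 5 ^ CARD('n) * B"
      using variational_bound_cells[OF vb B \<eta>, of "{j}" "\<lambda>_. k"] k j by (simp add: q_def)
    then have "?D k powr p \<le> 2 * 5 ^ CARD('n) * B * q" using q by (simp add: field_simps)
    then have "(?D k powr p) powr (1 / p) \<le> (2 * 5 ^ CARD('n) * B * q) powr (1 / p)"
      using p by (intro powr_mono2) auto
    then show ?thesis using p by (simp add: powr_powr)
  qed
  define s where "s = (SUP k\<in>nbrs j. ?D k)"
  have bdd: "bdd_above (?D ` nbrs j)" using bd by (auto intro!: bdd_aboveI)
  have ne: "nbrs j \<noteq> {}" using self_nbr[OF j] by auto
  have le: "?D k \<le> s" if "k \<in> nbrs j" for k unfolding s_def by (rule cSUP_upper[OF that bdd])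
  show ?thesis
  proof (cases "s \<le> 0")
    case True
    then have "?D k \<le> 2 * ?D j" if "k \<in> nbrs j" for k using le[OF that] by simp
    then show ?thesis using self_nbr[OF j] by blast
  next
    case False
    then have "s / 2 < s" by simp
    then obtain l where "l \<in> nbrs j" "s / 2 < ?D l"
      unfolding s_def using less_cSUP_iff[OF ne bdd] by auto
    then show ?thesis using le by (intro bexI[of _ l]) force+
  qed
qed

section \<open>The extension\<close>

definition bump :: "'n cell \<Rightarrow> real ^ 'n \<Rightarrow> real" where
  "bump j = cube_bump (node j) (side j)"

definition dbump :: "'n cell \<Rightarrow> real ^ 'n \<Rightarrow> real ^ 'n" where
  "dbump j x = (\<chi> i. partial i (bump j) x)"

lemma bump_C_k: "C_k k (bump j)"
  unfolding bump_def cube_bump_def by (rule C_k_box_bump)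

lemma bump_has_derivative: "(bump j has_derivative (\<lambda>v. dbump j x \<bullet> v)) (at x)"
  unfolding dbump_def using bump_C_k[of "Suc 0" j] by (intro has_derivative_partials) simp

lemma continuous_on_bump: "continuous_on T (bump j)"
  using bump_C_k[of 0 j] by (auto intro: continuous_on_subset)

lemma continuous_on_dbump: "continuous_on T (dbump j)"
proof -
  have "continuous_on UNIV (partial i (bump j))" for i using bump_C_k[of "Suc 0" j] by simp
  then have "continuous_on T (partial i (bump j))" for i using continuous_on_subset by blast
  then show ?thesis unfolding dbump_def by (intro continuous_on_vec_lambda)
qed

lemma bump_zero: "y \<notin> cube (node j) (side j) \<Longrightarrow> bump j y = 0"
  unfolding bump_def by (rule cube_bump_zero) simp

lemma dbump_zero:
  assumes "y \<notin> cube (node j) (side j)"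
  shows "dbump j y = 0"
proof -
  have "closure {x. bump j x \<noteq> 0} \<subseteq> cube (node j) (side j)"
    using bump_zero[of _ j] by (intro closure_minimal) (blast, simp)
  then have "partial i (bump j) y = 0" for i using assms by (intro test_function_partial_support) auto
  then show ?thesis by (simp add: dbump_def vec_eq_iff)
qed

lemma bump_nonneg: "0 \<le> bump j y"
  unfolding bump_def by (rule cube_bump_nonneg)

text \<open>
  Numerator and denominator of the average, and their gradients, with the set \<open>T\<close> of cells
  as a parameter: near \<open>x\<close> the set \<open>at_point x\<close> can be used for all points, and finite sums
  are easy to differentiate.
\<close>

definition Phi :: "'n cell set \<Rightarrow> real ^ 'n \<Rightarrow> real" where "Phi T x = (\<Sum>j\<in>T. bump j x)"
definition dPhi :: "'n cell set \<Rightarrow> real ^ 'n \<Rightarrow> real ^ 'n" where "dPhi T x = (\<Sum>j\<in>T. dbump j x)"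
definition Num :: "('n cell \<Rightarrow> real) \<Rightarrow> 'n cell set \<Rightarrow> real ^ 'n \<Rightarrow> real" where "Num v T x = (\<Sum>j\<in>T. bump j x * v j)"
definition dNum :: "('n cell \<Rightarrow> real) \<Rightarrow> 'n cell set \<Rightarrow> real ^ 'n \<Rightarrow> real ^ 'n" where "dNum v T x = (\<Sum>j\<in>T. v j *\<^sub>R dbump j x)"

definition ext :: "('n cell \<Rightarrow> real) \<Rightarrow> real ^ 'n \<Rightarrow> real" where
  "ext v x = Num v (at_point x) x / Phi (at_point x) x"

definition dquot :: "('n cell \<Rightarrow> real) \<Rightarrow> 'n cell set \<Rightarrow> real ^ 'n \<Rightarrow> real ^ 'n" where
  "dquot v T x = (1 / (Phi T x)\<^sup>2) *\<^sub>R (Phi T x *\<^sub>R dNum v T x - Num v T x *\<^sub>R dPhi T x)"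

definition dext :: "('n cell \<Rightarrow> real) \<Rightarrow> real ^ 'n \<Rightarrow> real ^ 'n" where
  "dext v x = dquot v (at_point x) x"

text \<open>
  Some cell has \<open>x\<close> in its half cube, where its bump is at least \<open>bump_min\<close>.
\<close>

lemma Phi_lower:
  assumes x: "x \<in> \<Omega>"
  shows "bump_min CARD('n) \<le> Phi (at_point x) x"
proof -
  obtain j where j: "j \<in> cells" "x \<in> cube (node j) (side j / 2)" using cells_cover[OF x] by blast
  have "side j / 2 \<le> 2 * side j" using side_pos[of j] by linarith
  then have jx: "j \<in> at_point x" using j cube_mono[of "side j / 2" "2 * side j" "node j"] by (auto simp: at_point_def)
  have "bump_min CARD('n) \<le> bump j x" unfolding bump_def by (rule cube_bump_lower[OF side_pos j(2)])
  also have "\<dots> \<le> Phi (at_point x) x"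
    unfolding Phi_def by (rule member_le_sum[OF jx]) (auto simp: bump_nonneg finite_at_point)
  finally show ?thesis .
qed

lemma Phi_pos: "x \<in> \<Omega> \<Longrightarrow> 0 < Phi (at_point x) x"
  using Phi_lower bump_min_pos less_le_trans by blast

lemma localize:
  assumes x: "x \<in> \<Omega>" and y: "infnorm (y - x) < bdist x / 40"
  shows "Phi (at_point y) y = Phi (at_point x) y" "dPhi (at_point y) y = dPhi (at_point x) y"
    "Num v (at_point y) y = Num v (at_point x) y" "dNum v (at_point y) y = dNum v (at_point x) y"
  unfolding Phi_def dPhi_def Num_def dNum_def
  by (rule sum_active[OF x y]; simp add: bump_zero dbump_zero)+

lemma near_eventually:
  assumes x: "x \<in> \<Omega>"
  shows "\<exists>U. open U \<and> x \<in> U \<and> U \<subseteq> \<Omega> \<and> (\<forall>y\<in>U. infnorm (y - x) < bdist x / 40)"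
proof -
  let ?U = "{y. infnorm (y - x) < bdist x / 40}"
  have "open ?U" by (rule open_Collect_less) (intro continuous_intros)+
  moreover have "x \<in> ?U" using bdist_pos[OF x] by simp
  moreover have "?U \<subseteq> \<Omega>" using near_point_in_dom[OF x] bdist_pos[OF x] by force
  ultimately show ?thesis by blast
qed

lemma ext_has_derivative:
  assumes x: "x \<in> \<Omega>"
  shows "(ext v has_derivative (\<lambda>w. dext v x \<bullet> w)) (at x)"
proof -
  let ?T = "at_point x"
  obtain U where U: "open U" "x \<in> U" "U \<subseteq> \<Omega>" "\<And>y. y \<in> U \<Longrightarrow> infnorm (y - x) < bdist x / 40"
    using near_eventually[OF x] by blast
  have P: "(Phi ?T has_derivative (\<lambda>w. dPhi ?T x \<bullet> w)) (at x)"
    unfolding Phi_def[abs_def] dPhi_def inner_sum_left by (intro has_derivative_sum bump_has_derivative)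
  have N: "(Num v ?T has_derivative (\<lambda>w. dNum v ?T x \<bullet> w)) (at x)"
    unfolding Num_def[abs_def] dNum_def inner_sum_left inner_scaleR_left
    by (rule has_derivative_sum) (simp add: mult.commute[of _ "v _"] has_derivative_mult_right bump_has_derivative)
  have P0: "Phi ?T x \<noteq> 0" using Phi_pos[OF x] by simp
  have "((\<lambda>y. Num v ?T y / Phi ?T y) has_derivative
      (\<lambda>w. - Num v ?T x * (inverse (Phi ?T x) * (dPhi ?T x \<bullet> w) * inverse (Phi ?T x)) + (dNum v ?T x \<bullet> w) / Phi ?T x)) (at x)"
    by (rule has_derivative_divide[OF N P P0])
  moreover have "(\<lambda>w. - Num v ?T x * (inverse (Phi ?T x) * (dPhi ?T x \<bullet> w) * inverse (Phi ?T x)) + (dNum v ?T x \<bullet> w) / Phi ?T x)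
     = (\<lambda>w. dext v x \<bullet> w)"
    using P0 by (simp add: dext_def dquot_def inner_diff_left fun_eq_iff field_simps power2_eq_square)
  ultimately have d: "((\<lambda>y. Num v ?T y / Phi ?T y) has_derivative (\<lambda>w. dext v x \<bullet> w)) (at x)" by simp
  show ?thesis
    by (rule has_derivative_transform_within_open[OF d U(1,2)])
      (use localize[OF x U(4)] in \<open>simp add: ext_def\<close>)
qed

lemma continuous_on_dext: "continuous_on \<Omega> (dext v)"
proof (rule continuous_at_imp_continuous_on, rule ballI)
  fix x assume x: "x \<in> \<Omega>"
  let ?T = "at_point x"
  obtain U where U: "open U" "x \<in> U" "U \<subseteq> \<Omega>" "\<And>y. y \<in> U \<Longrightarrow> infnorm (y - x) < bdist x / 40"
    using near_eventually[OF x] by blast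
  have "Phi ?T y \<noteq> 0" if "y \<in> U" for y
    using Phi_pos[of y] localize(1)[OF x U(4)[OF that]] U(3) that by force
  then have "continuous_on U (dquot v ?T)"
    unfolding dquot_def Phi_def dPhi_def Num_def dNum_def
    by (intro continuous_intros continuous_on_bump continuous_on_dbump) auto
  moreover have "dquot v ?T y = dext v y" if "y \<in> U" for y
    using localize[OF x U(4)[OF that]] by (simp add: dext_def dquot_def)
  ultimately have "continuous_on U (dext v)" using continuous_on_cong by (metis (mono_tags, lifting))
  then show "isCont (dext v) x" using U by (simp add: continuous_on_eq_continuous_at)
qed

lemma weak_gradient_ext: "weak_gradient \<Omega> (ext v) (dext v)"
  by (rule weak_gradient_of_C1[OF open_dom ext_has_derivative continuous_on_dext])

lemma continuous_on_ext: "continuous_on \<Omega> (ext v)"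
  by (rule continuous_at_imp_continuous_on) (use ext_has_derivative has_derivative_continuous in blast)

text \<open>
  An average of numbers in \<open>[c - e, c + e]\<close> lies in this interval.
\<close>

lemma ext_near:
  assumes x: "x \<in> \<Omega>" and v: "\<And>j. j \<in> cells \<Longrightarrow> x \<in> cube (node j) (side j) \<Longrightarrow> \<bar>v j - c\<bar> \<le> e"
  shows "\<bar>ext v x - c\<bar> \<le> e"
proof -
  let ?T = "at_point x"
  have P: "0 < Phi ?T x" by (rule Phi_pos[OF x])
  have "ext v x - c = (\<Sum>j\<in>?T. bump j x * (v j - c)) / Phi ?T x"
  proof -
    have "(\<Sum>j\<in>?T. bump j x * (v j - c)) = Num v ?T x - c * Phi ?T x"
      by (simp add: Num_def Phi_def right_diff_distrib sum_subtractf sum_distrib_left mult.commute)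
    then show ?thesis using P by (simp add: ext_def field_simps)
  qed
  then have "\<bar>ext v x - c\<bar> = \<bar>\<Sum>j\<in>?T. bump j x * (v j - c)\<bar> / Phi ?T x" using P by simp
  also have "\<dots> \<le> (\<Sum>j\<in>?T. bump j x * e) / Phi ?T x"
  proof (intro divide_right_mono order_trans[OF sum_abs] sum_mono)
    fix j assume j: "j \<in> ?T"
    show "\<bar>bump j x * (v j - c)\<bar> \<le> bump j x * e"
    proof (cases "x \<in> cube (node j) (side j)")
      case True
      then have "\<bar>v j - c\<bar> \<le> e" using v j by (simp add: at_point_def)
      then show ?thesis using bump_nonneg[of j x] by (simp add: abs_mult mult_left_mono)
    qed (simp add: bump_zero)
  qed (use P in simp)
  also have "\<dots> = e" using P by (simp add: Phi_def sum_distrib_right[symmetric])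
  finally show ?thesis .
qed

text \<open>
  The value of the extension at \<open>ys i\<close> is an average of \<open>f\<close> over elements of cells
  containing \<open>ys i\<close>. Their sides are comparable to \<open>bdist (ys i)\<close>, which tends to 0, so by
  \<open>d_alpha_closure_nearest\<close> these elements are close to \<open>\<omega>\<close>.
\<close>

lemma has_trace_ext:
  assumes f: "alpha_continuous \<alpha> \<Omega> f"
  shows "has_trace \<alpha> \<Omega> (ext (\<lambda>j. f (boundary_elem j))) f"
  unfolding has_trace_def
proof (intro ballI)
  fix \<omega> ys assume \<omega>: "\<omega> \<in> boundary" and ys: "ys \<in> \<omega>"
  note \<omega>c = boundary_completion[OF \<omega>]
  note yc = completion_Cauchy[OF \<omega>c ys]
  note mem = alpha_Cauchy_mem[OF yc]
  have l: "(\<lambda>i. infnorm (ys i - ell \<omega>)) \<longlonglongrightarrow> 0" using tendsto_ell[OF \<omega>c ys] tendsto_infnorm_iff by blast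
  have b0: "(\<lambda>i. bdist (ys i)) \<longlonglongrightarrow> 0"
    by (rule Lim_null_comparison[OF always_eventually[OF allI] l])
      (use bdist_le[OF ell_boundary[OF \<omega>]] bdist_nonneg in simp)
  define C where "C = 1 + 1 / (1 - ratio)"
  have C: "0 < C" using ratio by (simp add: C_def add_pos_pos)
  have "(\<lambda>i. 3 * bdist (ys i)) \<longlonglongrightarrow> 3 * 0" by (intro tendsto_intros b0)
  then have "(\<lambda>i. 3 * bdist (ys i)) \<longlonglongrightarrow> 0" by simp
  then have "(\<lambda>i. (3 * bdist (ys i)) powr \<alpha>) \<longlonglongrightarrow> 0"
    by (rule tendsto_powr_zero) (use bdist_nonneg alpha_pos in auto)
  from tendsto_mult_right_zero[OF this, of C] have p0: "(\<lambda>i. C * (3 * bdist (ys i)) powr \<alpha>) \<longlonglongrightarrow> 0" .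
  show "(\<lambda>i. ext (\<lambda>j. f (boundary_elem j)) (ys i)) \<longlonglongrightarrow> f \<omega>"
  proof (rule LIMSEQ_I)
    fix \<epsilon> :: real assume \<epsilon>: "0 < \<epsilon>"
    then have \<epsilon>2: "0 < \<epsilon> / 2" by simp
    obtain \<delta> where \<delta>: "0 < \<delta>" "\<forall>\<omega>'\<in>boundary. d_alpha_closure \<alpha> \<Omega> \<omega> \<omega>' < \<delta> \<longrightarrow> \<bar>f \<omega>' - f \<omega>\<bar> < \<epsilon> / 2"
      using f \<omega> \<epsilon>2 unfolding alpha_continuous_def by meson
    have \<delta>2: "0 < \<delta> / 2" using \<delta> by simp
    obtain N where N: "\<forall>i\<ge>N. \<forall>k\<ge>N. dist\<^sub>\<alpha> (ys i) (ys k) < \<delta> / 2 \<and> infnorm (ys i - ys k) < \<delta> / 2"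
      using alpha_CauchyD[OF yc \<delta>2] by blast
    have "\<forall>\<^sub>F i in sequentially. C * (3 * bdist (ys i)) powr \<alpha> < \<delta> / 2"
      by (rule order_tendstoD(2)[OF p0 \<delta>2])
    then obtain M where M: "\<forall>i\<ge>M. C * (3 * bdist (ys i)) powr \<alpha> < \<delta> / 2"
      unfolding eventually_sequentially by blast
    have "norm (ext (\<lambda>j. f (boundary_elem j)) (ys i) - f \<omega>) < \<epsilon>" if i: "max M N \<le> i" for i
    proof -
      have "\<bar>ext (\<lambda>j. f (boundary_elem j)) (ys i) - f \<omega>\<bar> \<le> \<epsilon> / 2"
      proof (rule ext_near[OF mem])
        fix j assume j: "j \<in> cells" "ys i \<in> cube (node j) (side j)"
        have z: "node j \<in> \<Omega>" "15 * side j \<le> bdist (node j)" "bdist (node j) \<le> 33 * side j" using j by (auto simp: cells_def)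
        have s: "14 * side j \<le> bdist (ys i)" using bdist_in_cell(1)[OF j(1), of "ys i" 1] j(2) by simp
        have n: "infnorm (node j - ys i) \<le> side j" using j(2) infnorm_sub[of "node j"] by (simp add: mem_cube)
        have near: "infnorm (node j - ys i) \<le> bdist (node j) / 2"
          using n z side_pos[of j] by linarith
        have le: "bdist (node j) \<le> 3 * bdist (ys i)" using z s side_pos[of j] by linarith
        have e: "dist\<^sub>\<alpha> (ys k) (ys i) \<le> \<delta> / 2" if "i \<le> k" for k using N i that by (simp add: less_imp_le)
        have "d_alpha_closure \<alpha> \<Omega> \<omega> (boundary_elem j) \<le> \<delta> / 2 + C * bdist (node j) powr \<alpha>"
          unfolding boundary_elem_def C_def
          by (rule d_alpha_closure_nearest[OF z(1) nearest \<omega> ys near e])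
        also have "C * bdist (node j) powr \<alpha> \<le> C * (3 * bdist (ys i)) powr \<alpha>"
          using le C bdist_nonneg alpha_pos by (intro mult_left_mono powr_mono2) auto
        also have "\<dots> < \<delta> / 2" using M i by simp
        finally have "d_alpha_closure \<alpha> \<Omega> \<omega> (boundary_elem j) < \<delta>" by simp
        then show "\<bar>f (boundary_elem j) - f \<omega>\<bar> \<le> \<epsilon> / 2" using \<delta>(2) boundary_elem_boundary[OF j(1)] by (simp add: less_imp_le)
      qed
      then show ?thesis using \<epsilon> by simp
    qed
    then show "\<exists>no. \<forall>i\<ge>no. norm (ext (\<lambda>j. f (boundary_elem j)) (ys i) - f \<omega>) < \<epsilon>" by blast
  qed
qed

end

text \<open>
  By scaling, the bump of the unit cube suffices; its partial derivatives are continuous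
  with compact support.
\<close>

lemma cube_bump_slope:
  "\<exists>Cb\<ge>0. \<forall>(c :: real ^ 'n) r y i. 0 < r \<longrightarrow> \<bar>partial i (cube_bump c r) y\<bar> \<le> Cb / r"
proof -
  let ?b = "cube_bump (0 :: real ^ 'n) 1"
  have C1: "C_k (Suc 0) ?b" unfolding cube_bump_def by (rule C_k_box_bump)
  then have d: "?b differentiable (at x)" and c: "continuous_on UNIV (partial i ?b)" for x i by simp_all
  have "\<exists>B. \<forall>y. \<bar>partial i ?b y\<bar> \<le> B" for i
  proof -
    have "bounded (partial i ?b ` cube 0 1)"
      by (intro compact_imp_bounded compact_continuous_image continuous_on_subset[OF c]) auto
    then obtain B where "\<forall>v\<in>partial i ?b ` cube 0 1. norm v \<le> B" unfolding bounded_iff by blast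
    then have B: "\<bar>partial i ?b y\<bar> \<le> B" if "y \<in> cube 0 1" for y using that by simp
    have z: "partial i ?b y = 0" if "y \<notin> cube 0 1" for y
    proof (rule test_function_partial_support)
      have "{x. ?b x \<noteq> 0} \<subseteq> cube 0 1" using cube_bump_zero[of 1 _ "0 :: real ^ 'n"] by force
      then have "closure {x. ?b x \<noteq> 0} \<subseteq> cube 0 1" by (rule closure_minimal) simp
      then show "y \<notin> closure {x. ?b x \<noteq> 0}" using that by auto
    qed
    have "\<bar>partial i ?b y\<bar> \<le> \<bar>B\<bar>" for y using B[of y] z[of y] by (cases "y \<in> cube 0 1") auto
    then show ?thesis by blast
  qed
  then obtain B where B: "\<And>i y. \<bar>partial i ?b y\<bar> \<le> B i" by metis
  define Cb where "Cb = (\<Sum>i\<in>UNIV. B i)"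
  have B0: "0 \<le> B i" for i using order_trans[OF abs_ge_zero B] .
  have BC: "B i \<le> Cb" for i unfolding Cb_def using B0 by (intro member_le_sum) auto
  have "\<bar>partial i (cube_bump c r) y\<bar> \<le> Cb / r" if r: "0 < r" for c :: "real ^ 'n" and r y i
  proof -
    have W: "((\<lambda>y. (1 / r) *\<^sub>R (y - c)) has_derivative (\<lambda>v. (1 / r) *\<^sub>R v)) (at y)"
      by (auto intro!: derivative_eq_intros)
    have eq: "cube_bump c r = (\<lambda>y. ?b ((1 / r) *\<^sub>R (y - c)))"
    proof
      fix y
      have "1 / r * (y $ i - (c - (\<chi> i. r)) $ i) = 1 * (((1 / r) *\<^sub>R (y - c)) $ i - (0 - (\<chi> i. 1)) $ i)"
        "- (1 / r) * (y $ i - (c + (\<chi> i. r)) $ i) = - 1 * (((1 / r) *\<^sub>R (y - c)) $ i - (0 + (\<chi> i. 1)) $ i)" for i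
        using r by (simp_all add: field_simps)
      then show "cube_bump c r y = ?b ((1 / r) *\<^sub>R (y - c))"
        unfolding cube_bump_def box_bump_def by simp
    qed
    have "(cube_bump c r has_derivative (\<lambda>v. (\<chi> i. partial i ?b ((1 / r) *\<^sub>R (y - c))) \<bullet> ((1 / r) *\<^sub>R v))) (at y)"
      unfolding eq using has_derivative_compose[OF W has_derivative_partials[OF d]] .
    from partial_eqI[OF this, of i] have "partial i (cube_bump c r) y = partial i ?b ((1 / r) *\<^sub>R (y - c)) / r"
      by (simp add: inner_axis)
    moreover have "\<bar>partial i ?b ((1 / r) *\<^sub>R (y - c))\<bar> \<le> Cb" using B BC order_trans by blast
    ultimately show ?thesis using r by (simp add: abs_divide divide_right_mono)
  qed
  moreover have "0 \<le> Cb" unfolding Cb_def by (intro sum_nonneg B0)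
  ultimately show ?thesis by blast
qed

text \<open>
  Enumerate the indices and use monotone convergence: the finite set \<open>T\<close> may depend on the
  point.
\<close>

lemma nn_integral_le_of_finite_sums:
  fixes g :: "'i::countable \<Rightarrow> 'a \<Rightarrow> ennreal"
  assumes meas [measurable]: "\<And>j. g j \<in> borel_measurable M"
    and fin: "\<And>x. x \<in> space M \<Longrightarrow> \<exists>T. finite T \<and> T \<subseteq> S \<and> H x \<le> (\<Sum>j\<in>T. g j x)"
    and bound: "\<And>J. finite J \<Longrightarrow> J \<subseteq> S \<Longrightarrow> (\<Sum>j\<in>J. \<integral>\<^sup>+x. g j x \<partial>M) \<le> B"
  shows "(\<integral>\<^sup>+x. H x \<partial>M) \<le> B"
proof -
  define J where "J N = {j \<in> S. to_nat j < N}" for N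
  have finJ: "finite (J N)" for N
  proof (rule finite_imageD)
    show "finite (to_nat ` J N)" by (rule finite_subset[of _ "{..<N}"]) (auto simp: J_def)
    show "inj_on to_nat (J N)" by (rule inj_on_to_nat)
  qed
  define K where "K N x = (\<Sum>j\<in>J N. g j x)" for N x
  have inc: "incseq K"
    unfolding incseq_def le_fun_def K_def using finJ by (auto intro!: sum_mono2 simp: J_def)
  have "(\<integral>\<^sup>+x. H x \<partial>M) \<le> (\<integral>\<^sup>+x. (SUP N. K N x) \<partial>M)"
  proof (rule nn_integral_mono)
    fix x assume "x \<in> space M"
    then obtain T where T: "finite T" "T \<subseteq> S" "H x \<le> (\<Sum>j\<in>T. g j x)" using fin by blast
    obtain N where N: "\<forall>n\<in>to_nat ` T. n < N" using finite_nat_set_iff_bounded T(1) by blast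
    have "(\<Sum>j\<in>T. g j x) \<le> K N x"
      unfolding K_def using finJ T N by (intro sum_mono2) (auto simp: J_def)
    then show "H x \<le> (SUP N. K N x)" using T(3) by (meson SUP_upper2 UNIV_I order_trans)
  qed
  also have "\<dots> = (SUP N. \<integral>\<^sup>+x. K N x \<partial>M)"
    by (rule nn_integral_monotone_convergence_SUP[OF inc]) (unfold K_def[abs_def], measurable)
  also have "\<dots> \<le> B"
  proof (rule SUP_least)
    fix N
    have "(\<integral>\<^sup>+x. K N x \<partial>M) = (\<Sum>j\<in>J N. \<integral>\<^sup>+x. g j x \<partial>M)"
      unfolding K_def by (rule nn_integral_sum) measurable
    also have "\<dots> \<le> B" by (rule bound[OF finJ]) (auto simp: J_def)
    finally show "(\<integral>\<^sup>+x. K N x \<partial>M) \<le> B" .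
  qed
  finally show ?thesis .
qed

text \<open>
  Bound all terms by the largest one.
\<close>

lemma powr_sum_le:
  fixes x :: "'i \<Rightarrow> real"
  assumes T: "finite T" and c: "real (card T) \<le> M" and x: "\<And>j. j \<in> T \<Longrightarrow> 0 \<le> x j" and p: "0 < p"
  shows "(\<Sum>j\<in>T. x j) powr p \<le> M powr p * (\<Sum>j\<in>T. x j powr p)"
proof (cases "T = {}")
  case False
  obtain k where k: "k \<in> T" "\<And>j. j \<in> T \<Longrightarrow> x j \<le> x k"
    using Max_in[of "x ` T"] Max_ge[of "x ` T"] T False by (metis (no_types, lifting) finite_imageI image_iff image_is_empty)
  have M0: "0 \<le> M" using c by (meson of_nat_0_le_iff order_trans)
  have "(\<Sum>j\<in>T. x j) \<le> (\<Sum>j\<in>T. x k)" by (rule sum_mono) (rule k(2))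
  also have "\<dots> = real (card T) * x k" by simp
  also have "\<dots> \<le> M * x k" using c x[OF k(1)] by (rule mult_right_mono)
  finally have "(\<Sum>j\<in>T. x j) powr p \<le> (M * x k) powr p"
    using p x by (intro powr_mono2) (auto simp: sum_nonneg)
  also have "\<dots> = M powr p * x k powr p" using M0 x[OF k(1)] by (simp add: powr_mult)
  also have "\<dots> \<le> M powr p * (\<Sum>j\<in>T. x j powr p)"
    using k(1) T by (intro mult_left_mono member_le_sum) auto
  finally show ?thesis .
qed (use p in simp)

text \<open>
  One factor \<open>2 \<cdot> 5\<^sup>n\<close> is the number of colours, the other bounds the number of cells at a
  point. The factor 8 is made of 2 from \<open>worst_neighbour\<close> and 4 from the diameter
  \<open>4 * side j\<close> of a patch.
\<close>

definition lower_const :: "nat \<Rightarrow> real \<Rightarrow> real \<Rightarrow> real" where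
  "lower_const n p Cb = (2 * 5 ^ n) * (8 * (2 * 5 ^ n) * Cb / bump_min n) powr p"

context alpha_domain
begin

text \<open>
  Only differences of values enter: since \<open>\<Phi>\<close> and its gradient are sums over the same cells,
  the numerator of the quotient rule is the double sum of \<open>\<phi>\<^sub>l (v\<^sub>j - v\<^sub>l) \<nabla>\<phi>\<^sub>j\<close>. Summing
  over \<open>l\<close> first gives back the factor \<open>\<Phi>\<close>.
\<close>

lemma dext_bound:
  assumes slope: "\<And>(c :: real ^ 'n) r y i. 0 < r \<Longrightarrow> \<bar>partial i (cube_bump c r) y\<bar> \<le> Cb / r"
    and Cb: "0 \<le> Cb" and x: "x \<in> \<Omega>"
    and D: "\<And>j l. j \<in> cells \<Longrightarrow> l \<in> nbrs j \<Longrightarrow> \<bar>v j - v l\<bar> \<le> D j"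
  shows "infnorm (dext v x) \<le> (\<Sum>j\<in>at_point x. Cb / bump_min CARD('n) * (D j / side j))"
  unfolding infnorm_le_iff
proof
  fix i
  let ?T = "at_point x" and ?P = "Phi (at_point x) x"
  have P: "0 < ?P" "bump_min CARD('n) \<le> ?P" using Phi_pos[OF x] Phi_lower[OF x] by auto
  have D0: "0 \<le> D j" if "j \<in> cells" for j using order_trans[OF abs_ge_zero D[OF that self_nbr[OF that]]] .
  have "(?P *\<^sub>R dNum v ?T x - Num v ?T x *\<^sub>R dPhi ?T x) $ i
      = (\<Sum>j\<in>?T. \<Sum>l\<in>?T. bump l x * (v j - v l) * dbump j x $ i)"
  proof -
    have "(?P *\<^sub>R dNum v ?T x - Num v ?T x *\<^sub>R dPhi ?T x) $ i
       = (\<Sum>l\<in>?T. bump l x) * (\<Sum>j\<in>?T. v j * dbump j x $ i) - (\<Sum>l\<in>?T. bump l x * v l) * (\<Sum>j\<in>?T. dbump j x $ i)"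
      by (simp add: Phi_def dNum_def Num_def dPhi_def sum_component)
    also have "\<dots> = (\<Sum>j\<in>?T. \<Sum>l\<in>?T. bump l x * (v j * dbump j x $ i) - bump l x * v l * dbump j x $ i)"
    proof -
      have "(\<Sum>l\<in>?T. bump l x) * (\<Sum>j\<in>?T. v j * dbump j x $ i) = (\<Sum>j\<in>?T. \<Sum>l\<in>?T. bump l x * (v j * dbump j x $ i))"
        by (subst sum_distrib_left) (simp add: sum_distrib_right)
      moreover have "(\<Sum>l\<in>?T. bump l x * v l) * (\<Sum>j\<in>?T. dbump j x $ i) = (\<Sum>j\<in>?T. \<Sum>l\<in>?T. bump l x * v l * dbump j x $ i)"
        by (subst sum_distrib_left) (simp add: sum_distrib_right)
      ultimately show ?thesis by (simp only: sum_subtractf)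
    qed
    also have "\<dots> = (\<Sum>j\<in>?T. \<Sum>l\<in>?T. bump l x * (v j - v l) * dbump j x $ i)"
      by (intro sum.cong refl) (simp add: algebra_simps)
    finally show ?thesis .
  qed
  then have "\<bar>dext v x $ i\<bar> = \<bar>\<Sum>j\<in>?T. \<Sum>l\<in>?T. bump l x * (v j - v l) * dbump j x $ i\<bar> / ?P\<^sup>2"
    by (simp add: dext_def dquot_def abs_divide)
  also have "\<dots> \<le> (\<Sum>j\<in>?T. ?P * (Cb * (D j / side j))) / ?P\<^sup>2"
  proof (intro divide_right_mono order_trans[OF sum_abs] sum_mono)
    fix j assume j: "j \<in> ?T"
    then have jc: "j \<in> cells" by (simp add: at_point_def)
    have "(\<Sum>l\<in>?T. \<bar>bump l x * (v j - v l) * dbump j x $ i\<bar>) \<le> (\<Sum>l\<in>?T. bump l x * (Cb * (D j / side j)))"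
    proof (rule sum_mono)
      fix l assume l: "l \<in> ?T"
      then have "l \<in> nbrs j" using j by (auto simp: nbrs_def at_point_def)
      then have 1: "\<bar>v j - v l\<bar> \<le> D j" by (rule D[OF jc])
      have 2: "\<bar>dbump j x $ i\<bar> \<le> Cb / side j" unfolding dbump_def bump_def using slope[OF side_pos] by simp
      have "\<bar>v j - v l\<bar> * \<bar>dbump j x $ i\<bar> \<le> D j * (Cb / side j)"
        using 1 2 D0[OF jc] by (intro mult_mono) auto
      then have "bump l x * (\<bar>v j - v l\<bar> * \<bar>dbump j x $ i\<bar>) \<le> bump l x * (Cb * (D j / side j))"
        using bump_nonneg[of l x] by (intro mult_left_mono) (auto simp: mult.commute)
      then show "\<bar>bump l x * (v j - v l) * dbump j x $ i\<bar> \<le> bump l x * (Cb * (D j / side j))"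
        using bump_nonneg[of l x] by (simp add: abs_mult mult.assoc)
    qed
    also have "\<dots> = ?P * (Cb * (D j / side j))" by (simp only: Phi_def sum_distrib_right)
    finally show "(\<Sum>l\<in>?T. \<bar>bump l x * (v j - v l) * dbump j x $ i\<bar>) \<le> ?P * (Cb * (D j / side j))" .
  qed simp
  also have "\<dots> = (\<Sum>j\<in>?T. Cb / ?P * (D j / side j))"
    using P by (simp add: sum_divide_distrib power2_eq_square field_simps)
  also have "\<dots> \<le> (\<Sum>j\<in>?T. Cb / bump_min CARD('n) * (D j / side j))"
  proof (intro sum_mono mult_right_mono)
    fix j assume "j \<in> ?T"
    then show "0 \<le> D j / side j" using D0 by (simp add: at_point_def)
    show "Cb / ?P \<le> Cb / bump_min CARD('n)"
      using P bump_min_pos[of "CARD('n)"] Cb by (intro divide_left_mono) auto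
  qed
  finally show "\<bar>dext v x $ i\<bar> \<le> (\<Sum>j\<in>?T. Cb / bump_min CARD('n) * (D j / side j))" .
qed

text \<open>
  By \<open>dext_bound\<close> with the worst neighbours, the integrand is at most a finite sum of
  constants on patches. The integral of the \<open>j\<close>-th constant over its patch, of volume
  \<open>(4 * side j) ^ n\<close>, is a multiple of the term of \<open>j\<close> in \<open>variational_bound_cells\<close>.
\<close>

lemma ext_energy:
  assumes slope: "\<And>(c :: real ^ 'n) r y i. 0 < r \<Longrightarrow> \<bar>partial i (cube_bump c r) y\<bar> \<le> Cb / r"
    and Cb: "0 \<le> Cb" and p: "real CARD('n) < p" and \<eta>: "41 \<le> \<eta>"
    and vb: "variational_bound p \<alpha> \<eta> \<Omega> f B" and B: "0 \<le> B"
  defines "v \<equiv> \<lambda>j. f (boundary_elem j)"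
  shows "(\<integral>\<^sup>+x. ennreal (indicator \<Omega> x * infnorm (dext v x) powr p) \<partial>lborel) \<le> ennreal (lower_const CARD('n) p Cb * B)"
proof -
  have p0: "0 < p" using p by (meson le_less_trans of_nat_0_le_iff)
  let ?n = "real CARD('n)"
  define M :: real where "M = 2 * 5 ^ CARD('n)"
  define \<kappa> where "\<kappa> = bump_min CARD('n)"
  have \<kappa>: "0 < \<kappa>" by (simp add: \<kappa>_def bump_min_pos)
  have M: "0 < M" by (simp add: M_def)
  define Q where "Q = 2 * M * Cb / \<kappa>"
  have Q0: "0 \<le> Q" using M Cb \<kappa> by (simp add: Q_def)
  have "\<forall>j. \<exists>l. j \<in> cells \<longrightarrow> l \<in> nbrs j \<and> (\<forall>k\<in>nbrs j. \<bar>v j - v k\<bar> \<le> 2 * \<bar>v j - v l\<bar>)"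
    using worst_neighbour[OF vb B \<eta> p0] unfolding v_def by blast
  then obtain L where L: "\<And>j. j \<in> cells \<Longrightarrow> L j \<in> nbrs j"
    "\<And>j k. j \<in> cells \<Longrightarrow> k \<in> nbrs j \<Longrightarrow> \<bar>v j - v k\<bar> \<le> 2 * \<bar>v j - v (L j)\<bar>" by metis
  define D where "D j = \<bar>v j - v (L j)\<bar>" for j
  have D0: "0 \<le> D j" for j by (simp add: D_def)
  define g where "g j x = ennreal (Q powr p * (D j / side j) powr p) * indicator (patch j) x" for j x
  show ?thesis
  proof (rule nn_integral_le_of_finite_sums[where g = g and S = cells])
    show "g j \<in> borel_measurable lborel" for j unfolding g_def[abs_def] by measurable
    fix x :: "real ^ 'n"
    have "ennreal (indicator \<Omega> x * infnorm (dext v x) powr p) \<le> (\<Sum>j\<in>at_point x. g j x)"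
    proof (cases "x \<in> \<Omega>")
      case True
      have "infnorm (dext v x) \<le> (\<Sum>j\<in>at_point x. Cb / \<kappa> * ((2 * D j) / side j))"
        unfolding \<kappa>_def by (rule dext_bound[OF slope Cb True]) (use L in \<open>auto simp: D_def\<close>)
      also have "\<dots> = 2 * Cb / \<kappa> * (\<Sum>j\<in>at_point x. D j / side j)" by (simp add: sum_distrib_left mult_ac)
      finally have "infnorm (dext v x) powr p \<le> (2 * Cb / \<kappa> * (\<Sum>j\<in>at_point x. D j / side j)) powr p"
        using p0 by (intro powr_mono2) auto
      also have "\<dots> = (2 * Cb / \<kappa>) powr p * (\<Sum>j\<in>at_point x. D j / side j) powr p"
        by (rule powr_mult)
      also have "\<dots> \<le> (2 * Cb / \<kappa>) powr p * (M powr p * (\<Sum>j\<in>at_point x. (D j / side j) powr p))"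
      proof (intro mult_left_mono powr_sum_le[OF finite_at_point _ _ p0])
        show "real (card (at_point x)) \<le> M" using of_nat_mono[OF card_at_point[of x]] by (simp add: M_def)
      qed (use D0 in auto)
      also have "\<dots> = (\<Sum>j\<in>at_point x. Q powr p * (D j / side j) powr p)"
      proof -
        have "Q = (2 * Cb / \<kappa>) * M" by (simp add: Q_def mult_ac)
        then have "Q powr p = (2 * Cb / \<kappa>) powr p * M powr p" using Cb \<kappa> M by (simp only: powr_mult)
        then show ?thesis by (simp add: sum_distrib_left mult.assoc)
      qed
      finally have "ennreal (infnorm (dext v x) powr p) \<le> ennreal (\<Sum>j\<in>at_point x. Q powr p * (D j / side j) powr p)"
        by (rule ennreal_leI)
      also have "\<dots> = (\<Sum>j\<in>at_point x. ennreal (Q powr p * (D j / side j) powr p))"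
        by (subst sum_ennreal) auto
      also have "\<dots> = (\<Sum>j\<in>at_point x. g j x)"
        by (rule sum.cong) (auto simp: g_def at_point_def)
      finally show ?thesis using True by simp
    qed simp
    then show "\<exists>T. finite T \<and> T \<subseteq> cells \<and> ennreal (indicator \<Omega> x * infnorm (dext v x) powr p) \<le> (\<Sum>j\<in>T. g j x)"
      by (intro exI[of _ "at_point x"]) (auto simp: finite_at_point, simp add: at_point_def)
  next
    fix J :: "'n cell set" assume J: "finite J" "J \<subseteq> cells"
    have gi: "(\<integral>\<^sup>+x. g j x \<partial>lborel) = ennreal (Q powr p * 4 powr p * (D j powr p / (4 * side j) powr (p - ?n)))" for j
    proof -
      have "(\<integral>\<^sup>+x. g j x \<partial>lborel) = ennreal (Q powr p * (D j / side j) powr p) * emeasure lborel (patch j)"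
        unfolding g_def by (rule nn_integral_cmult_indicator) simp
      also have "\<dots> = ennreal (Q powr p * (D j / side j) powr p * (4 * side j) ^ CARD('n))"
        by (simp add: emeasure_cube ennreal_mult'[symmetric])
      also have "(4 * side j) ^ CARD('n) = (4 * side j) powr ?n" by (simp add: powr_realpow)
      also have "(D j / side j) powr p = 4 powr p * D j powr p / (4 * side j) powr p"
        using D0 by (simp add: powr_divide powr_mult)
      also have "Q powr p * (4 powr p * D j powr p / (4 * side j) powr p) * (4 * side j) powr ?n
         = Q powr p * 4 powr p * (D j powr p / (4 * side j) powr (p - ?n))"
        by (simp add: powr_diff)
      finally show ?thesis .
    qed
    have "(\<Sum>j\<in>J. \<integral>\<^sup>+x. g j x \<partial>lborel) = ennreal (\<Sum>j\<in>J. Q powr p * 4 powr p * (D j powr p / (4 * side j) powr (p - ?n)))"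
      unfolding gi by (rule sum_ennreal) auto
    also have "\<dots> = ennreal (Q powr p * 4 powr p * (\<Sum>j\<in>J. D j powr p / (4 * side j) powr (p - ?n)))"
      by (simp add: sum_distrib_left)
    also have "\<dots> \<le> ennreal (Q powr p * 4 powr p * (M * B))"
    proof (intro ennreal_leI mult_left_mono)
      show "(\<Sum>j\<in>J. D j powr p / (4 * side j) powr (p - ?n)) \<le> M * B"
        unfolding D_def v_def M_def by (rule variational_bound_cells[OF vb B \<eta> J]) (use L J in auto)
    qed simp
    also have "Q powr p * 4 powr p * (M * B) = lower_const CARD('n) p Cb * B"
    proof -
      have "8 * (2 * 5 ^ CARD('n)) * Cb / bump_min CARD('n) = Q * 4" by (simp add: Q_def M_def \<kappa>_def)
      then show ?thesis using Q0 by (simp add: lower_const_def powr_mult M_def)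
    qed
    finally show "(\<Sum>j\<in>J. \<integral>\<^sup>+x. g j x \<partial>lborel) \<le> ennreal (lower_const CARD('n) p Cb * B)" .
  qed
qed

lemma ext_in_L1p:
  assumes slope: "\<And>(c :: real ^ 'n) r y i. 0 < r \<Longrightarrow> \<bar>partial i (cube_bump c r) y\<bar> \<le> Cb / r"
    and Cb: "0 \<le> Cb" and p: "real CARD('n) < p" and \<eta>: "41 \<le> \<eta>"
    and vb: "variational_bound p \<alpha> \<eta> \<Omega> f B" and B: "0 \<le> B"
  defines "v \<equiv> \<lambda>j. f (boundary_elem j)"
  shows "set_integrable lebesgue \<Omega> (\<lambda>x. infnorm (dext v x) powr p)"
    and "(LINT x:\<Omega>|lebesgue. infnorm (dext v x) powr p) \<le> lower_const CARD('n) p Cb * B"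
proof -
  have le: "(\<integral>\<^sup>+x. ennreal (indicator \<Omega> x * infnorm (dext v x) powr p) \<partial>lborel) \<le> ennreal (lower_const CARD('n) p Cb * B)"
    unfolding v_def by (rule ext_energy[OF slope Cb p \<eta> vb B])
  have "continuous_on \<Omega> (\<lambda>x. infnorm (dext v x))" by (intro continuous_intros continuous_on_dext)
  then have "(\<lambda>x. indicator \<Omega> x *\<^sub>R infnorm (dext v x)) \<in> borel_measurable borel"
    using open_dom by (intro borel_measurable_continuous_on_indicator) auto
  then have "(\<lambda>x. (indicator \<Omega> x *\<^sub>R infnorm (dext v x)) powr p) \<in> borel_measurable borel" by measurable
  moreover have "(indicator \<Omega> x *\<^sub>R infnorm (dext v x)) powr p = indicator \<Omega> x * infnorm (dext v x) powr p" for x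
    by (auto simp: indicator_def)
  ultimately have m: "(\<lambda>x. indicator \<Omega> x * infnorm (dext v x) powr p) \<in> borel_measurable borel" by simp
  have K: "0 \<le> lower_const CARD('n) p Cb * B" using B by (simp add: lower_const_def)
  have i: "integrable lborel (\<lambda>x. indicator \<Omega> x * infnorm (dext v x) powr p)"
    using m le by (intro integrableI_nonneg) (auto intro: le_less_trans)
  then show "set_integrable lebesgue \<Omega> (\<lambda>x. infnorm (dext v x) powr p)"
    unfolding set_integrable_def using m by (simp add: integrable_completion)
  have "(LINT x:\<Omega>|lebesgue. infnorm (dext v x) powr p) = (\<integral>x. indicator \<Omega> x * infnorm (dext v x) powr p \<partial>lborel)"
    unfolding set_lebesgue_integral_def using m by (simp add: integral_completion)
  also have "ennreal \<dots> = (\<integral>\<^sup>+x. ennreal (indicator \<Omega> x * infnorm (dext v x) powr p) \<partial>lborel)"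
    by (rule nn_integral_eq_integral[OF i, symmetric]) simp
  finally have "ennreal (LINT x:\<Omega>|lebesgue. infnorm (dext v x) powr p) \<le> ennreal (lower_const CARD('n) p Cb * B)"
    using le by simp
  then show "(LINT x:\<Omega>|lebesgue. infnorm (dext v x) powr p) \<le> lower_const CARD('n) p Cb * B"
    using K by (simp add: ennreal_le_iff)
qed

section \<open>The norm\<close>

text \<open>
  The choice of the gradient in the definition is immaterial. All integrals are compared
  with that of one Borel version \<open>g\<close>; working with nonnegative integrals covers the case in
  which \<open>|G|\<^sup>p\<close> is not integrable.
\<close>

lemma L1p_norm_eq:
  assumes G: "weak_gradient \<Omega> F G"
  shows "L1p_norm p \<Omega> F = (LINT x:\<Omega>|lebesgue. infnorm (G x) powr p) powr (1 / p)"
proof -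
  define G' where "G' = (SOME G. weak_gradient \<Omega> F G)"
  have G': "weak_gradient \<Omega> F G'"
    unfolding G'_def by (rule someI[where P = "weak_gradient \<Omega> F", OF G])
  obtain g where g: "g \<in> borel_measurable borel" "\<And>x. x \<notin> \<Omega> \<Longrightarrow> g x = 0"
      "weak_gradient \<Omega> F g" "AE x in lebesgue. x \<in> \<Omega> \<longrightarrow> G x = g x"
    using weak_gradient_borel_version[OF open_dom G] by blast
  have gen: "(LINT x:\<Omega>|lebesgue. infnorm (H x) powr p) = enn2real (\<integral>\<^sup>+x. ennreal (infnorm (g x) powr p) \<partial>lebesgue)"
    if H: "weak_gradient \<Omega> F H" for H
  proof -
    obtain h where h: "h \<in> borel_measurable borel" "\<And>x. x \<notin> \<Omega> \<Longrightarrow> h x = 0"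
      "weak_gradient \<Omega> F h" "AE x in lebesgue. x \<in> \<Omega> \<longrightarrow> H x = h x"
      using weak_gradient_borel_version[OF open_dom H] by blast
    have hg: "AE x in lebesgue. x \<in> \<Omega> \<longrightarrow> h x = g x" by (rule weak_gradient_unique[OF open_dom h(3) g(3)])
    note [measurable] = h(1) g(1)
    have hm: "(\<lambda>x. infnorm (h x) powr p) \<in> borel_measurable lebesgue"
      by (intro measurable_completion) measurable
    have ae: "AE x in lebesgue. infnorm (h x) powr p = indicator \<Omega> x *\<^sub>R infnorm (H x) powr p"
      using h(4) by eventually_elim (use h(2) in \<open>auto simp: indicator_def\<close>)
    have Hm: "(\<lambda>x. indicator \<Omega> x *\<^sub>R infnorm (H x) powr p) \<in> borel_measurable lebesgue"
    proof -
      let ?H = "\<lambda>x. \<chi> i. indicator \<Omega> x * H x $ i"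
      have "?H \<in> borel_measurable lebesgue"
      proof (rule borel_measurable_vec_lambda)
        show "(\<lambda>x. ?H x $ i) \<in> borel_measurable lebesgue" for i
          using locally_integrable_measurable[OF open_dom, of "\<lambda>x. H x $ i"] H by (simp add: weak_gradient_def)
      qed
      then have "(\<lambda>x. infnorm (?H x) powr p) \<in> borel_measurable lebesgue" by measurable
      moreover have "infnorm (?H x) powr p = indicator \<Omega> x *\<^sub>R infnorm (H x) powr p" for x
      proof (cases "x \<in> \<Omega>")
        case False
        then have "?H x = 0" by (simp add: vec_eq_iff)
        then show ?thesis using False by simp
      qed simp
      ultimately show ?thesis by simp
    qed
    have "(LINT x:\<Omega>|lebesgue. infnorm (H x) powr p) = (\<integral>x. infnorm (h x) powr p \<partial>lebesgue)"
      unfolding set_lebesgue_integral_def by (rule integral_cong_AE[OF Hm hm]) (use ae in eventually_elim, simp)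
    also have "\<dots> = enn2real (\<integral>\<^sup>+x. ennreal (infnorm (h x) powr p) \<partial>lebesgue)"
      using hm by (rule integral_eq_nn_integral) simp
    also have "(\<integral>\<^sup>+x. ennreal (infnorm (h x) powr p) \<partial>lebesgue) = (\<integral>\<^sup>+x. ennreal (infnorm (g x) powr p) \<partial>lebesgue)"
      by (rule nn_integral_cong_AE) (use hg in eventually_elim, use h(2) g(2) in metis)
    finally show ?thesis .
  qed
  show ?thesis unfolding L1p_norm_def G'_def[symmetric] Let_def using gen[OF G'] gen[OF G] by simp
qed

lemma variational_bound_mono:
  assumes vb: "variational_bound p \<alpha> \<eta> \<Omega> f B" and le: "B \<le> B'"
  shows "variational_bound p \<alpha> \<eta> \<Omega> f B'"
  unfolding variational_bound_def
  by (intro allI impI) (rule order_trans[OF vb[unfolded variational_bound_def, rule_format] le]; blast)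

lemma L1p_norm_nonneg: "0 \<le> L1p_norm p \<Omega> F"
  by (simp add: L1p_norm_def Let_def)

text \<open>
  The summand \<open>e\<close> makes the bound positive even if the seminorm vanishes, as for constant
  functions.
\<close>

lemma variational_bound_of_extension:
  assumes p: "real CARD('n) < p" and \<eta>: "1 \<le> \<eta>" and F: "F \<in> trace_extensions p \<alpha> \<Omega> f"
    and e: "0 < e" and K: "1 \<le> K" "upper_const (real CARD('n)) p \<eta> \<le> K"
  shows "variational_bound p \<alpha> \<eta> \<Omega> f (K * (L1p_norm p \<Omega> F + e) powr p)"
proof -
  have p0: "0 < p" using p by (meson le_less_trans of_nat_0_le_iff)
  have Fc: "continuous_on \<Omega> F" and tr: "has_trace \<alpha> \<Omega> F f" and "F \<in> L1p p \<Omega>"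
    using F by (auto simp: trace_extensions_def)
  then obtain G where G: "weak_gradient \<Omega> F G" and i: "set_integrable lebesgue \<Omega> (\<lambda>x. infnorm (G x) powr p)"
    by (auto simp: L1p_def)
  let ?I = "LINT x:\<Omega>|lebesgue. infnorm (G x) powr p"
  have I0: "0 \<le> ?I" unfolding set_lebesgue_integral_def by (intro integral_nonneg_AE) auto
  have "L1p_norm p \<Omega> F powr p = ?I"
    using I0 p0 by (simp add: L1p_norm_eq[OF G] powr_powr)
  moreover have "L1p_norm p \<Omega> F powr p \<le> (L1p_norm p \<Omega> F + e) powr p"
    using e p0 L1p_norm_nonneg by (intro powr_mono2) auto
  ultimately have "upper_const (real CARD('n)) p \<eta> * ?I \<le> K * (L1p_norm p \<Omega> F + e) powr p"
    using K I0 by (intro mult_mono) auto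
  with variational_bound_of_trace[OF p \<eta> Fc G i tr] show ?thesis by (rule variational_bound_mono)
qed

lemma extension_of_variational_bound:
  assumes slope: "\<And>(c :: real ^ 'n) r y i. 0 < r \<Longrightarrow> \<bar>partial i (cube_bump c r) y\<bar> \<le> Cb / r"
    and Cb: "0 \<le> Cb" and p: "real CARD('n) < p" and \<eta>: "41 \<le> \<eta>"
    and f: "alpha_continuous \<alpha> \<Omega> f" and vb: "variational_bound p \<alpha> \<eta> \<Omega> f B" and B: "0 < B"
  shows "\<exists>F\<in>trace_extensions p \<alpha> \<Omega> f. L1p_norm p \<Omega> F \<le> lower_const CARD('n) p Cb powr (1 / p) * B powr (1 / p)"
proof -
  have p0: "0 < p" using p by (meson le_less_trans of_nat_0_le_iff)
  let ?v = "\<lambda>j. f (boundary_elem j)"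
  note e = ext_in_L1p[OF slope Cb p \<eta> vb less_imp_le[OF B]]
  have "ext ?v \<in> L1p p \<Omega>" unfolding L1p_def using weak_gradient_ext e(1) by blast
  then have "ext ?v \<in> trace_extensions p \<alpha> \<Omega> f"
    unfolding trace_extensions_def using continuous_on_ext has_trace_ext[OF f] by blast
  moreover have "L1p_norm p \<Omega> (ext ?v) \<le> lower_const CARD('n) p Cb powr (1 / p) * B powr (1 / p)"
  proof -
    have "L1p_norm p \<Omega> (ext ?v) = (LINT x:\<Omega>|lebesgue. infnorm (dext ?v x) powr p) powr (1 / p)"
      by (rule L1p_norm_eq[OF weak_gradient_ext])
    also have "\<dots> \<le> (lower_const CARD('n) p Cb * B) powr (1 / p)"
    proof (rule powr_mono2)
      show "0 \<le> (LINT x:\<Omega>|lebesgue. infnorm (dext ?v x) powr p)"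
        unfolding set_lebesgue_integral_def by (intro integral_nonneg_AE) auto
    qed (use p0 e(2) in auto)
    finally show ?thesis by (simp add: powr_mult)
  qed
  ultimately show ?thesis by blast
qed

end

lemma le_of_le_add_small:
  fixes a b :: real
  assumes "0 \<le> C" "\<And>e. 0 < e \<Longrightarrow> a \<le> C * (b + e)"
  shows "a \<le> C * b"
proof (rule field_le_epsilon)
  fix e :: real assume e: "0 < e"
  have "a \<le> C * (b + e / (C + 1))" using assms e by simp
  also have "\<dots> \<le> C * b + e" using assms(1) e by (simp add: field_simps)
  finally show "a \<le> C * b + e" .
qed

theorem theorem5p1:
  fixes p \<alpha> \<eta> :: real
  assumes "real CARD('n::finite) < p"
    and "\<alpha> = (p - real CARD('n)) / (p - 1)"
    and "41 \<le> \<eta>"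
  shows "(\<forall>(\<Omega> :: (real ^ 'n) set) f. is_domain \<Omega> \<longrightarrow>
            ((\<exists>F \<in> L1p p \<Omega>. continuous_on \<Omega> F \<and> has_trace \<alpha> \<Omega> F f) \<longleftrightarrow>
             alpha_continuous \<alpha> \<Omega> f \<and> (\<exists>B>0. variational_bound p \<alpha> \<eta> \<Omega> f B)))
       \<and> (\<exists>C\<ge>1. \<forall>(\<Omega> :: (real ^ 'n) set) f. is_domain \<Omega> \<longrightarrow>
            (\<exists>F \<in> L1p p \<Omega>. continuous_on \<Omega> F \<and> has_trace \<alpha> \<Omega> F f) \<longrightarrow>
            (let I = Inf {B powr (1 / p) | B. B > 0 \<and> variational_bound p \<alpha> \<eta> \<Omega> f B}
             in trace_norm p \<alpha> \<Omega> f / C \<le> I \<and> I \<le> C * trace_norm p \<alpha> \<Omega> f))"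
proof -
  have n1: "1 \<le> real CARD('n)" by (simp add: Suc_le_eq)
  have p1: "1 < p" using assms(1) n1 by linarith
  have \<alpha>: "0 < \<alpha>" "\<alpha> \<le> 1" unfolding assms(2) using assms(1) n1 p1 by (auto simp: divide_le_eq)
  have \<eta>1: "1 \<le> \<eta>" using assms(3) by simp
  obtain Cb where Cb: "0 \<le> Cb" "\<And>(c :: real ^ 'n) r y i. 0 < r \<Longrightarrow> \<bar>partial i (cube_bump c r) y\<bar> \<le> Cb / r"
    using cube_bump_slope by metis
  \<comment> \<open>The maxima with 1 keep the constants positive, so that they can be divided by.\<close>
  define K where "K = max 1 (upper_const (real CARD('n)) p \<eta>)"
  define C1 where "C1 = K powr (1 / p)"
  define C2 where "C2 = max 1 (lower_const CARD('n) p Cb powr (1 / p))"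
  have K: "1 \<le> K" "upper_const (real CARD('n)) p \<eta> \<le> K" by (auto simp: K_def)
  have C1: "0 < C1" using K by (simp add: C1_def)
  have C2: "1 \<le> C2" by (simp add: C2_def)
  have loc: "alpha_domain \<Omega> \<alpha>" if "is_domain \<Omega>" for \<Omega> :: "(real ^ 'n) set"
    using that \<alpha> by unfold_locales
  have nec: "alpha_continuous \<alpha> \<Omega> f" "\<And>e. 0 < e \<Longrightarrow> variational_bound p \<alpha> \<eta> \<Omega> f (K * (L1p_norm p \<Omega> F + e) powr p)"
    if dom: "is_domain \<Omega>" and F: "F \<in> trace_extensions p \<alpha> \<Omega> f" for \<Omega> :: "(real ^ 'n) set" and F f
  proof -
    interpret alpha_domain \<Omega> \<alpha> by (rule loc[OF dom])
    show "alpha_continuous \<alpha> \<Omega> f"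
      using F by (intro alpha_continuous_of_has_trace[of F]) (simp add: trace_extensions_def)
    show "variational_bound p \<alpha> \<eta> \<Omega> f (K * (L1p_norm p \<Omega> F + e) powr p)" if "0 < e" for e
      by (rule variational_bound_of_extension[OF assms(1) \<eta>1 F that K])
  qed
  have suf: "\<exists>F\<in>trace_extensions p \<alpha> \<Omega> f. L1p_norm p \<Omega> F \<le> C2 * B powr (1 / p)"
    if dom: "is_domain \<Omega>" and f: "alpha_continuous \<alpha> \<Omega> f" and vb: "variational_bound p \<alpha> \<eta> \<Omega> f B"
      and B: "0 < B" for \<Omega> :: "(real ^ 'n) set" and f B
  proof -
    interpret alpha_domain \<Omega> \<alpha> by (rule loc[OF dom])
    obtain F where F: "F \<in> trace_extensions p \<alpha> \<Omega> f"
      "L1p_norm p \<Omega> F \<le> lower_const CARD('n) p Cb powr (1 / p) * B powr (1 / p)"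
      using extension_of_variational_bound[OF Cb(2,1) assms(1,3) f vb B] by blast
    have "lower_const CARD('n) p Cb powr (1 / p) * B powr (1 / p) \<le> C2 * B powr (1 / p)"
      by (intro mult_right_mono) (auto simp: C2_def)
    then show ?thesis using F by force
  qed
  have ext_iff: "(\<exists>F \<in> L1p p \<Omega>. continuous_on \<Omega> F \<and> has_trace \<alpha> \<Omega> F f) \<longleftrightarrow> trace_extensions p \<alpha> \<Omega> f \<noteq> {}"
    for \<Omega> :: "(real ^ 'n) set" and f by (auto simp: trace_extensions_def)
  have pos: "0 < K * (L1p_norm p \<Omega> F + e) powr p" if "0 < e" for \<Omega> :: "(real ^ 'n) set" and F e
    using K that by (simp add: L1p_norm_def Let_def add_nonneg_pos order_less_imp_not_eq2)
  have part1: "(\<exists>F \<in> L1p p \<Omega>. continuous_on \<Omega> F \<and> has_trace \<alpha> \<Omega> F f) \<longleftrightarrow>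
             alpha_continuous \<alpha> \<Omega> f \<and> (\<exists>B>0. variational_bound p \<alpha> \<eta> \<Omega> f B)"
    if dom: "is_domain \<Omega>" for \<Omega> :: "(real ^ 'n) set" and f
    unfolding ext_iff using nec[OF dom] suf[OF dom] pos[of 1] zero_less_one by blast
  define C where "C = max 1 (max C1 C2)"
  have C: "1 \<le> C" "C1 \<le> C" "C2 \<le> C" by (auto simp: C_def)
  have part2: "trace_norm p \<alpha> \<Omega> f / C \<le> Inf {B powr (1 / p) | B. B > 0 \<and> variational_bound p \<alpha> \<eta> \<Omega> f B} \<and>
      Inf {B powr (1 / p) | B. B > 0 \<and> variational_bound p \<alpha> \<eta> \<Omega> f B} \<le> C * trace_norm p \<alpha> \<Omega> f"
    (is "?t / C \<le> Inf ?S \<and> Inf ?S \<le> _")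
    if dom: "is_domain \<Omega>" and ne: "trace_extensions p \<alpha> \<Omega> f \<noteq> {}" for \<Omega> :: "(real ^ 'n) set" and f
  proof
    obtain F0 where F0: "F0 \<in> trace_extensions p \<alpha> \<Omega> f" using ne by blast
    have f: "alpha_continuous \<alpha> \<Omega> f" by (rule nec(1)[OF dom F0])
    have norm0: "0 \<le> L1p_norm p \<Omega> F" for F by (simp add: L1p_norm_def Let_def)
    have t0: "0 \<le> ?t" unfolding trace_norm_def by (rule cINF_greatest[OF ne norm0])
    have t_le: "?t \<le> L1p_norm p \<Omega> F" if "F \<in> trace_extensions p \<alpha> \<Omega> f" for F
      unfolding trace_norm_def by (rule cINF_lower[OF _ that]) (auto intro!: bdd_belowI[of _ 0] norm0)
    have S0: "x \<in> ?S \<Longrightarrow> 0 \<le> x" for x by auto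
    have mem: "C1 * (L1p_norm p \<Omega> F + e) \<in> ?S" if F: "F \<in> trace_extensions p \<alpha> \<Omega> f" and e: "0 < e" for F e
    proof -
      have "C1 * (L1p_norm p \<Omega> F + e) = (K * (L1p_norm p \<Omega> F + e) powr p) powr (1 / p)"
      proof -
        have "((L1p_norm p \<Omega> F + e) powr p) powr (1 / p) = L1p_norm p \<Omega> F + e"
          using p1 e norm0[of F] by (simp add: powr_powr)
        then show ?thesis by (simp only: C1_def powr_mult)
      qed
      then show ?thesis
        by (intro CollectI exI[of _ "K * (L1p_norm p \<Omega> F + e) powr p"] conjI nec(2)[OF dom F e] pos[OF e])
    qed
    have "?t / C2 \<le> Inf ?S"
    proof (rule cInf_greatest)
      show "?S \<noteq> {}"
        unfolding ex_in_conv[symmetric] by (rule exI) (rule mem[OF F0 zero_less_one])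
      fix x assume "x \<in> ?S"
      then obtain B where B: "x = B powr (1 / p)" "0 < B" "variational_bound p \<alpha> \<eta> \<Omega> f B" by blast
      obtain F where F: "F \<in> trace_extensions p \<alpha> \<Omega> f" "L1p_norm p \<Omega> F \<le> C2 * B powr (1 / p)"
        using suf[OF dom f B(3,2)] by blast
      have "?t \<le> C2 * x" using t_le[OF F(1)] F(2) B(1) by simp
      then show "?t / C2 \<le> x" using C2 by (simp add: field_simps)
    qed
    moreover have "?t / C \<le> ?t / C2" using t0 C C2 by (intro divide_left_mono) auto
    ultimately show "?t / C \<le> Inf ?S" by simp
    have "Inf ?S / C1 \<le> ?t"
      unfolding trace_norm_def
    proof (rule cINF_greatest[OF ne])
      fix F assume F: "F \<in> trace_extensions p \<alpha> \<Omega> f"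
      have "Inf ?S \<le> C1 * L1p_norm p \<Omega> F"
      proof (rule le_of_le_add_small)
        show "Inf ?S \<le> C1 * (L1p_norm p \<Omega> F + e)" if "0 < e" for e
          by (rule cInf_lower[OF mem[OF F that]]) (use S0 in \<open>auto intro!: bdd_belowI[of _ 0]\<close>)
      qed (use C1 in simp)
      then show "Inf ?S / C1 \<le> L1p_norm p \<Omega> F" using C1 by (simp add: field_simps)
    qed
    then have "Inf ?S \<le> C1 * ?t" using C1 by (simp add: field_simps)
    also have "\<dots> \<le> C * ?t" using C t0 by (intro mult_right_mono) auto
    finally show "Inf ?S \<le> C * ?t" .
  qed
  show ?thesis
    unfolding Let_def using part1 part2[unfolded ext_iff[symmetric]] C(1) by blast
qed

end
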